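(* Let $G$ be a classical group, or a product of two copies of a classical group. Let $G$ belong to a dual pair $(G,G')$ in a symplectic group $Sp_{2m}$. Let $H\subset G$ be a symmetric subgroup (with $(G,H)$ one of the ten types of classical symmetric pairs), and let $H'$ be the centralizer of $H$ in $Sp_{2m}$. Then $(H,H')$ is also a dual pair in $Sp_{2m}$, and $G'$ is a symmetric subgroup inside $H'$.
   Context: All groups are over $\mathbb C$; classical groups are $GL_n$, $O_n$, $Sp_{2n}$. A symmetric subgroup of a group is the fixed-point subgroup of an involutive automorphism. A dual pair $(G,G')$ in a symplectic group $Sp_{2r}=Sp_{2r}(\mathbb C)$ is a pair of reductive subgroups that are mutual centralizers in $Sp_{2r}$. The irreducible dual pairs are $(GL_n,GL_k)$ and $(O_n,Sp_{2k})$ (in either order), each in $Sp_{2nk}$: $GL_n\times GL_k$ acts on $(\mathbb C^n\otimes\mathbb C^k)\oplus(\mathbb C^n\otimes\mathbb C^k)^*$ and $O_n\times Sp_{2k}$ acts on $\mathbb C^n\otimes\mathbb C^{2k}$. In general a dual pair is a product of irreducible ones in $\prod_i Sp_{2r_i}\subset Sp_{2\sum r_i}$. If $G$ is a classical group the pair $(G,G')$ is irreducible; if $G$ is a product of two copies of a classical group, $(G,G')$ is a product of two irreducible pairs. The ten types of classical symmetric pairs $(G,H)$ are: diagonal: $(GL_n\times GL_n,GL_n)$, $(O_n\times O_n,O_n)$, $(Sp_{2n}\times Sp_{2n},Sp_{2n})$; direct sum: $(GL_{n+k},GL_n\times GL_k)$, $(O_{n+k},O_n\times O_k)$, $(Sp_{2(n+k)},Sp_{2n}\times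 Sp_{2k})$; polarization: $(O_{2n},GL_n)$, $(Sp_{2n},GL_n)$ (stabilizer of a pair of complementary maximal isotropic subspaces); bilinear form: $(GL_n,O_n)$, $(GL_{2n},Sp_{2n})$. *)

theory Defs
  imports
    "HOL-Algebra.Coset"
    "Jordan_Normal_Form.VS_Connect"
begin

section \<open>Matrix groups\<close>

definition GL :: "nat \<Rightarrow> complex mat monoid" where
  "GL n = \<lparr>carrier = {A \<in> carrier_mat n n. invertible_mat A}, mult = (*), one = 1\<^sub>m n\<rparr>"

abbreviation GL_group :: "nat \<Rightarrow> complex mat set" where
  "GL_group n \<equiv> carrier (GL n)"

text \<open>A square matrix \<open>B\<close> of size \<open>N\<close> stands for the bilinear form \<open>(u, v) \<mapsto> u\<^sup>T B v\<close>. The set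
  \<open>isometries N B C\<close> consists of the linear isomorphisms from the space with form \<open>B\<close> to the
  space with form \<open>C\<close>.\<close>

definition isometries :: "nat \<Rightarrow> complex mat \<Rightarrow> complex mat \<Rightarrow> complex mat set" where
  "isometries N B C = {P \<in> GL_group N. transpose_mat P * C * P = B}"

definition sympl_form :: "nat \<Rightarrow> complex mat" where
  "sympl_form r = four_block_mat (0\<^sub>m r r) (1\<^sub>m r) (- 1\<^sub>m r) (0\<^sub>m r r)"

definition O_group :: "nat \<Rightarrow> complex mat set" where
  "O_group n = isometries n (1\<^sub>m n) (1\<^sub>m n)"

text \<open>\<open>Sp_group r\<close> is the group usually written \<open>Sp\<^bsub>2r\<^esub>\<close>; its elements have size \<open>2 * r\<close>.\<close>

definition Sp_group :: "nat \<Rightarrow> complex mat set" where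
  "Sp_group r = isometries (2 * r) (sympl_form r) (sympl_form r)"

definition centralizer :: "complex mat set \<Rightarrow> complex mat set \<Rightarrow> complex mat set" where
  "centralizer S X = {g \<in> S. \<forall>x\<in>X. g * x = x * g}"

definition conj_by :: "complex mat \<Rightarrow> complex mat \<Rightarrow> complex mat" where
  "conj_by P x = P * x * inv\<^bsub>GL (dim_row P)\<^esub> P"

definition dsum :: "complex mat \<Rightarrow> complex mat \<Rightarrow> complex mat" where
  "dsum a b = four_block_mat a (0\<^sub>m (dim_row a) (dim_col b)) (0\<^sub>m (dim_row b) (dim_col a)) b"

text \<open>The direct product of two matrix groups, acting on the direct sum of the two spaces.\<close>

definition dprod :: "complex mat set \<Rightarrow> complex mat set \<Rightarrow> complex mat set" where
  "dprod X Y = {dsum a b | a b. a \<in> X \<and> b \<in> Y}"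

text \<open>The matrix of \<open>A \<otimes> B\<close> with respect to the lexicographically ordered product basis.\<close>

definition kron :: "complex mat \<Rightarrow> complex mat \<Rightarrow> complex mat" where
  "kron A B = mat (dim_row A * dim_row B) (dim_col A * dim_col B)
     (\<lambda>(i, j). A $$ (i div dim_row B, j div dim_col B) * B $$ (i mod dim_row B, j mod dim_col B))"

text \<open>The action of \<open>a\<close> on \<open>X \<oplus> X\<^sup>*\<close>, which preserves \<^const>\<open>sympl_form\<close>.\<close>

definition plus_dual :: "complex mat \<Rightarrow> complex mat" where
  "plus_dual a = dsum a (transpose_mat (inv\<^bsub>GL (dim_row a)\<^esub> a))"


section \<open>Linear algebraic groups and reductivity\<close>

text \<open>The regular functions on \<open>GL\<^bsub>N\<^esub>\<close>, i.e. the algebra generated by the matrix entries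
  and the inverse of the determinant.\<close>

inductive_set regular_functions :: "nat \<Rightarrow> (complex mat \<Rightarrow> complex) set" for N :: nat where
  const: "(\<lambda>g. c) \<in> regular_functions N"
| entry: "i < N \<Longrightarrow> j < N \<Longrightarrow> (\<lambda>g. g $$ (i, j)) \<in> regular_functions N"
| inv_det: "(\<lambda>g. inverse (det g)) \<in> regular_functions N"
| add: "f \<in> regular_functions N \<Longrightarrow> h \<in> regular_functions N \<Longrightarrow> (\<lambda>g. f g + h g) \<in> regular_functions N"
| mult: "f \<in> regular_functions N \<Longrightarrow> h \<in> regular_functions N \<Longrightarrow> (\<lambda>g. f g * h g) \<in> regular_functions N"

definition zariski_closed :: "nat \<Rightarrow> complex mat set \<Rightarrow> bool" where
  "zariski_closed N X \<longleftrightarrow>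
     (\<exists>F \<subseteq> regular_functions N. X = {g \<in> GL_group N. \<forall>f\<in>F. f g = 0})"

text \<open>Connectedness of a Zariski closed set \<open>X\<close>: the relatively closed subsets of \<open>X\<close> are then
  the closed sets contained in \<open>X\<close>.\<close>

definition zariski_connected :: "nat \<Rightarrow> complex mat set \<Rightarrow> bool" where
  "zariski_connected N X \<longleftrightarrow>
     \<not> (\<exists>A B. zariski_closed N A \<and> zariski_closed N B \<and> A \<noteq> {} \<and> B \<noteq> {} \<and>
              A \<inter> B = {} \<and> A \<union> B = X)"

definition unipotent :: "nat \<Rightarrow> complex mat \<Rightarrow> bool" where
  "unipotent N g \<longleftrightarrow> g \<in> carrier_mat N N \<and> (\<exists>k. (g - 1\<^sub>m N) ^\<^sub>m k = 0\<^sub>m N N)"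

definition algebraic_subgroup :: "nat \<Rightarrow> complex mat set \<Rightarrow> bool" where
  "algebraic_subgroup N X \<longleftrightarrow> subgroup X (GL N) \<and> zariski_closed N X"

text \<open>Reductive means that the unipotent radical is trivial; the group itself need not be
  connected.\<close>

definition reductive :: "nat \<Rightarrow> complex mat set \<Rightarrow> bool" where
  "reductive N X \<longleftrightarrow> algebraic_subgroup N X \<and>
     (\<forall>U. normal U ((GL N)\<lparr>carrier := X\<rparr>) \<and> zariski_closed N U \<and> zariski_connected N U \<and>
          (\<forall>u\<in>U. unipotent N u) \<longrightarrow> U = {1\<^sub>m N})"


section \<open>Symmetric subgroups and dual pairs\<close>

text \<open>An automorphism of order exactly two of the algebraic group \<open>X\<close>.\<close>

definition involutive_automorphism ::
  "nat \<Rightarrow> complex mat set \<Rightarrow> (complex mat \<Rightarrow> complex mat) \<Rightarrow> bool" where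
  "involutive_automorphism N X \<theta> \<longleftrightarrow>
     \<theta> \<in> iso ((GL N)\<lparr>carrier := X\<rparr>) ((GL N)\<lparr>carrier := X\<rparr>) \<and>
     (\<forall>i<N. \<forall>j<N. \<exists>f\<in>regular_functions N. \<forall>g\<in>X. \<theta> g $$ (i, j) = f g) \<and>
     (\<forall>g\<in>X. \<theta> (\<theta> g) = g) \<and> (\<exists>g\<in>X. \<theta> g \<noteq> g)"

definition symmetric_subgroup :: "nat \<Rightarrow> complex mat set \<Rightarrow> complex mat set \<Rightarrow> bool" where
  "symmetric_subgroup N X Y \<longleftrightarrow> algebraic_subgroup N X \<and>
     (\<exists>\<theta>. involutive_automorphism N X \<theta> \<and> Y = {g \<in> X. \<theta> g = g})"

definition dual_pair :: "nat \<Rightarrow> complex mat set \<Rightarrow> complex mat set \<Rightarrow> bool" where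
  "dual_pair m G G' \<longleftrightarrow> reductive (2 * m) G \<and> reductive (2 * m) G' \<and>
     G \<subseteq> Sp_group m \<and> G' \<subseteq> Sp_group m \<and>
     G' = centralizer (Sp_group m) G \<and> G = centralizer (Sp_group m) G'"

text \<open>\<open>irreducible_pair m K \<iota> G'\<close>: \<open>K\<close> is a classical group, \<open>\<iota>\<close> embeds it into \<open>Sp\<^bsub>2m\<^esub>\<close> as a
  member of an irreducible dual pair, and \<open>G'\<close> is the other member. The matrix \<open>P\<close>
  is an arbitrary symplectic isomorphism from the model space to \<open>\<complex>\<^bsup>2m\<^esup>\<close>.\<close>

inductive irreducible_pair ::
  "nat \<Rightarrow> complex mat set \<Rightarrow> (complex mat \<Rightarrow> complex mat) \<Rightarrow> complex mat set \<Rightarrow> bool" where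
  GL_GL: "n > 0 \<Longrightarrow> k > 0 \<Longrightarrow> P \<in> Sp_group (n * k) \<Longrightarrow>
    irreducible_pair (n * k)
      (GL_group n) (\<lambda>g. conj_by P (plus_dual (kron g (1\<^sub>m k))))
      ((\<lambda>h. conj_by P (plus_dual (kron (1\<^sub>m n) h))) ` GL_group k)"
| O_Sp: "n > 0 \<Longrightarrow> k > 0 \<Longrightarrow>
    P \<in> isometries (2 * (n * k)) (kron (1\<^sub>m n) (sympl_form k)) (sympl_form (n * k)) \<Longrightarrow>
    irreducible_pair (n * k)
      (O_group n) (\<lambda>g. conj_by P (kron g (1\<^sub>m (2 * k))))
      ((\<lambda>h. conj_by P (kron (1\<^sub>m n) h)) ` Sp_group k)"
| Sp_O: "n > 0 \<Longrightarrow> k > 0 \<Longrightarrow>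
    P \<in> isometries (2 * (n * k)) (kron (1\<^sub>m n) (sympl_form k)) (sympl_form (n * k)) \<Longrightarrow>
    irreducible_pair (n * k)
      (Sp_group k) (\<lambda>h. conj_by P (kron (1\<^sub>m n) h))
      ((\<lambda>g. conj_by P (kron g (1\<^sub>m (2 * k)))) ` O_group n)"

text \<open>The same for \<open>K\<close> a classical group or a product of two copies of a classical group. In the
  second case the dual pair is a product of two irreducible ones; the two copies occur with
  independent embeddings and possibly with different partners.\<close>

inductive classical_pair ::
  "nat \<Rightarrow> complex mat set \<Rightarrow> (complex mat \<Rightarrow> complex mat) \<Rightarrow> complex mat set \<Rightarrow> bool" where
  single: "irreducible_pair m K \<iota> G' \<Longrightarrow> classical_pair m K \<iota> G'"
| two_copies: "irreducible_pair m1 K \<iota>1 G1' \<Longrightarrow> irreducible_pair m2 K \<iota>2 G2' \<Longrightarrow>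
    Q \<in> isometries (2 * (m1 + m2)) (dsum (sympl_form m1) (sympl_form m2)) (sympl_form (m1 + m2)) \<Longrightarrow>
    (\<And>a b. a \<in> K \<Longrightarrow> b \<in> K \<Longrightarrow> \<iota> (dsum a b) = conj_by Q (dsum (\<iota>1 a) (\<iota>2 b))) \<Longrightarrow>
    classical_pair (m1 + m2) (dprod K K) \<iota> (conj_by Q ` dprod G1' G2')"


section \<open>The ten types of classical symmetric pairs\<close>

definition isotropic :: "nat \<Rightarrow> complex mat \<Rightarrow> complex vec set \<Rightarrow> bool" where
  "isotropic N B L \<longleftrightarrow> VectorSpace.subspace class_ring L (module_vec TYPE(complex) N) \<and>
     (\<forall>u\<in>L. \<forall>v\<in>L. u \<bullet> (B *\<^sub>v v) = 0)"

definition maximal_isotropic :: "nat \<Rightarrow> complex mat \<Rightarrow> complex vec set \<Rightarrow> bool" where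
  "maximal_isotropic N B L \<longleftrightarrow> isotropic N B L \<and> (\<forall>M. isotropic N B M \<and> L \<subseteq> M \<longrightarrow> M = L)"

definition polarization :: "nat \<Rightarrow> complex mat \<Rightarrow> complex vec set \<Rightarrow> complex vec set \<Rightarrow> bool" where
  "polarization N B L1 L2 \<longleftrightarrow> maximal_isotropic N B L1 \<and> maximal_isotropic N B L2 \<and>
     L1 \<inter> L2 = {0\<^sub>v N} \<and> {u + v | u v. u \<in> L1 \<and> v \<in> L2} = carrier_vec N"

definition pair_stabilizer ::
  "complex mat set \<Rightarrow> complex vec set \<Rightarrow> complex vec set \<Rightarrow> complex mat set" where
  "pair_stabilizer K L1 L2 = {g \<in> K. (*\<^sub>v) g ` L1 = L1 \<and> (*\<^sub>v) g ` L2 = L2}"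

text \<open>In the direct sum and bilinear form types, \<open>Q\<close> is a change of basis: it ranges over all
  (orthogonal) decompositions into two nonzero summands, respectively over all nondegenerate
  symmetric or alternating forms.\<close>

inductive classical_symmetric_pair :: "complex mat set \<Rightarrow> complex mat set \<Rightarrow> bool" where
  diagonal_GL: "n > 0 \<Longrightarrow>
    classical_symmetric_pair (dprod (GL_group n) (GL_group n)) {dsum g g | g. g \<in> GL_group n}"
| diagonal_O: "n > 0 \<Longrightarrow>
    classical_symmetric_pair (dprod (O_group n) (O_group n)) {dsum g g | g. g \<in> O_group n}"
| diagonal_Sp: "n > 0 \<Longrightarrow>
    classical_symmetric_pair (dprod (Sp_group n) (Sp_group n)) {dsum g g | g. g \<in> Sp_group n}"
| direct_sum_GL: "n > 0 \<Longrightarrow> k > 0 \<Longrightarrow> Q \<in> GL_group (n + k) \<Longrightarrow>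
    classical_symmetric_pair (GL_group (n + k)) (conj_by Q ` dprod (GL_group n) (GL_group k))"
| direct_sum_O: "n > 0 \<Longrightarrow> k > 0 \<Longrightarrow> Q \<in> O_group (n + k) \<Longrightarrow>
    classical_symmetric_pair (O_group (n + k)) (conj_by Q ` dprod (O_group n) (O_group k))"
| direct_sum_Sp: "n > 0 \<Longrightarrow> k > 0 \<Longrightarrow>
    Q \<in> isometries (2 * (n + k)) (dsum (sympl_form n) (sympl_form k)) (sympl_form (n + k)) \<Longrightarrow>
    classical_symmetric_pair (Sp_group (n + k)) (conj_by Q ` dprod (Sp_group n) (Sp_group k))"
| polarization_O: "n > 0 \<Longrightarrow> polarization (2 * n) (1\<^sub>m (2 * n)) L1 L2 \<Longrightarrow>
    classical_symmetric_pair (O_group (2 * n)) (pair_stabilizer (O_group (2 * n)) L1 L2)"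
| polarization_Sp: "n > 0 \<Longrightarrow> polarization (2 * n) (sympl_form n) L1 L2 \<Longrightarrow>
    classical_symmetric_pair (Sp_group n) (pair_stabilizer (Sp_group n) L1 L2)"
| bilinear_O: "n > 0 \<Longrightarrow> Q \<in> GL_group n \<Longrightarrow>
    classical_symmetric_pair (GL_group n) (conj_by Q ` O_group n)"
| bilinear_Sp: "n > 0 \<Longrightarrow> Q \<in> GL_group (2 * n) \<Longrightarrow>
    classical_symmetric_pair (GL_group (2 * n)) (conj_by Q ` Sp_group n)"

end

theory Submission
  imports Defs "Jordan_Normal_Form.Schur_Decomposition"
begin

text \<open>Let \<open>Z\<close> be the centralizer of \<open>H\<close> in the symplectic group. In a suitable basis all groups \<open>X\<close> are
  closed under \<open>x \<mapsto> x\<^sup>\<dagger>\<close>, hence reductive: for a normal unipotent subgroup \<open>U\<close> the trace of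
  \<open>x (u - 1)\<close> vanishes for \<open>x \<in> X\<close> and \<open>u \<in> U\<close>, so \<open>(u - 1)\<^sup>\<dagger> (u - 1)\<close> has trace zero. In every type \<open>H\<close> is the
  centralizer in \<open>G\<close> of a single element \<open>t \<in> Z\<close>. An element of the symplectic group that commutes
  with \<open>Z \<supseteq> G'\<close> lies in \<open>G\<close> by duality and commutes with \<open>t\<close>, so it lies in \<open>H\<close>; thus \<open>(H, Z)\<close> is
  a dual pair. If the standard module of \<open>G\<close> splits under \<open>H\<close> into two isotypic components, then an
  element of \<open>Z\<close> is a pair of operators on the multiplicity space, it lies in \<open>G'\<close> if and only if
  the two agree, and exchanging them is the involution. In the diagonal and the bilinear form types
  the involution is conjugation by an element of \<open>G\<close> that centralizes \<open>H\<close>.\<close>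

section \<open>The general linear group and regular maps\<close>

text \<open>The obstacle is that \<open>H'\<close> has a different shape in each of the ten types;
  neither its reductivity nor its involution is obtained by identifying it. Reductivity is
  inherited: in a basis where the symplectic form is a matrix \<open>w\<close> with
  \<open>w * w\<close> scalar and \<open>dagger w\<close> proportional to \<open>w\<close>, the
  isometries are stable under adjoints, and so is the centralizer in them of any set stable under
  adjoints. The embeddings and the subgroups \<open>L\<close> come in arbitrary bases, so much of
  the work is a change of basis into such a position. The vanishing of the traces does not go
  through an invariant flag: the span of the \<open>u - 1\<close> is an algebra of matrices of trace
  zero, so none of its elements fixes a nonzero vector, and an eigenvector of
  \<open>x * (u - 1)\<close> with nonzero eigenvalue would start a chain of nonzero vectors that is
  too long. The exchange of operators is written with matrix units, as the sum of the
  \<open>E p (f p) * b * E (f p) p\<close>, which is visibly regular. A member of type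
  \<open>GL\<close> acts on a standard module plus its dual, so there \<open>G\<close> itself has
  two components.\<close>

lemma sq_assoc:
  "a \<in> carrier_mat n n \<Longrightarrow> b \<in> carrier_mat n n \<Longrightarrow> c \<in> carrier_mat n n \<Longrightarrow> a * b * c = a * (b * c)"
  by (rule assoc_mult_mat)

lemma sq_mult: "a \<in> carrier_mat n n \<Longrightarrow> b \<in> carrier_mat n n \<Longrightarrow> a * b \<in> carrier_mat n n"
  by (rule mult_carrier_mat)

lemma GL_simps [simp]: "x \<otimes>\<^bsub>GL n\<^esub> y = x * y" "\<one>\<^bsub>GL n\<^esub> = 1\<^sub>m n"
  by (simp_all add: GL_def)

lemma GL_groupD: "A \<in> GL_group n \<Longrightarrow> A \<in> carrier_mat n n"
  by (simp add: GL_def)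

lemma GL_group_if_right_inverse:
  assumes "A \<in> carrier_mat n n" "B \<in> carrier_mat n n" "A * B = 1\<^sub>m n"
  shows "A \<in> GL_group n"
proof -
  have "B * A = 1\<^sub>m n" using mat_mult_left_right_inverse[OF assms(1,2,3)] .
  then have "invertible_mat A" using assms unfolding invertible_mat_def inverts_mat_def by auto
  then show ?thesis using assms by (simp add: GL_def)
qed

lemma GL_group_if_left_inverse:
  assumes "A \<in> carrier_mat n n" "B \<in> carrier_mat n n" "B * A = 1\<^sub>m n"
  shows "A \<in> GL_group n"
  using GL_group_if_right_inverse[OF assms(1,2)] mat_mult_left_right_inverse[OF assms(2,1,3)] by simp

lemma GL_obtain_inverse:
  assumes "A \<in> GL_group n"
  obtains B where "B \<in> carrier_mat n n" "A * B = 1\<^sub>m n" "B * A = 1\<^sub>m n"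
proof -
  have A: "A \<in> carrier_mat n n" "invertible_mat A" using assms by (simp_all add: GL_def)
  then obtain B where B: "A * B = 1\<^sub>m (dim_row A)" "B * A = 1\<^sub>m (dim_row B)"
    unfolding invertible_mat_def inverts_mat_def by auto
  have "dim_col (B * A) = dim_row B" "dim_col (A * B) = dim_row A" using B by simp_all
  then have "B \<in> carrier_mat n n" using A(1) by auto
  then show ?thesis using that[of B] B A(1) by auto
qed

lemma one_in_GL [simp]: "1\<^sub>m n \<in> GL_group n"
  using GL_group_if_right_inverse[of "1\<^sub>m n" n "1\<^sub>m n"] by simp

lemma GL_group_mult: "A \<in> GL_group n \<Longrightarrow> B \<in> GL_group n \<Longrightarrow> A * B \<in> GL_group n"
proof -
  assume A: "A \<in> GL_group n" and B: "B \<in> GL_group n"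
  obtain A' where A': "A' \<in> carrier_mat n n" "A * A' = 1\<^sub>m n" by (rule GL_obtain_inverse[OF A])
  obtain B' where B': "B' \<in> carrier_mat n n" "B * B' = 1\<^sub>m n" by (rule GL_obtain_inverse[OF B])
  note c = GL_groupD[OF A] GL_groupD[OF B] A'(1) B'(1)
  have "A * B * (B' * A') = A * (B * B') * A'" using c by (simp add: sq_assoc[of _ n] sq_mult[of _ n])
  then have "A * B * (B' * A') = 1\<^sub>m n" using c A' B' by simp
  then show ?thesis using c GL_group_if_right_inverse[of "A * B" n "B' * A'"] by (simp add: sq_mult[of _ n])
qed

lemma group_GL: "group (GL n)"
proof (rule groupI)
  fix x y z assume "x \<in> carrier (GL n)" "y \<in> carrier (GL n)" "z \<in> carrier (GL n)"
  then show "x \<otimes>\<^bsub>GL n\<^esub> y \<otimes>\<^bsub>GL n\<^esub> z = x \<otimes>\<^bsub>GL n\<^esub> (y \<otimes>\<^bsub>GL n\<^esub> z)"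
    by (simp add: GL_groupD sq_assoc[of _ n])
next
  fix x assume x: "x \<in> carrier (GL n)"
  then obtain B where B: "B \<in> carrier_mat n n" "x * B = 1\<^sub>m n" "B * x = 1\<^sub>m n" by (rule GL_obtain_inverse)
  then have "B \<in> carrier (GL n)" using GL_group_if_right_inverse[of B n x] GL_groupD[OF x] by simp
  then show "\<exists>y\<in>carrier (GL n). y \<otimes>\<^bsub>GL n\<^esub> x = \<one>\<^bsub>GL n\<^esub>" using B by auto
qed (auto simp: GL_group_mult dest: GL_groupD)

abbreviation minv :: "nat \<Rightarrow> complex mat \<Rightarrow> complex mat" where
  "minv n A \<equiv> inv\<^bsub>GL n\<^esub> A"

lemma minv_GL: "A \<in> GL_group n \<Longrightarrow> minv n A \<in> GL_group n"
  by (rule group.inv_closed[OF group_GL])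

lemma minv_carrier: "A \<in> GL_group n \<Longrightarrow> minv n A \<in> carrier_mat n n"
  using minv_GL GL_groupD by blast

lemma minv_right: "A \<in> GL_group n \<Longrightarrow> A * minv n A = 1\<^sub>m n"
  using group.r_inv[OF group_GL] by simp

lemma minv_left: "A \<in> GL_group n \<Longrightarrow> minv n A * A = 1\<^sub>m n"
  using group.l_inv[OF group_GL] by simp

lemma minv_eq:
  assumes "A \<in> carrier_mat n n" "B \<in> carrier_mat n n" "A * B = 1\<^sub>m n"
  shows "minv n A = B"
proof (rule group.inv_equality[OF group_GL])
  show "A \<in> carrier (GL n)" using assms by (rule GL_group_if_right_inverse)
  show "B \<in> carrier (GL n)" using assms GL_group_if_left_inverse by blast
  show "B \<otimes>\<^bsub>GL n\<^esub> A = \<one>\<^bsub>GL n\<^esub>" using mat_mult_left_right_inverse[OF assms] by simp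
qed

lemma minv_minv [simp]: "A \<in> GL_group n \<Longrightarrow> minv n (minv n A) = A"
  by (rule group.inv_inv[OF group_GL])

lemma minv_one [simp]: "minv n (1\<^sub>m n) = 1\<^sub>m n"
  by (rule minv_eq) auto

lemma minv_mult: "A \<in> GL_group n \<Longrightarrow> B \<in> GL_group n \<Longrightarrow> minv n (A * B) = minv n B * minv n A"
  using group.inv_mult_group[OF group_GL] by simp

lemma minv_cancel:
  assumes "P \<in> GL_group n" "a \<in> carrier_mat n n"
  shows "minv n P * (P * a) = a" "P * (minv n P * a) = a"
  using assms minv_left[OF assms(1)] minv_right[OF assms(1)] minv_carrier[OF assms(1)] GL_groupD[OF assms(1)]
  by (simp_all flip: sq_assoc[of _ n])

lemma conj_by_eq: "P \<in> GL_group n \<Longrightarrow> conj_by P x = P * x * minv n P"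
  by (auto simp: conj_by_def dest: GL_groupD)

lemma conj_by_carrier: "P \<in> GL_group n \<Longrightarrow> x \<in> carrier_mat n n \<Longrightarrow> conj_by P x \<in> carrier_mat n n"
  by (simp add: conj_by_eq sq_mult[of _ n] minv_carrier GL_groupD)

lemma conj_by_one: "P \<in> GL_group n \<Longrightarrow> conj_by P (1\<^sub>m n) = 1\<^sub>m n"
  by (simp add: conj_by_eq minv_right right_mult_one_mat[OF GL_groupD])

lemma conj_by_mult:
  assumes "P \<in> GL_group n" "x \<in> carrier_mat n n" "y \<in> carrier_mat n n"
  shows "conj_by P (x * y) = conj_by P x * conj_by P y"
  using assms minv_carrier[OF assms(1)] GL_groupD[OF assms(1)]
  by (simp add: conj_by_eq sq_assoc[of _ n] sq_mult[of _ n] minv_cancel)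

lemma conj_by_comp:
  assumes "P \<in> GL_group n" "Q \<in> GL_group n" "x \<in> carrier_mat n n"
  shows "conj_by P (conj_by Q x) = conj_by (P * Q) x"
  using assms minv_carrier[OF assms(1)] GL_groupD[OF assms(1)] minv_carrier[OF assms(2)] GL_groupD[OF assms(2)]
  by (simp add: conj_by_eq[where n = n] sq_assoc[of _ n] sq_mult[of _ n] GL_group_mult minv_mult)

lemma conj_by_minv:
  assumes "P \<in> GL_group n" "x \<in> carrier_mat n n"
  shows "conj_by P (conj_by (minv n P) x) = x" "conj_by (minv n P) (conj_by P x) = x"
  using conj_by_comp[OF assms(1) minv_GL[OF assms(1)] assms(2)] conj_by_comp[OF minv_GL[OF assms(1)] assms(1,2)]
    assms by (simp_all add: minv_right minv_left conj_by_eq[OF one_in_GL])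

lemma conj_by_cancel:
  assumes "P \<in> GL_group n" "x \<in> carrier_mat n n" "y \<in> carrier_mat n n"
  shows "conj_by P x = conj_by P y \<longleftrightarrow> x = y"
  using conj_by_minv(2)[OF assms(1)] assms by metis

lemma conj_by_commute:
  assumes "P \<in> GL_group n" "x \<in> carrier_mat n n" "y \<in> carrier_mat n n"
  shows "conj_by P x * conj_by P y = conj_by P y * conj_by P x \<longleftrightarrow> x * y = y * x"
  using assms by (simp add: sq_mult[of _ n] conj_by_cancel flip: conj_by_mult[OF assms(1)])

lemma conj_by_GL: "P \<in> GL_group n \<Longrightarrow> x \<in> GL_group n \<Longrightarrow> conj_by P x \<in> GL_group n"
  by (simp add: conj_by_eq GL_group_mult minv_GL)

lemma transpose_GL: "A \<in> GL_group n \<Longrightarrow> transpose_mat A \<in> GL_group n"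
  using GL_group_if_left_inverse[of "transpose_mat A" n "transpose_mat (minv n A)"]
    transpose_mult[of A n n "minv n A" n] minv_carrier[of A n] GL_groupD[of A n] minv_right[of A n]
  by auto

lemma minv_transpose: "A \<in> GL_group n \<Longrightarrow> minv n (transpose_mat A) = transpose_mat (minv n A)"
  using minv_eq[of "transpose_mat A" n "transpose_mat (minv n A)"]
    transpose_mult[of "minv n A" n n "A" n] minv_carrier[of A n] GL_groupD[of A n] minv_left[of A n]
  by auto

section \<open>Isometry groups of bilinear forms\<close>

lemma isometries_sq_iff:
  "P \<in> isometries N B B \<longleftrightarrow> P \<in> GL_group N \<and> transpose_mat P * B * P = B"
  by (auto simp: isometries_def)

lemma isometriesD:
  assumes "P \<in> isometries N B C"
  shows "P \<in> GL_group N" "P \<in> carrier_mat N N" "transpose_mat P * C * P = B"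
  using assms by (auto simp: isometries_def dest: GL_groupD)

text \<open>The form equation alone yields a left inverse of \<open>P\<close>, namely
  \<open>minv N B * (transpose_mat P * C)\<close>. So when the source form is invertible,
  invertibility of \<open>P\<close> is not a separate obligation.\<close>

lemma isometries_if_nondegenerate:
  assumes "P \<in> carrier_mat N N" "B \<in> GL_group N" "C \<in> carrier_mat N N" "transpose_mat P * C * P = B"
  shows "P \<in> isometries N B C"
proof -
  have "minv N B * (transpose_mat P * C) * P = 1\<^sub>m N"
    using assms minv_left[OF assms(2)] minv_carrier[OF assms(2)]
    by (simp add: sq_assoc[of _ N] sq_mult[of _ N])
  then have "P \<in> GL_group N"
    using assms minv_carrier[OF assms(2)]
    by (intro GL_group_if_left_inverse[of P N "minv N B * (transpose_mat P * C)"]) (simp_all add: sq_mult[of _ N])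
  then show ?thesis using assms by (simp add: isometries_def)
qed

lemma isometries_comp:
  assumes "P \<in> isometries N C D" "Q \<in> isometries N B C" "D \<in> carrier_mat N N"
  shows "P * Q \<in> isometries N B D"
proof -
  note p = isometriesD[OF assms(1)] and q = isometriesD[OF assms(2)]
  have "transpose_mat (P * Q) * D * (P * Q) = transpose_mat Q * (transpose_mat P * D * P) * Q"
    using p(2) q(2) assms(3) by (simp add: transpose_mult[of _ N N _ N] sq_assoc[of _ N] sq_mult[of _ N])
  then show ?thesis using p q by (simp add: isometries_def GL_group_mult)
qed

lemma isometries_minv:
  assumes "P \<in> isometries N B C" "C \<in> carrier_mat N N"
  shows "minv N P \<in> isometries N C B"
proof -
  note p = isometriesD[OF assms(1)]
  note c = minv_carrier[OF p(1)]
  have "transpose_mat (minv N P) * B * minv N P = transpose_mat (P * minv N P) * C * (P * minv N P)"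
    unfolding p(3)[symmetric] using p(2) c assms(2) by (simp add: transpose_mult[of _ N N _ N] sq_assoc[of _ N] sq_mult[of _ N])
  then show ?thesis using p c assms(2) by (simp add: isometries_def minv_right minv_GL)
qed

lemma isometries_subgroup:
  assumes "B \<in> carrier_mat N N"
  shows "subgroup (isometries N B B) (GL N)"
proof (rule group.subgroupI[OF group_GL])
  have "1\<^sub>m N \<in> isometries N B B" using assms by (simp add: isometries_def)
  then show "isometries N B B \<noteq> {}" by blast
next
  show "isometries N B B \<subseteq> carrier (GL N)" by (auto simp: isometries_def)
qed (auto intro: isometries_comp[OF _ _ assms] isometries_minv[OF _ assms])

text \<open>The entries only have to agree on \<open>X\<close> with regular functions, which is how
  regularity of an automorphism is stated in \<open>involutive_automorphism\<close>. Membership in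
  \<open>carrier_mat\<close> is included so that sums and products compose.\<close>

definition regular_map :: "nat \<Rightarrow> complex mat set \<Rightarrow> (complex mat \<Rightarrow> complex mat) \<Rightarrow> bool" where
  "regular_map N X F \<longleftrightarrow> (\<forall>g\<in>X. F g \<in> carrier_mat N N) \<and>
     (\<forall>i<N. \<forall>j<N. \<exists>f\<in>regular_functions N. \<forall>g\<in>X. F g $$ (i, j) = f g)"

lemma regular_functions_sum:
  "finite S \<Longrightarrow> (\<And>s. s \<in> S \<Longrightarrow> f s \<in> regular_functions N) \<Longrightarrow> (\<lambda>g. \<Sum>s\<in>S. f s g) \<in> regular_functions N"
  by (induction S rule: finite_induct) (auto intro: regular_functions.intros)

lemma regular_map_id: "X \<subseteq> carrier_mat N N \<Longrightarrow> regular_map N X (\<lambda>g. g)"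
  unfolding regular_map_def by (auto intro: regular_functions.entry)

lemma regular_map_const: "A \<in> carrier_mat N N \<Longrightarrow> regular_map N X (\<lambda>g. A)"
  unfolding regular_map_def by (auto intro: regular_functions.const)

lemma regular_map_transpose: "regular_map N X F \<Longrightarrow> regular_map N X (\<lambda>g. transpose_mat (F g))"
proof -
  assume F: "regular_map N X F"
  have "transpose_mat (F g) $$ (i, j) = F g $$ (j, i)" if "g \<in> X" "i < N" "j < N" for g i j
  proof -
    have "F g \<in> carrier_mat N N" using F that(1) unfolding regular_map_def by blast
    then show ?thesis using that(2,3) by auto
  qed
  note e = this
  show "regular_map N X (\<lambda>g. transpose_mat (F g))"
    unfolding regular_map_def
  proof (intro conjI allI impI ballI)
    fix i j assume ij: "i < N" "j < N"
    then obtain f where "f \<in> regular_functions N" "\<forall>g\<in>X. F g $$ (j, i) = f g"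
      using F unfolding regular_map_def by blast
    then show "\<exists>f\<in>regular_functions N. \<forall>g\<in>X. transpose_mat (F g) $$ (i, j) = f g"
      using e ij by (intro bexI[of _ f]) auto
  next
    fix g assume "g \<in> X"
    then show "transpose_mat (F g) \<in> carrier_mat N N" using F unfolding regular_map_def by auto
  qed
qed

lemma regular_map_add:
  assumes "regular_map N X F" "regular_map N X H"
  shows "regular_map N X (\<lambda>g. F g + H g)"
  unfolding regular_map_def
proof (intro conjI allI impI ballI)
  fix i j assume ij: "i < N" "j < N"
  obtain f h where f: "f \<in> regular_functions N" "\<And>g. g \<in> X \<Longrightarrow> F g $$ (i, j) = f g"
    and h: "h \<in> regular_functions N" "\<And>g. g \<in> X \<Longrightarrow> H g $$ (i, j) = h g"
    using assms ij unfolding regular_map_def by metis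
  have c: "\<And>g. g \<in> X \<Longrightarrow> H g \<in> carrier_mat N N" using assms unfolding regular_map_def by blast
  show "\<exists>f\<in>regular_functions N. \<forall>g\<in>X. (F g + H g) $$ (i, j) = f g"
  proof (intro bexI[of _ "\<lambda>g. f g + h g"] ballI)
    fix g assume g: "g \<in> X"
    show "(F g + H g) $$ (i, j) = f g + h g"
      using carrier_matD[OF c[OF g]] ij f(2)[OF g] h(2)[OF g] by simp
  qed (use f(1) h(1) in \<open>auto intro: regular_functions.add\<close>)
next
  fix g assume "g \<in> X" then show "F g + H g \<in> carrier_mat N N"
    using assms unfolding regular_map_def by auto
qed

lemma regular_map_mult:
  assumes "regular_map N X F" "regular_map N X H"
  shows "regular_map N X (\<lambda>g. F g * H g)"
  unfolding regular_map_def
proof (intro conjI allI impI ballI)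
  fix i j assume ij: "i < N" "j < N"
  have "\<forall>k. \<exists>f. k < N \<longrightarrow> f \<in> regular_functions N \<and> (\<forall>g\<in>X. F g $$ (i, k) = f g)"
    using assms(1) ij unfolding regular_map_def by metis
  then obtain f where f: "\<And>k. k < N \<Longrightarrow> f k \<in> regular_functions N" "\<And>k g. k < N \<Longrightarrow> g \<in> X \<Longrightarrow> F g $$ (i, k) = f k g"
    by metis
  have "\<forall>k. \<exists>f. k < N \<longrightarrow> f \<in> regular_functions N \<and> (\<forall>g\<in>X. H g $$ (k, j) = f g)"
    using assms(2) ij unfolding regular_map_def by metis
  then obtain h where h: "\<And>k. k < N \<Longrightarrow> h k \<in> regular_functions N" "\<And>k g. k < N \<Longrightarrow> g \<in> X \<Longrightarrow> H g $$ (k, j) = h k g"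
    by metis
  have c: "F g \<in> carrier_mat N N" "H g \<in> carrier_mat N N" if "g \<in> X" for g
    using assms that unfolding regular_map_def by blast+
  show "\<exists>f\<in>regular_functions N. \<forall>g\<in>X. (F g * H g) $$ (i, j) = f g"
  proof (intro bexI[of _ "\<lambda>g. \<Sum>k\<in>{0..<N}. f k g * h k g"] ballI)
    fix g assume g: "g \<in> X"
    then show "(F g * H g) $$ (i, j) = (\<Sum>k\<in>{0..<N}. f k g * h k g)"
      using c[OF g] ij f(2)[OF _ g] h(2)[OF _ g] by (simp add: scalar_prod_def)
  qed (use f(1) h(1) in \<open>auto intro!: regular_functions_sum regular_functions.mult\<close>)
next
  fix g assume "g \<in> X" then show "F g * H g \<in> carrier_mat N N"
    using assms mult_carrier_mat unfolding regular_map_def by blast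
qed

text \<open>Each matrix equation \<open>F s g = H s g\<close> is a family of scalar equations, and
  these are added to the equations of \<open>X\<close>. The index set \<open>S\<close> may be
  infinite, which is what centralizers require.\<close>

lemma zariski_closed_equalizer:
  assumes X: "zariski_closed N X" and "\<And>s. s \<in> S \<Longrightarrow> regular_map N X (F s)" "\<And>s. s \<in> S \<Longrightarrow> regular_map N X (H s)"
  shows "zariski_closed N {g \<in> X. \<forall>s\<in>S. F s g = H s g}"
proof -
  obtain E where E: "E \<subseteq> regular_functions N" "X = {g \<in> GL_group N. \<forall>f\<in>E. f g = 0}"
    using X unfolding zariski_closed_def by blast
  \<comment> \<open>A regular function representing an entry is determined only on \<open>X\<close>.
    Collecting every function that agrees there with the entrywise difference avoids choosing
    representatives for all \<open>s\<close>, \<open>i\<close>, \<open>j\<close>.\<close>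
  define q where "q d s i j \<longleftrightarrow> (\<forall>g\<in>X. d g = F s g $$ (i, j) - H s g $$ (i, j))" for d s i j
  define D where "D = {d \<in> regular_functions N. \<exists>s i j. s \<in> S \<and> i < N \<and> j < N \<and> q d s i j}"
  have "{g \<in> X. \<forall>s\<in>S. F s g = H s g} = {g \<in> GL_group N. \<forall>f\<in>E \<union> D. f g = 0}"
  proof (intro equalityI subsetI)
    fix g assume "g \<in> {g \<in> X. \<forall>s\<in>S. F s g = H s g}"
    then have g: "g \<in> X" "\<And>s. s \<in> S \<Longrightarrow> F s g = H s g" by auto
    have "d g = 0" if d: "d \<in> D" for d
    proof -
      obtain s i j where "s \<in> S" "q d s i j"
        using d unfolding D_def by blast
      then show ?thesis using g by (simp add: q_def)
    qed
    then show "g \<in> {g \<in> GL_group N. \<forall>f\<in>E \<union> D. f g = 0}" using E(2) g(1) by blast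
  next
    fix g assume g: "g \<in> {g \<in> GL_group N. \<forall>f\<in>E \<union> D. f g = 0}"
    then have gX: "g \<in> X" using E(2) by auto
    have "F s g = H s g" if s: "s \<in> S" for s
    proof (rule eq_matI)
      have c: "F s g \<in> carrier_mat N N" "H s g \<in> carrier_mat N N"
        using assms(2,3)[OF s] gX unfolding regular_map_def by blast+
      then show "dim_row (F s g) = dim_row (H s g)" "dim_col (F s g) = dim_col (H s g)" by auto
      fix i j assume "i < dim_row (H s g)" "j < dim_col (H s g)"
      then have ij: "i < N" "j < N" using c by auto
      obtain f h where f: "f \<in> regular_functions N" "\<forall>g\<in>X. F s g $$ (i, j) = f g"
        and h: "h \<in> regular_functions N" "\<forall>g\<in>X. H s g $$ (i, j) = h g"
        using assms(2,3)[OF s] ij unfolding regular_map_def by metis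
      have r: "(\<lambda>g. f g + (- 1) * h g) \<in> regular_functions N"
        by (intro regular_functions.add regular_functions.mult regular_functions.const f(1) h(1))
      define d where "d = (\<lambda>g. f g + (- 1) * h g)"
      have d: "q d s i j" using f(2) h(2) by (simp add: d_def q_def)
      have r': "d \<in> regular_functions N" using r by (simp only: d_def)
      have "\<exists>s i j. s \<in> S \<and> i < N \<and> j < N \<and> q d s i j" using s ij d by blast
      then have "d \<in> D" unfolding D_def using r' by blast
      then have "d g = 0" using g by blast
      then show "F s g $$ (i, j) = H s g $$ (i, j)" using d gX by (simp add: q_def)
    qed
    then show "g \<in> {g \<in> X. \<forall>s\<in>S. F s g = H s g}" using gX by blast
  qed
  moreover have "E \<union> D \<subseteq> regular_functions N" using E(1) unfolding D_def by blast
  ultimately show ?thesis unfolding zariski_closed_def by blast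
qed

lemma zariski_closed_GL: "zariski_closed N (GL_group N)"
  unfolding zariski_closed_def by (intro exI[of _ "{}"]) auto

lemma zariski_closed_isometries:
  assumes "B \<in> carrier_mat N N"
  shows "zariski_closed N (isometries N B B)"
proof -
  have "zariski_closed N {g \<in> GL_group N. \<forall>s\<in>{()}. transpose_mat g * B * g = B}"
    using assms GL_groupD
    by (intro zariski_closed_equalizer zariski_closed_GL regular_map_mult regular_map_transpose regular_map_id regular_map_const) auto
  then show ?thesis by (simp add: isometries_def)
qed

lemma isometries_algebraic:
  "B \<in> carrier_mat N N \<Longrightarrow> algebraic_subgroup N (isometries N B B)"
  by (simp add: algebraic_subgroup_def isometries_subgroup zariski_closed_isometries)

text \<open>Commuting with \<open>x\<close> is the coincidence of two regular maps, right and left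
  multiplication by \<open>x\<close>, so closedness is an instance of the equalizer.\<close>

lemma centralizer_algebraic:
  assumes "algebraic_subgroup N S" "X \<subseteq> GL_group N"
  shows "algebraic_subgroup N (centralizer S X)"
proof -
  have S: "subgroup S (GL N)" "zariski_closed N S" using assms(1) by (simp_all add: algebraic_subgroup_def)
  have SG: "S \<subseteq> GL_group N" using S(1) by (rule subgroup.subset)
  have cS: "g \<in> carrier_mat N N" if "g \<in> S" for g using SG that GL_groupD by blast
  have cX: "g \<in> carrier_mat N N" if "g \<in> X" for g using assms(2) that GL_groupD by blast
  have "zariski_closed N (centralizer S X)"
    unfolding centralizer_def using S(2) cS cX
    by (intro zariski_closed_equalizer regular_map_mult regular_map_id regular_map_const) auto
  moreover have "subgroup (centralizer S X) (GL N)"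
  proof (rule group.subgroupI[OF group_GL])
    show "centralizer S X \<subseteq> carrier (GL N)" using SG by (auto simp: centralizer_def)
    have "1\<^sub>m N * x = x * 1\<^sub>m N" if "x \<in> X" for x
      using left_mult_one_mat[OF cX[OF that]] right_mult_one_mat[OF cX[OF that]] by simp
    then have "1\<^sub>m N \<in> centralizer S X"
      using subgroup.one_closed[OF S(1)] by (simp add: centralizer_def)
    then show "centralizer S X \<noteq> {}" by blast
  next
    fix a assume a: "a \<in> centralizer S X"
    then have aS: "a \<in> S" by (simp add: centralizer_def)
    then have aG: "a \<in> GL_group N" using SG by blast
    have "minv N a * x = x * minv N a" if x: "x \<in> X" for x
    proof -
      have ax: "a * x = x * a" using a x by (simp add: centralizer_def)
      have "minv N a * x = minv N a * (x * a) * minv N a"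
        using aG cX[OF x] GL_groupD[OF aG] minv_carrier[OF aG]
        by (simp add: sq_assoc[of _ N] sq_mult[of _ N] minv_right)
      also have "\<dots> = x * minv N a"
        using aG cX[OF x] GL_groupD[OF aG] minv_carrier[OF aG]
        by (simp add: sq_assoc[of _ N] sq_mult[of _ N] minv_cancel flip: ax)
      finally show ?thesis .
    qed
    then show "minv N a \<in> centralizer S X"
      using subgroup.m_inv_closed[OF S(1) aS] by (simp add: centralizer_def)
  next
    fix a b assume a: "a \<in> centralizer S X" and b: "b \<in> centralizer S X"
    then have ab: "a \<in> S" "b \<in> S" by (simp_all add: centralizer_def)
    have "a * b * x = x * (a * b)" if x: "x \<in> X" for x
    proof -
      have e: "a * x = x * a" "b * x = x * b" using a b x by (auto simp: centralizer_def)
      note c = cS[OF ab(1)] cS[OF ab(2)] cX[OF x]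
      have "a * b * x = a * (b * x)" by (rule sq_assoc[OF c])
      also have "\<dots> = a * x * b" unfolding e(2) by (rule sq_assoc[OF c(1,3,2), symmetric])
      also have "\<dots> = x * (a * b)" unfolding e(1) by (rule sq_assoc[OF c(3,1,2)])
      finally show ?thesis .
    qed
    then show "a \<otimes>\<^bsub>GL N\<^esub> b \<in> centralizer S X"
      using subgroup.m_closed[OF S(1) ab] by (simp add: centralizer_def)
  qed
  ultimately show ?thesis by (simp add: algebraic_subgroup_def)
qed

section \<open>A trace criterion for nilpotency\<close>

definition mtrace :: "complex mat \<Rightarrow> complex" where
  "mtrace A = (\<Sum>i<dim_row A. A $$ (i, i))"

lemma mtrace_mult_commute:
  assumes "A \<in> carrier_mat n n" "B \<in> carrier_mat n n"
  shows "mtrace (A * B) = mtrace (B * A)"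
proof -
  have "mtrace (A * B) = (\<Sum>i<n. \<Sum>j\<in>{0..<n}. A $$ (i, j) * B $$ (j, i))"
    using assms unfolding mtrace_def by (intro sum.cong) (auto simp: scalar_prod_def)
  also have "\<dots> = (\<Sum>j\<in>{0..<n}. \<Sum>i<n. A $$ (i, j) * B $$ (j, i))" by (rule sum.swap)
  also have "\<dots> = mtrace (B * A)"
    using assms unfolding mtrace_def
    by (intro sum.cong) (auto simp: scalar_prod_def mult.commute atLeast0LessThan)
  finally show ?thesis .
qed

lemma mtrace_add: "A \<in> carrier_mat n n \<Longrightarrow> B \<in> carrier_mat n n \<Longrightarrow> mtrace (A + B) = mtrace A + mtrace B"
  by (simp add: mtrace_def sum.distrib)

lemma mtrace_minus: "A \<in> carrier_mat n n \<Longrightarrow> B \<in> carrier_mat n n \<Longrightarrow> mtrace (A - B) = mtrace A - mtrace B"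
  by (simp add: mtrace_def sum_subtractf)

lemma mtrace_smult: "mtrace (c \<cdot>\<^sub>m A) = c * mtrace A" if "A \<in> carrier_mat n n"
  using that by (simp add: mtrace_def sum_distrib_left)

lemma upper_triangular_mult:
  assumes "A \<in> carrier_mat n n" "B \<in> carrier_mat n n" "upper_triangular A" "upper_triangular (B :: complex mat)"
  shows "upper_triangular (A * B)" "\<And>i. i < n \<Longrightarrow> (A * B) $$ (i, i) = A $$ (i, i) * B $$ (i, i)"
proof -
  have A0: "A $$ (i, k) = 0" if "k < i" "i < n" for i k using that assms(1,3) by auto
  have B0: "B $$ (i, k) = 0" if "k < i" "i < n" for i k using that assms(2,4) by auto
  have e: "(A * B) $$ (i, j) = (\<Sum>k\<in>{0..<n}. A $$ (i, k) * B $$ (k, j))" if "i < n" "j < n" for i j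
    using assms(1,2) that by (simp add: scalar_prod_def)
  show "upper_triangular (A * B)"
  proof (rule upper_triangularI)
    fix i j assume ij: "j < i" "i < dim_row (A * B)"
    then have "i < n" "j < n" using assms by auto
    then have "(\<Sum>k\<in>{0..<n}. A $$ (i, k) * B $$ (k, j)) = 0"
      using ij A0 B0 by (intro sum.neutral) (metis atLeastLessThan_iff le_less_trans mult_eq_0_iff not_le)
    then show "(A * B) $$ (i, j) = 0" using e[OF \<open>i < n\<close> \<open>j < n\<close>] by simp
  qed
  fix i assume i: "i < n"
  have "(\<Sum>k\<in>{0..<n}. A $$ (i, k) * B $$ (k, i)) = (\<Sum>k\<in>{0..<n}. if k = i then A $$ (i, i) * B $$ (i, i) else 0)"
    using i A0 B0 by (intro sum.cong) (auto simp: linorder_neq_iff)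
  then show "(A * B) $$ (i, i) = A $$ (i, i) * B $$ (i, i)" using e[OF i i] i by simp
qed

lemma upper_triangular_pow:
  assumes "B \<in> carrier_mat n n" "upper_triangular (B :: complex mat)"
  shows "upper_triangular (B ^\<^sub>m k) \<and> (\<forall>i<n. (B ^\<^sub>m k) $$ (i, i) = (B $$ (i, i)) ^ k)"
proof (induction k)
  case 0 then show ?case using assms by auto
next
  case (Suc k)
  have "B ^\<^sub>m k \<in> carrier_mat n n" using assms(1) by (rule pow_carrier_mat)
  then show ?case using Suc upper_triangular_mult[OF _ assms(1) _ assms(2), of "B ^\<^sub>m k"] by auto
qed

text \<open>The diagonal of a Schur form carries the eigenvalues and the traces of all powers.\<close>

lemma schur_diagonal:
  assumes A: "A \<in> carrier_mat n n"
  shows "\<exists>d :: nat \<Rightarrow> complex. (\<forall>k. mtrace (A ^\<^sub>m k) = (\<Sum>i<n. d i ^ k)) \<and>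
    (\<forall>c. (\<exists>i<n. d i = c) \<longleftrightarrow> (\<exists>v \<in> carrier_vec n. v \<noteq> 0\<^sub>v n \<and> A *\<^sub>v v = c \<cdot>\<^sub>v v))"
proof -
  obtain es where es: "char_poly A = (\<Prod>e\<leftarrow>es. [:- e, 1:])" "length es = n"
    using char_poly_factorized[OF A] by blast
  obtain B P Q where dec: "schur_decomposition A es = (B, P, Q)" by (cases "schur_decomposition A es")
  have w: "similar_mat_wit A B P Q" "upper_triangular B" "diag_mat B = es"
    using schur_decomposition[OF A es(1) dec] by auto
  have c: "B \<in> carrier_mat n n" "P \<in> carrier_mat n n" "Q \<in> carrier_mat n n" "P * Q = 1\<^sub>m n" "Q * P = 1\<^sub>m n" "A = P * B * Q"
    using w(1) A unfolding similar_mat_wit_def Let_def by auto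
  define d where "d i = B $$ (i, i)" for i
  have "mtrace (A ^\<^sub>m k) = (\<Sum>i<n. d i ^ k)" for k
  proof -
    have Bk: "B ^\<^sub>m k \<in> carrier_mat n n" using c(1) by (rule pow_carrier_mat)
    have "A ^\<^sub>m k = P * B ^\<^sub>m k * Q"
      using similar_mat_wit_pow[OF w(1)] unfolding similar_mat_wit_def Let_def by auto
    then have "mtrace (A ^\<^sub>m k) = mtrace (P * (B ^\<^sub>m k * Q))" using c Bk by (simp add: sq_assoc[of _ n])
    also have "\<dots> = mtrace (B ^\<^sub>m k * Q * P)" using c Bk by (intro mtrace_mult_commute[of _ n]) auto
    also have "\<dots> = mtrace (B ^\<^sub>m k)" using c Bk by (simp add: sq_assoc[of _ n])
    finally show ?thesis
      using upper_triangular_pow[OF c(1) w(2), of k] Bk c(1) by (simp add: mtrace_def d_def)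
  qed
  moreover have "(\<exists>i<n. d i = x) \<longleftrightarrow> (\<exists>v \<in> carrier_vec n. v \<noteq> 0\<^sub>v n \<and> A *\<^sub>v v = x \<cdot>\<^sub>v v)" for x
  proof -
    have "(\<exists>i<n. d i = x) \<longleftrightarrow> x \<in> set es" using c(1) by (auto simp: d_def w(3)[symmetric] diag_mat_def)
    also have "\<dots> \<longleftrightarrow> poly (char_poly A) x = 0"
      unfolding es(1) by (auto simp: poly_prod_list prod_list_zero_iff)
    also have "\<dots> \<longleftrightarrow> eigenvalue A x" using eigenvalue_root_char_poly[OF A] by simp
    finally show ?thesis using A by (auto simp: eigenvalue_def eigenvector_def)
  qed
  ultimately show ?thesis by (intro exI[of _ d] conjI allI)
qed

text \<open>Zero is the only possible eigenvalue, and the trace is the sum of the diagonal of a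
  Schur form.\<close>

lemma mtrace_eq_0_if_no_eigenvalue:
  assumes A: "A \<in> carrier_mat n n"
    and no: "\<And>c v. v \<in> carrier_vec n \<Longrightarrow> v \<noteq> 0\<^sub>v n \<Longrightarrow> A *\<^sub>v v = c \<cdot>\<^sub>v v \<Longrightarrow> c = 0"
  shows "mtrace A = 0"
proof -
  obtain d where d': "(\<forall>k. mtrace (A ^\<^sub>m k) = (\<Sum>i<n. d i ^ k)) \<and>
    (\<forall>c. (\<exists>i<n. d i = c) \<longleftrightarrow> (\<exists>v \<in> carrier_vec n. v \<noteq> 0\<^sub>v n \<and> A *\<^sub>v v = c \<cdot>\<^sub>v v))"
    using schur_diagonal[OF A] by (elim exE) (rule that)
  note d = d'[THEN conjunct1, rule_format] d'[THEN conjunct2, rule_format]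
  have "d i = 0" if "i < n" for i using d(2)[of "d i"] that no by blast
  then show ?thesis using d(1)[of 1] A by simp
qed

text \<open>In characteristic zero, vanishing power sums leave no room for a nonzero eigenvalue. For
  the eigenvalue 1 this is seen by evaluating a suitable polynomial on the spectrum, in place of
  Newton's identities.\<close>

lemma no_eigenvalue_1_if_trace_powers_0:
  assumes A: "A \<in> carrier_mat n n" and tr: "\<And>k. mtrace (A ^\<^sub>m Suc k) = 0"
    and v: "v \<in> carrier_vec n" "A *\<^sub>v v = v"
  shows "v = 0\<^sub>v n"
proof (rule ccontr)
  assume v0: "v \<noteq> 0\<^sub>v n"
  obtain d where d': "(\<forall>k. mtrace (A ^\<^sub>m k) = (\<Sum>i<n. d i ^ k)) \<and>
    (\<forall>c. (\<exists>i<n. d i = c) \<longleftrightarrow> (\<exists>v \<in> carrier_vec n. v \<noteq> 0\<^sub>v n \<and> A *\<^sub>v v = c \<cdot>\<^sub>v v))"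
    using schur_diagonal[OF A] by (elim exE) (rule that)
  note d = d'[THEN conjunct1, rule_format] d'[THEN conjunct2, rule_format]
  have one: "\<exists>i<n. d i = 1" using d(2)[of 1] v v0 by auto
  \<comment> \<open>The factor \<open>[:0, 1:]\<close> removes the constant term, because
    \<open>tr\<close> says nothing about the zeroth power; the other factors vanish at the
    eigenvalues different from 1. What remains of the sum is the multiplicity of 1 times
    \<open>poly p 1\<close>.\<close>
  define p where "p = [:0, 1:] * (\<Prod>x\<in>d ` {..<n} - {1}. [:- x, 1:])"
  have "coeff p 0 = 0" by (simp add: p_def coeff_mult)
  then have "(\<Sum>k\<le>degree p. coeff p k * (\<Sum>i<n. d i ^ k)) = 0"
    using tr unfolding d(1)[symmetric] by (intro sum.neutral) (metis mult_eq_0_iff not0_implies_Suc)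
  moreover have "(\<Sum>k\<le>degree p. coeff p k * (\<Sum>i<n. d i ^ k)) = (\<Sum>i<n. poly p (d i))"
    unfolding poly_altdef sum_distrib_left by (rule sum.swap)
  moreover have "(\<Sum>i<n. poly p (d i)) = (\<Sum>i<n. if d i = 1 then poly p 1 else 0)"
    by (intro sum.cong refl) (auto simp: p_def poly_prod)
  moreover have "\<dots> = of_nat (card {i \<in> {..<n}. d i = 1}) * poly p 1"
    by (simp add: sum.If_cases Int_def)
  moreover have "poly p 1 \<noteq> 0" by (auto simp: p_def poly_prod)
  moreover have "card {i \<in> {..<n}. d i = 1} \<noteq> 0" using one by auto
  ultimately show False by auto
qed

section \<open>Reductivity of self-adjoint groups\<close>

definition dagger :: "complex mat \<Rightarrow> complex mat" where
  "dagger A = transpose_mat (map_mat cnj A)"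

lemma dagger_carrier [simp]: "A \<in> carrier_mat n m \<Longrightarrow> dagger A \<in> carrier_mat m n"
  by (auto simp: dagger_def)

lemma dagger_dim [simp]: "dim_row (dagger A) = dim_col A" "dim_col (dagger A) = dim_row A"
  by (auto simp: dagger_def)

lemma dagger_index [simp]: "i < dim_col A \<Longrightarrow> j < dim_row A \<Longrightarrow> dagger A $$ (i, j) = cnj (A $$ (j, i))"
  by (auto simp: dagger_def)

lemma dagger_dagger [simp]: "dagger (dagger A) = A"
  by (rule eq_matI) auto

lemma dagger_one [simp]: "dagger (1\<^sub>m n) = 1\<^sub>m n"
  by (rule eq_matI) auto

lemma dagger_zero [simp]: "dagger (0\<^sub>m n m) = 0\<^sub>m m n"
  by (rule eq_matI) auto

lemma dagger_mult:
  assumes "A \<in> carrier_mat n m" "B \<in> carrier_mat m k"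
  shows "dagger (A * B) = dagger B * dagger A"
  by (rule eq_matI) (use assms in \<open>auto simp: scalar_prod_def mult.commute intro!: sum.cong\<close>)

lemma dagger_minus:
  assumes "A \<in> carrier_mat n m" "B \<in> carrier_mat n m"
  shows "dagger (A - B) = dagger A - dagger B"
  by (rule eq_matI) (use assms in auto)

lemma dagger_transpose: "dagger (transpose_mat A) = transpose_mat (dagger A)"
  by (rule eq_matI) auto

lemma dagger_GL: "A \<in> GL_group n \<Longrightarrow> dagger A \<in> GL_group n"
  using GL_group_if_left_inverse[of "dagger A" n "dagger (minv n A)"]
    dagger_mult[of A n n "minv n A" n] minv_carrier[of A n] GL_groupD[of A n] minv_right[of A n]
  by auto

lemma minv_dagger: "A \<in> GL_group n \<Longrightarrow> minv n (dagger A) = dagger (minv n A)"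
  using minv_eq[of "dagger A" n "dagger (minv n A)"]
    dagger_mult[of "minv n A" n n "A" n] minv_carrier[of A n] GL_groupD[of A n] minv_left[of A n]
  by auto

text \<open>The trace of \<open>dagger A * A\<close> is the square of the Frobenius norm, a sum of
  squared absolute values of the entries.\<close>

lemma eq_0_if_mtrace_dagger_0:
  assumes "A \<in> carrier_mat n n" "mtrace (dagger A * A) = 0"
  shows "A = 0\<^sub>m n n"
proof -
  have "mtrace (dagger A * A) = (\<Sum>i<n. \<Sum>j\<in>{0..<n}. cnj (A $$ (j, i)) * A $$ (j, i))"
    using assms(1) unfolding mtrace_def by (intro sum.cong) (auto simp: scalar_prod_def)
  also have "\<dots> = (\<Sum>i<n. \<Sum>j\<in>{0..<n}. complex_of_real ((cmod (A $$ (j, i)))\<^sup>2))"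
    by (intro sum.cong refl) (simp add: complex_norm_square mult.commute flip: of_real_power)
  also have "\<dots> = complex_of_real (\<Sum>i<n. \<Sum>j\<in>{0..<n}. (cmod (A $$ (j, i)))\<^sup>2)" by simp
  finally have "(\<Sum>i<n. \<Sum>j\<in>{0..<n}. (cmod (A $$ (j, i)))\<^sup>2) = 0" using assms(2) of_real_eq_0_iff by metis
  then have "\<forall>i\<in>{..<n}. (\<Sum>j\<in>{0..<n}. (cmod (A $$ (j, i)))\<^sup>2) = 0"
    by (subst (asm) sum_nonneg_eq_0_iff) (auto intro: sum_nonneg)
  then have "\<forall>i\<in>{..<n}. \<forall>j\<in>{0..<n}. A $$ (j, i) = 0"
    by (simp add: sum_nonneg_eq_0_iff)
  then show ?thesis using assms(1) by (intro eq_matI) auto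
qed

text \<open>The image in the matrix algebra of the augmentation ideal of the group algebra of
  \<open>U\<close>. The inductive description of this span lets products and traces be treated by
  rule induction.\<close>

inductive_set augmentation :: "nat \<Rightarrow> complex mat set \<Rightarrow> complex mat set" for n U where
  base: "u \<in> U \<Longrightarrow> u - 1\<^sub>m n \<in> augmentation n U"
| add: "a \<in> augmentation n U \<Longrightarrow> b \<in> augmentation n U \<Longrightarrow> a + b \<in> augmentation n U"
| smult: "a \<in> augmentation n U \<Longrightarrow> c \<cdot>\<^sub>m a \<in> augmentation n U"

text \<open>Padded by a zero in row \<open>n\<close>, the \<open>n + 1\<close> vectors are the
  columns of a square matrix. Its transpose kills the last unit vector, so the determinant vanishes,
  and a kernel vector gives the coefficients.\<close>

lemma mat_vec_sum_dependent:
  fixes v :: "nat \<Rightarrow> complex vec"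
  assumes v: "\<And>i. i \<le> n \<Longrightarrow> v i \<in> carrier_vec n"
  shows "\<exists>c. (\<exists>i\<le>n. c i \<noteq> 0) \<and> (\<forall>r<n. (\<Sum>i\<le>n. v i $ r * c i) = 0)"
proof -
  define W where "W = mat (Suc n) (Suc n) (\<lambda>(r, i). if r < n then v i $ r else 0)"
  have W: "W \<in> carrier_mat (Suc n) (Suc n)" by (simp add: W_def)
  have "transpose_mat W *\<^sub>v unit_vec (Suc n) n = 0\<^sub>v (Suc n)"
    by (rule eq_vecI) (auto simp: W_def)
  moreover have "unit_vec (Suc n) n \<noteq> (0\<^sub>v (Suc n) :: complex vec)"
    by (metis index_unit_vec(2) index_zero_vec(1) lessI zero_neq_one)
  moreover have "transpose_mat W \<in> carrier_mat (Suc n) (Suc n)" using W by simp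
  ultimately have "det (transpose_mat W) = 0"
    using det_0_iff_vec_prod_zero_field[of "transpose_mat W" "Suc n"] unit_vec_carrier by blast
  then have "det W = 0" using det_transpose[OF W] by simp
  then obtain x where x: "x \<in> carrier_vec (Suc n)" "x \<noteq> 0\<^sub>v (Suc n)" "W *\<^sub>v x = 0\<^sub>v (Suc n)"
    using det_0_iff_vec_prod_zero_field[OF W] by blast
  have "\<exists>i\<le>n. x $ i \<noteq> 0"
  proof (rule ccontr)
    assume "\<not> (\<exists>i\<le>n. x $ i \<noteq> 0)"
    then have "x = 0\<^sub>v (Suc n)" using x(1) by (intro eq_vecI) auto
    then show False using x(2) by simp
  qed
  moreover have "(\<Sum>i\<le>n. v i $ r * x $ i) = 0" if r: "r < n" for r
  proof -
    have "(W *\<^sub>v x) $ r = (\<Sum>i\<in>{0..<Suc n}. v i $ r * x $ i)"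
      using r x(1) W by (auto simp: scalar_prod_def W_def intro!: sum.cong)
    moreover have "{0..<Suc n} = {..n}" by auto
    ultimately show ?thesis using x(3) r by simp
  qed
  ultimately show ?thesis by (intro exI[of _ "\<lambda>i. x $ i"] conjI allI impI)
qed

locale unipotent_group =
  fixes n :: nat and U :: "complex mat set"
  assumes carrier: "u \<in> U \<Longrightarrow> u \<in> carrier_mat n n"
    and one: "1\<^sub>m n \<in> U"
    and closed: "u \<in> U \<Longrightarrow> u' \<in> U \<Longrightarrow> u * u' \<in> U"
    and unip: "u \<in> U \<Longrightarrow> unipotent n u"
begin

abbreviation "I \<equiv> augmentation n U"

lemma I_carrier: "a \<in> I \<Longrightarrow> a \<in> carrier_mat n n"
  by (induction rule: augmentation.induct) (auto dest: carrier)

lemma I_zero: "0\<^sub>m n n \<in> I"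
proof -
  have e: "1\<^sub>m n - 1\<^sub>m n = (0\<^sub>m n n :: complex mat)" by auto
  show ?thesis using augmentation.base[OF one, of n] unfolding e .
qed

text \<open>On generators, \<open>(u - 1) * (u' - 1)\<close> equals
  \<open>(u * u' - 1) - (u - 1) - (u' - 1)\<close>; the rest is bilinearity.\<close>

lemma I_mult:
  assumes "a \<in> I" "b \<in> I" shows "a * b \<in> I"
  using assms(1)
proof (induction rule: augmentation.induct)
  case (base u)
  show ?case using assms(2)
  proof (induction rule: augmentation.induct)
    case (base u')
    note c = carrier[OF \<open>u \<in> U\<close>] carrier[OF \<open>u' \<in> U\<close>]
    have "(u - 1\<^sub>m n) * (u' - 1\<^sub>m n) = (u * u' - 1\<^sub>m n) + (- 1) \<cdot>\<^sub>m ((u - 1\<^sub>m n) + (u' - 1\<^sub>m n))"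
    proof -
      have "(u - 1\<^sub>m n) * (u' - 1\<^sub>m n) = u * (u' - 1\<^sub>m n) - 1\<^sub>m n * (u' - 1\<^sub>m n)"
        using c by (intro minus_mult_distrib_mat) auto
      also have "u * (u' - 1\<^sub>m n) = u * u' - u * 1\<^sub>m n"
        using c by (intro mult_minus_distrib_mat) auto
      finally show ?thesis using c by (intro eq_matI) auto
    qed
    then show ?case using \<open>u \<in> U\<close> \<open>u' \<in> U\<close> closed by (auto intro!: augmentation.intros)
  next
    case (add a b)
    have "(u - 1\<^sub>m n) * (a + b) = (u - 1\<^sub>m n) * a + (u - 1\<^sub>m n) * b"
      using carrier[OF \<open>u \<in> U\<close>] I_carrier[OF add.hyps(1)] I_carrier[OF add.hyps(2)]
      by (intro mult_add_distrib_mat) auto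
    then show ?case using augmentation.add[OF add.IH] by simp
  next
    case (smult a c)
    have "(u - 1\<^sub>m n) * (c \<cdot>\<^sub>m a) = c \<cdot>\<^sub>m ((u - 1\<^sub>m n) * a)"
      using carrier[OF \<open>u \<in> U\<close>] I_carrier[OF smult.hyps] by (intro mult_smult_distrib) auto
    then show ?case using augmentation.smult[OF smult.IH] by simp
  qed
next
  case (add a' b')
  have "(a' + b') * b = a' * b + b' * b"
    using I_carrier[OF add.hyps(1)] I_carrier[OF add.hyps(2)] I_carrier[OF assms(2)] by (rule add_mult_distrib_mat)
  then show ?case using augmentation.add[OF add.IH] by simp
next
  case (smult a c)
  have "(c \<cdot>\<^sub>m a) * b = c \<cdot>\<^sub>m (a * b)"
    using I_carrier[OF smult.hyps] I_carrier[OF assms(2)] by (rule mult_smult_assoc_mat)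
  then show ?case using augmentation.smult[OF smult.IH] by simp
qed

lemma pow_eigenvector:
  fixes A :: "complex mat"
  assumes "A \<in> carrier_mat n n" "v \<in> carrier_vec n" "A *\<^sub>v v = c \<cdot>\<^sub>v v"
  shows "A ^\<^sub>m k *\<^sub>v v = c ^ k \<cdot>\<^sub>v v"
proof (induction k)
  case 0 then show ?case using assms by auto
next
  case (Suc k)
  have p: "A ^\<^sub>m k \<in> carrier_mat n n" using assms(1) by (rule pow_carrier_mat)
  have "A ^\<^sub>m Suc k *\<^sub>v v = A ^\<^sub>m k *\<^sub>v (c \<cdot>\<^sub>v v)"
    using assoc_mult_mat_vec[OF p assms(1,2)] assms(3) by simp
  also have "\<dots> = c \<cdot>\<^sub>v (c ^ k \<cdot>\<^sub>v v)" using mult_mat_vec[OF p assms(2)] Suc by simp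
  finally show ?case by (simp add: smult_smult_assoc)
qed

text \<open>Each generator \<open>u - 1\<close> is nilpotent, so its only eigenvalue is zero, and
  the trace is linear on the span.\<close>

lemma I_trace: "a \<in> I \<Longrightarrow> mtrace a = 0"
proof (induction rule: augmentation.induct)
  case (base u)
  have c: "u - 1\<^sub>m n \<in> carrier_mat n n" using carrier[OF base] by auto
  obtain k where k: "(u - 1\<^sub>m n) ^\<^sub>m k = 0\<^sub>m n n" using unip[OF base] by (auto simp: unipotent_def)
  show ?case
  proof (rule mtrace_eq_0_if_no_eigenvalue[OF c])
    fix x and v :: "complex vec"
    assume v: "v \<in> carrier_vec n" "v \<noteq> 0\<^sub>v n" "(u - 1\<^sub>m n) *\<^sub>v v = x \<cdot>\<^sub>v v"
    have "0\<^sub>m n n *\<^sub>v v = 0\<^sub>v n" using v(1) by auto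
    then have "x ^ k \<cdot>\<^sub>v v = 0\<^sub>v n" using pow_eigenvector[OF c v(1,3), of k] unfolding k by metis
    moreover obtain r where "r < n" "v $ r \<noteq> 0" using v(1,2) by (metis carrier_vecD eq_vecI index_zero_vec)
    ultimately have "x ^ k * v $ r = 0" using v(1) by (metis carrier_vecD index_smult_vec(1) index_zero_vec(1))
    then show "x = 0" using \<open>v $ r \<noteq> 0\<close> by simp
  qed
next
  case (add a b)
  then show ?case using mtrace_add[OF I_carrier[OF add.hyps(1)] I_carrier[OF add.hyps(2)]] by simp
next
  case (smult a c)
  then show ?case using mtrace_smult[OF I_carrier[OF smult.hyps]] by simp
qed

text \<open>All powers of \<open>a\<close> stay in \<open>I\<close> and therefore have trace zero.
  This stands in for a common flag of \<open>U\<close> as provided by Kolchin's theorem.\<close>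

lemma I_no_fixed_vector:
  assumes "a \<in> I" "v \<in> carrier_vec n" "a *\<^sub>v v = v"
  shows "v = 0\<^sub>v n"
proof (rule no_eigenvalue_1_if_trace_powers_0[OF I_carrier[OF assms(1)] _ assms(2,3)])
  fix k
  have "a ^\<^sub>m Suc k \<in> I"
    using I_carrier[OF assms(1)] assms(1) by (induction k) (auto intro: I_mult)
  then show "mtrace (a ^\<^sub>m Suc k) = 0" by (rule I_trace)
qed

text \<open>In a nontrivial relation between the \<open>n + 1\<close> vectors, let \<open>i\<close>
  be the first index with a nonzero coefficient. All later vectors arise from \<open>w i\<close> by
  elements of \<open>I\<close>, so the relation reads \<open>w i = a *\<^sub>v w i\<close> with
  \<open>a\<close> in \<open>I\<close>, and \<open>w i\<close> vanishes.\<close>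

lemma I_chain_vanishes:
  assumes w: "\<And>i. i \<le> n \<Longrightarrow> w i \<in> carrier_vec n"
    and chain: "\<And>i j. i < j \<Longrightarrow> j \<le> n \<Longrightarrow> \<exists>a\<in>I. w j = a *\<^sub>v w i"
  shows "\<exists>i\<le>n. w i = 0\<^sub>v n"
proof -
  have ex: "\<exists>c. (\<exists>i\<le>n. c i \<noteq> 0) \<and> (\<forall>r<n. (\<Sum>i\<le>n. w i $ r * c i) = 0)"
    by (rule mat_vec_sum_dependent) (rule w)
  obtain c where c': "(\<exists>i\<le>n. c i \<noteq> 0) \<and> (\<forall>r<n. (\<Sum>i\<le>n. w i $ r * c i) = 0)"
    using ex by (elim exE) (rule that)
  note c = c'[THEN conjunct1] c'[THEN conjunct2, rule_format]
  define i where "i = (LEAST i. i \<le> n \<and> c i \<noteq> 0)"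
  have i: "i \<le> n" "c i \<noteq> 0" using LeastI_ex[OF c(1)] by (simp_all add: i_def)
  have below: "c j = 0" if "j < i" for j
    using not_less_Least[of j "\<lambda>i. i \<le> n \<and> c i \<noteq> 0"] that i(1) by (auto simp: i_def)
  \<comment> \<open>The part of the relation beyond \<open>i\<close>, cut off at \<open>k\<close>,
    is a single element of \<open>I\<close> applied to \<open>w i\<close>. For \<open>k\<close> up
    to \<open>i + 1\<close> the range is empty and the zero matrix serves.\<close>
  have "\<exists>a\<in>I. \<forall>r<n. (\<Sum>j\<in>{i<..<k}. w j $ r * c j) = (a *\<^sub>v w i) $ r" if "k \<le> Suc n" for k
    using that
  proof (induction k)
    case 0
    then show ?case using I_zero w[OF i(1)] by (intro bexI[of _ "0\<^sub>m n n"]) auto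
  next
    case (Suc k)
    then obtain a where a: "a \<in> I" "\<forall>r<n. (\<Sum>j\<in>{i<..<k}. w j $ r * c j) = (a *\<^sub>v w i) $ r" by auto
    show ?case
    proof (cases "i < k")
      case True
      then obtain b where b: "b \<in> I" "w k = b *\<^sub>v w i" using chain[of i k] Suc.prems by auto
      have ins: "{i<..<Suc k} = insert k {i<..<k}" using True by auto
      show ?thesis
      proof (intro bexI[of _ "c k \<cdot>\<^sub>m b + a"] allI impI)
        fix r assume "r < n"
        then show "(\<Sum>j\<in>{i<..<Suc k}. w j $ r * c j) = ((c k \<cdot>\<^sub>m b + a) *\<^sub>v w i) $ r"
          using a b I_carrier[OF a(1)] I_carrier[OF b(1)] w[OF i(1)]
          by (simp add: ins add_scalar_prod_distrib[of _ n])
      qed (use a b in \<open>auto intro: augmentation.intros\<close>)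
    next
      case False
      then have "{i<..<Suc k} = {i<..<k}" by auto
      then show ?thesis using a by auto
    qed
  qed
  from this[of "Suc n"] obtain a where
    a: "a \<in> I" "\<And>r. r < n \<Longrightarrow> (\<Sum>j\<in>{i<..<Suc n}. w j $ r * c j) = (a *\<^sub>v w i) $ r" by auto
  have "((- 1 / c i) \<cdot>\<^sub>m a) *\<^sub>v w i = w i"
  proof (rule eq_vecI)
    fix r assume "r < dim_vec (w i)"
    then have r: "r < n" using w[OF i(1)] by auto
    have "(\<Sum>j\<le>n. w j $ r * c j) = w i $ r * c i + (\<Sum>j\<in>{i<..<Suc n}. w j $ r * c j)"
    proof -
      have "{..n} = {..<i} \<union> insert i {i<..<Suc n}" using i(1) by auto
      then have "(\<Sum>j\<le>n. w j $ r * c j) = (\<Sum>j<i. w j $ r * c j) + (\<Sum>j\<in>insert i {i<..<Suc n}. w j $ r * c j)"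
        by (simp only:) (rule sum.union_disjoint, auto)
      then show ?thesis using below by simp
    qed
    then have "w i $ r * c i + (a *\<^sub>v w i) $ r = 0" using c(2)[OF r] a(2)[OF r] by simp
    then have "(- 1 / c i) * (a *\<^sub>v w i) $ r = w i $ r"
      using i(2) by (simp add: field_simps add_eq_0_iff)
    then show "(((- 1 / c i) \<cdot>\<^sub>m a) *\<^sub>v w i) $ r = w i $ r"
      using I_carrier[OF a(1)] w[OF i(1)] r by simp
  qed (use w[OF i(1)] I_carrier[OF a(1)] in auto)
  then have "w i = 0\<^sub>v n" using I_no_fixed_vector[of "(- 1 / c i) \<cdot>\<^sub>m a" "w i"] a(1) w[OF i(1)]
    by (auto intro: augmentation.smult)
  then show ?thesis using i(1) by blast
qed

end

context unipotent_group begin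

text \<open>Suppose \<open>v\<close> is an eigenvector of \<open>x * (u - 1)\<close> with eigenvalue
  \<open>c \<noteq> 0\<close>, and let \<open>z\<close> be the power of \<open>x\<close> with
  exponent \<open>k > 0\<close>. The element \<open>z * u * minv n z - 1\<close> of \<open>I\<close>
  maps \<open>z *\<^sub>v v\<close> to \<open>z * (u - 1)\<close> applied to \<open>v\<close>, which
  is \<open>c\<close> times the power with exponent \<open>k - 1\<close> applied to
  \<open>v\<close>. Normality keeps the conjugates of \<open>u\<close> in \<open>U\<close>, so the
  powers of \<open>x\<close> applied to \<open>v\<close> form, up to scalars, a chain as in
  \<open>I_chain_vanishes\<close> without a zero member.\<close>

lemma trace_mult_augmentation_eq_0:
  assumes X: "subgroup X (GL n)" and normal: "\<And>x u. x \<in> X \<Longrightarrow> u \<in> U \<Longrightarrow> x * u * minv n x \<in> U"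
    and x: "x \<in> X" and u: "u \<in> U"
  shows "mtrace (x * (u - 1\<^sub>m n)) = 0"
proof (rule mtrace_eq_0_if_no_eigenvalue[where n = n])
  have XG: "z \<in> GL_group n" if "z \<in> X" for z using subgroup.mem_carrier[OF X that] .
  have xc: "x \<in> carrier_mat n n" using GL_groupD[OF XG[OF x]] .
  have uc: "u - 1\<^sub>m n \<in> carrier_mat n n" using carrier[OF u] by auto
  show yc: "x * (u - 1\<^sub>m n) \<in> carrier_mat n n" using xc uc by simp
  fix c and v :: "complex vec"
  assume v: "v \<in> carrier_vec n" "v \<noteq> 0\<^sub>v n" "(x * (u - 1\<^sub>m n)) *\<^sub>v v = c \<cdot>\<^sub>v v"
  show "c = 0"
  proof (rule ccontr)
    assume c: "c \<noteq> 0"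
    have pX: "x ^\<^sub>m k \<in> X" for k
    proof (induction k)
      case 0 then show ?case using subgroup.one_closed[OF X] xc by simp
    next
      case (Suc k) then show ?case using subgroup.m_closed[OF X Suc x] by simp
    qed
    have pc: "x ^\<^sub>m k \<in> carrier_mat n n" for k using GL_groupD[OF XG[OF pX]] .
    \<comment> \<open>The exponent descends with \<open>i\<close>: each step of the chain removes
      one factor \<open>x\<close> and contributes one factor \<open>c\<close>, and the indices from
      0 to \<open>n\<close> give the required \<open>n + 1\<close> vectors.\<close>
    define w where "w i = c ^ i \<cdot>\<^sub>v (x ^\<^sub>m (n - i) *\<^sub>v v)" for i
    have pv: "x ^\<^sub>m k *\<^sub>v v \<in> carrier_vec n" for k using mult_mat_vec_carrier[OF pc v(1)] .
    have wc: "w i \<in> carrier_vec n" for i unfolding w_def using pv by (rule smult_carrier_vec[THEN iffD2])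
    have w0: "w i \<noteq> 0\<^sub>v n" for i
    proof
      assume z: "w i = 0\<^sub>v n"
      let ?z = "x ^\<^sub>m (n - i)"
      have "?z *\<^sub>v v = (1 / c ^ i) \<cdot>\<^sub>v w i" using c by (simp add: w_def smult_smult_assoc)
      also have "\<dots> = 0\<^sub>v n" unfolding z by auto
      finally have z0: "?z *\<^sub>v v = 0\<^sub>v n" .
      note ic = minv_carrier[OF XG[OF pX], of "n - i"]
      have "v = (minv n ?z * ?z) *\<^sub>v v" using v(1) minv_left[OF XG[OF pX], of "n - i"] by simp
      also have "\<dots> = minv n ?z *\<^sub>v 0\<^sub>v n" using assoc_mult_mat_vec[OF ic pc v(1)] z0 by simp
      also have "\<dots> = 0\<^sub>v n" using ic by auto
      finally show False using v(2) by simp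
    qed
    have step: "\<exists>a\<in>I. w (Suc i) = a *\<^sub>v w i" if "Suc i \<le> n" for i
    proof -
      define z where "z = x ^\<^sub>m (n - i)"
      define z' where "z' = x ^\<^sub>m (n - Suc i)"
      have "n - i = Suc (n - Suc i)" using that by simp
      then have zz': "z = z' * x" by (simp only: z_def z'_def pow_mat.simps)
      have zX: "z \<in> X" and zc: "z \<in> carrier_mat n n" and z'c: "z' \<in> carrier_mat n n"
        using pX pc by (auto simp: z_def z'_def)
      have ic: "minv n z \<in> carrier_mat n n" using minv_carrier[OF XG[OF zX]] .
      define a where "a = z * u * minv n z - 1\<^sub>m n"
      have a: "a \<in> I" unfolding a_def using normal[OF zX u] by (rule augmentation.base)
      have "a * z = z * u * minv n z * z - 1\<^sub>m n * z"
        unfolding a_def using zc carrier[OF u] ic by (intro minus_mult_distrib_mat) auto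
      also have "\<dots> = z * u - z"
        using zc carrier[OF u] ic by (simp add: sq_assoc[of _ n] sq_mult[of _ n] minv_left[OF XG[OF zX]])
      also have "\<dots> = z * (u - 1\<^sub>m n)"
        using zc carrier[OF u] by (simp add: mult_minus_distrib_mat[of _ n n])
      also have "\<dots> = z' * (x * (u - 1\<^sub>m n))" using zz' z'c xc uc by (simp add: sq_assoc[of _ n])
      finally have az: "a * z = z' * (x * (u - 1\<^sub>m n))" .
      note ac = I_carrier[OF a]
      have "a *\<^sub>v w i = c ^ i \<cdot>\<^sub>v (a *\<^sub>v (z *\<^sub>v v))"
        unfolding w_def z_def using mult_mat_vec[OF ac pv] .
      also have "a *\<^sub>v (z *\<^sub>v v) = (a * z) *\<^sub>v v" using assoc_mult_mat_vec[OF ac zc v(1)] by simp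
      also have "\<dots> = z' *\<^sub>v (c \<cdot>\<^sub>v v)" unfolding az using assoc_mult_mat_vec[OF z'c yc v(1)] v(3) by simp
      also have "\<dots> = c \<cdot>\<^sub>v (z' *\<^sub>v v)" using mult_mat_vec[OF z'c v(1)] .
      finally have "a *\<^sub>v w i = w (Suc i)"
        by (simp add: w_def z'_def smult_smult_assoc mult.commute)
      then have "w (Suc i) = a *\<^sub>v w i" by simp
      then show ?thesis using a by blast
    qed
    have "\<exists>a\<in>I. w j = a *\<^sub>v w i" if "i < j" "j \<le> n" for i j
      using that
    proof (induction j)
      case (Suc j)
      obtain a where a: "a \<in> I" "w (Suc j) = a *\<^sub>v w j" using step[OF Suc.prems(2)] by blast
      show ?case
      proof (cases "i = j")
        case False
        then obtain b where b: "b \<in> I" "w j = b *\<^sub>v w i" using Suc by auto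
        then have "w (Suc j) = (a * b) *\<^sub>v w i"
          using a assoc_mult_mat_vec[OF I_carrier[OF a(1)] I_carrier[OF b(1)] wc] by simp
        then show ?thesis using I_mult[OF a(1) b(1)] by blast
      qed (use a in auto)
    qed simp
    then show False using I_chain_vanishes[of w] wc w0 by blast
  qed
qed

text \<open>Since \<open>u\<^sup>\<dagger>\<close> lies in \<open>X\<close>, the trace of \<open>(u - 1)\<^sup>\<dagger> (u - 1) = u\<^sup>\<dagger> (u - 1) - (u - 1)\<close> vanishes.\<close>

lemma trivial_if_normal_in_self_adjoint:
  assumes X: "subgroup X (GL n)" and normal: "\<And>x u. x \<in> X \<Longrightarrow> u \<in> U \<Longrightarrow> x * u * minv n x \<in> U"
    and adj: "\<And>x. x \<in> X \<Longrightarrow> dagger x \<in> X" and "U \<subseteq> X" and u: "u \<in> U"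
  shows "u = 1\<^sub>m n"
proof -
  have uc: "u \<in> carrier_mat n n" using carrier[OF u] .
  have uc1: "u - 1\<^sub>m n \<in> carrier_mat n n" using uc by auto
  have dX: "dagger u \<in> X" using adj u assms(4) by blast
  have dc: "dagger u \<in> carrier_mat n n" using uc by simp
  have "dagger (u - 1\<^sub>m n) * (u - 1\<^sub>m n) = dagger u * (u - 1\<^sub>m n) - (u - 1\<^sub>m n)"
    using minus_mult_distrib_mat[OF dc one_carrier_mat uc1] left_mult_one_mat[OF uc1]
    by (simp add: dagger_minus[OF uc one_carrier_mat])
  moreover have "mtrace (dagger u * (u - 1\<^sub>m n)) = 0"
    using trace_mult_augmentation_eq_0[OF X normal dX u] by blast
  moreover have "mtrace (u - 1\<^sub>m n) = 0" using I_trace[OF augmentation.base[OF u]] .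
  moreover have "mtrace (dagger u * (u - 1\<^sub>m n) - (u - 1\<^sub>m n)) = mtrace (dagger u * (u - 1\<^sub>m n)) - mtrace (u - 1\<^sub>m n)"
    using uc dc by (intro mtrace_minus[of _ n] sq_mult) auto
  ultimately have "mtrace (dagger (u - 1\<^sub>m n) * (u - 1\<^sub>m n)) = 0" by simp
  then have "u - 1\<^sub>m n = 0\<^sub>m n n" using uc by (intro eq_0_if_mtrace_dagger_0) auto
  then have e: "(u - 1\<^sub>m n) $$ (i, j) = 0" if "i < n" "j < n" for i j using that by simp
  show ?thesis by (rule eq_matI) (use uc e in auto)
qed

end

section \<open>Conjugation, and reductivity in an adapted basis\<close>

lemma conj_by_minus:
  assumes "P \<in> GL_group n" "a \<in> carrier_mat n n" "b \<in> carrier_mat n n"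
  shows "conj_by P (a - b) = conj_by P a - conj_by P b"
  using assms GL_groupD[OF assms(1)] minv_carrier[OF assms(1)]
  by (simp add: conj_by_eq mult_minus_distrib_mat[of _ n n _ n] minus_mult_distrib_mat[of _ n n])

lemma conj_by_pow:
  assumes "P \<in> GL_group n" "a \<in> carrier_mat n n"
  shows "conj_by P (a ^\<^sub>m k) = conj_by P a ^\<^sub>m k"
proof (induction k)
  case 0
  have "conj_by P a \<in> carrier_mat n n" using conj_by_carrier[OF assms] .
  then show ?case using assms(2) conj_by_one[OF assms(1)] by simp
next
  case (Suc k)
  have "a ^\<^sub>m k \<in> carrier_mat n n" using assms(2) by (rule pow_carrier_mat)
  then show ?case using Suc conj_by_mult[OF assms(1) _ assms(2)] by simp
qed

lemma conj_by_unipotent: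
  assumes "P \<in> GL_group n" "unipotent n u"
  shows "unipotent n (conj_by P u)"
proof -
  obtain k where k: "u \<in> carrier_mat n n" "(u - 1\<^sub>m n) ^\<^sub>m k = 0\<^sub>m n n" using assms(2) by (auto simp: unipotent_def)
  have "(conj_by P u - 1\<^sub>m n) ^\<^sub>m k = conj_by P ((u - 1\<^sub>m n) ^\<^sub>m k)"
    using conj_by_pow[OF assms(1) minus_carrier_mat[OF one_carrier_mat], of u k] conj_by_minus[OF assms(1) k(1) one_carrier_mat]
      conj_by_one[OF assms(1)] k(1) by simp
  also have "\<dots> = 0\<^sub>m n n" using k assms(1) GL_groupD[OF assms(1)] minv_carrier[OF assms(1)] by (simp add: conj_by_eq)
  finally show ?thesis using conj_by_carrier[OF assms(1) k(1)] by (auto simp: unipotent_def)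
qed

lemma minv_conj_by:
  assumes "P \<in> GL_group n" "x \<in> GL_group n"
  shows "minv n (conj_by P x) = conj_by P (minv n x)"
  using assms GL_groupD minv_carrier
  by (intro minv_eq) (simp_all add: conj_by_carrier minv_right conj_by_one flip: conj_by_mult)

lemma subgroup_conj_by:
  assumes "P \<in> GL_group n" "subgroup X (GL n)"
  shows "subgroup (conj_by P ` X) (GL n)"
proof (rule group.subgroupI[OF group_GL])
  have XG: "x \<in> GL_group n" if "x \<in> X" for x using subgroup.mem_carrier[OF assms(2) that] .
  show "conj_by P ` X \<subseteq> carrier (GL n)" using XG conj_by_GL[OF assms(1)] by blast
  show "conj_by P ` X \<noteq> {}" using subgroup.one_closed[OF assms(2)] by blast
  show "minv n a \<in> conj_by P ` X" if "a \<in> conj_by P ` X" for a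
    using that XG minv_conj_by[OF assms(1)] subgroup.m_inv_closed[OF assms(2)] by auto
  show "a \<otimes>\<^bsub>GL n\<^esub> b \<in> conj_by P ` X" if ab: "a \<in> conj_by P ` X" "b \<in> conj_by P ` X" for a b
  proof -
    obtain x y where x: "x \<in> X" "a = conj_by P x" and y: "y \<in> X" "b = conj_by P y" using ab by blast
    then have "a * b = conj_by P (x * y)" using conj_by_mult[OF assms(1)] XG GL_groupD by metis
    then show ?thesis using subgroup.m_closed[OF assms(2) x(1) y(1)] by simp
  qed
qed

text \<open>The hypothesis \<open>adj\<close> says that the conjugate of \<open>X\<close> by
  \<open>minv N R\<close> is closed under \<open>dagger\<close>. Unipotence and normality survive
  conjugation, so the trace argument applies to the conjugate of \<open>U\<close> and is carried
  back.\<close>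

lemma reductive_if_self_adjoint:
  assumes alg: "algebraic_subgroup N X" and R: "R \<in> GL_group N"
    and adj: "\<And>x. x \<in> X \<Longrightarrow> conj_by R (dagger (conj_by (minv N R) x)) \<in> X"
  shows "reductive N X"
proof -
  have X: "subgroup X (GL N)" using alg by (simp add: algebraic_subgroup_def)
  have XG: "x \<in> GL_group N" if "x \<in> X" for x using subgroup.mem_carrier[OF X that] .
  have "U = {1\<^sub>m N}" if nU: "normal U ((GL N)\<lparr>carrier := X\<rparr>)" and uni: "\<forall>u\<in>U. unipotent N u" for U
  proof -
    let ?R' = "minv N R"
    have R': "?R' \<in> GL_group N" using minv_GL[OF R] .
    have sU: "subgroup U ((GL N)\<lparr>carrier := X\<rparr>)" using nU by (simp add: normal_def)
    have UX: "U \<subseteq> X" using subgroup.subset[OF sU] by simp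
    have one: "1\<^sub>m N \<in> U" using subgroup.one_closed[OF sU] by (simp add: GL_def)
    have mul: "u * v \<in> U" if "u \<in> U" "v \<in> U" for u v
      using subgroup.m_closed[OF sU that] by (simp add: GL_def)
    have nor: "x * u * minv N x \<in> U" if "x \<in> X" "u \<in> U" for x u
      using normal.inv_op_closed2[OF nU, of x u] that group.m_inv_consistent[OF group_GL X that(1)]
      by (simp add: GL_def)
    have Uc: "u \<in> carrier_mat N N" if "u \<in> U" for u using GL_groupD[OF XG] UX that by blast
    interpret V: unipotent_group N "conj_by ?R' ` U"
    proof
      show "1\<^sub>m N \<in> conj_by ?R' ` U" using one conj_by_one[OF R'] by (metis image_eqI)
      show "u \<in> carrier_mat N N" if "u \<in> conj_by ?R' ` U" for u using that Uc conj_by_carrier[OF R'] by blast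
      show "u * u' \<in> conj_by ?R' ` U" if "u \<in> conj_by ?R' ` U" "u' \<in> conj_by ?R' ` U" for u u'
        using that mul conj_by_mult[OF R'] Uc by (smt (verit) imageE image_eqI)
      show "unipotent N u" if "u \<in> conj_by ?R' ` U" for u using that uni conj_by_unipotent[OF R'] by blast
    qed
    have "conj_by ?R' u = 1\<^sub>m N" if u: "u \<in> U" for u
    proof (rule V.trivial_if_normal_in_self_adjoint[OF subgroup_conj_by[OF R' X]])
      show "conj_by ?R' ` U \<subseteq> conj_by ?R' ` X" using UX by blast
      show "conj_by ?R' u \<in> conj_by ?R' ` U" using u by blast
      show "dagger x \<in> conj_by ?R' ` X" if x: "x \<in> conj_by ?R' ` X" for x
      proof -
        obtain y where y: "y \<in> X" "x = conj_by ?R' y" using x by blast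
        have "dagger x \<in> carrier_mat N N" using y conj_by_carrier[OF R' GL_groupD[OF XG]] by simp
        then have "dagger x = conj_by ?R' (conj_by R (dagger x))" using conj_by_minv(2)[OF R] by simp
        then show ?thesis using adj[OF y(1)] y(2) by (metis image_eqI)
      qed
      show "x * u * minv N x \<in> conj_by ?R' ` U" if x: "x \<in> conj_by ?R' ` X" and u: "u \<in> conj_by ?R' ` U" for x u
      proof -
        obtain y v where y: "y \<in> X" "x = conj_by ?R' y" and v: "v \<in> U" "u = conj_by ?R' v" using x u by blast
        note c = GL_groupD[OF XG[OF y(1)]] Uc[OF v(1)] minv_carrier[OF XG[OF y(1)]]
        have "x * u * minv N x = conj_by ?R' (y * v * minv N y)"
          unfolding y(2) v(2) minv_conj_by[OF R' XG[OF y(1)]] using c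
          by (simp only: conj_by_mult[OF R' sq_mult[OF c(1,2)] c(3)] conj_by_mult[OF R' c(1,2)])
        then show ?thesis using nor[OF y(1) v(1)] by blast
      qed
    qed
    then have "u = 1\<^sub>m N" if "u \<in> U" for u
      using that conj_by_cancel[OF R' Uc[OF that] one_carrier_mat] conj_by_one[OF R'] by simp
    then show ?thesis using one by blast
  qed
  then show ?thesis using alg unfolding reductive_def by blast
qed

text \<open>A symmetric subgroup is the equalizer of \<open>\<theta>\<close> and the identity, both
  regular maps. Hence the closedness of \<open>H\<close> follows from the assumption on the pair,
  without inspecting its type.\<close>

lemma symmetric_subgroup_algebraic:
  assumes "symmetric_subgroup N G H"
  shows "algebraic_subgroup N H"
proof -
  obtain \<theta> where G: "algebraic_subgroup N G" and t: "involutive_automorphism N G \<theta>" and H: "H = {g \<in> G. \<theta> g = g}"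
    using assms unfolding symmetric_subgroup_def by blast
  have sG: "subgroup G (GL N)" and zG: "zariski_closed N G" using G by (simp_all add: algebraic_subgroup_def)
  have iso: "\<theta> \<in> iso ((GL N)\<lparr>carrier := G\<rparr>) ((GL N)\<lparr>carrier := G\<rparr>)" using t by (simp add: involutive_automorphism_def)
  then have hom: "\<theta> \<in> hom ((GL N)\<lparr>carrier := G\<rparr>) ((GL N)\<lparr>carrier := G\<rparr>)" by (simp add: iso_def)
  have tG: "\<theta> g \<in> G" if "g \<in> G" for g using hom_in_carrier[OF hom, of g] that by simp
  have Gc: "g \<in> carrier_mat N N" if "g \<in> G" for g using GL_groupD[OF subgroup.mem_carrier[OF sG that]] .
  have "regular_map N G \<theta>"
    using t tG Gc unfolding regular_map_def involutive_automorphism_def by blast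
  moreover have "regular_map N G (\<lambda>g. g)" using Gc by (intro regular_map_id) blast
  ultimately have "zariski_closed N {g \<in> G. \<forall>s\<in>{()}. \<theta> g = g}" by (intro zariski_closed_equalizer zG) auto
  then have "zariski_closed N H" by (simp add: H)
  moreover have "subgroup H (GL N)"
  proof -
    interpret K: group "(GL N)\<lparr>carrier := G\<rparr>" by (rule group.subgroup_imp_group[OF group_GL sG])
    interpret T: group_hom "(GL N)\<lparr>carrier := G\<rparr>" "(GL N)\<lparr>carrier := G\<rparr>" \<theta>
      using hom by unfold_locales
    have m: "\<theta> (a * b) = \<theta> a * \<theta> b" if "a \<in> G" "b \<in> G" for a b
      using T.hom_mult[of a b] that by (simp add: GL_def)
    show ?thesis
    proof (rule group.subgroupI[OF group_GL])
      show "H \<subseteq> carrier (GL N)" using subgroup.subset[OF sG] H by blast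
      have "1\<^sub>m N \<in> H" using T.hom_one subgroup.one_closed[OF sG] by (simp add: H GL_def)
      then show "H \<noteq> {}" by blast
      show "minv N a \<in> H" if "a \<in> H" for a
      proof -
        have a: "a \<in> G" "\<theta> a = a" using that by (simp_all add: H)
        then show ?thesis using T.hom_inv[of a] group.m_inv_consistent[OF group_GL sG a(1)] subgroup.m_inv_closed[OF sG a(1)]
          by (simp add: H)
      qed
      show "a \<otimes>\<^bsub>GL N\<^esub> b \<in> H" if "a \<in> H" "b \<in> H" for a b
        using that m subgroup.m_closed[OF sG, of a b] by (simp add: H)
    qed
  qed
  ultimately show ?thesis by (simp add: algebraic_subgroup_def)
qed

section \<open>A criterion for see-saw pairs\<close>

lemma isometries_conj_by:
  assumes "R \<in> isometries N B C" "B \<in> carrier_mat N N" "C \<in> carrier_mat N N"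
  shows "isometries N C C = conj_by R ` isometries N B B"
proof (intro equalityI subsetI)
  note R = isometriesD(1)[OF assms(1)]
  note mR = isometries_minv[OF assms(1,3)]
  fix g assume g: "g \<in> isometries N C C"
  have "minv N R * g * minv N (minv N R) \<in> isometries N B B"
    using isometries_comp[OF isometries_comp[OF mR g assms(2)] _ assms(2)] assms(1) R by simp
  then have "conj_by (minv N R) g \<in> isometries N B B" by (simp add: conj_by_eq[OF minv_GL[OF R]])
  moreover have "g = conj_by R (conj_by (minv N R) g)" using conj_by_minv(1)[OF R] isometriesD(2)[OF g] by simp
  ultimately show "g \<in> conj_by R ` isometries N B B" by blast
next
  note R = isometriesD(1)[OF assms(1)]
  fix g assume "g \<in> conj_by R ` isometries N B B"
  then obtain b where b: "b \<in> isometries N B B" "g = conj_by R b" by blast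
  show "g \<in> isometries N C C" unfolding b(2) conj_by_eq[OF R]
    by (rule isometries_comp[OF isometries_comp[OF assms(1) b(1) assms(3)] isometries_minv[OF assms(1,3)] assms(3)])
qed

lemma smult_smult: "c \<cdot>\<^sub>m (d \<cdot>\<^sub>m A) = (c * d) \<cdot>\<^sub>m (A :: complex mat)"
  by (rule eq_matI) auto

lemma smult_one: "1 \<cdot>\<^sub>m A = (A :: complex mat)"
  by (rule eq_matI) auto

lemma smult_eq_iff:
  assumes "c \<noteq> 0" shows "c \<cdot>\<^sub>m A = c \<cdot>\<^sub>m B \<longleftrightarrow> A = (B :: complex mat)"
proof
  assume "c \<cdot>\<^sub>m A = c \<cdot>\<^sub>m B"
  then have "(1 / c) \<cdot>\<^sub>m (c \<cdot>\<^sub>m A) = (1 / c) \<cdot>\<^sub>m (c \<cdot>\<^sub>m B)" by simp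
  then show "A = B" using assms by (simp add: smult_smult smult_one)
qed simp

text \<open>From \<open>transpose_mat b * w * b = w\<close> and \<open>w * w = c\<close> it follows
  that \<open>w * transpose_mat b * w / c\<close> inverts \<open>b\<close>, hence
  \<open>b * w * transpose_mat b = w\<close>. Applying \<open>dagger\<close> to this equation gives
  the isometry equation for \<open>dagger b\<close>, because \<open>dagger w\<close> is proportional
  to \<open>w\<close>.\<close>

lemma dagger_isometry:
  assumes w: "w \<in> carrier_mat N N" "w * w = c \<cdot>\<^sub>m 1\<^sub>m N" "dagger w = e \<cdot>\<^sub>m w" "c \<noteq> 0" "e \<noteq> 0"
    and b: "b \<in> isometries N w w"
  shows "dagger b \<in> isometries N w w"
proof -
  note b' = isometriesD[OF b]
  have bt: "transpose_mat b \<in> carrier_mat N N" using b' by simp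
  define u where "u = w * (transpose_mat b * w)"
  have uc: "u \<in> carrier_mat N N" using w(1) bt by (simp add: u_def sq_mult[of _ N])
  have "u * b = w * (transpose_mat b * w * b)"
    unfolding u_def using w(1) b'(2) bt by (simp add: sq_assoc[of _ N] sq_mult[of _ N])
  then have "u * b = c \<cdot>\<^sub>m 1\<^sub>m N" using w(2) b'(3) by simp
  then have "((1 / c) \<cdot>\<^sub>m u) * b = 1\<^sub>m N"
    using mult_smult_assoc_mat[OF uc b'(2)] w(4) by (simp add: smult_smult smult_one)
  then have "b * ((1 / c) \<cdot>\<^sub>m u) = 1\<^sub>m N"
    using mat_mult_left_right_inverse[of "(1 / c) \<cdot>\<^sub>m u" N b] uc b'(2) by simp
  then have "(1 / c) \<cdot>\<^sub>m (b * u) = (1 / c) \<cdot>\<^sub>m (c \<cdot>\<^sub>m 1\<^sub>m N)"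
    using mult_smult_distrib[OF b'(2) uc] w(4) by (simp add: smult_smult smult_one)
  then have "b * u = c \<cdot>\<^sub>m 1\<^sub>m N" using w(4) by (simp add: smult_eq_iff)
  then have "b * u * w = (c \<cdot>\<^sub>m 1\<^sub>m N) * w" by simp
  moreover have "b * u * w = b * (w * transpose_mat b) * (w * w)"
    unfolding u_def using w(1) b'(2) bt by (simp add: sq_assoc[of _ N] sq_mult[of _ N])
  moreover have "b * (w * transpose_mat b) * (w * w) = c \<cdot>\<^sub>m (b * (w * transpose_mat b))"
    unfolding w(2) using mult_smult_distrib[of "b * (w * transpose_mat b)" N N "1\<^sub>m N" N] w(1) b'(2) bt
    by (simp add: sq_mult[of _ N])
  moreover have "(c \<cdot>\<^sub>m 1\<^sub>m N) * w = c \<cdot>\<^sub>m w"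
    using mult_smult_assoc_mat[OF one_carrier_mat w(1)] w(1) by simp
  ultimately have "c \<cdot>\<^sub>m (b * (w * transpose_mat b)) = c \<cdot>\<^sub>m w" by simp
  then have "b * (w * transpose_mat b) = w" using w(4) by (simp add: smult_eq_iff)
  then have "dagger (b * (w * transpose_mat b)) = dagger w" by simp
  then have "transpose_mat (dagger b) * dagger w * dagger b = dagger w"
    using w(1) b'(2) bt by (simp add: dagger_mult[of _ N N _ N] sq_mult[of _ N] dagger_transpose)
  then have e: "transpose_mat (dagger b) * (e \<cdot>\<^sub>m w) * dagger b = e \<cdot>\<^sub>m w" unfolding w(3) .
  have d: "dagger b \<in> carrier_mat N N" "transpose_mat (dagger b) \<in> carrier_mat N N" using b'(2) by simp_all
  have "e \<cdot>\<^sub>m (transpose_mat (dagger b) * w * dagger b) = e \<cdot>\<^sub>m w"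
    using e mult_smult_distrib[OF d(2) w(1)] mult_smult_assoc_mat[OF sq_mult[OF d(2) w(1)] d(1)] by simp
  then have "transpose_mat (dagger b) * w * dagger b = w" using w(5) by (simp add: smult_eq_iff)
  then show ?thesis using dagger_GL[OF b'(1)] by (simp add: isometries_def)
qed

lemma sympl_form_carrier [simp]: "sympl_form r \<in> carrier_mat (2 * r) (2 * r)"
  unfolding sympl_form_def mult_2 by (rule four_block_carrier_mat) auto

lemma involutive_automorphismI:
  assumes S: "subgroup S (GL N)" and mem: "\<And>g. g \<in> S \<Longrightarrow> \<theta> g \<in> S"
    and mult: "\<And>g h. g \<in> S \<Longrightarrow> h \<in> S \<Longrightarrow> \<theta> (g * h) = \<theta> g * \<theta> h"
    and inv: "\<And>g. g \<in> S \<Longrightarrow> \<theta> (\<theta> g) = g" and nontriv: "\<exists>g\<in>S. \<theta> g \<noteq> g" and reg: "regular_map N S \<theta>"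
  shows "involutive_automorphism N S \<theta>"
proof -
  have "\<theta> \<in> hom ((GL N)\<lparr>carrier := S\<rparr>) ((GL N)\<lparr>carrier := S\<rparr>)"
    using mem mult by (auto simp: hom_def GL_def)
  moreover have "bij_betw \<theta> S S" by (rule bij_betwI[of _ _ _ \<theta>]) (use mem inv in auto)
  ultimately have "\<theta> \<in> iso ((GL N)\<lparr>carrier := S\<rparr>) ((GL N)\<lparr>carrier := S\<rparr>)" by (simp add: iso_def)
  then show ?thesis using inv nontriv reg unfolding involutive_automorphism_def regular_map_def by blast
qed

text \<open>Here \<open>Y\<close>, \<open>X\<close> and \<open>Z\<close> are \<open>G\<close>,
  \<open>H\<close> and \<open>H'\<close> seen in a model with form \<open>w\<close>. The conditions
  on \<open>w\<close> make the isometry group closed under \<open>dagger\<close>; \<open>bk\<close>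
  is the double centralizer property inside \<open>Y\<close>; and \<open>fixed\<close> identifies
  the fixed points of \<open>\<theta>\<close> in \<open>Z\<close> with \<open>G'\<close>. Each type
  only has to supply these data.\<close>

lemma see_saw_criterion:
  assumes dp: "dual_pair m G G'" and sym: "symmetric_subgroup (2 * m) G H"
    and R: "R \<in> isometries (2 * m) w (sympl_form m)"
    and w: "w \<in> carrier_mat (2 * m) (2 * m)" "w * w = c \<cdot>\<^sub>m 1\<^sub>m (2 * m)" "dagger w = e \<cdot>\<^sub>m w" "c \<noteq> 0" "e \<noteq> 0"
    and G: "G = conj_by R ` Y" and H: "H = conj_by R ` X" and XY: "X \<subseteq> Y" and Yc: "Y \<subseteq> carrier_mat (2 * m) (2 * m)"
    and adj: "\<And>x. x \<in> X \<Longrightarrow> dagger x \<in> X"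
    and Z: "Z = {b \<in> isometries (2 * m) w w. \<forall>x\<in>X. b * x = x * b}"
    and bk: "\<And>y. y \<in> Y \<Longrightarrow> (\<And>b. b \<in> Z \<Longrightarrow> y * b = b * y) \<Longrightarrow> y \<in> X"
    and mem: "\<And>b. b \<in> Z \<Longrightarrow> \<theta> b \<in> Z"
    and mult: "\<And>b b'. b \<in> Z \<Longrightarrow> b' \<in> Z \<Longrightarrow> \<theta> (b * b') = \<theta> b * \<theta> b'"
    and inv: "\<And>b. b \<in> Z \<Longrightarrow> \<theta> (\<theta> b) = b"
    and fixed: "\<And>b. b \<in> Z \<Longrightarrow> \<theta> b = b \<longleftrightarrow> (\<forall>y\<in>Y. b * y = y * b)"
    and reg: "\<And>S F. regular_map (2 * m) S F \<Longrightarrow> regular_map (2 * m) S (\<lambda>g. \<theta> (F g))"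
  shows "dual_pair m H (centralizer (Sp_group m) H) \<and> symmetric_subgroup (2 * m) (centralizer (Sp_group m) H) G'"
proof -
  let ?N = "2 * m" and ?R' = "minv (2 * m) R"
  define H' where "H' = centralizer (Sp_group m) H"
  note RG = isometriesD(1)[OF R]
  note R'G = minv_GL[OF RG]
  note d = dp[unfolded dual_pair_def, THEN conjunct2, THEN conjunct2]
  have GSp: "G \<subseteq> Sp_group m" by (rule d[THEN conjunct1])
  have G'eq: "G' = centralizer (Sp_group m) G" by (rule d[THEN conjunct2, THEN conjunct2, THEN conjunct1])
  have Geq: "G = centralizer (Sp_group m) G'" by (rule d[THEN conjunct2, THEN conjunct2, THEN conjunct2])
  have HG: "H \<subseteq> G" using XY G H by blast
  have Sp: "Sp_group m = conj_by R ` isometries ?N w w"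
    unfolding Sp_group_def by (rule isometries_conj_by[OF R w(1)]) simp
  have Spalg: "algebraic_subgroup ?N (Sp_group m)" unfolding Sp_group_def by (rule isometries_algebraic) simp
  have SpG: "Sp_group m \<subseteq> GL_group ?N" by (auto simp: Sp_group_def isometries_def)
  have Xc: "x \<in> carrier_mat ?N ?N" if "x \<in> X" for x using that XY Yc by blast
  have Zc: "b \<in> carrier_mat ?N ?N" if "b \<in> Z" for b using that Z isometriesD(2) by blast
  have cent: "centralizer (Sp_group m) (conj_by R ` W) = conj_by R ` {b \<in> isometries ?N w w. \<forall>x\<in>W. b * x = x * b}"
    if W: "W \<subseteq> carrier_mat ?N ?N" for W
  proof -
    have "conj_by R b * conj_by R x = conj_by R x * conj_by R b \<longleftrightarrow> b * x = x * b"
      if "b \<in> isometries ?N w w" "x \<in> W" for b x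
      using conj_by_commute[OF RG isometriesD(2)[OF that(1)]] that(2) W by blast
    then show ?thesis unfolding centralizer_def Sp by blast
  qed
  have H'Z: "H' = conj_by R ` Z" unfolding H'_def H Z using Xc by (intro cent) blast
  have G'Z: "G' = conj_by R ` {b \<in> isometries ?N w w. \<forall>y\<in>Y. b * y = y * b}"
    unfolding G'eq G using Yc by (rule cent)
  have Halg: "algebraic_subgroup ?N H" using sym by (rule symmetric_subgroup_algebraic)
  have H'alg: "algebraic_subgroup ?N H'"
    unfolding H'_def using HG GSp SpG by (intro centralizer_algebraic Spalg) blast
  have H'sub: "subgroup H' (GL ?N)" using H'alg by (simp add: algebraic_subgroup_def)
  have redH: "reductive ?N H"
  proof (rule reductive_if_self_adjoint[OF Halg RG])
    fix h assume "h \<in> H"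
    then obtain x where x: "x \<in> X" "h = conj_by R x" using H by blast
    then show "conj_by R (dagger (conj_by ?R' h)) \<in> H" using adj H conj_by_minv(2)[OF RG Xc] by auto
  qed
  \<comment> \<open>If \<open>b\<close> commutes with the self-adjoint set \<open>X\<close>, then
    the adjoint of \<open>b * dagger x = dagger x * b\<close> says that \<open>dagger b\<close>
    commutes with \<open>x\<close>.\<close>
  have Zadj: "dagger b \<in> Z" if b: "b \<in> Z" for b
  proof -
    have bi: "b \<in> isometries ?N w w" using b Z by blast
    have "dagger b * x = x * dagger b" if x: "x \<in> X" for x
    proof -
      have "b * dagger x = dagger x * b" using b adj[OF x] Z by blast
      then have "dagger (b * dagger x) = dagger (dagger x * b)" by simp
      then show ?thesis using Zc[OF b] Xc[OF x] by (simp add: dagger_mult[of _ ?N ?N _ ?N])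
    qed
    then show ?thesis using dagger_isometry[OF w bi] Z by blast
  qed
  have redH': "reductive ?N H'"
  proof (rule reductive_if_self_adjoint[OF H'alg RG])
    fix h assume "h \<in> H'"
    then obtain x where x: "x \<in> Z" "h = conj_by R x" using H'Z by blast
    then show "conj_by R (dagger (conj_by ?R' h)) \<in> H'" using Zadj H'Z conj_by_minv(2)[OF RG Zc] by auto
  qed
  have bk2: "x \<in> H" if x: "x \<in> centralizer (Sp_group m) H'" for x
  proof -
    have "G' \<subseteq> H'" unfolding G'eq H'_def centralizer_def using HG by blast
    then have "x \<in> centralizer (Sp_group m) G'" using x by (auto simp: centralizer_def)
    then have "x \<in> G" using Geq by blast
    then obtain y where y: "y \<in> Y" "x = conj_by R y" using G by blast
    have "y * b = b * y" if b: "b \<in> Z" for b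
    proof -
      have "conj_by R b \<in> H'" using b H'Z by blast
      then have "conj_by R y * conj_by R b = conj_by R b * conj_by R y"
        using x y(2) by (auto simp: centralizer_def)
      then show ?thesis using conj_by_commute[OF RG _ Zc[OF b]] y(1) Yc by blast
    qed
    then show ?thesis using bk[OF y(1)] y(2) H by blast
  qed
  have "dual_pair m H H'"
    unfolding dual_pair_def
  proof (intro conjI redH redH')
    show "H \<subseteq> Sp_group m" using HG GSp by blast
    show "H' \<subseteq> Sp_group m" by (auto simp: H'_def centralizer_def)
    show "H' = centralizer (Sp_group m) H" by (rule H'_def)
    have "H \<subseteq> centralizer (Sp_group m) H'" using HG GSp unfolding H'_def centralizer_def by auto
    then show "H = centralizer (Sp_group m) H'" using bk2 by blast
  qed
  moreover have "symmetric_subgroup ?N H' G'"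
  proof -
    define T where "T h = conj_by R (\<theta> (conj_by ?R' h))" for h
    have TZ: "T (conj_by R b) = conj_by R (\<theta> b)" if "b \<in> Z" for b
      using that conj_by_minv(2)[OF RG Zc[OF that]] by (simp add: T_def)
    have G'fix: "G' = {h \<in> H'. T h = h}"
    proof -
      have "T (conj_by R b) = conj_by R b \<longleftrightarrow> (\<forall>y\<in>Y. b * y = y * b)" if "b \<in> Z" for b
        using that TZ fixed[OF that] conj_by_cancel[OF RG Zc[OF mem[OF that]] Zc[OF that]] by simp
      then show ?thesis unfolding G'Z H'Z using XY Z by blast
    qed
    have regT: "regular_map ?N H' T"
    proof -
      have "regular_map ?N H' (\<lambda>h. ?R' * h * R)"
        using GL_groupD[OF subgroup.mem_carrier[OF H'sub]] GL_groupD[OF RG] GL_groupD[OF R'G]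
        by (intro regular_map_mult regular_map_const regular_map_id) auto
      then have "regular_map ?N H' (\<lambda>h. R * \<theta> (?R' * h * R) * ?R')"
        by (rule regular_map_mult[OF regular_map_mult[OF regular_map_const[OF GL_groupD[OF RG]] reg] regular_map_const[OF GL_groupD[OF R'G]]])
      moreover have "T = (\<lambda>h. R * \<theta> (?R' * h * R) * ?R')"
        unfolding T_def using RG R'G by (simp add: conj_by_eq[where n = ?N])
      ultimately show ?thesis by simp
    qed
    have "involutive_automorphism ?N H' T"
    proof (rule involutive_automorphismI[OF H'sub _ _ _ _ regT])
      show "T g \<in> H'" if "g \<in> H'" for g using that TZ mem H'Z by auto
      show "T (g * h) = T g * T h" if gh': "g \<in> H'" "h \<in> H'" for g h
      proof -
        obtain a b where a: "a \<in> Z" "g = conj_by R a" and b: "b \<in> Z" "h = conj_by R b" using gh' H'Z by blast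
        have gh: "g * h = conj_by R (a * b)" using a b conj_by_mult[OF RG] Zc by simp
        have "g * h \<in> H'" using subgroup.m_closed[OF H'sub gh'] by simp
        then obtain z where z: "z \<in> Z" "g * h = conj_by R z" using H'Z by blast
        have "z = a * b" using gh z a b Zc conj_by_cancel[OF RG] sq_mult by metis
        then have "T (g * h) = conj_by R (\<theta> (a * b))" using TZ z by metis
        also have "\<dots> = T g * T h"
          using TZ mult[OF a(1) b(1)] a b conj_by_mult[OF RG Zc[OF mem[OF a(1)]] Zc[OF mem[OF b(1)]]] by simp
        finally show ?thesis .
      qed
      show "T (T g) = g" if "g \<in> H'" for g using that TZ mem inv H'Z by auto
      show "\<exists>g\<in>H'. T g \<noteq> g"
      proof (rule ccontr)
        assume "\<not> (\<exists>g\<in>H'. T g \<noteq> g)"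
        \<comment> \<open>A trivial \<open>T\<close> would give \<open>G' = H'\<close>. The
          centralizers of both then force \<open>G\<close> into \<open>H\<close>, which is
          impossible because the involution defining \<open>H\<close> moves some element of
          \<open>G\<close>.\<close>
        then have "G' = H'" using G'fix by blast
        then have "G \<subseteq> H" using Geq bk2 by blast
        moreover have "\<exists>g\<in>G. g \<notin> H"
          using sym unfolding symmetric_subgroup_def involutive_automorphism_def by blast
        ultimately show False by blast
      qed
    qed
    then show ?thesis unfolding symmetric_subgroup_def using H'alg G'fix by blast
  qed
  ultimately show ?thesis by (simp add: H'_def)
qed

text \<open>Conjugation by \<open>s\<close> is involutive because \<open>s * s\<close> is scalar,
  and it preserves \<open>Z\<close> because \<open>s\<close> is an isometry commuting with
  \<open>X\<close>. Its fixed points are the elements commuting with \<open>s\<close>: since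
  \<open>s\<close> lies in \<open>Y\<close> they include \<open>G'\<close>, and \<open>fixed\<close>
  gives the converse. The element \<open>t\<close> lies in \<open>Z\<close> and cuts
  \<open>X\<close> out of \<open>Y\<close>.\<close>

lemma see_saw_inner:
  assumes dp: "dual_pair m G G'" and sym: "symmetric_subgroup (2 * m) G H"
    and R: "R \<in> isometries (2 * m) w (sympl_form m)"
    and w: "w \<in> carrier_mat (2 * m) (2 * m)" "w * w = c \<cdot>\<^sub>m 1\<^sub>m (2 * m)" "dagger w = e \<cdot>\<^sub>m w" "c \<noteq> 0" "e \<noteq> 0"
    and G: "G = conj_by R ` Y" and H: "H = conj_by R ` X" and XY: "X \<subseteq> Y" and Yc: "Y \<subseteq> carrier_mat (2 * m) (2 * m)"
    and adj: "\<And>x. x \<in> X \<Longrightarrow> dagger x \<in> X"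
    and t: "t \<in> isometries (2 * m) w w" "\<And>x. x \<in> X \<Longrightarrow> t * x = x * t"
    and bk: "\<And>y. y \<in> Y \<Longrightarrow> y * t = t * y \<Longrightarrow> y \<in> X"
    and s: "s \<in> Y" "s \<in> isometries (2 * m) w w" "\<And>x. x \<in> X \<Longrightarrow> s * x = x * s" "s * s = d \<cdot>\<^sub>m 1\<^sub>m (2 * m)"
    and fixed: "\<And>b y. b \<in> isometries (2 * m) w w \<Longrightarrow> (\<And>x. x \<in> X \<Longrightarrow> b * x = x * b) \<Longrightarrow> b * s = s * b \<Longrightarrow> y \<in> Y \<Longrightarrow> b * y = y * b"
  shows "dual_pair m H (centralizer (Sp_group m) H) \<and> symmetric_subgroup (2 * m) (centralizer (Sp_group m) H) G'"
proof -
  let ?N = "2 * m"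
  define Z where "Z = {b \<in> isometries ?N w w. \<forall>x\<in>X. b * x = x * b}"
  have sG: "s \<in> GL_group ?N" and sc: "s \<in> carrier_mat ?N ?N" using isometriesD[OF s(2)] by auto
  note s'c = minv_carrier[OF sG]
  have Zc: "b \<in> carrier_mat ?N ?N" if "b \<in> Z" for b using that Z_def isometriesD(2) by blast
  have Xc: "x \<in> carrier_mat ?N ?N" if "x \<in> X" for x using that XY Yc by blast
  have d0: "d \<cdot>\<^sub>m 1\<^sub>m ?N \<in> GL_group ?N" using GL_group_mult[OF sG sG] s(4) by simp
  show ?thesis
  proof (rule see_saw_criterion[OF dp sym R w G H XY Yc adj Z_def, where \<theta> = "conj_by s"])
    fix y assume y: "y \<in> Y" "\<And>b. b \<in> Z \<Longrightarrow> y * b = b * y"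
    have "t \<in> Z" using t by (simp add: Z_def)
    then show "y \<in> X" using bk y by blast
  next
    fix b assume b: "b \<in> Z"
    have "conj_by s b \<in> isometries ?N w w"
      using b isometries_conj_by[OF s(2) w(1) w(1)] by (auto simp: Z_def)
    moreover have "conj_by s b * x = x * conj_by s b" if x: "x \<in> X" for x
    proof -
      have "conj_by s x = x * (s * minv ?N s)"
        using s(3)[OF x] sc s'c Xc[OF x] by (simp add: conj_by_eq[OF sG] sq_assoc[of _ ?N])
      then have "conj_by s x = x" using minv_right[OF sG] Xc[OF x] by simp
      then show ?thesis
        using conj_by_commute[OF sG Zc[OF b] Xc[OF x]] b x by (simp add: Z_def)
    qed
    ultimately show "conj_by s b \<in> Z" by (simp add: Z_def)
    have "conj_by s (conj_by s b) = conj_by (d \<cdot>\<^sub>m 1\<^sub>m ?N) b" using conj_by_comp[OF sG sG Zc[OF b]] s(4) by simp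
    also have "\<dots> = b * (d \<cdot>\<^sub>m 1\<^sub>m ?N) * minv ?N (d \<cdot>\<^sub>m 1\<^sub>m ?N)"
      using mult_smult_assoc_mat[OF one_carrier_mat Zc[OF b], of d] mult_smult_distrib[OF Zc[OF b] one_carrier_mat, of d] Zc[OF b]
      by (simp add: conj_by_eq[OF d0])
    also have "\<dots> = b"
      using Zc[OF b] minv_right[OF d0] minv_carrier[OF d0] by (simp add: sq_assoc[of _ ?N] del: mult_smult_distrib)
    finally show "conj_by s (conj_by s b) = b" .
    have "conj_by s b = b \<longleftrightarrow> s * b = b * s"
    proof
      assume "conj_by s b = b"
      then have "conj_by s b * s = b * s" by simp
      then show "s * b = b * s"
        using sc s'c Zc[OF b] by (simp add: conj_by_eq[OF sG] sq_assoc[of _ ?N] sq_mult[of _ ?N] minv_left[OF sG])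
    next
      assume "s * b = b * s"
      then show "conj_by s b = b"
        using sc s'c Zc[OF b] by (simp add: conj_by_eq[OF sG] sq_assoc[of _ ?N] minv_right[OF sG])
    qed
    then show "conj_by s b = b \<longleftrightarrow> (\<forall>y\<in>Y. b * y = y * b)"
      using fixed[of b] b s(1) unfolding Z_def by (smt (verit) mem_Collect_eq)
  next
    show "conj_by s (b * b') = conj_by s b * conj_by s b'" if "b \<in> Z" "b' \<in> Z" for b b'
      using conj_by_mult[OF sG Zc[OF that(1)] Zc[OF that(2)]] .
  next
    fix S F assume "regular_map ?N S F"
    then show "regular_map ?N S (\<lambda>g. conj_by s (F g))"
      unfolding conj_by_eq[OF sG] using sc s'c by (intro regular_map_mult regular_map_const)
  qed (use w in auto)
qed

section \<open>Kronecker products and amplifications\<close>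

definition eu :: "nat \<Rightarrow> nat \<Rightarrow> nat \<Rightarrow> complex mat" where
  "eu N p q = mat N N (\<lambda>(i, j). if i = p \<and> j = q then 1 else 0)"

lemma smult_zero: "A \<in> carrier_mat n m \<Longrightarrow> 0 \<cdot>\<^sub>m A = (0\<^sub>m n m :: complex mat)"
  by (rule eq_matI) auto

lemma eu_carrier [simp]: "eu N p q \<in> carrier_mat N N" by (simp add: eu_def)
lemma eu_dim [simp]: "dim_row (eu N p q) = N" "dim_col (eu N p q) = N" by (simp_all add: eu_def)
lemma eu_index [simp]: "i < N \<Longrightarrow> j < N \<Longrightarrow> eu N p q $$ (i, j) = (if i = p \<and> j = q then 1 else 0)"
  by (simp add: eu_def)

lemma eu_mult_index:
  assumes "a \<in> carrier_mat N N" "i < N" "j < N" "q < N"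
  shows "(eu N p q * a) $$ (i, j) = (if i = p then a $$ (q, j) else 0)"
proof -
  have "(eu N p q * a) $$ (i, j) = (\<Sum>k\<in>{0..<N}. eu N p q $$ (i, k) * a $$ (k, j))"
    using assms by (simp add: scalar_prod_def)
  also have "\<dots> = (\<Sum>k\<in>{0..<N}. if k = q then (if i = p then a $$ (q, j) else 0) else 0)"
    using assms by (intro sum.cong) auto
  finally show ?thesis using assms by simp
qed

lemma mult_eu_index:
  assumes "a \<in> carrier_mat N N" "i < N" "j < N" "p < N"
  shows "(a * eu N p q) $$ (i, j) = (if j = q then a $$ (i, p) else 0)"
proof -
  have "(a * eu N p q) $$ (i, j) = (\<Sum>k\<in>{0..<N}. a $$ (i, k) * eu N p q $$ (k, j))"
    using assms by (simp add: scalar_prod_def)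
  also have "\<dots> = (\<Sum>k\<in>{0..<N}. if k = p then (if j = q then a $$ (i, p) else 0) else 0)"
    using assms by (intro sum.cong) auto
  finally show ?thesis using assms by simp
qed

lemma eu_mult_mult:
  assumes "a \<in> carrier_mat N N" "q < N" "r < N"
  shows "eu N p q * a * eu N r s = a $$ (q, r) \<cdot>\<^sub>m eu N p s"
  by (rule eq_matI)
    (use assms in \<open>auto simp: mult_eu_index[OF mult_carrier_mat[OF eu_carrier assms(1)]] eu_mult_index
      simp del: index_mult_mat(1)\<close>)

lemma eu_mult_eu: "q < N \<Longrightarrow> r < N \<Longrightarrow> eu N p q * eu N r s = (if q = r then eu N p s else 0\<^sub>m N N)"
  by (rule eq_matI) (auto simp: eu_mult_index[OF eu_carrier] simp del: index_mult_mat(1))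

lemma eu_transpose: "transpose_mat (eu N p q) = eu N q p"
  by (rule eq_matI) auto

lemma sum_div_mod:
  fixes f :: "nat \<Rightarrow> nat \<Rightarrow> complex"
  shows "(\<Sum>l<n * k. f (l div k) (l mod k)) = (\<Sum>p<n. \<Sum>q<k. f p q)"
proof -
  have "(\<Sum>l<n * k. f (l div k) (l mod k)) = (\<Sum>p<n. \<Sum>l\<in>{p * k..<p * k + k}. f (l div k) (l mod k))"
    by (rule sum.nat_group[symmetric])
  also have "\<dots> = (\<Sum>p<n. \<Sum>q<k. f p q)"
  proof (rule sum.cong[OF refl])
    fix p
    have "(\<Sum>l\<in>{p * k..<p * k + k}. f (l div k) (l mod k)) = (\<Sum>q\<in>{0..<k}. f ((q + p * k) div k) ((q + p * k) mod k))"
      using sum.shift_bounds_nat_ivl[of "\<lambda>l. f (l div k) (l mod k)" 0 "p * k" k] by (simp add: add.commute)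
    also have "\<dots> = (\<Sum>q<k. f p q)" by (intro sum.cong) auto
    finally show "(\<Sum>l\<in>{p * k..<p * k + k}. f (l div k) (l mod k)) = (\<Sum>q<k. f p q)" .
  qed
  finally show ?thesis .
qed

lemma kron_dim [simp]: "dim_row (kron A B) = dim_row A * dim_row B" "dim_col (kron A B) = dim_col A * dim_col B"
  by (simp_all add: kron_def)

lemma kron_carrier [simp]:
  "A \<in> carrier_mat n n' \<Longrightarrow> B \<in> carrier_mat k k' \<Longrightarrow> kron A B \<in> carrier_mat (n * k) (n' * k')"
  by auto

lemma kron_index:
  "A \<in> carrier_mat n n' \<Longrightarrow> B \<in> carrier_mat k k' \<Longrightarrow> i < n * k \<Longrightarrow> j < n' * k' \<Longrightarrow>
    kron A B $$ (i, j) = A $$ (i div k, j div k') * B $$ (i mod k, j mod k')"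
  by (auto simp: kron_def)

lemma div_mod_bounds:
  assumes "i < n * (k :: nat)" shows "i div k < n" "i mod k < k" "k > 0"
proof -
  show k: "k > 0" using assms by (cases k) auto
  show "i div k < n" using assms k by (simp add: less_mult_imp_div_less)
  show "i mod k < k" using k by simp
qed

lemma kron_mult:
  assumes "A \<in> carrier_mat n n'" "C \<in> carrier_mat n' n''" "B \<in> carrier_mat k k'" "D \<in> carrier_mat k' k''"
  shows "kron A B * kron C D = kron (A * C) (B * D)"
proof (rule eq_matI)
  fix i j assume "i < dim_row (kron (A * C) (B * D))" "j < dim_col (kron (A * C) (B * D))"
  then have ij: "i < n * k" "j < n'' * k''" using assms by auto
  note b = div_mod_bounds[OF ij(1)] div_mod_bounds[OF ij(2)]
  have "(kron A B * kron C D) $$ (i, j) = (\<Sum>l<n' * k'. kron A B $$ (i, l) * kron C D $$ (l, j))"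
    using ij assms by (simp add: scalar_prod_def atLeast0LessThan)
  also have "\<dots> = (\<Sum>l<n' * k'. (A $$ (i div k, l div k') * B $$ (i mod k, l mod k')) * (C $$ (l div k', j div k'') * D $$ (l mod k', j mod k'')))"
  proof (rule sum.cong[OF refl])
    fix l assume "l \<in> {..<n' * k'}"
    then have l: "l < n' * k'" by simp
    show "kron A B $$ (i, l) * kron C D $$ (l, j) =
      (A $$ (i div k, l div k') * B $$ (i mod k, l mod k')) * (C $$ (l div k', j div k'') * D $$ (l mod k', j mod k''))"
      unfolding kron_index[OF assms(1,3) ij(1) l] kron_index[OF assms(2,4) l ij(2)] ..
  qed
  also have "\<dots> = (\<Sum>p<n'. \<Sum>q<k'. (A $$ (i div k, p) * B $$ (i mod k, q)) * (C $$ (p, j div k'') * D $$ (q, j mod k'')))"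
    by (rule sum_div_mod)
  also have "\<dots> = (\<Sum>p<n'. A $$ (i div k, p) * C $$ (p, j div k'')) * (\<Sum>q<k'. B $$ (i mod k, q) * D $$ (q, j mod k''))"
    by (simp add: sum_product mult.assoc mult.left_commute)
  also have "\<dots> = kron (A * C) (B * D) $$ (i, j)"
    using ij b assms by (simp add: kron_index[OF mult_carrier_mat[OF assms(1,2)] mult_carrier_mat[OF assms(3,4)]] scalar_prod_def atLeast0LessThan)
  finally show "(kron A B * kron C D) $$ (i, j) = kron (A * C) (B * D) $$ (i, j)" .
qed (use assms in auto)

lemma kron_one: "kron (1\<^sub>m n) (1\<^sub>m k) = 1\<^sub>m (n * k)"
proof (rule eq_matI)
  fix i j assume "i < dim_row (1\<^sub>m (n * k))" "j < dim_col (1\<^sub>m (n * k))"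
  then have ij: "i < n * k" "j < n * k" by auto
  note b = div_mod_bounds[OF ij(1)] div_mod_bounds[OF ij(2)]
  have "i = j \<longleftrightarrow> i div k = j div k \<and> i mod k = j mod k" by (metis div_mult_mod_eq)
  then show "kron (1\<^sub>m n) (1\<^sub>m k) $$ (i, j) = 1\<^sub>m (n * k) $$ (i, j)"
    using ij b by (auto simp: kron_index[of _ n n _ k k])
qed auto

text \<open>Abstracts the two maps \<open>a \<mapsto> kron a 1\<close> and
  \<open>a \<mapsto> kron 1 a\<close>, the action of a matrix algebra on its standard module with
  multiplicity. The arguments below see only an injective unital homomorphism compatible with
  transpose and adjoint, so the side on which the multiplicity space stands is immaterial.\<close>

locale amplification =
  fixes N M :: nat and \<phi> :: "complex mat \<Rightarrow> complex mat"
  assumes car [simp]: "a \<in> carrier_mat N N \<Longrightarrow> \<phi> a \<in> carrier_mat M M"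
    and mul: "a \<in> carrier_mat N N \<Longrightarrow> b \<in> carrier_mat N N \<Longrightarrow> \<phi> (a * b) = \<phi> a * \<phi> b"
    and one [simp]: "\<phi> (1\<^sub>m N) = 1\<^sub>m M"
    and add: "a \<in> carrier_mat N N \<Longrightarrow> b \<in> carrier_mat N N \<Longrightarrow> \<phi> (a + b) = \<phi> a + \<phi> b"
    and smu: "a \<in> carrier_mat N N \<Longrightarrow> \<phi> (c \<cdot>\<^sub>m a) = c \<cdot>\<^sub>m \<phi> a"
    and trn: "a \<in> carrier_mat N N \<Longrightarrow> \<phi> (transpose_mat a) = transpose_mat (\<phi> a)"
    and dag: "a \<in> carrier_mat N N \<Longrightarrow> \<phi> (dagger a) = dagger (\<phi> a)"
    and inj: "a \<in> carrier_mat N N \<Longrightarrow> b \<in> carrier_mat N N \<Longrightarrow> \<phi> a = \<phi> b \<Longrightarrow> a = b"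

lemma amplification_left:
  assumes "k > 0"
  shows "amplification n (n * k) (\<lambda>a. kron a (1\<^sub>m k))"
proof
  show "kron (a * b) (1\<^sub>m k) = kron a (1\<^sub>m k) * kron b (1\<^sub>m k)" if "a \<in> carrier_mat n n" "b \<in> carrier_mat n n" for a b
    using kron_mult[OF that one_carrier_mat one_carrier_mat] by simp
  have i: "kron a (1\<^sub>m k) $$ (i, j) = (if i mod k = j mod k then a $$ (i div k, j div k) else 0)"
    if "a \<in> carrier_mat n n" "i < n * k" "j < n * k" for a i j
    using that div_mod_bounds[OF that(2)] div_mod_bounds[OF that(3)] by (auto simp: kron_index[of _ n n _ k k])
  show "kron (a + b) (1\<^sub>m k) = kron a (1\<^sub>m k) + kron b (1\<^sub>m k)" if "a \<in> carrier_mat n n" "b \<in> carrier_mat n n" for a b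
    by (rule eq_matI) (use that in \<open>auto simp: i div_mod_bounds(1,2)\<close>)
  show "kron (c \<cdot>\<^sub>m a) (1\<^sub>m k) = c \<cdot>\<^sub>m kron a (1\<^sub>m k)" if "a \<in> carrier_mat n n" for a c
    by (rule eq_matI) (use that in \<open>auto simp: i div_mod_bounds(1,2)\<close>)
  show "kron (transpose_mat a) (1\<^sub>m k) = transpose_mat (kron a (1\<^sub>m k))" if "a \<in> carrier_mat n n" for a
    by (rule eq_matI) (use that in \<open>auto simp: i div_mod_bounds(1,2)\<close>)
  show "kron (dagger a) (1\<^sub>m k) = dagger (kron a (1\<^sub>m k))" if "a \<in> carrier_mat n n" for a
    by (rule eq_matI) (use that in \<open>auto simp: i div_mod_bounds(1,2)\<close>)
  show "a = b" if ab: "a \<in> carrier_mat n n" "b \<in> carrier_mat n n" "kron a (1\<^sub>m k) = kron b (1\<^sub>m k)" for a b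
  proof (rule eq_matI)
    fix p q assume "p < dim_row b" "q < dim_col b"
    then have pq: "p < n" "q < n" using ab by auto
    then have "p * k < n * k" "q * k < n * k" using assms by simp_all
    then show "a $$ (p, q) = b $$ (p, q)"
      using i[OF ab(1), of "p * k" "q * k"] i[OF ab(2), of "p * k" "q * k"] ab(3) assms by simp
  qed (use ab in auto)
qed (auto simp: kron_one)

lemma amplification_right:
  assumes "n > 0"
  shows "amplification k (n * k) (\<lambda>a. kron (1\<^sub>m n) a)"
proof
  show "kron (1\<^sub>m n) (a * b) = kron (1\<^sub>m n) a * kron (1\<^sub>m n) b" if "a \<in> carrier_mat k k" "b \<in> carrier_mat k k" for a b
    using kron_mult[OF one_carrier_mat one_carrier_mat that] by simp
  have i: "kron (1\<^sub>m n) a $$ (i, j) = (if i div k = j div k then a $$ (i mod k, j mod k) else 0)"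
    if "a \<in> carrier_mat k k" "i < n * k" "j < n * k" for a i j
    using that div_mod_bounds[OF that(2)] div_mod_bounds[OF that(3)] by (auto simp: kron_index[of _ n n _ k k])
  show "kron (1\<^sub>m n) (a + b) = kron (1\<^sub>m n) a + kron (1\<^sub>m n) b" if "a \<in> carrier_mat k k" "b \<in> carrier_mat k k" for a b
    by (rule eq_matI) (use that in \<open>auto simp: i div_mod_bounds(1,2)\<close>)
  show "kron (1\<^sub>m n) (c \<cdot>\<^sub>m a) = c \<cdot>\<^sub>m kron (1\<^sub>m n) a" if "a \<in> carrier_mat k k" for a c
    by (rule eq_matI) (use that in \<open>auto simp: i div_mod_bounds(1,2)\<close>)
  show "kron (1\<^sub>m n) (transpose_mat a) = transpose_mat (kron (1\<^sub>m n) a)" if "a \<in> carrier_mat k k" for a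
    by (rule eq_matI) (use that in \<open>auto simp: i div_mod_bounds(1,2)\<close>)
  show "kron (1\<^sub>m n) (dagger a) = dagger (kron (1\<^sub>m n) a)" if "a \<in> carrier_mat k k" for a
    by (rule eq_matI) (use that in \<open>auto simp: i div_mod_bounds(1,2)\<close>)
  show "a = b" if ab: "a \<in> carrier_mat k k" "b \<in> carrier_mat k k" "kron (1\<^sub>m n) a = kron (1\<^sub>m n) b" for a b
  proof (rule eq_matI)
    fix p q assume "p < dim_row b" "q < dim_col b"
    then have pq: "p < k" "q < k" using ab by auto
    moreover have "k \<le> n * k" using assms by simp
    ultimately have "p < n * k" "q < n * k" by linarith+
    then show "a $$ (p, q) = b $$ (p, q)"
      using i[OF ab(1), of p q] i[OF ab(2), of p q] ab(3) pq by simp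
  qed (use ab in auto)
qed (auto simp: kron_one)

lemma kron_commute:
  assumes "a \<in> carrier_mat n n" "b \<in> carrier_mat k k"
  shows "kron a (1\<^sub>m k) * kron (1\<^sub>m n) b = kron a b" "kron (1\<^sub>m n) b * kron a (1\<^sub>m k) = kron a b"
  using kron_mult[OF assms(1) one_carrier_mat one_carrier_mat assms(2)]
    kron_mult[OF one_carrier_mat assms(1) assms(2) one_carrier_mat] assms by simp_all

section \<open>Subalgebras, commutants and matrix units\<close>

definition subalgebra :: "nat \<Rightarrow> complex mat set \<Rightarrow> bool" where
  "subalgebra N S \<longleftrightarrow> S \<subseteq> carrier_mat N N \<and> 1\<^sub>m N \<in> S \<and> (\<forall>a\<in>S. \<forall>b\<in>S. a + b \<in> S \<and> a * b \<in> S) \<and>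
     (\<forall>a\<in>S. \<forall>c. c \<cdot>\<^sub>m a \<in> S)"

lemma subalgebraD:
  assumes "subalgebra N S"
  shows "a \<in> S \<Longrightarrow> a \<in> carrier_mat N N" "1\<^sub>m N \<in> S" "a \<in> S \<Longrightarrow> b \<in> S \<Longrightarrow> a + b \<in> S"
    "a \<in> S \<Longrightarrow> b \<in> S \<Longrightarrow> a * b \<in> S" "a \<in> S \<Longrightarrow> c \<cdot>\<^sub>m a \<in> S"
  using assms unfolding subalgebra_def by blast+

context amplification begin

abbreviation E :: "nat \<Rightarrow> nat \<Rightarrow> complex mat" where "E p q \<equiv> \<phi> (eu N p q)"

lemma zero [simp]: "\<phi> (0\<^sub>m N N) = 0\<^sub>m M M"
proof -
  have c: "\<phi> (0\<^sub>m N N) \<in> carrier_mat M M" by simp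
  have "0 \<cdot>\<^sub>m 0\<^sub>m N N = (0\<^sub>m N N :: complex mat)" by (rule eq_matI) auto
  then have "\<phi> (0\<^sub>m N N) = 0 \<cdot>\<^sub>m \<phi> (0\<^sub>m N N)" using smu[of "0\<^sub>m N N" 0] by simp
  also have "\<dots> = 0\<^sub>m M M" using c by (rule smult_zero)
  finally show ?thesis .
qed

lemma E_mult: "q < N \<Longrightarrow> r < N \<Longrightarrow> E p q * E r s = (if q = r then E p s else 0\<^sub>m M M)"
  by (simp add: eu_mult_eu flip: mul)

lemma E_mult_same [simp]: "q < N \<Longrightarrow> E p q * E q s = E p s"
  by (simp add: E_mult)

lemma E_mult_same_left [simp]:
  "q < N \<Longrightarrow> c \<in> carrier_mat M M \<Longrightarrow> E p q * (E q s * c) = E p s * c"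
  by (simp flip: sq_assoc[of _ M])

lemma E_transpose: "transpose_mat (E p q) = E q p"
  by (simp add: eu_transpose flip: trn)

lemma GL: "a \<in> GL_group N \<Longrightarrow> \<phi> a \<in> GL_group M"
  using GL_group_if_right_inverse[of "\<phi> a" M "\<phi> (minv N a)"] mul[of a "minv N a"] minv_carrier[of a N] GL_groupD[of a N]
  by (simp add: minv_right)

lemma minv: "a \<in> GL_group N \<Longrightarrow> minv M (\<phi> a) = \<phi> (minv N a)"
  using minv_eq[of "\<phi> a" M "\<phi> (minv N a)"] mul[of a "minv N a"] minv_carrier[of a N] GL_groupD[of a N]
  by (simp add: minv_right)

text \<open>To be used with the generation results: whatever commutes with the images of some group
  elements commutes with the images of all matrices that these elements generate, in particular of
  matrix units.\<close>

lemma commutant_subalgebra: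
  assumes b: "b \<in> carrier_mat M M"
  shows "subalgebra N {a \<in> carrier_mat N N. \<phi> a * b = b * \<phi> a}"
  unfolding subalgebra_def
proof (intro conjI ballI allI)
  fix a a' assume a: "a \<in> {a \<in> carrier_mat N N. \<phi> a * b = b * \<phi> a}" and a': "a' \<in> {a \<in> carrier_mat N N. \<phi> a * b = b * \<phi> a}"
  have c: "a \<in> carrier_mat N N" "a' \<in> carrier_mat N N" and e: "\<phi> a * b = b * \<phi> a" "\<phi> a' * b = b * \<phi> a'" using a a' by auto
  have "(\<phi> a + \<phi> a') * b = b * (\<phi> a + \<phi> a')"
    using e add_mult_distrib_mat[OF car[OF c(1)] car[OF c(2)] b] mult_add_distrib_mat[OF b car[OF c(1)] car[OF c(2)]] by simp
  then show "a + a' \<in> {a \<in> carrier_mat N N. \<phi> a * b = b * \<phi> a}" using c by (simp add: add)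
  have "\<phi> a * \<phi> a' * b = \<phi> a * (\<phi> a' * b)" using c b by (simp add: sq_assoc[of _ M])
  also have "\<dots> = \<phi> a * b * \<phi> a'" unfolding e(2) using c b by (simp add: sq_assoc[of _ M])
  also have "\<dots> = b * (\<phi> a * \<phi> a')" unfolding e(1) using c b by (simp add: sq_assoc[of _ M])
  finally show "a * a' \<in> {a \<in> carrier_mat N N. \<phi> a * b = b * \<phi> a}" using c by (simp add: mul sq_mult[of _ N])
next
  fix a c assume a: "a \<in> {a \<in> carrier_mat N N. \<phi> a * b = b * \<phi> a}"
  then have "c \<cdot>\<^sub>m \<phi> a * b = b * (c \<cdot>\<^sub>m \<phi> a)"
    using mult_smult_assoc_mat[of "\<phi> a" M M b M] mult_smult_distrib[of b M M "\<phi> a" M] b by simp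
  then show "c \<cdot>\<^sub>m a \<in> {a \<in> carrier_mat N N. \<phi> a * b = b * \<phi> a}" using a by (simp add: smu)
qed (use b in auto)

text \<open>The \<open>E q q\<close> add up to the identity, so a matrix is determined by its
  products with them.\<close>

lemma eq_if_right_cuts:
  assumes C: "C \<in> carrier_mat M M" and D: "D \<in> carrier_mat M M" and cut: "\<And>q. q < N \<Longrightarrow> C * E q q = D * E q q"
  shows "C = D"
proof -
  \<comment> \<open>Partial sums of the diagonal matrix units, written entrywise; the induction runs
    from the zero matrix \<open>P 0\<close> to the identity \<open>P N\<close>.\<close>
  define P where "P k = mat N N (\<lambda>(i, j). if i = j \<and> i < k then 1 else (0 :: complex))" for k
  have Pc: "P k \<in> carrier_mat N N" for k by (simp add: P_def)
  have "C * \<phi> (P k) = D * \<phi> (P k)" if "k \<le> N" for k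
    using that
  proof (induction k)
    case 0
    have "P 0 = 0\<^sub>m N N" by (rule eq_matI) (auto simp: P_def)
    then show ?case using C D by simp
  next
    case (Suc k)
    have "P (Suc k) = P k + eu N k k" by (rule eq_matI) (auto simp: P_def)
    then have "\<phi> (P (Suc k)) = \<phi> (P k) + E k k" using Pc by (simp add: add)
    then show ?case using Suc cut[of k] Pc C D
      mult_add_distrib_mat[OF C car[OF Pc[of k]] car[OF eu_carrier]] mult_add_distrib_mat[OF D car[OF Pc[of k]] car[OF eu_carrier]]
      by simp
  qed
  moreover have "P N = 1\<^sub>m N" by (rule eq_matI) (auto simp: P_def)
  ultimately have "C * \<phi> (1\<^sub>m N) = D * \<phi> (1\<^sub>m N)" by (metis order_refl)
  then show ?thesis using C D by simp
qed

lemma eq_if_cuts: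
  assumes C: "C \<in> carrier_mat M M" and D: "D \<in> carrier_mat M M"
    and cut: "\<And>p q. p < N \<Longrightarrow> q < N \<Longrightarrow> E p p * C * E q q = E p p * D * E q q"
  shows "C = D"
proof (rule eq_if_right_cuts[OF C D])
  fix q assume q: "q < N"
  have "transpose_mat (C * E q q) = transpose_mat (D * E q q)"
  proof (rule eq_if_right_cuts)
    fix p assume p: "p < N"
    have "transpose_mat (E p p * C * E q q) = transpose_mat (E p p * D * E q q)" using cut[OF p q] by simp
    then show "transpose_mat (C * E q q) * E p p = transpose_mat (D * E q q) * E p p"
      using C D by (simp add: transpose_mult[of _ M M _ M] sq_assoc[of _ M] sq_mult[of _ M] E_transpose)
  qed (use C D in \<open>auto intro!: sq_mult[of _ M]\<close>)
  then show "C * E q q = D * E q q" by (metis transpose_transpose)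
qed

text \<open>Between the cuts \<open>E p p\<close> and \<open>E q q\<close> the matrix
  \<open>\<phi> a\<close> is the entry \<open>a $$ (p, q)\<close> times \<open>E p q\<close>, so a
  vanishing entry imposes no condition on \<open>b\<close>.\<close>

lemma commutes_if_support:
  assumes b: "b \<in> carrier_mat M M" and a: "a \<in> carrier_mat N N"
    and diag: "\<And>p. p < N \<Longrightarrow> E p p * b = b * E p p"
    and supp: "\<And>p q. p < N \<Longrightarrow> q < N \<Longrightarrow> a $$ (p, q) \<noteq> 0 \<Longrightarrow> E p q * b = b * E p q"
  shows "b * \<phi> a = \<phi> a * b"
proof (rule eq_if_cuts)
  fix p q assume pq: "p < N" "q < N"
  have cut: "E p p * \<phi> a * E q q = a $$ (p, q) \<cdot>\<^sub>m E p q"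
    using eu_mult_mult[OF a pq, of p q] a by (simp add: sq_mult[of _ N] smu flip: mul)
  have "E p p * (b * \<phi> a) * E q q = b * (E p p * \<phi> a * E q q)"
    using a b by (simp add: sq_assoc[of _ M] sq_mult[of _ M] diag[OF pq(1)] flip: sq_assoc[of "E p p" M b])
  also have "\<dots> = a $$ (p, q) \<cdot>\<^sub>m (b * E p q)"
    unfolding cut by (rule mult_smult_distrib[OF b car[OF eu_carrier]])
  also have "\<dots> = a $$ (p, q) \<cdot>\<^sub>m (E p q * b)" 
    using supp[OF pq] smult_zero[OF sq_mult[OF b car[OF eu_carrier]]] smult_zero[OF sq_mult[OF car[OF eu_carrier] b]]
    by (cases "a $$ (p, q) = 0") simp_all
  also have "\<dots> = (E p p * \<phi> a * E q q) * b"
    unfolding cut by (rule mult_smult_assoc_mat[OF car[OF eu_carrier] b, symmetric])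
  also have "\<dots> = E p p * (\<phi> a * b) * E q q"
    using a b by (simp add: sq_assoc[of _ M] sq_mult[of _ M] diag[OF pq(2)])
  finally show "E p p * (b * \<phi> a) * E q q = E p p * (\<phi> a * b) * E q q" .
qed (use a b in \<open>auto intro!: sq_mult[of _ M]\<close>)

end

section \<open>The colour swap\<close>

text \<open>Matrices of all sizes share one type, so the empty sum has to be told its size
  \<open>M\<close>.\<close>

primrec msum :: "nat \<Rightarrow> (nat \<Rightarrow> complex mat) \<Rightarrow> nat \<Rightarrow> complex mat" where
  "msum M F 0 = 0\<^sub>m M M"
| "msum M F (Suc n) = msum M F n + F n"

lemma msum_carrier: "(\<And>p. p < n \<Longrightarrow> F p \<in> carrier_mat M M) \<Longrightarrow> msum M F n \<in> carrier_mat M M"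
  by (induction n) auto

context amplification begin

lemma E_dim [simp]: "dim_row (E p q) = M" "dim_col (E p q) = M"
  by (rule carrier_matD[OF car[OF eu_carrier]])+

text \<open>Block \<open>p\<close> of the result is block \<open>f p\<close> of \<open>b\<close>,
  carried over by \<open>E p (f p)\<close> and back by \<open>E (f p) p\<close>. For
  \<open>b\<close> in the commutant of a block algebra this replaces the operator on the
  multiplicity space of one component by that of the partner component.\<close>

definition twist :: "(nat \<Rightarrow> nat) \<Rightarrow> complex mat \<Rightarrow> complex mat" where
  "twist f b = msum M (\<lambda>p. E p (f p) * b * E (f p) p) N"

lemma twist_carrier [simp]: "b \<in> carrier_mat M M \<Longrightarrow> twist f b \<in> carrier_mat M M"
  unfolding twist_def by (intro msum_carrier sq_mult) auto

lemma twist_regular: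
  assumes "regular_map M S F"
  shows "regular_map M S (\<lambda>g. twist f (F g))"
proof -
  have "regular_map M S (\<lambda>g. msum M (\<lambda>p. E p (f p) * F g * E (f p) p) n)" for n
    by (induction n) (simp_all add: regular_map_const regular_map_add regular_map_mult assms)
  then show ?thesis by (simp add: twist_def)
qed

text \<open>Multiplication by \<open>E q q\<close> annihilates every summand but the one with index
  \<open>q\<close>. Together with the version on the left, this is the block description on which
  the later computations rest.\<close>

lemma twist_right_cut:
  assumes b: "b \<in> carrier_mat M M" and q: "q < N"
  shows "twist f b * E q q = E q (f q) * b * E (f q) q"
proof -
  let ?T = "\<lambda>p. E p (f p) * b * E (f p) p"
  have T: "?T p \<in> carrier_mat M M" for p using b by (auto intro!: sq_mult)
  have "msum M ?T n * E q q = (if q < n then ?T q else 0\<^sub>m M M)" if "n \<le> N" for n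
    using that
  proof (induction n)
    case 0
    show ?case using left_mult_zero_mat[OF car[OF eu_carrier]] by simp
  next
    case (Suc n)
    have n: "n < N" using Suc.prems by simp
    have "?T n * E q q = (if n = q then ?T q else 0\<^sub>m M M)"
    proof -
      have "?T n * E q q = E n (f n) * b * (E (f n) n * E q q)" using b by (intro sq_assoc[of _ M] sq_mult) auto
      also have "\<dots> = E n (f n) * b * (if n = q then E (f n) q else 0\<^sub>m M M)" using n q by (simp add: E_mult)
      finally show ?thesis using b by (auto simp: sq_mult[of _ M])
    qed
    moreover have "(msum M ?T n + ?T n) * E q q = msum M ?T n * E q q + ?T n * E q q"
      using T by (intro add_mult_distrib_mat[of _ M M _ _ M] msum_carrier) auto
    ultimately show ?case using Suc T by (auto simp: left_add_zero_mat right_add_zero_mat)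
  qed
  then show ?thesis using q by (simp add: twist_def)
qed

lemma twist_left_cut:
  assumes b: "b \<in> carrier_mat M M" and q: "q < N"
  shows "E q q * twist f b = E q (f q) * b * E (f q) q"
proof -
  let ?T = "\<lambda>p. E p (f p) * b * E (f p) p"
  have T: "?T p \<in> carrier_mat M M" for p using b by (auto intro!: sq_mult)
  have "E q q * msum M ?T n = (if q < n then ?T q else 0\<^sub>m M M)" if "n \<le> N" for n
    using that
  proof (induction n)
    case 0
    show ?case using right_mult_zero_mat[OF car[OF eu_carrier]] by simp
  next
    case (Suc n)
    have n: "n < N" using Suc.prems by simp
    have "E q q * ?T n = (if n = q then ?T q else 0\<^sub>m M M)"
    proof -
      have "E q q * ?T n = E q q * E n (f n) * (b * E (f n) n)" using b by (simp add: sq_assoc[of _ M] sq_mult[of _ M])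
      also have "\<dots> = (if n = q then E q (f n) else 0\<^sub>m M M) * (b * E (f n) n)" using n q by (simp add: E_mult)
      finally show ?thesis using b by (auto simp: sq_mult[of _ M] sq_assoc[of _ M])
    qed
    moreover have "E q q * (msum M ?T n + ?T n) = E q q * msum M ?T n + E q q * ?T n"
      using T by (intro mult_add_distrib_mat[of _ M M _ M] msum_carrier) auto
    ultimately show ?case using Suc T by (auto simp: left_add_zero_mat right_add_zero_mat)
  qed
  then show ?thesis using q by (simp add: twist_def)
qed

end

text \<open>The colour \<open>col p\<close> of a basis vector \<open>p\<close> is its isotypic component under \<open>H\<close>. The partner
  \<open>f p\<close> is a fixed representative of the other \<open>H\<close>-component inside the \<open>G\<close>-component of \<open>p\<close>, and
  \<open>st p\<close> is the basis vector that the form \<open>\<beta>\<close> pairs with \<open>p\<close>.\<close>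

locale coloured = amplification +
  fixes col f st :: "nat \<Rightarrow> nat" and \<beta> w' :: "complex mat"
  assumes f: "p < N \<Longrightarrow> f p < N"
    and f_col: "p < N \<Longrightarrow> q < N \<Longrightarrow> col p = col q \<Longrightarrow> f p = f q"
    and f_f: "p < N \<Longrightarrow> col (f (f p)) = col p"
    and st: "p < N \<Longrightarrow> st p < N"
    and f_st: "p < N \<Longrightarrow> col (f (st p)) = col (st (f p))"
    and \<beta>: "\<beta> \<in> carrier_mat N N" and \<beta>_zero: "p < N \<Longrightarrow> q < N \<Longrightarrow> q \<noteq> st p \<Longrightarrow> \<beta> $$ (p, q) = 0"
    and \<beta>_nonzero: "p < N \<Longrightarrow> \<beta> $$ (p, st p) \<noteq> 0"
    and w': "w' \<in> carrier_mat M M" and w'_commute: "a \<in> carrier_mat N N \<Longrightarrow> w' * \<phi> a = \<phi> a * w'"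
begin

text \<open>The commutant of the algebra spanned by the \<open>E p q\<close> with \<open>p\<close>
  and \<open>q\<close> of one colour. When \<open>X\<close> generates that algebra, the isometries
  in \<open>A\<close> are the elements of \<open>Z\<close>.\<close>

definition A :: "complex mat set" where
  "A = {b \<in> carrier_mat M M. \<forall>p<N. \<forall>q<N. col p = col q \<longrightarrow> E p q * b = b * E p q}"

lemma AD: "b \<in> A \<Longrightarrow> b \<in> carrier_mat M M"
  "b \<in> A \<Longrightarrow> p < N \<Longrightarrow> q < N \<Longrightarrow> col p = col q \<Longrightarrow> E p q * b = b * E p q"
  by (auto simp: A_def)

lemma A_transpose:
  assumes b: "b \<in> A"
  shows "transpose_mat b \<in> A"
proof -
  have "E p q * transpose_mat b = transpose_mat b * E p q" if "p < N" "q < N" "col p = col q" for p q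
  proof -
    have "transpose_mat (E q p * b) = transpose_mat (b * E q p)" using AD(2)[OF b that(2,1) that(3)[symmetric]] by simp
    then show ?thesis using AD(1)[OF b] by (simp add: transpose_mult[of _ M M _ M] E_transpose)
  qed
  then show ?thesis using AD(1)[OF b] by (simp add: A_def)
qed

lemma f2: "p < N \<Longrightarrow> f (f p) < N" using f by blast

lemma Ec [simp]: "E p q \<in> carrier_mat M M" by simp

lemmas as = sq_assoc[of _ M] sq_mult[of _ M]

text \<open>For \<open>p\<close> and \<open>q\<close> of one colour both products equal
  \<open>E p (f q) * b * E (f q) q\<close>, because \<open>f p = f q\<close>. This is where it
  matters that \<open>f\<close> depends on the colour alone.\<close>

lemma twist_A:
  assumes b: "b \<in> A"
  shows "twist f b \<in> A"
proof -
  note bc = AD(1)[OF b]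
  have "E p q * twist f b = twist f b * E p q" if pq: "p < N" "q < N" "col p = col q" for p q
  proof -
    have "E p q * twist f b = E p q * (E q q * twist f b)" using pq bc by (simp add: as)
    also have "\<dots> = E p (f q) * (b * E (f q) q)" using pq f[of q] bc by (simp add: twist_left_cut as)
    also have "\<dots> = twist f b * E p p * E p q"
      using pq f_col[OF pq] f[of q] bc by (simp add: twist_right_cut as)
    also have "\<dots> = twist f b * E p q" using pq bc by (simp add: as)
    finally show ?thesis .
  qed
  then show ?thesis using bc by (simp add: A_def)
qed

text \<open>The two transports meet in \<open>E (f q) (f q)\<close>, which stands between
  \<open>b\<close> and \<open>b'\<close>; it commutes with \<open>b\<close> and is absorbed.\<close>

lemma twist_mult:
  assumes b: "b \<in> A" and b': "b' \<in> A"
  shows "twist f (b * b') = twist f b * twist f b'"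
proof (rule eq_if_right_cuts)
  note c = AD(1)[OF b] AD(1)[OF b']
  show "twist f (b * b') \<in> carrier_mat M M" "twist f b * twist f b' \<in> carrier_mat M M" using c by (simp_all add: sq_mult[of _ M])
  fix q assume q: "q < N"
  have "twist f b * twist f b' * E q q = twist f b * (E q (f q) * b' * E (f q) q)"
    using c q by (simp add: as twist_right_cut)
  also have "\<dots> = (twist f b * E q q) * (E q (f q) * b' * E (f q) q)" using c q by (simp add: as)
  also have "\<dots> = E q (f q) * (b * E (f q) (f q) * b') * E (f q) q"
    using c q f[OF q] by (simp add: as twist_right_cut)
  also have "b * E (f q) (f q) = E (f q) (f q) * b" using AD(2)[OF b, of "f q" "f q"] f[OF q] by simp
  also have "E q (f q) * (E (f q) (f q) * b * b') * E (f q) q = twist f (b * b') * E q q"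
    using c q f[OF q] by (simp add: as twist_right_cut)
  finally show "twist f (b * b') * E q q = twist f b * twist f b' * E q q" by simp
qed

text \<open>Twisting twice transports block \<open>q\<close> through \<open>f (f q)\<close>. This
  index need not be \<open>q\<close>, but it has the same colour, so \<open>b\<close> commutes with
  the transporting matrix unit.\<close>

lemma twist_twist:
  assumes b: "b \<in> A"
  shows "twist f (twist f b) = b"
proof (rule eq_if_right_cuts)
  note bc = AD(1)[OF b]
  show "twist f (twist f b) \<in> carrier_mat M M" "b \<in> carrier_mat M M" using bc by simp_all
  fix q assume q: "q < N"
  note fq = f[OF q] f2[OF q]
  have "twist f (twist f b) * E q q = E q (f q) * twist f b * E (f q) q" using bc q by (simp add: twist_right_cut)
  also have "\<dots> = E q (f q) * (twist f b * E (f q) (f q)) * E (f q) q" using bc q fq by (simp add: as)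
  also have "\<dots> = E q (f (f q)) * b * E (f (f q)) q" using bc q fq by (simp add: as twist_right_cut)
  also have "\<dots> = b * E q (f (f q)) * E (f (f q)) q" using AD(2)[OF b q fq(2) f_f[OF q, symmetric]] by simp
  also have "\<dots> = b * E q q" using bc q fq by (simp add: as)
  finally show "twist f (twist f b) * E q q = b * E q q" .
qed

text \<open>Commuting with \<open>E p (f p)\<close> says that \<open>b\<close> induces the same
  operator on the multiplicity spaces of the two partner colours.\<close>

lemma twist_fixed_iff:
  assumes b: "b \<in> A"
  shows "twist f b = b \<longleftrightarrow> (\<forall>p<N. E p (f p) * b = b * E p (f p))"
proof (intro iffI allI impI)
  note bc = AD(1)[OF b]
  fix p assume t: "twist f b = b" and p: "p < N"
  have "E p (f p) * b = E p (f p) * (E (f p) (f p) * b)" using bc p f[OF p] by (simp add: as)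
  also have "\<dots> = E p (f p) * (b * E (f p) (f p))" using AD(2)[OF b f[OF p] f[OF p]] by simp
  also have "\<dots> = (E p (f p) * b * E (f p) p) * E p (f p)" using bc p f[OF p] by (simp add: as)
  also have "\<dots> = twist f b * E p p * E p (f p)" using bc p by (simp add: twist_right_cut)
  also have "\<dots> = b * E p (f p)" unfolding t using bc p by (simp add: as)
  finally show "E p (f p) * b = b * E p (f p)" .
next
  note bc = AD(1)[OF b]
  assume c: "\<forall>p<N. E p (f p) * b = b * E p (f p)"
  show "twist f b = b"
  proof (rule eq_if_right_cuts)
    fix q assume q: "q < N"
    have "twist f b * E q q = b * E q (f q) * E (f q) q" using bc q c by (simp add: twist_right_cut)
    also have "\<dots> = b * E q q" using bc q f[OF q] by (simp add: as)
    finally show "twist f b * E q q = b * E q q" .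
  qed (use bc in auto)
qed

lemma \<beta>_cut: "p < N \<Longrightarrow> q < N \<Longrightarrow> E r p * \<phi> \<beta> * E q s = \<beta> $$ (p, q) \<cdot>\<^sub>m E r s"
  using eu_mult_mult[OF \<beta>, of p q r s] \<beta> by (simp add: sq_mult[of _ N] smu flip: mul)

lemma \<beta>_left: assumes "r < N" shows "E r r * \<phi> \<beta> = \<beta> $$ (r, st r) \<cdot>\<^sub>m E r (st r)"
proof -
  have "eu N r r * \<beta> = \<beta> $$ (r, st r) \<cdot>\<^sub>m eu N r (st r)"
    by (rule eq_matI) (use assms \<beta> \<beta>_zero in \<open>auto simp: eu_mult_index[OF \<beta>] simp del: index_mult_mat(1)\<close>)
  then show ?thesis using \<beta> by (simp add: smu flip: mul)
qed

text \<open>The transports turn the block of the form at \<open>p\<close>, \<open>q\<close> into a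
  block of \<open>b\<close> at \<open>f p\<close>, \<open>f q\<close>, with the scalar entry of
  \<open>\<beta>\<close> split off; \<open>w'\<close> passes through the matrix units because it
  commutes with the image of \<open>\<phi>\<close>.\<close>

lemma form_cut:
  assumes b: "b \<in> carrier_mat M M" and pq: "p < N" "q < N"
  shows "E p p * (transpose_mat (twist f b) * (\<phi> \<beta> * w') * twist f b) * E q q =
    \<beta> $$ (p, q) \<cdot>\<^sub>m (E p (f p) * (transpose_mat b * E (f p) (f q) * w' * b) * E (f q) q)"
proof -
  note bt = transpose_carrier_mat[THEN iffD2, OF b]
  have "E p p * transpose_mat (twist f b) = transpose_mat (twist f b * E p p)"
    using b by (simp add: transpose_mult[of _ M M _ M] E_transpose)
  also have "\<dots> = E p (f p) * transpose_mat b * E (f p) p"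
    using b bt pq by (simp add: twist_right_cut transpose_mult[of _ M M _ M] E_transpose as)
  finally have l: "E p p * transpose_mat (twist f b) = E p (f p) * transpose_mat b * E (f p) p" .
  have "E p p * (transpose_mat (twist f b) * (\<phi> \<beta> * w') * twist f b) * E q q =
    (E p p * transpose_mat (twist f b)) * (\<phi> \<beta> * w') * (twist f b * E q q)"
    using b \<beta> w' by (simp add: as)
  also have "\<dots> = E p (f p) * transpose_mat b * (E (f p) p * \<phi> \<beta> * (w' * E q (f q))) * (b * E (f q) q)"
    unfolding l using b bt \<beta> w' pq by (simp add: twist_right_cut as)
  also have "w' * E q (f q) = E q (f q) * w'" by (simp add: w'_commute)
  also have "E p (f p) * transpose_mat b * (E (f p) p * \<phi> \<beta> * (E q (f q) * w')) * (b * E (f q) q)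
    = E p (f p) * transpose_mat b * (E (f p) p * \<phi> \<beta> * E q (f q)) * (w' * b * E (f q) q)"
    using b bt \<beta> w' by (simp add: as)
  also have "\<dots> = \<beta> $$ (p, q) \<cdot>\<^sub>m (E p (f p) * transpose_mat b * E (f p) (f q) * (w' * b * E (f q) q))"
    unfolding \<beta>_cut[OF pq] using b bt w'
    by (simp add: mult_smult_distrib[of _ M M _ M] mult_smult_assoc_mat[of _ M M _ M] sq_mult[of _ M])
  also have "\<dots> = \<beta> $$ (p, q) \<cdot>\<^sub>m (E p (f p) * (transpose_mat b * E (f p) (f q) * w' * b) * E (f q) q)"
    using b bt w' by (simp add: as)
  finally show ?thesis .
qed

text \<open>Only blocks with \<open>q = st p\<close> carry a nonzero entry of
  \<open>\<beta>\<close>. By \<open>f_st\<close> the partner of \<open>st p\<close> has the colour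
  of \<open>st (f p)\<close>, so up to nonzero scalars this block of the claim is the block of the
  hypothesis \<open>iso\<close> at \<open>f p\<close> and \<open>st (f p)\<close>.\<close>

lemma twist_isometry:
  assumes b: "b \<in> A" and iso: "transpose_mat b * (\<phi> \<beta> * w') * b = \<phi> \<beta> * w'"
  shows "transpose_mat (twist f b) * (\<phi> \<beta> * w') * twist f b = \<phi> \<beta> * w'"
proof (rule eq_if_cuts)
  note bc = AD(1)[OF b]
  note bt = transpose_carrier_mat[THEN iffD2, OF bc]
  show "transpose_mat (twist f b) * (\<phi> \<beta> * w') * twist f b \<in> carrier_mat M M" "\<phi> \<beta> * w' \<in> carrier_mat M M"
    using bc \<beta> w' by (simp_all add: sq_mult[of _ M])
  fix p q assume pq: "p < N" "q < N"
  have "E p p * (\<phi> \<beta> * w') * E q q = E p p * \<phi> \<beta> * (w' * E q q)" using \<beta> w' by (simp add: as)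
  also have "\<dots> = E p p * \<phi> \<beta> * E q q * w'" using \<beta> w' by (simp add: as w'_commute)
  also have "\<dots> = \<beta> $$ (p, q) \<cdot>\<^sub>m (E p q * w')"
    unfolding \<beta>_cut[OF pq] by (rule mult_smult_assoc_mat[OF Ec w'])
  finally have R: "E p p * (\<phi> \<beta> * w') * E q q = \<beta> $$ (p, q) \<cdot>\<^sub>m (E p q * w')" .
  show "E p p * (transpose_mat (twist f b) * (\<phi> \<beta> * w') * twist f b) * E q q = E p p * (\<phi> \<beta> * w') * E q q"
  proof (cases "q = st p")
    case False
    have z: "\<beta> $$ (p, q) = 0" using \<beta>_zero[OF pq False] .
    have "0 \<cdot>\<^sub>m C = (0\<^sub>m M M :: complex mat)" if "C \<in> carrier_mat M M" for C
      by (rule eq_matI) (use that in auto)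
    then show ?thesis unfolding form_cut[OF bc pq] R z using bc bt w' by (simp add: sq_mult[of _ M])
  next
    case True
    \<comment> \<open>The index \<open>s\<close> is paired with \<open>r\<close> by
      \<open>\<beta>\<close>, while \<open>f q\<close> merely shares the colour of \<open>s\<close>;
      membership of \<open>b\<close> in \<open>A\<close> allows one to be exchanged for the
      other.\<close>
    define r where "r = f p"
    define s where "s = st r"
    have rs: "r < N" "s < N" using f st pq by (auto simp: r_def s_def)
    have fq: "f q < N" using f pq by blast
    have col: "col s = col (f q)" using f_st[OF pq(1)] True by (simp add: r_def s_def)
    have sw: "E s (f q) * (w' * b) = w' * b * E s (f q)"
    proof -
      have "E s (f q) * (w' * b) = w' * (E s (f q) * b)"
        using bc w' w'_commute[OF eu_carrier, of s "f q"] by (simp flip: sq_assoc[of _ M])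
      then show ?thesis using AD(2)[OF b rs(2) fq col] bc w' by (simp add: as)
    qed
    have "E r (f q) = E r s * E s (f q)" using rs by simp
    then have "transpose_mat b * E r (f q) * w' * b = transpose_mat b * E r s * (E s (f q) * (w' * b))"
      using bc bt w' rs by (simp add: as del: E_mult_same E_mult_same_left)
    also have "\<dots> = (transpose_mat b * E r s * w' * b) * E s (f q)" unfolding sw using bc bt w' by (simp add: as)
    finally have 1: "E p r * (transpose_mat b * E r (f q) * w' * b) * E (f q) q = E p r * (transpose_mat b * E r s * w' * b) * E s q"
      using bc bt w' fq by (simp add: as)
    \<comment> \<open>Row \<open>r\<close> of \<open>\<beta>\<close> has a single nonzero entry, so
      the matrix unit can be traded for the full form, to which \<open>iso\<close> applies. The
      entry is cancelled at the end.\<close>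
    have ers: "\<beta> $$ (r, s) \<cdot>\<^sub>m E r s = E r r * \<phi> \<beta>" using \<beta>_left[OF rs(1)] by (simp add: s_def)
    have "\<beta> $$ (r, s) \<cdot>\<^sub>m (E p r * (transpose_mat b * E r s * w' * b) * E s q)
      = E p r * (transpose_mat b * (\<beta> $$ (r, s) \<cdot>\<^sub>m E r s) * w' * b) * E s q"
      using bc bt w' by (simp add: mult_smult_distrib[of _ M M _ M] mult_smult_assoc_mat[of _ M M _ M] sq_mult[of _ M])
    also have "\<dots> = E p r * (transpose_mat b * E r r) * (\<phi> \<beta> * w' * b) * E s q"
      unfolding ers using bc bt w' \<beta> by (simp add: as)
    also have "transpose_mat b * E r r = E r r * transpose_mat b" using AD(2)[OF A_transpose[OF b] rs(1) rs(1)] by simp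
    also have "E p r * (E r r * transpose_mat b) * (\<phi> \<beta> * w' * b) * E s q = E p r * (transpose_mat b * (\<phi> \<beta> * w') * b) * E s q"
      using bc bt w' \<beta> rs by (simp add: as)
    also have "\<dots> = E p r * \<phi> \<beta> * (w' * E s q)" unfolding iso using w' \<beta> by (simp add: as)
    also have "\<dots> = E p r * \<phi> \<beta> * E s q * w'" using w' \<beta> by (simp add: as w'_commute)
    also have "\<dots> = \<beta> $$ (r, s) \<cdot>\<^sub>m (E p q * w')"
      unfolding \<beta>_cut[OF rs] by (rule mult_smult_assoc_mat[OF Ec w'])
    finally have "E p r * (transpose_mat b * E r s * w' * b) * E s q = E p q * w'"
      using \<beta>_nonzero[OF rs(1)] by (simp add: smult_eq_iff s_def)
    then show ?thesis unfolding form_cut[OF bc pq] R using 1 by (simp add: r_def)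
  qed
qed

text \<open>Across partner colours,
  \<open>E p q = E p (f q) * E (f q) (f (f q)) * E (f (f q)) q\<close>: the outer factors join equal
  colours, and the middle one is a partner unit as in \<open>c\<close>.\<close>

lemma commutes_partner:
  assumes b: "b \<in> A" and c: "\<And>p. p < N \<Longrightarrow> E p (f p) * b = b * E p (f p)"
    and pq: "p < N" "q < N" "col p = col q \<or> col p = col (f q)"
  shows "E p q * b = b * E p q"
proof (cases "col p = col q")
  case True then show ?thesis using AD(2)[OF b] pq by blast
next
  case False
  then have pf: "col p = col (f q)" using pq by blast
  note bc = AD(1)[OF b]
  note fq = f[OF pq(2)] f2[OF pq(2)]
  have 1: "E p (f q) * b = b * E p (f q)" using AD(2)[OF b pq(1) fq(1) pf] .
  have 2: "E (f (f q)) q * b = b * E (f (f q)) q" using AD(2)[OF b fq(2) pq(2) f_f[OF pq(2)]] .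
  note 3 = c[OF fq(1)]
  have "E p q * b = E p (f q) * (E (f q) (f (f q)) * (E (f (f q)) q * b))" using bc fq by (simp add: as)
  also have "\<dots> = E p (f q) * (E (f q) (f (f q)) * b * E (f (f q)) q)" unfolding 2 using bc by (simp add: as)
  also have "\<dots> = E p (f q) * b * (E (f q) (f (f q)) * E (f (f q)) q)" unfolding 3 using bc by (simp add: as)
  also have "\<dots> = b * E p q" unfolding 1 using bc fq by (simp add: as)
  finally show ?thesis .
qed

end

text \<open>\<open>Xsupp\<close> and \<open>Xgen\<close> say that \<open>X\<close> generates the
  algebra of matrices supported within the colours, so its commutant is \<open>A\<close>.
  \<open>Ysupp\<close> and \<open>Ygen\<close> say that \<open>Y\<close> adds exactly the units
  between partner colours, so commuting with \<open>Y\<close> means being fixed by the twist. The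
  form is \<open>\<beta>\<close> on the standard module times a commuting factor \<open>w'\<close>
  on the multiplicities.\<close>

lemma see_saw_swap:
  fixes col f st :: "nat \<Rightarrow> nat"
  assumes dp: "dual_pair m G G'" and sym: "symmetric_subgroup (2 * m) G H"
    and R: "R \<in> isometries (2 * m) (\<phi> \<beta> * w') (sympl_form m)"
    and w: "(\<phi> \<beta> * w') * (\<phi> \<beta> * w') = c \<cdot>\<^sub>m 1\<^sub>m (2 * m)" "dagger (\<phi> \<beta> * w') = e \<cdot>\<^sub>m (\<phi> \<beta> * w')" "c \<noteq> 0" "e \<noteq> 0"
    and col: "coloured N (2 * m) \<phi> col f st \<beta> w'"
    and G: "G = conj_by R ` \<phi> ` Y" and H: "H = conj_by R ` \<phi> ` X" and XY: "X \<subseteq> Y" and Yc: "Y \<subseteq> carrier_mat N N"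
    and adj: "\<And>x. x \<in> X \<Longrightarrow> dagger x \<in> X"
    and Xsupp: "\<And>x p q. x \<in> X \<Longrightarrow> p < N \<Longrightarrow> q < N \<Longrightarrow> col p \<noteq> col q \<Longrightarrow> x $$ (p, q) = 0"
    and Xgen: "\<And>S p q. subalgebra N S \<Longrightarrow> X \<subseteq> S \<Longrightarrow> p < N \<Longrightarrow> q < N \<Longrightarrow> col p = col q \<Longrightarrow> eu N p q \<in> S"
    and Ysupp: "\<And>y p q. y \<in> Y \<Longrightarrow> p < N \<Longrightarrow> q < N \<Longrightarrow> col p \<noteq> col q \<Longrightarrow> col p \<noteq> col (f q) \<Longrightarrow> y $$ (p, q) = 0"
    and Ygen: "\<And>S p. subalgebra N S \<Longrightarrow> Y \<subseteq> S \<Longrightarrow> p < N \<Longrightarrow> eu N p (f p) \<in> S"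
    and s: "s \<in> isometries N \<beta> \<beta>" "\<And>x. x \<in> X \<Longrightarrow> s * x = x * s" "\<And>y. y \<in> Y \<Longrightarrow> y * s = s * y \<Longrightarrow> y \<in> X"
  shows "dual_pair m H (centralizer (Sp_group m) H) \<and> symmetric_subgroup (2 * m) (centralizer (Sp_group m) H) G'"
proof -
  interpret coloured N "2 * m" \<phi> col f st \<beta> w' by (rule col)
  let ?w = "\<phi> \<beta> * w'"
  have wc: "?w \<in> carrier_mat (2 * m) (2 * m)" using \<beta> w' by (simp add: sq_mult[of _ "2 * m"])
  have Xc: "x \<in> carrier_mat N N" if "x \<in> X" for x using that XY Yc by blast
  have sc: "s \<in> carrier_mat N N" using isometriesD(2)[OF s(1)] .
  define Z where "Z = {b \<in> isometries (2 * m) ?w ?w. \<forall>x\<in>\<phi> ` X. b * x = x * b}"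
  have AX: "(\<forall>x\<in>\<phi> ` X. b * x = x * b) \<longleftrightarrow> b \<in> A" if b: "b \<in> carrier_mat (2 * m) (2 * m)" for b
  proof
    assume c: "\<forall>x\<in>\<phi> ` X. b * x = x * b"
    have "X \<subseteq> {a \<in> carrier_mat N N. \<phi> a * b = b * \<phi> a}" using c Xc by auto
    then have "eu N p q \<in> {a \<in> carrier_mat N N. \<phi> a * b = b * \<phi> a}" if "p < N" "q < N" "col p = col q" for p q
      using Xgen[OF commutant_subalgebra[OF b]] that by blast
    then show "b \<in> A" using b by (simp add: A_def)
  next
    assume bA: "b \<in> A"
    have "b * \<phi> x = \<phi> x * b" if x: "x \<in> X" for x
    proof (rule commutes_if_support[OF b Xc[OF x]])
      show "E p p * b = b * E p p" if "p < N" for p using AD(2)[OF bA that that] by simp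
      show "E p q * b = b * E p q" if "p < N" "q < N" "x $$ (p, q) \<noteq> 0" for p q
        using AD(2)[OF bA that(1,2)] Xsupp[OF x that(1,2)] that(3) by blast
    qed
    then show "\<forall>x\<in>\<phi> ` X. b * x = x * b" by blast
  qed
  have ZA: "b \<in> Z \<longleftrightarrow> b \<in> A \<and> b \<in> isometries (2 * m) ?w ?w" for b
    using AX[of b] isometriesD(2)[of b] unfolding Z_def by blast
  have ZD: "b \<in> A" "transpose_mat b * ?w * b = ?w" if "b \<in> Z" for b
    using that isometriesD(3)[of b] unfolding ZA by auto
  show ?thesis
  proof (rule see_saw_criterion[OF dp sym R wc w G H _ _ _ Z_def, where \<theta> = "twist f"])
    show "\<phi> ` X \<subseteq> \<phi> ` Y" using XY by blast
    show "\<phi> ` Y \<subseteq> carrier_mat (2 * m) (2 * m)" using Yc by auto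
    show "dagger x \<in> \<phi> ` X" if x: "x \<in> \<phi> ` X" for x
    proof -
      obtain a where a: "a \<in> X" "x = \<phi> a" using x by blast
      then show ?thesis using adj[OF a(1)] dag[OF Xc[OF a(1)]] by (metis image_eqI)
    qed
    show "y \<in> \<phi> ` X" if y: "y \<in> \<phi> ` Y" "\<And>b. b \<in> Z \<Longrightarrow> y * b = b * y" for y
    proof -
      obtain a where a: "a \<in> Y" "y = \<phi> a" using y(1) by blast
      have ac: "a \<in> carrier_mat N N" using a Yc by blast
      \<comment> \<open>The one element of \<open>Z\<close> behind the double centralizer property.
        It is amplified from the standard module, so commutation with it can be tested before
        amplification.\<close>
      have "\<phi> s \<in> Z"
      proof -
        have "transpose_mat (\<phi> s) * ?w * \<phi> s = transpose_mat (\<phi> s) * \<phi> \<beta> * (w' * \<phi> s)"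
          using sc \<beta> w' by (simp add: as)
        also have "\<dots> = \<phi> (transpose_mat s * \<beta> * s) * w'"
          using sc \<beta> w' by (simp add: w'_commute mul trn sq_mult[of _ N] as)
        finally have "\<phi> s \<in> isometries (2 * m) ?w ?w"
          using isometriesD(3)[OF s(1)] GL[OF isometriesD(1)[OF s(1)]] by (simp add: isometries_def)
        moreover have "\<phi> s * \<phi> x = \<phi> x * \<phi> s" if "x \<in> X" for x
          using s(2)[OF that] mul[OF sc Xc[OF that]] mul[OF Xc[OF that] sc] by simp
        ultimately show ?thesis by (auto simp: Z_def)
      qed
      then have "\<phi> (a * s) = \<phi> (s * a)" using y(2) a ac sc by (simp add: mul)
      then have "a * s = s * a" using inj ac sc sq_mult by metis
      then show ?thesis using s(3)[OF a(1)] a(2) by blast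
    qed
    show "twist f b \<in> Z" if b: "b \<in> Z" for b
    proof -
      have "twist f b \<in> isometries (2 * m) ?w ?w"
      proof (rule isometries_if_nondegenerate[OF _ _ wc twist_isometry[OF ZD[OF b]]])
        show "twist f b \<in> carrier_mat (2 * m) (2 * m)" using AD(1)[OF ZD(1)[OF b]] by simp
        show "?w \<in> GL_group (2 * m)"
        proof (rule GL_group_if_right_inverse[OF wc, of "(1 / c) \<cdot>\<^sub>m ?w"])
          show "?w * ((1 / c) \<cdot>\<^sub>m ?w) = 1\<^sub>m (2 * m)"
            using mult_smult_distrib[OF wc wc] w(1,3) by (simp add: smult_smult smult_one)
        qed (use wc in simp)
      qed
      then show ?thesis using twist_A[OF ZD(1)[OF b]] unfolding ZA by blast
    qed
    show "twist f (b * b') = twist f b * twist f b'" if "b \<in> Z" "b' \<in> Z" for b b'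
      using twist_mult ZD(1) that by blast
    show "twist f (twist f b) = b" if "b \<in> Z" for b using twist_twist ZD(1) that by blast
    show "twist f b = b \<longleftrightarrow> (\<forall>y\<in>\<phi> ` Y. b * y = y * b)" if "b \<in> Z" for b
    proof -
      have bA: "b \<in> A" using ZD(1) that by blast
      note bc = AD(1)[OF bA]
      show ?thesis unfolding twist_fixed_iff[OF bA]
      proof
        assume c: "\<forall>p<N. E p (f p) * b = b * E p (f p)"
        have "b * \<phi> y = \<phi> y * b" if y: "y \<in> Y" for y
        proof (rule commutes_if_support[OF bc])
          show "y \<in> carrier_mat N N" using y Yc by blast
          show "E p p * b = b * E p p" if "p < N" for p using AD(2)[OF bA that that] by simp
          show "E p q * b = b * E p q" if "p < N" "q < N" "y $$ (p, q) \<noteq> 0" for p q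
          proof (rule commutes_partner[OF bA _ that(1,2)])
            show "col p = col q \<or> col p = col (f q)" using Ysupp[OF y that(1,2)] that(3) by blast
          qed (use c in blast)
        qed
        then show "\<forall>y\<in>\<phi> ` Y. b * y = y * b" by blast
      next
        assume c: "\<forall>y\<in>\<phi> ` Y. b * y = y * b"
        have "Y \<subseteq> {a \<in> carrier_mat N N. \<phi> a * b = b * \<phi> a}" using c Yc by auto
        then show "\<forall>p<N. E p (f p) * b = b * E p (f p)"
          using Ygen[OF commutant_subalgebra[OF bc]] by blast
      qed
    qed
    show "regular_map (2 * m) S (\<lambda>g. twist f (F g))" if "regular_map (2 * m) S F" for S F
      using twist_regular[OF that] .
  qed
qed

section \<open>Monomial matrices and standard forms\<close>

text \<open>Diagonal matrices, permutations and the standard forms all have this shape, so their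
  products, transposes and isometry conditions become computations with indices.\<close>

definition gm :: "nat \<Rightarrow> (nat \<Rightarrow> nat) \<Rightarrow> (nat \<Rightarrow> complex) \<Rightarrow> complex mat" where
  "gm N \<sigma> c = mat N N (\<lambda>(i, j). if j = \<sigma> i then c i else 0)"

lemma gm_carrier [simp]: "gm N \<sigma> c \<in> carrier_mat N N" by (simp add: gm_def)
lemma gm_dim [simp]: "dim_row (gm N \<sigma> c) = N" "dim_col (gm N \<sigma> c) = N" by (simp_all add: gm_def)
lemma gm_index [simp]: "i < N \<Longrightarrow> j < N \<Longrightarrow> gm N \<sigma> c $$ (i, j) = (if j = \<sigma> i then c i else 0)"
  by (simp add: gm_def)

lemma gm_mult_index:
  assumes "A \<in> carrier_mat N N" "i < N" "j < N" "\<sigma> i < N"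
  shows "(gm N \<sigma> c * A) $$ (i, j) = c i * A $$ (\<sigma> i, j)"
proof -
  have "(gm N \<sigma> c * A) $$ (i, j) = (\<Sum>k\<in>{0..<N}. gm N \<sigma> c $$ (i, k) * A $$ (k, j))"
    using assms by (simp add: scalar_prod_def)
  also have "\<dots> = (\<Sum>k\<in>{0..<N}. if k = \<sigma> i then c i * A $$ (\<sigma> i, j) else 0)"
    using assms by (intro sum.cong) auto
  finally show ?thesis using assms by simp
qed

lemma gm_cong: "(\<And>i. i < N \<Longrightarrow> \<sigma> i = \<tau> i) \<Longrightarrow> (\<And>i. i < N \<Longrightarrow> c i = d i) \<Longrightarrow> gm N \<sigma> c = gm N \<tau> d"
  by (rule eq_matI) auto

lemma gm_mult:
  assumes "\<And>i. i < N \<Longrightarrow> \<sigma> i < N"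
  shows "gm N \<sigma> c * gm N \<tau> d = gm N (\<lambda>i. \<tau> (\<sigma> i)) (\<lambda>i. c i * d (\<sigma> i))"
  by (rule eq_matI) (use assms in \<open>auto simp: gm_mult_index[OF gm_carrier] simp del: index_mult_mat(1)\<close>)

lemma gm_one: "1\<^sub>m N = gm N (\<lambda>i. i) (\<lambda>_. 1)"
  by (rule eq_matI) auto

lemma gm_transpose:
  assumes "\<And>i. i < N \<Longrightarrow> \<sigma> i < N \<and> \<sigma> (\<sigma> i) = i"
  shows "transpose_mat (gm N \<sigma> c) = gm N \<sigma> (\<lambda>i. c (\<sigma> i))"
  by (rule eq_matI) (use assms in force)+

lemma gm_smult: "a \<cdot>\<^sub>m gm N \<sigma> c = gm N \<sigma> (\<lambda>i. a * c i)"
  by (rule eq_matI) auto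

lemma gm_add: "gm N \<sigma> c + gm N \<sigma> d = gm N \<sigma> (\<lambda>i. c i + d i)"
  by (rule eq_matI) auto

lemma gm_dagger:
  assumes "\<And>i. i < N \<Longrightarrow> \<sigma> i < N \<and> \<sigma> (\<sigma> i) = i"
  shows "dagger (gm N \<sigma> c) = gm N \<sigma> (\<lambda>i. cnj (c (\<sigma> i)))"
  by (rule eq_matI) (use assms in force)+

lemma gm_GL:
  assumes "\<And>i. i < N \<Longrightarrow> \<sigma> i < N \<and> \<sigma> (\<sigma> i) = i" "\<And>i. i < N \<Longrightarrow> c i \<noteq> 0"
  shows "gm N \<sigma> c \<in> GL_group N"
proof (rule GL_group_if_right_inverse[OF gm_carrier gm_carrier])
  show "gm N \<sigma> c * gm N \<sigma> (\<lambda>i. 1 / c (\<sigma> i)) = 1\<^sub>m N"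
    unfolding gm_one using assms by (subst gm_mult) (auto intro!: gm_cong)
qed

lemma gm_isometry:
  assumes \<sigma>: "\<And>i. i < N \<Longrightarrow> \<sigma> i < N \<and> \<sigma> (\<sigma> i) = i" and \<tau>: "\<And>i. i < N \<Longrightarrow> \<tau> i < N \<and> \<tau> (\<tau> i) = i"
    and d: "\<And>i. i < N \<Longrightarrow> d i \<noteq> 0"
    and 1: "\<And>i. i < N \<Longrightarrow> \<sigma> (\<tau> (\<sigma> i)) = \<tau> i"
    and 2: "\<And>i. i < N \<Longrightarrow> c (\<sigma> i) * d (\<sigma> i) * c (\<tau> (\<sigma> i)) = d i"
  shows "gm N \<sigma> c \<in> isometries N (gm N \<tau> d) (gm N \<tau> d)"
proof (rule isometries_if_nondegenerate[OF gm_carrier gm_GL[OF \<tau> d] gm_carrier])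
  have "transpose_mat (gm N \<sigma> c) * gm N \<tau> d * gm N \<sigma> c = gm N \<sigma> (\<lambda>i. c (\<sigma> i)) * gm N \<tau> d * gm N \<sigma> c"
    using gm_transpose[OF \<sigma>] by simp
  also have "\<dots> = gm N (\<lambda>i. \<tau> (\<sigma> i)) (\<lambda>i. c (\<sigma> i) * d (\<sigma> i)) * gm N \<sigma> c" using gm_mult[of N \<sigma>] \<sigma> by simp
  also have "\<dots> = gm N (\<lambda>i. \<sigma> (\<tau> (\<sigma> i))) (\<lambda>i. c (\<sigma> i) * d (\<sigma> i) * c (\<tau> (\<sigma> i)))"
    using gm_mult[of N "\<lambda>i. \<tau> (\<sigma> i)"] \<sigma> \<tau> by simp
  also have "\<dots> = gm N \<tau> d" using 1 2 by (rule gm_cong)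
  finally show "transpose_mat (gm N \<sigma> c) * gm N \<tau> d * gm N \<sigma> c = gm N \<tau> d" .
qed auto

lemma eu_gm: "eu N p p = gm N (\<lambda>i. i) (\<lambda>i. if i = p then 1 else 0)"
  by (rule eq_matI) auto

text \<open>A form that pairs each basis vector \<open>i\<close> with \<open>\<tau> i\<close> up to
  sign and has symmetry \<open>\<epsilon>\<close>. The entries \<open>1\<close> and
  \<open>-1\<close> give \<open>\<beta> * \<beta> = \<epsilon>\<close> and
  \<open>dagger \<beta> = \<epsilon> * \<beta>\<close>, the properties asked for by
  \<open>dagger_isometry\<close>.\<close>

definition std_form :: "nat \<Rightarrow> complex mat \<Rightarrow> (nat \<Rightarrow> nat) \<Rightarrow> (nat \<Rightarrow> complex) \<Rightarrow> complex \<Rightarrow> bool" where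
  "std_form N \<beta> \<tau> d \<epsilon> \<longleftrightarrow> \<beta> = gm N \<tau> d \<and> (\<forall>i<N. \<tau> i < N \<and> \<tau> (\<tau> i) = i \<and> d i \<in> {1, -1} \<and> d (\<tau> i) = \<epsilon> * d i) \<and>
     \<epsilon> \<in> {1, -1}"

lemma std_formD:
  assumes "std_form N \<beta> \<tau> d \<epsilon>"
  shows "\<beta> = gm N \<tau> d" "\<And>i. i < N \<Longrightarrow> \<tau> i < N \<and> \<tau> (\<tau> i) = i" "\<And>i. i < N \<Longrightarrow> d i = 1 \<or> d i = -1"
    "\<And>i. i < N \<Longrightarrow> d (\<tau> i) = \<epsilon> * d i" "\<And>i. i < N \<Longrightarrow> d i \<noteq> 0" "\<epsilon> = 1 \<or> \<epsilon> = -1" "\<epsilon> \<noteq> 0"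
proof -
  show "\<beta> = gm N \<tau> d" and \<epsilon>: "\<epsilon> = 1 \<or> \<epsilon> = -1" using assms unfolding std_form_def by blast+
  show "\<epsilon> \<noteq> 0" using \<epsilon> by (elim disjE) simp_all
  fix i assume i: "i < N"
  show "\<tau> i < N \<and> \<tau> (\<tau> i) = i" "d (\<tau> i) = \<epsilon> * d i" and d: "d i = 1 \<or> d i = -1"
    using assms i unfolding std_form_def by blast+
  show "d i \<noteq> 0" using d by (elim disjE) simp_all
qed

lemma std_form_props:
  assumes "std_form N \<beta> \<tau> d \<epsilon>"
  shows "\<beta> \<in> carrier_mat N N" "\<beta> \<in> GL_group N" "\<beta> * \<beta> = \<epsilon> \<cdot>\<^sub>m 1\<^sub>m N" "dagger \<beta> = \<epsilon> \<cdot>\<^sub>m \<beta>" "transpose_mat \<beta> = \<epsilon> \<cdot>\<^sub>m \<beta>"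
proof -
  note b = std_formD[OF assms]
  show "\<beta> \<in> carrier_mat N N" by (simp add: b(1))
  show "\<beta> \<in> GL_group N" unfolding b(1) using b(2,5) by (rule gm_GL)
  have sq: "d i * d i = 1" if "i < N" for i using b(3)[OF that] by (elim disjE) simp_all
  have cn: "cnj (d i) = d i" if "i < N" for i using b(3)[OF that] by (elim disjE) simp_all
  have "\<beta> * \<beta> = gm N (\<lambda>i. \<tau> (\<tau> i)) (\<lambda>i. d i * d (\<tau> i))"
    unfolding b(1) using b(2) by (intro gm_mult) blast
  also have "\<dots> = gm N (\<lambda>i. i) (\<lambda>i. \<epsilon> * 1)"
  proof (rule gm_cong)
    fix i assume i: "i < N"
    show "\<tau> (\<tau> i) = i" using b(2)[OF i] by blast
    show "d i * d (\<tau> i) = \<epsilon> * 1" unfolding b(4)[OF i] using sq[OF i] by (simp only: mult.left_commute)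
  qed
  finally show "\<beta> * \<beta> = \<epsilon> \<cdot>\<^sub>m 1\<^sub>m N" by (simp only: gm_one gm_smult)
  show "transpose_mat \<beta> = \<epsilon> \<cdot>\<^sub>m \<beta>"
  proof -
    have "transpose_mat (gm N \<tau> d) = gm N \<tau> (\<lambda>i. d (\<tau> i))" by (rule gm_transpose) (rule b(2))
    also have "\<dots> = gm N \<tau> (\<lambda>i. \<epsilon> * d i)" by (intro gm_cong refl b(4))
    finally show ?thesis by (simp only: b(1) gm_smult)
  qed
  show "dagger \<beta> = \<epsilon> \<cdot>\<^sub>m \<beta>"
  proof -
    have "dagger (gm N \<tau> d) = gm N \<tau> (\<lambda>i. cnj (d (\<tau> i)))" by (rule gm_dagger) (rule b(2))
    also have "\<dots> = gm N \<tau> (\<lambda>i. \<epsilon> * d i)"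
    proof (intro gm_cong refl)
      fix i assume i: "i < N"
      have "cnj (d (\<tau> i)) = d (\<tau> i)" using b(2)[OF i] by (intro cn) blast
      then show "cnj (d (\<tau> i)) = \<epsilon> * d i" using b(4)[OF i] by simp
    qed
    finally show ?thesis by (simp only: b(1) gm_smult)
  qed
qed

lemma std_form_one: "std_form N (1\<^sub>m N) (\<lambda>i. i) (\<lambda>_. 1) 1"
  by (simp add: std_form_def gm_one)

text \<open>The form \<open>[[0, 1], [\<epsilon>, 0]]\<close>.\<close>

definition hyp_form :: "nat \<Rightarrow> complex \<Rightarrow> complex mat" where
  "hyp_form n \<epsilon> = gm (2 * n) (\<lambda>i. if i < n then i + n else i - n) (\<lambda>i. if i < n then 1 else \<epsilon>)"

lemma std_form_hyp:
  "\<epsilon> = 1 \<or> \<epsilon> = -1 \<Longrightarrow>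
    std_form (2 * n) (hyp_form n \<epsilon>) (\<lambda>i. if i < n then i + n else i - n) (\<lambda>i. if i < n then 1 else \<epsilon>) \<epsilon>"
  by (auto simp: std_form_def hyp_form_def)

lemma sympl_form_eq: "sympl_form n = hyp_form n (-1)"
  by (rule eq_matI) (auto simp: sympl_form_def hyp_form_def)

lemmas std_form_sympl = std_form_hyp[of "-1", simplified, folded sympl_form_eq]

section \<open>Block diagonal matrices and their isometries\<close>

lemma dsum_carrier [simp]: "a \<in> carrier_mat n n \<Longrightarrow> b \<in> carrier_mat k k \<Longrightarrow> dsum a b \<in> carrier_mat (n + k) (n + k)"
  unfolding dsum_def by (intro four_block_carrier_mat) auto

lemma dsum_index:
  assumes "a \<in> carrier_mat n n" "b \<in> carrier_mat k k" "i < n + k" "j < n + k"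
  shows "dsum a b $$ (i, j) = (if i < n \<and> j < n then a $$ (i, j) else if i \<ge> n \<and> j \<ge> n then b $$ (i - n, j - n) else 0)"
  using assms by (auto simp: dsum_def)

lemma dsum_mult:
  assumes "a \<in> carrier_mat n n" "a' \<in> carrier_mat n n" "b \<in> carrier_mat k k" "b' \<in> carrier_mat k k"
  shows "dsum a b * dsum a' b' = dsum (a * a') (b * b')"
  using assms unfolding dsum_def
  by (subst mult_four_block_mat[of _ n n _ k _ k _ _ n _ k]) (auto intro!: cong_four_block_mat)

lemma dsum_one: "dsum (1\<^sub>m n) (1\<^sub>m k) = 1\<^sub>m (n + k)"
  by (simp add: dsum_def)

lemma dsum_transpose:
  "a \<in> carrier_mat n n \<Longrightarrow> b \<in> carrier_mat k k \<Longrightarrow> transpose_mat (dsum a b) = dsum (transpose_mat a) (transpose_mat b)"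
  by (rule eq_matI) (auto simp: dsum_index[of _ n _ k] dsum_def)

lemma dsum_dagger:
  "a \<in> carrier_mat n n \<Longrightarrow> b \<in> carrier_mat k k \<Longrightarrow> dagger (dsum a b) = dsum (dagger a) (dagger b)"
  by (rule eq_matI) (auto simp: dsum_def)

lemma dsum_smult:
  "a \<in> carrier_mat n n \<Longrightarrow> b \<in> carrier_mat k k \<Longrightarrow> c \<cdot>\<^sub>m dsum a b = dsum (c \<cdot>\<^sub>m a) (c \<cdot>\<^sub>m b)"
  by (rule eq_matI) (auto simp: dsum_def)

lemma dsum_eq_iff:
  assumes "a \<in> carrier_mat n n" "a' \<in> carrier_mat n n" "b \<in> carrier_mat k k" "b' \<in> carrier_mat k k"
  shows "dsum a b = dsum a' b' \<longleftrightarrow> a = a' \<and> b = b'"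
proof
  assume e: "dsum a b = dsum a' b'"
  have "a $$ (i, j) = a' $$ (i, j)" if "i < n" "j < n" for i j
    using arg_cong[OF e, of "\<lambda>z. z $$ (i, j)"] that assms by (simp add: dsum_index[of _ n _ k])
  moreover have "b $$ (i, j) = b' $$ (i, j)" if "i < k" "j < k" for i j
    using arg_cong[OF e, of "\<lambda>z. z $$ (n + i, n + j)"] that assms by (simp add: dsum_index[of _ n _ k])
  ultimately show "a = a' \<and> b = b'" using assms by (auto intro!: eq_matI)
qed simp

lemma dsum_GL: "a \<in> GL_group n \<Longrightarrow> b \<in> GL_group k \<Longrightarrow> dsum a b \<in> GL_group (n + k)"
  using GL_group_if_right_inverse[of "dsum a b" "n + k" "dsum (minv n a) (minv k b)"]
    dsum_mult[of a n "minv n a" b k "minv k b"] GL_groupD minv_carrier minv_right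
  by (simp add: dsum_one)

lemma minv_dsum: "a \<in> GL_group n \<Longrightarrow> b \<in> GL_group k \<Longrightarrow> minv (n + k) (dsum a b) = dsum (minv n a) (minv k b)"
  using minv_eq[of "dsum a b" "n + k" "dsum (minv n a) (minv k b)"]
    dsum_mult[of a n "minv n a" b k "minv k b"] GL_groupD minv_carrier minv_right
  by (simp add: dsum_one)

lemma dsum_isometries_iff:
  assumes "a \<in> carrier_mat n n" "b \<in> carrier_mat k k" "\<beta> \<in> GL_group n" "\<gamma> \<in> GL_group k"
  shows "dsum a b \<in> isometries (n + k) (dsum \<beta> \<gamma>) (dsum \<beta> \<gamma>) \<longleftrightarrow> a \<in> isometries n \<beta> \<beta> \<and> b \<in> isometries k \<gamma> \<gamma>"
proof -
  note c = GL_groupD[OF assms(3)] GL_groupD[OF assms(4)]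
  have e: "transpose_mat (dsum a b) * dsum \<beta> \<gamma> * dsum a b = dsum (transpose_mat a * \<beta> * a) (transpose_mat b * \<gamma> * b)"
    using assms c by (simp add: dsum_transpose[of _ n _ k] dsum_mult[of _ n _ _ k] sq_mult[of _ n] sq_mult[of _ k])
  have i: "dsum (transpose_mat a * \<beta> * a) (transpose_mat b * \<gamma> * b) = dsum \<beta> \<gamma> \<longleftrightarrow>
    transpose_mat a * \<beta> * a = \<beta> \<and> transpose_mat b * \<gamma> * b = \<gamma>"
    using assms c by (intro dsum_eq_iff[of _ n _ _ k] sq_mult) auto
  have "dsum a b \<in> isometries (n + k) (dsum \<beta> \<gamma>) (dsum \<beta> \<gamma>) \<longleftrightarrow> dsum (transpose_mat a * \<beta> * a) (transpose_mat b * \<gamma> * b) = dsum \<beta> \<gamma>"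
    using isometries_if_nondegenerate[of "dsum a b" "n + k" "dsum \<beta> \<gamma>" "dsum \<beta> \<gamma>"] isometriesD(3)[of "dsum a b" "n + k" "dsum \<beta> \<gamma>" "dsum \<beta> \<gamma>"]
      e dsum_GL[OF assms(3,4)] assms c by auto
  moreover have "a \<in> isometries n \<beta> \<beta> \<longleftrightarrow> transpose_mat a * \<beta> * a = \<beta>"
    using isometries_if_nondegenerate[of a n \<beta> \<beta>] isometriesD(3)[of a n \<beta> \<beta>] assms c by auto
  moreover have "b \<in> isometries k \<gamma> \<gamma> \<longleftrightarrow> transpose_mat b * \<gamma> * b = \<gamma>"
    using isometries_if_nondegenerate[of b k \<gamma> \<gamma>] isometriesD(3)[of b k \<gamma> \<gamma>] assms c by auto
  ultimately show ?thesis using i by simp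
qed

lemma std_form_dsum:
  assumes "std_form n \<beta> \<tau> d \<epsilon>" "std_form k \<gamma> \<upsilon> e \<epsilon>"
  shows "std_form (n + k) (dsum \<beta> \<gamma>) (\<lambda>i. if i < n then \<tau> i else n + \<upsilon> (i - n)) (\<lambda>i. if i < n then d i else e (i - n)) \<epsilon>"
proof -
  note b = std_formD[OF assms(1)] and g = std_formD[OF assms(2)]
  have "dsum \<beta> \<gamma> = gm (n + k) (\<lambda>i. if i < n then \<tau> i else n + \<upsilon> (i - n)) (\<lambda>i. if i < n then d i else e (i - n))"
    unfolding b(1) g(1)
  proof (rule eq_matI)
    fix i j assume "i < dim_row (gm (n + k) (\<lambda>i. if i < n then \<tau> i else n + \<upsilon> (i - n)) (\<lambda>i. if i < n then d i else e (i - n)))"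
      "j < dim_col (gm (n + k) (\<lambda>i. if i < n then \<tau> i else n + \<upsilon> (i - n)) (\<lambda>i. if i < n then d i else e (i - n)))"
    then have ij: "i < n + k" "j < n + k" by simp_all
    show "dsum (gm n \<tau> d) (gm k \<upsilon> e) $$ (i, j) =
      gm (n + k) (\<lambda>i. if i < n then \<tau> i else n + \<upsilon> (i - n)) (\<lambda>i. if i < n then d i else e (i - n)) $$ (i, j)"
      using ij b(2)[of i] g(2)[of "i - n"] by (auto simp: dsum_index[OF gm_carrier gm_carrier ij])
  qed (auto simp: dsum_def)
  moreover have "\<forall>i<n + k. (if i < n then \<tau> i else n + \<upsilon> (i - n)) < n + k"
    using b(2) g(2) by (auto simp: less_diff_conv2 trans_less_add1)
  moreover have "i - n < k" if "i < n + k" "\<not> i < n" for i using that by auto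
  ultimately show ?thesis
    unfolding std_form_def
  proof (intro conjI allI impI)
    fix i assume i: "i < n + k"
    let ?t = "\<lambda>i. if i < n then \<tau> i else n + \<upsilon> (i - n)" and ?d = "\<lambda>i. if i < n then d i else e (i - n)"
    have "?t (?t i) = i \<and> (?d i = 1 \<or> ?d i = -1) \<and> ?d (?t i) = \<epsilon> * ?d i"
    proof (cases "i < n")
      case True
      then show ?thesis using b(2,3,4)[OF True] by simp
    next
      case False
      then have j: "i - n < k" using i by simp
      show ?thesis using False b(2)[of i] g(2,3,4)[OF j] by simp
    qed
    then show "?t (?t i) = i" "?d i \<in> {1, -1}" "?d (?t i) = \<epsilon> * ?d i" by simp_all
  qed (use b(6) in simp_all)
qed

section \<open>Generators of matrix algebras\<close>

text \<open>For a matrix group on a nonzero space this amounts to irreducibility, by Burnside's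
  theorem. The formulation with subalgebras is the one that applies to commutants.\<close>

definition generating :: "nat \<Rightarrow> complex mat set \<Rightarrow> bool" where
  "generating n K \<longleftrightarrow> (\<forall>S. subalgebra n S \<and> K \<subseteq> S \<longrightarrow> carrier_mat n n \<subseteq> S)"

lemma generatingD: "generating n K \<Longrightarrow> subalgebra n S \<Longrightarrow> K \<subseteq> S \<Longrightarrow> a \<in> carrier_mat n n \<Longrightarrow> a \<in> S"
  unfolding generating_def by blast

lemma generating_mono: "generating n K \<Longrightarrow> K \<subseteq> K' \<Longrightarrow> generating n K'"
  unfolding generating_def by blast

lemma subalgebra_full:
  assumes S: "subalgebra n S" and eu: "\<And>p q. p < n \<Longrightarrow> q < n \<Longrightarrow> eu n p q \<in> S"
  shows "carrier_mat n n \<subseteq> S"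
proof
  fix a :: "complex mat" assume a: "a \<in> carrier_mat n n"
  note s = subalgebraD[OF S]
  have z: "0\<^sub>m n n \<in> S" using s(5)[OF s(2), of 0] smult_zero[OF one_carrier_mat, of n] by simp
  define r where "r p t = mat n n (\<lambda>(i, j). if i = p \<and> j < t then a $$ (i, j) else 0)" for p t
  define h where "h t = mat n n (\<lambda>(i, j). if i < t then a $$ (i, j) else 0)" for t
  have r: "r p t \<in> S" if "p < n" "t \<le> n" for p t
    using that(2)
  proof (induction t)
    case 0
    have "r p 0 = 0\<^sub>m n n" by (rule eq_matI) (auto simp: r_def)
    then show ?case using z by simp
  next
    case (Suc t)
    have "r p (Suc t) = r p t + a $$ (p, t) \<cdot>\<^sub>m eu n p t"
      by (rule eq_matI) (use Suc.prems in \<open>auto simp: r_def less_Suc_eq\<close>)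
    then show ?case using Suc s(3,5) eu that(1) by simp
  qed
  have "h t \<in> S" if "t \<le> n" for t
    using that
  proof (induction t)
    case 0
    have "h 0 = 0\<^sub>m n n" by (rule eq_matI) (auto simp: h_def)
    then show ?case using z by simp
  next
    case (Suc t)
    have "h (Suc t) = h t + r t n" by (rule eq_matI) (auto simp: h_def r_def)
    then show ?case using Suc s(3) r by simp
  qed
  moreover have "h n = a" by (rule eq_matI) (use a in \<open>auto simp: h_def\<close>)
  ultimately show "a \<in> S" by (metis order_refl)
qed

text \<open>Sign changes and transpositions suffice: half the difference between the identity and
  the reflection in coordinate \<open>p\<close> is the matrix unit at \<open>(p, p)\<close>, and
  multiplying by the transposition of \<open>p\<close> and \<open>q\<close> moves it to
  \<open>(p, q)\<close>.\<close>

lemma generating_O: "generating n (O_group n)"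
  unfolding generating_def
proof (intro allI impI, elim conjE, rule subalgebra_full, assumption)
  fix S p q assume S: "subalgebra n S" and K: "O_group n \<subseteq> S" and pq: "p < n" "q < n"
  note s = subalgebraD[OF S]
  let ?D = "gm n (\<lambda>i. i) (\<lambda>i. if i = p then -1 else 1)"
  let ?T = "gm n (\<lambda>i. if i = p then q else if i = q then p else i) (\<lambda>_. 1)"
  have "?D \<in> O_group n" unfolding O_group_def gm_one by (rule gm_isometry) auto
  then have "?D \<in> S" by (rule subsetD[OF K])
  then have "(1 / 2) \<cdot>\<^sub>m (1\<^sub>m n + (-1) \<cdot>\<^sub>m ?D) \<in> S" by (intro s(3,5) s(2))
  moreover have "(1 / 2) \<cdot>\<^sub>m (1\<^sub>m n + (-1) \<cdot>\<^sub>m ?D) = eu n p p" by (rule eq_matI) auto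
  ultimately have e: "eu n p p \<in> S" by simp
  have "?T \<in> O_group n" unfolding O_group_def gm_one by (rule gm_isometry) (use pq in auto)
  then have "eu n p p * ?T \<in> S" by (intro s(4)[OF e] subsetD[OF K])
  moreover have "eu n p p * ?T = eu n p q"
    by (rule eq_matI) (use pq in \<open>auto simp: eu_mult_index[OF gm_carrier] simp del: index_mult_mat(1)\<close>)
  ultimately show "eu n p q \<in> S" by simp
qed

lemma generating_GL: "generating n (GL_group n)"
  by (rule generating_mono[OF generating_O]) (auto simp: O_group_def isometries_def)

text \<open>The diagonal units of the upper left quarter come from torus elements, the other units
  there from permutations acting on both halves at once. The form matrix, itself an element of the
  group, moves them into the remaining quarters.\<close>

lemma generating_Sp: "generating (2 * k) (Sp_group k)"
  unfolding generating_def
proof (intro allI impI, elim conjE, rule subalgebra_full, assumption)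
  let ?N = "2 * k"
  let ?\<tau> = "\<lambda>i. if i < k then i + k else i - k" and ?d = "\<lambda>i. if i < k then 1 else (- 1 :: complex)"
  have J: "sympl_form k = gm ?N ?\<tau> ?d" by (simp add: sympl_form_eq hyp_form_def)
  fix S p q assume S: "subalgebra ?N S" and K: "Sp_group k \<subseteq> S" and pq: "p < ?N" "q < ?N"
  note s = subalgebraD[OF S]
  have "sympl_form k \<in> Sp_group k" unfolding Sp_group_def J by (rule gm_isometry) auto
  then have JS: "sympl_form k \<in> S" using K by blast
  have diag: "eu ?N p p \<in> S" if p: "p < k" for p
  proof -
    \<comment> \<open>Eigenvalues 2 at \<open>p\<close>, 1/2 at its partner \<open>p + k\<close>,
      and 1 elsewhere. The quadratic expression below is the interpolation polynomial (2/3)(x - 1)(x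
      - 1/2), with value 1 at 2 and 0 at the other two.\<close>
    let ?D = "gm ?N (\<lambda>i. i) (\<lambda>i. if i = p then 2 else if i = p + k then 1 / 2 else 1)"
    have "?D \<in> Sp_group k" unfolding Sp_group_def J by (rule gm_isometry) (use p in auto)
    then have D: "?D \<in> S" by (rule subsetD[OF K])
    have "(2 / 3) \<cdot>\<^sub>m (?D * ?D + ((- 3 / 2) \<cdot>\<^sub>m ?D + (1 / 2) \<cdot>\<^sub>m 1\<^sub>m ?N)) \<in> S"
      by (intro s(3,4,5) D s(2))
    moreover have "?D * ?D = gm ?N (\<lambda>i. i) (\<lambda>i. if i = p then 4 else if i = p + k then 1 / 4 else 1)"
      using p by (subst gm_mult) (auto intro!: gm_cong)
    moreover have "(2 / 3) \<cdot>\<^sub>m (gm ?N (\<lambda>i. i) (\<lambda>i. if i = p then 4 else if i = p + k then 1 / 4 else 1) +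
      ((- 3 / 2) \<cdot>\<^sub>m ?D + (1 / 2) \<cdot>\<^sub>m 1\<^sub>m ?N)) = eu ?N p p"
      unfolding gm_one gm_smult gm_add eu_gm using p by (intro gm_cong) auto
    ultimately show ?thesis by simp
  qed
  have low: "eu ?N p q \<in> S" if pq: "p < k" "q < k" for p q
  proof -
    let ?T = "gm ?N (\<lambda>i. if i = p then q else if i = q then p else if i = p + k then q + k else if i = q + k then p + k else i) (\<lambda>_. 1)"
    have "?T \<in> Sp_group k" unfolding Sp_group_def J by (rule gm_isometry) (use pq in auto)
    then have "eu ?N p p * ?T \<in> S" by (intro s(4)[OF diag[OF pq(1)]] subsetD[OF K])
    moreover have "eu ?N p p * ?T = eu ?N p q"
      by (rule eq_matI) (use pq in \<open>auto simp: eu_mult_index[OF gm_carrier] simp del: index_mult_mat(1)\<close>)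
    ultimately show ?thesis by simp
  qed
  have right: "eu ?N p (q + k) \<in> S" if "p < ?N" "q < k" "eu ?N p q \<in> S" for p q
  proof -
    have "eu ?N p q * sympl_form k = eu ?N p (q + k)" unfolding J
      by (rule eq_matI) (use that in \<open>auto simp: eu_mult_index[OF gm_carrier] simp del: index_mult_mat(1)\<close>)
    then show ?thesis using s(4)[OF that(3) JS] by simp
  qed
  have left: "eu ?N (p + k) q \<in> S" if "p < k" "q < ?N" "eu ?N p q \<in> S" for p q
  proof -
    have "(-1) \<cdot>\<^sub>m (sympl_form k * eu ?N p q) = eu ?N (p + k) q" unfolding J
    proof (rule eq_matI)
      fix i j assume "i < dim_row (eu ?N (p + k) q)" "j < dim_col (eu ?N (p + k) q)"
      then have ij: "i < ?N" "j < ?N" by simp_all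
      then have t: "?\<tau> i < ?N" by auto
      have "((-1) \<cdot>\<^sub>m (gm ?N ?\<tau> ?d * eu ?N p q)) $$ (i, j) = - (?d i * eu ?N p q $$ (?\<tau> i, j))"
        using gm_mult_index[where \<sigma> = ?\<tau> and c = ?d, OF eu_carrier ij t, of p q] ij by (simp del: index_mult_mat(1))
      also have "\<dots> = eu ?N (p + k) q $$ (i, j)" using that ij t by auto
      finally show "((-1) \<cdot>\<^sub>m (gm ?N ?\<tau> ?d * eu ?N p q)) $$ (i, j) = eu ?N (p + k) q $$ (i, j)" .
    qed simp_all
    then show ?thesis using s(5)[OF s(4)[OF JS that(3)], of "-1"] by simp
  qed
  define p' where "p' = (if p < k then p else p - k)"
  define q' where "q' = (if q < k then q else q - k)"
  have p'q': "p' < k" "q' < k" using pq by (auto simp: p'_def q'_def)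
  have 1: "eu ?N p' q' \<in> S" "eu ?N p' (q' + k) \<in> S" using low[OF p'q'] right[of p' q'] p'q' by auto
  have 2: "eu ?N p' q \<in> S" using 1 by (cases "q < k") (auto simp: q'_def)
  show "eu ?N p q \<in> S" using 2 left[OF p'q'(1) pq(2) 2] by (cases "p < k") (auto simp: p'_def)
qed

lemma conj_subalgebra:
  assumes "Q \<in> GL_group n" "subalgebra n S"
  shows "subalgebra n {a \<in> carrier_mat n n. conj_by Q a \<in> S}"
  unfolding subalgebra_def
proof (intro conjI ballI allI)
  note s = subalgebraD[OF assms(2)]
  note q = GL_groupD[OF assms(1)] minv_carrier[OF assms(1)]
  fix a b assume a: "a \<in> {a \<in> carrier_mat n n. conj_by Q a \<in> S}" and b: "b \<in> {a \<in> carrier_mat n n. conj_by Q a \<in> S}"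
  then have c: "a \<in> carrier_mat n n" "b \<in> carrier_mat n n" by auto
  have "conj_by Q (a + b) = conj_by Q a + conj_by Q b"
    unfolding conj_by_eq[OF assms(1)] mult_add_distrib_mat[OF q(1) c]
    using q c by (intro add_mult_distrib_mat) auto
  then show "a + b \<in> {a \<in> carrier_mat n n. conj_by Q a \<in> S}" using a b s(3) by simp
  show "a * b \<in> {a \<in> carrier_mat n n. conj_by Q a \<in> S}"
    using a b s(4) conj_by_mult[OF assms(1) c] c by (simp add: sq_mult[of _ n])
next
  note s = subalgebraD[OF assms(2)]
  note q = GL_groupD[OF assms(1)] minv_carrier[OF assms(1)]
  fix a c assume a: "a \<in> {a \<in> carrier_mat n n. conj_by Q a \<in> S}"
  have "conj_by Q (c \<cdot>\<^sub>m a) = c \<cdot>\<^sub>m conj_by Q a"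
    unfolding conj_by_eq[OF assms(1)] using a q mult_smult_distrib[of Q n n a n c] mult_smult_assoc_mat[of "Q * a" n n "minv n Q" n c]
    by (simp add: sq_mult[of _ n])
  then show "c \<cdot>\<^sub>m a \<in> {a \<in> carrier_mat n n. conj_by Q a \<in> S}" using a s(5) by simp
qed (use subalgebraD(2)[OF assms(2)] conj_by_one[OF assms(1)] in auto)

lemma generating_conj:
  assumes Q: "Q \<in> GL_group n" and K: "generating n K" "K \<subseteq> carrier_mat n n"
  shows "generating n (conj_by Q ` K)"
  unfolding generating_def
proof (intro allI impI subsetI, elim conjE)
  fix S and a :: "complex mat" assume S: "subalgebra n S" "conj_by Q ` K \<subseteq> S" and a: "a \<in> carrier_mat n n"
  note Q' = minv_GL[OF Q]
  have "K \<subseteq> {a \<in> carrier_mat n n. conj_by Q a \<in> S}" using S(2) K(2) by blast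
  then have "conj_by (minv n Q) a \<in> {a \<in> carrier_mat n n. conj_by Q a \<in> S}"
    using generatingD[OF K(1) conj_subalgebra[OF Q S(1)]] conj_by_carrier[OF Q' a] by blast
  then show "a \<in> S" using conj_by_minv(1)[OF Q a] by simp
qed

section \<open>Diagonal blocks\<close>

lemma mult_diag_index:
  assumes "A \<in> carrier_mat N N" "i < N" "j < N"
  shows "(A * gm N (\<lambda>i. i) c) $$ (i, j) = A $$ (i, j) * c j"
proof -
  have "(A * gm N (\<lambda>i. i) c) $$ (i, j) = (\<Sum>k\<in>{0..<N}. A $$ (i, k) * gm N (\<lambda>i. i) c $$ (k, j))"
    using assms by (simp add: scalar_prod_def)
  also have "\<dots> = (\<Sum>k\<in>{0..<N}. if k = j then A $$ (i, j) * c j else 0)"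
    using assms by (intro sum.cong) auto
  finally show ?thesis using assms by simp
qed

lemma commute_diag_zero:
  assumes "A \<in> carrier_mat N N" "A * gm N (\<lambda>i. i) c = gm N (\<lambda>i. i) c * A" "i < N" "j < N" "c i \<noteq> c j"
  shows "A $$ (i, j) = 0"
proof -
  have "A $$ (i, j) * c j = (A * gm N (\<lambda>i. i) c) $$ (i, j)" using mult_diag_index[OF assms(1,3,4)] by (rule sym)
  also have "\<dots> = (gm N (\<lambda>i. i) c * A) $$ (i, j)" by (rule arg_cong[OF assms(2)])
  also have "\<dots> = c i * A $$ (i, j)" by (rule gm_mult_index[where \<sigma> = "\<lambda>i. i", OF assms(1,3,4,3)])
  finally have "A $$ (i, j) * c j = A $$ (i, j) * c i" by (simp only: mult.commute)
  then show ?thesis using assms(5) by simp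
qed

lemma diag_poly:
  assumes S: "subalgebra N S" and D: "gm N (\<lambda>i. i) c \<in> S"
  shows "gm N (\<lambda>i. i) (\<lambda>i. poly p (c i)) \<in> S"
proof (induction p)
  case 0
  have "0 \<cdot>\<^sub>m 1\<^sub>m N \<in> S" by (intro subalgebraD(2,5)[OF S])
  then show ?case by (simp add: gm_one gm_smult)
next
  case (pCons a p)
  have "a \<cdot>\<^sub>m 1\<^sub>m N + gm N (\<lambda>i. i) c * gm N (\<lambda>i. i) (\<lambda>i. poly p (c i)) \<in> S"
    by (intro subalgebraD(2-5)[OF S] D pCons)
  then show ?case by (simp add: gm_one gm_smult gm_mult gm_add)
qed

text \<open>Applied below with interpolation polynomials, which produce the projections onto
  eigenspaces from one diagonal element with sufficiently distinct eigenvalues.\<close>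

lemma diag_in_subalgebra:
  assumes S: "subalgebra N S" and D: "gm N (\<lambda>i. i) c \<in> S" and p: "\<And>i. i < N \<Longrightarrow> poly p (c i) = e i"
  shows "gm N (\<lambda>i. i) e \<in> S"
proof -
  have "gm N (\<lambda>i. i) (\<lambda>i. poly p (c i)) = gm N (\<lambda>i. i) e" using p by (intro gm_cong) auto
  then show ?thesis using diag_poly[OF S D, of p] by simp
qed

definition proj :: "nat \<Rightarrow> nat \<Rightarrow> nat \<Rightarrow> complex mat" where
  "proj N r n = gm N (\<lambda>i. i) (\<lambda>i. if r \<le> i \<and> i < r + n then 1 else 0)"

definition emb :: "nat \<Rightarrow> nat \<Rightarrow> nat \<Rightarrow> complex mat \<Rightarrow> complex mat" where
  "emb N r n a = mat N N (\<lambda>(i, j). if r \<le> i \<and> i < r + n \<and> r \<le> j \<and> j < r + n then a $$ (i - r, j - r) else 0)"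

lemma emb_carrier [simp]: "emb N r n a \<in> carrier_mat N N" by (simp add: emb_def)

lemma emb_mult:
  assumes "r + n \<le> N" "a \<in> carrier_mat n n" "b \<in> carrier_mat n n"
  shows "emb N r n (a * b) = emb N r n a * emb N r n b"
proof (rule eq_matI)
  fix i j assume "i < dim_row (emb N r n a * emb N r n b)" "j < dim_col (emb N r n a * emb N r n b)"
  then have ij: "i < N" "j < N" by (simp_all add: emb_def)
  let ?g = "\<lambda>k. emb N r n a $$ (i, k) * emb N r n b $$ (k, j)"
  have "(emb N r n a * emb N r n b) $$ (i, j) = (\<Sum>k\<in>{0..<N}. ?g k)"
    using ij by (simp add: scalar_prod_def emb_def)
  also have "\<dots> = (\<Sum>k\<in>{r..<r + n}. ?g k)"
    using assms(1) ij by (intro sum.mono_neutral_right) (auto simp: emb_def)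
  also have "\<dots> = (\<Sum>k\<in>{0..<n}. ?g (k + r))"
    using sum.shift_bounds_nat_ivl[of ?g 0 r n] by (simp add: add.commute)
  also have "\<dots> = emb N r n (a * b) $$ (i, j)"
  proof (cases "r \<le> i \<and> i < r + n \<and> r \<le> j \<and> j < r + n")
    case True
    then have "i - r < n" "j - r < n" by auto
    then have "emb N r n (a * b) $$ (i, j) = (\<Sum>k\<in>{0..<n}. a $$ (i - r, k) * b $$ (k, j - r))"
      using True ij assms by (simp add: emb_def scalar_prod_def)
    moreover have "?g (k + r) = a $$ (i - r, k) * b $$ (k, j - r)" if "k < n" for k
      using True ij assms that by (simp add: emb_def)
    ultimately show ?thesis by simp
  next
    case False
    then have "emb N r n (a * b) $$ (i, j) = 0" using ij unfolding emb_def by simp blast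
    moreover have "?g (k + r) = 0" if "k < n" for k
      using False ij assms that by (auto simp: emb_def)
    then have "(\<Sum>k\<in>{0..<n}. ?g (k + r)) = 0" by (intro sum.neutral) simp
    ultimately show ?thesis by (simp only:)
  qed
  finally show "emb N r n (a * b) $$ (i, j) = (emb N r n a * emb N r n b) $$ (i, j)" by simp
qed (auto simp: emb_def)

text \<open>The embedding of a diagonal block is multiplicative but sends the identity to
  \<open>proj N r n\<close>, which therefore has to lie in \<open>S\<close> for the preimage to be
  unital.\<close>

lemma emb_subalgebra:
  assumes S: "subalgebra N S" and n: "r + n \<le> N" and e: "proj N r n \<in> S"
  shows "subalgebra n {a \<in> carrier_mat n n. emb N r n a \<in> S}"
  unfolding subalgebra_def
proof (intro conjI ballI allI)
  note s = subalgebraD[OF S]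
  have "emb N r n (1\<^sub>m n) = proj N r n" by (rule eq_matI) (auto simp: emb_def proj_def)
  then show "1\<^sub>m n \<in> {a \<in> carrier_mat n n. emb N r n a \<in> S}" using e by simp
  fix a assume a: "a \<in> {a \<in> carrier_mat n n. emb N r n a \<in> S}"
  then have ac: "a \<in> carrier_mat n n" by simp
  have "emb N r n (c \<cdot>\<^sub>m a) = c \<cdot>\<^sub>m emb N r n a" for c
    by (rule eq_matI) (use ac in \<open>auto simp: emb_def\<close>)
  then show "c \<cdot>\<^sub>m a \<in> {a \<in> carrier_mat n n. emb N r n a \<in> S}" for c using a s(5) by simp
  fix b assume b: "b \<in> {a \<in> carrier_mat n n. emb N r n a \<in> S}"
  then have bc: "b \<in> carrier_mat n n" by simp
  have "emb N r n (a + b) = emb N r n a + emb N r n b"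
    by (rule eq_matI) (use ac bc in \<open>auto simp: emb_def\<close>)
  then show "a + b \<in> {a \<in> carrier_mat n n. emb N r n a \<in> S}" using a b s(3) by simp
  show "a * b \<in> {a \<in> carrier_mat n n. emb N r n a \<in> S}"
    using a b s(4) emb_mult[OF n ac bc] by (simp add: sq_mult[of _ n])
qed auto

text \<open>Cutting \<open>x\<close> by the projection on both sides leaves only its block
  \<open>g\<close>, whatever the other blocks are. The blocks whose embedding lies in
  \<open>S\<close> form a subalgebra containing \<open>K\<close>, hence all matrices of that
  size.\<close>

lemma eu_in_subalgebra_if_block:
  assumes S: "subalgebra N S" and n: "r + n \<le> N" and e: "proj N r n \<in> S" and K: "generating n K" "K \<subseteq> carrier_mat n n"
    and x: "\<And>g. g \<in> K \<Longrightarrow> \<exists>x\<in>S. \<forall>i<n. \<forall>j<n. x $$ (r + i, r + j) = g $$ (i, j)"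
    and pq: "r \<le> p" "p < r + n" "r \<le> q" "q < r + n"
  shows "eu N p q \<in> S"
proof -
  note s = subalgebraD[OF S]
  have "g \<in> {a \<in> carrier_mat n n. emb N r n a \<in> S}" if g: "g \<in> K" for g
  proof -
    obtain x where x: "x \<in> S" "\<forall>i<n. \<forall>j<n. x $$ (r + i, r + j) = g $$ (i, j)" using x[OF g] by blast
    have xc: "x \<in> carrier_mat N N" using s(1)[OF x(1)] .
    have "emb N r n g = proj N r n * (x * proj N r n)"
    proof (rule eq_matI)
      fix i j assume "i < dim_row (proj N r n * (x * proj N r n))" "j < dim_col (proj N r n * (x * proj N r n))"
      then have ij: "i < N" "j < N" by (auto simp: proj_def)
      have "(proj N r n * (x * proj N r n)) $$ (i, j) =
        (if r \<le> i \<and> i < r + n then 1 else 0) * (x $$ (i, j) * (if r \<le> j \<and> j < r + n then 1 else 0))"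
        unfolding proj_def gm_mult_index[where \<sigma> = "\<lambda>i. i", OF sq_mult[OF xc gm_carrier] ij ij(1)] mult_diag_index[OF xc ij] ..
      also have "\<dots> = emb N r n g $$ (i, j)"
        using ij x(2)[rule_format, of "i - r" "j - r"] by (auto simp: emb_def)
      finally show "emb N r n g $$ (i, j) = (proj N r n * (x * proj N r n)) $$ (i, j)" by simp
    qed (auto simp: emb_def proj_def)
    then show ?thesis using g K(2) s(4)[OF e s(4)[OF x(1) e]] by auto
  qed
  then have "eu n (p - r) (q - r) \<in> {a \<in> carrier_mat n n. emb N r n a \<in> S}"
    using generatingD[OF K(1) emb_subalgebra[OF S n e]] eu_carrier by blast
  moreover have "emb N r n (eu n (p - r) (q - r)) = eu N p q"
    by (rule eq_matI) (use pq n in \<open>auto simp: emb_def\<close>)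
  ultimately show ?thesis by simp
qed

section \<open>Off-diagonal blocks\<close>

definition off :: "complex mat \<Rightarrow> complex mat \<Rightarrow> complex mat" where
  "off a b = four_block_mat (0\<^sub>m (dim_row a) (dim_col b)) a b (0\<^sub>m (dim_row b) (dim_col a))"

lemma off_carrier [simp]: "a \<in> carrier_mat n n \<Longrightarrow> b \<in> carrier_mat n n \<Longrightarrow> off a b \<in> carrier_mat (n + n) (n + n)"
  unfolding off_def by (intro four_block_carrier_mat) auto

lemma off_transpose: "a \<in> carrier_mat n n \<Longrightarrow> b \<in> carrier_mat n n \<Longrightarrow> transpose_mat (off a b) = off (transpose_mat b) (transpose_mat a)"
  by (rule eq_matI) (auto simp: off_def)

lemma off_mult:
  assumes "a \<in> carrier_mat n n" "b \<in> carrier_mat n n" "c \<in> carrier_mat n n" "d \<in> carrier_mat n n"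
  shows "dsum a b * off c d = off (a * c) (b * d)" "off c d * dsum a b = off (c * b) (d * a)"
    "off a b * off c d = dsum (a * d) (b * c)"
  using assms unfolding dsum_def off_def
  by (subst mult_four_block_mat[of _ n n _ n _ n _ _ n _ n]; auto intro!: cong_four_block_mat)+

lemma off_eq_iff:
  assumes "a \<in> carrier_mat n n" "a' \<in> carrier_mat n n" "b \<in> carrier_mat n n" "b' \<in> carrier_mat n n"
  shows "off a b = off a' b' \<longleftrightarrow> a = a' \<and> b = b'"
proof
  assume e: "off a b = off a' b'"
  have "a $$ (i, j) = a' $$ (i, j)" if "i < n" "j < n" for i j
    using arg_cong[OF e, of "\<lambda>z. z $$ (i, n + j)"] that assms by (simp add: off_def)
  moreover have "b $$ (i, j) = b' $$ (i, j)" if "i < n" "j < n" for i j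
    using arg_cong[OF e, of "\<lambda>z. z $$ (n + i, j)"] that assms by (simp add: off_def)
  ultimately show "a = a' \<and> b = b'" using assms by (auto intro!: eq_matI)
qed simp

lemma hyp_form_off: "hyp_form n \<epsilon> = off (1\<^sub>m n) (\<epsilon> \<cdot>\<^sub>m 1\<^sub>m n)"
  by (rule eq_matI) (auto simp: hyp_form_def off_def)

text \<open>The hyperbolic form pairs the first half with the second, so the condition splits into
  two off-diagonal equations that are transposes of each other, and the sign
  \<open>\<epsilon>\<close> cancels. A block diagonal isometry is thus a matrix together with its
  contragredient.\<close>

lemma dsum_isometry_hyp_iff:
  assumes a: "a \<in> carrier_mat n n" and b: "b \<in> carrier_mat n n" and \<epsilon>: "\<epsilon> = 1 \<or> \<epsilon> = -1"
  shows "dsum a b \<in> isometries (n + n) (hyp_form n \<epsilon>) (hyp_form n \<epsilon>) \<longleftrightarrow> transpose_mat a * b = 1\<^sub>m n"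
proof -
  have g: "hyp_form n \<epsilon> \<in> GL_group (n + n)" "hyp_form n \<epsilon> \<in> carrier_mat (n + n) (n + n)"
    using std_form_props(1,2)[OF std_form_hyp[OF \<epsilon>]] by (simp_all add: mult_2)
  have e: "transpose_mat (dsum a b) * hyp_form n \<epsilon> * dsum a b = off (transpose_mat a * b) (\<epsilon> \<cdot>\<^sub>m (transpose_mat b * a))"
    unfolding hyp_form_off using a b
    by (simp add: dsum_transpose[of _ n _ n] off_mult[of _ n] mult_smult_distrib[of _ n n _ n] mult_smult_assoc_mat[of _ n n _ n])
  have "dsum a b \<in> isometries (n + n) (hyp_form n \<epsilon>) (hyp_form n \<epsilon>) \<longleftrightarrow>
    off (transpose_mat a * b) (\<epsilon> \<cdot>\<^sub>m (transpose_mat b * a)) = off (1\<^sub>m n) (\<epsilon> \<cdot>\<^sub>m 1\<^sub>m n)"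
    using isometries_if_nondegenerate[OF dsum_carrier[OF a b] g] isometriesD(3)[of "dsum a b" "n + n" "hyp_form n \<epsilon>" "hyp_form n \<epsilon>"] e
    unfolding hyp_form_off by auto
  also have "\<dots> \<longleftrightarrow> transpose_mat a * b = 1\<^sub>m n \<and> transpose_mat b * a = 1\<^sub>m n"
  proof -
    have "\<epsilon> \<noteq> 0" using \<epsilon> by auto
    moreover have "transpose_mat a * b \<in> carrier_mat n n" "transpose_mat b * a \<in> carrier_mat n n" using a b by auto
    ultimately show ?thesis by (simp add: off_eq_iff[of _ n] smult_eq_iff)
  qed
  also have "\<dots> \<longleftrightarrow> transpose_mat a * b = 1\<^sub>m n"
  proof -
    have "transpose_mat (transpose_mat a * b) = transpose_mat b * a" using a b by (simp add: transpose_mult[of _ n n _ n])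
    then show ?thesis by (metis transpose_one)
  qed
  finally show ?thesis .
qed

lemma plus_dual_eq: "g \<in> GL_group n \<Longrightarrow> plus_dual g = dsum g (transpose_mat (minv n g))"
  using GL_groupD[of g n] by (simp add: plus_dual_def)

lemma plus_dual_carrier: "g \<in> GL_group n \<Longrightarrow> plus_dual g \<in> carrier_mat (n + n) (n + n)"
  by (simp add: plus_dual_eq GL_groupD minv_carrier)

lemma plus_dual_mult:
  assumes "g \<in> GL_group n" "h \<in> GL_group n"
  shows "plus_dual (g * h) = plus_dual g * plus_dual h"
  using assms GL_groupD[OF assms(1)] GL_groupD[OF assms(2)] minv_carrier[OF assms(1)] minv_carrier[OF assms(2)]
  by (simp add: plus_dual_eq[of _ n] GL_group_mult minv_mult dsum_mult[of _ n _ _ n] transpose_mult[of _ n n _ n])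

lemma plus_dual_isometry:
  assumes "g \<in> GL_group n" "\<epsilon> = 1 \<or> \<epsilon> = -1"
  shows "plus_dual g \<in> isometries (n + n) (hyp_form n \<epsilon>) (hyp_form n \<epsilon>)"
proof -
  have "transpose_mat g * transpose_mat (minv n g) = transpose_mat (minv n g * g)"
    using GL_groupD[OF assms(1)] minv_carrier[OF assms(1)] by (simp add: transpose_mult[of _ n n _ n])
  then show ?thesis
    unfolding plus_dual_eq[OF assms(1)] using assms GL_groupD[OF assms(1)] minv_carrier[OF assms(1)]
    by (simp add: dsum_isometry_hyp_iff minv_left)
qed

lemma plus_dual_if_dsum_isometry:
  assumes "a \<in> carrier_mat n n" "b \<in> carrier_mat n n" "\<epsilon> = 1 \<or> \<epsilon> = -1"
    "dsum a b \<in> isometries (n + n) (hyp_form n \<epsilon>) (hyp_form n \<epsilon>)"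
  shows "a \<in> GL_group n" "dsum a b = plus_dual a"
proof -
  have e: "transpose_mat a * b = 1\<^sub>m n" using assms dsum_isometry_hyp_iff by blast
  then have ta: "transpose_mat a \<in> GL_group n" using assms GL_group_if_right_inverse[of "transpose_mat a" n b] by simp
  show a: "a \<in> GL_group n" using transpose_GL[OF ta] by simp
  have "minv n (transpose_mat a) = b" using assms e by (intro minv_eq) auto
  then show "dsum a b = plus_dual a" unfolding plus_dual_eq[OF a] using minv_transpose[OF a] by simp
qed

lemma dagger_plus_dual:
  assumes "g \<in> GL_group n"
  shows "dagger (plus_dual g) = plus_dual (dagger g)"
  unfolding plus_dual_eq[OF assms] plus_dual_eq[OF dagger_GL[OF assms]]
  using GL_groupD[OF assms] minv_carrier[OF assms]
  by (simp add: dsum_dagger[of _ n _ n] minv_dagger[OF assms] dagger_transpose)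

lemma plus_dual_GL: "g \<in> GL_group n \<Longrightarrow> plus_dual g \<in> GL_group (n + n)"
  by (simp add: plus_dual_eq dsum_GL transpose_GL minv_GL)

lemma minv_plus_dual: "g \<in> GL_group n \<Longrightarrow> minv (n + n) (plus_dual g) = plus_dual (minv n g)"
  by (simp add: plus_dual_eq[of _ n] minv_dsum transpose_GL minv_GL minv_transpose)

lemma plus_dual_inj:
  assumes "g \<in> GL_group n" "h \<in> GL_group n" "plus_dual g = plus_dual h"
  shows "g = h"
  using assms GL_groupD minv_carrier by (simp add: plus_dual_eq[of _ n] dsum_eq_iff[of _ n _ _ n])

lemma dsum_blocks:
  assumes "y \<in> carrier_mat (n + k) (n + k)"
    and "\<And>i j. i < n \<Longrightarrow> j < k \<Longrightarrow> y $$ (i, n + j) = 0 \<and> y $$ (n + j, i) = 0"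
  obtains a b where "a \<in> carrier_mat n n" "b \<in> carrier_mat k k" "y = dsum a b"
proof -
  define a where "a = mat n n (\<lambda>(i, j). y $$ (i, j))"
  define b where "b = mat k k (\<lambda>(i, j). y $$ (n + i, n + j))"
  have c: "a \<in> carrier_mat n n" "b \<in> carrier_mat k k" by (simp_all add: a_def b_def)
  have "y = dsum a b"
  proof (rule eq_matI)
    fix i j assume "i < dim_row (dsum a b)" "j < dim_col (dsum a b)"
    then have ij: "i < n + k" "j < n + k" using c by (auto simp: dsum_def)
    show "y $$ (i, j) = dsum a b $$ (i, j)"
      unfolding dsum_index[OF c ij] using ij assms(2)[of i "j - n"] assms(2)[of j "i - n"]
      by (auto simp: a_def b_def)
  qed (use assms(1) c in \<open>auto simp: dsum_def\<close>)
  then show thesis using that c by blast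
qed

section \<open>Direct sums and polarizations\<close>

lemma dsum_commute_blocks:
  assumes y: "y \<in> carrier_mat (n + k) (n + k)"
    and c: "y * gm (n + k) (\<lambda>i. i) (\<lambda>i. if i < n then a else b) = gm (n + k) (\<lambda>i. i) (\<lambda>i. if i < n then a else b) * y"
    and ab: "a \<noteq> b"
  obtains y1 y2 where "y1 \<in> carrier_mat n n" "y2 \<in> carrier_mat k k" "y = dsum y1 y2"
proof (rule dsum_blocks[OF y])
  fix i j assume "i < n" "j < k"
  then show "y $$ (i, n + j) = 0 \<and> y $$ (n + j, i) = 0"
    using commute_diag_zero[OF y c, of i "n + j"] commute_diag_zero[OF y c, of "n + j" i] ab by auto
qed blast

lemma dsum_scalar_gm:
  "dsum (a \<cdot>\<^sub>m 1\<^sub>m n) (b \<cdot>\<^sub>m 1\<^sub>m k) = gm (n + k) (\<lambda>i. i) (\<lambda>i. if i < n then a else b)"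
  by (rule eq_matI) (auto simp: dsum_def)

lemma dsum_scalar_commute:
  assumes "a \<in> carrier_mat n n" "b \<in> carrier_mat k k"
  shows "gm (n + k) (\<lambda>i. i) (\<lambda>i. if i < n then x else z) * dsum a b = dsum a b * gm (n + k) (\<lambda>i. i) (\<lambda>i. if i < n then x else z)"
  unfolding dsum_scalar_gm[symmetric] using assms
  by (simp add: dsum_mult[of _ n _ _ k] mult_smult_distrib[of _ n n _ n] mult_smult_assoc_mat[of _ n n _ n]
      mult_smult_distrib[of _ k k _ k] mult_smult_assoc_mat[of _ k k _ k])

lemma dprodI: "a \<in> X \<Longrightarrow> b \<in> Y \<Longrightarrow> dsum a b \<in> dprod X Y"
  by (auto simp: dprod_def)

lemma dprodE:
  assumes "x \<in> dprod X Y" obtains a b where "a \<in> X" "b \<in> Y" "x = dsum a b"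
  using assms by (auto simp: dprod_def)

lemma isometries_dagger:
  assumes "std_form N \<beta> \<tau> d \<epsilon>" "g \<in> isometries N \<beta> \<beta>"
  shows "dagger g \<in> isometries N \<beta> \<beta>"
  using dagger_isometry[OF std_form_props(1,3,4)[OF assms(1)] _ _ assms(2)] std_formD(7)[OF assms(1)] by blast

text \<open>The standard module is irreducible under \<open>G\<close> and has two components under
  \<open>H\<close>, one for each summand, so there are two colours. The form pairs each summand with
  itself, hence \<open>st\<close> preserves colours.\<close>

lemma see_saw_direct_sum:
  assumes dp: "dual_pair m G G'" and sym: "symmetric_subgroup (2 * m) G H"
    and amp: "amplification (n1 + n2) (2 * m) \<phi>"
    and w': "w' \<in> carrier_mat (2 * m) (2 * m)" "\<And>a. a \<in> carrier_mat (n1 + n2) (n1 + n2) \<Longrightarrow> w' * \<phi> a = \<phi> a * w'"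
    and f1: "std_form n1 \<beta>1 \<tau>1 d1 \<epsilon>" and f2: "std_form n2 \<beta>2 \<tau>2 d2 \<epsilon>" and n: "n1 > 0" "n2 > 0"
    and g1: "generating n1 (isometries n1 \<beta>1 \<beta>1)" and g2: "generating n2 (isometries n2 \<beta>2 \<beta>2)"
    and g: "generating (n1 + n2) (isometries (n1 + n2) (dsum \<beta>1 \<beta>2) (dsum \<beta>1 \<beta>2))"
    and R: "R \<in> isometries (2 * m) (\<phi> (dsum \<beta>1 \<beta>2) * w') (sympl_form m)"
    and w: "(\<phi> (dsum \<beta>1 \<beta>2) * w') * (\<phi> (dsum \<beta>1 \<beta>2) * w') = c \<cdot>\<^sub>m 1\<^sub>m (2 * m)"
      "dagger (\<phi> (dsum \<beta>1 \<beta>2) * w') = e \<cdot>\<^sub>m (\<phi> (dsum \<beta>1 \<beta>2) * w')" "c \<noteq> 0" "e \<noteq> 0"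
    and G: "G = conj_by R ` \<phi> ` isometries (n1 + n2) (dsum \<beta>1 \<beta>2) (dsum \<beta>1 \<beta>2)"
    and H: "H = conj_by R ` \<phi> ` dprod (isometries n1 \<beta>1 \<beta>1) (isometries n2 \<beta>2 \<beta>2)"
  shows "dual_pair m H (centralizer (Sp_group m) H) \<and> symmetric_subgroup (2 * m) (centralizer (Sp_group m) H) G'"
proof -
  let ?N = "n1 + n2" and ?\<beta> = "dsum \<beta>1 \<beta>2"
  let ?Y = "isometries ?N ?\<beta> ?\<beta>" and ?X = "dprod (isometries n1 \<beta>1 \<beta>1) (isometries n2 \<beta>2 \<beta>2)"
  let ?s = "gm ?N (\<lambda>i. i) (\<lambda>i. if i < n1 then 1 else -1)"
  define col where "col p = (if p < n1 then 0 else 1 :: nat)" for p :: nat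
  \<comment> \<open>The representatives are the first basis vectors of the two summands, with
    indices \<open>n1\<close> and 0; both exist because the summands are nonzero.\<close>
  define f where "f p = (if p < n1 then n1 else 0)" for p :: nat
  define st where "st i = (if i < n1 then \<tau>1 i else n1 + \<tau>2 (i - n1))" for i
  define dd where "dd i = (if i < n1 then d1 i else d2 (i - n1))" for i
  have sf: "std_form ?N ?\<beta> st dd \<epsilon>" unfolding st_def dd_def using std_form_dsum[OF f1 f2] .
  note b1 = std_form_props[OF f1] and b2 = std_form_props[OF f2]
  have X: "dsum a b \<in> ?Y \<longleftrightarrow> a \<in> isometries n1 \<beta>1 \<beta>1 \<and> b \<in> isometries n2 \<beta>2 \<beta>2"
    if "a \<in> carrier_mat n1 n1" "b \<in> carrier_mat n2 n2" for a b
    using dsum_isometries_iff[OF that b1(2) b2(2)] .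
  have one: "1\<^sub>m n1 \<in> isometries n1 \<beta>1 \<beta>1" "1\<^sub>m n2 \<in> isometries n2 \<beta>2 \<beta>2"
    using b1(1) b2(1) by (simp_all add: isometries_def)
  have neg: "(-1) \<cdot>\<^sub>m 1\<^sub>m n2 \<in> isometries n2 \<beta>2 \<beta>2"
  proof (rule isometries_if_nondegenerate[OF _ b2(2,1)])
    have t: "transpose_mat ((-1) \<cdot>\<^sub>m 1\<^sub>m n2 :: complex mat) = (-1) \<cdot>\<^sub>m 1\<^sub>m n2" by (rule eq_matI) auto
    have l: "(-1) \<cdot>\<^sub>m 1\<^sub>m n2 * \<beta>2 = (-1) \<cdot>\<^sub>m \<beta>2"
      using mult_smult_assoc_mat[OF one_carrier_mat b2(1), of "-1"] b2(1) by simp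
    have "(-1) \<cdot>\<^sub>m \<beta>2 * ((-1) \<cdot>\<^sub>m 1\<^sub>m n2) = (-1) \<cdot>\<^sub>m ((-1) \<cdot>\<^sub>m \<beta>2 * 1\<^sub>m n2)"
      by (rule mult_smult_distrib[of _ n2 n2]) (use b2(1) in auto)
    also have "\<dots> = \<beta>2" using b2(1) by (simp add: smult_smult smult_one)
    finally show "transpose_mat ((-1) \<cdot>\<^sub>m 1\<^sub>m n2) * \<beta>2 * ((-1) \<cdot>\<^sub>m 1\<^sub>m n2) = \<beta>2" unfolding t l .
  qed simp
  have ds: "dsum (1\<^sub>m n1) ((-1) \<cdot>\<^sub>m 1\<^sub>m n2) = ?s"
    using dsum_scalar_gm[of 1 n1 "-1" n2] by (simp add: smult_one)
  have nc: "(-1) \<cdot>\<^sub>m 1\<^sub>m n2 \<in> carrier_mat n2 n2" by simp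
  have sX: "?s \<in> ?X" using dprodI[OF one(1) neg] unfolding ds .
  have sY: "?s \<in> ?Y" using X[OF one_carrier_mat nc] one(1) neg unfolding ds by blast
  have col: "coloured ?N (2 * m) \<phi> col f st ?\<beta> w'"
  proof (intro coloured.intro amp coloured_axioms.intro w')
    note s = std_formD[OF sf]
    show "f p < ?N" if "p < ?N" for p using n by (simp add: f_def)
    show "f p = f q" if "col p = col q" for p q using that by (auto simp: f_def col_def split: if_splits)
    show "col (f (f p)) = col p" for p using n by (auto simp: f_def col_def)
    show "st p < ?N" if "p < ?N" for p using s(2)[OF that] by blast
    show "col (f (st p)) = col (st (f p))" if p: "p < ?N" for p
    proof (cases "p < n1")
      case True
      then show ?thesis using std_formD(2)[OF f1 True] std_formD(2)[OF f2 n(2)] by (simp add: f_def col_def st_def)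
    next
      case False
      then show ?thesis using std_formD(2)[OF f1 n(1)] n by (simp add: f_def col_def st_def)
    qed
    show "?\<beta> \<in> carrier_mat ?N ?N" using b1(1) b2(1) by simp
    show "?\<beta> $$ (p, q) = 0" if "p < ?N" "q < ?N" "q \<noteq> st p" for p q unfolding s(1) using that by simp
    show "?\<beta> $$ (p, st p) \<noteq> 0" if "p < ?N" for p unfolding s(1) using s(2,5)[OF that] that by simp
  qed
  have XD: "\<exists>a b. x = dsum a b \<and> a \<in> isometries n1 \<beta>1 \<beta>1 \<and> b \<in> isometries n2 \<beta>2 \<beta>2 \<and> a \<in> carrier_mat n1 n1 \<and> b \<in> carrier_mat n2 n2"
    if "x \<in> ?X" for x
    by (rule dprodE[OF that]) (use isometriesD(2) in blast)
  show ?thesis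
  proof (rule see_saw_swap[OF dp sym R w col G H, where s = ?s])
    show "?X \<subseteq> ?Y" using XD X by blast
    show "?Y \<subseteq> carrier_mat ?N ?N" using isometriesD(2) by blast
    show "dagger x \<in> ?X" if x: "x \<in> ?X" for x
    proof -
      obtain a b where ab: "x = dsum a b" "a \<in> isometries n1 \<beta>1 \<beta>1" "b \<in> isometries n2 \<beta>2 \<beta>2" "a \<in> carrier_mat n1 n1" "b \<in> carrier_mat n2 n2"
        using XD[OF x] by blast
      then show ?thesis
        using dsum_dagger[OF ab(4,5)] isometries_dagger[OF f1 ab(2)] isometries_dagger[OF f2 ab(3)] ab(1) by (simp add: dprodI)
    qed
    show "x $$ (p, q) = 0" if x: "x \<in> ?X" and pq: "p < ?N" "q < ?N" "col p \<noteq> col q" for x p q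
    proof -
      obtain a b where ab: "x = dsum a b" "a \<in> carrier_mat n1 n1" "b \<in> carrier_mat n2 n2" using XD[OF x] by blast
      show ?thesis unfolding ab(1) dsum_index[OF ab(2,3) pq(1,2)] using pq(3) by (auto simp: col_def split: if_splits)
    qed
    show "eu ?N p q \<in> S" if S: "subalgebra ?N S" "?X \<subseteq> S" and pq: "p < ?N" "q < ?N" "col p = col q" for S p q
    proof -
      have "?s \<in> S" using sX S(2) by blast
      \<comment> \<open>The projections onto the summands are the polynomials (1 + x)/2 and (1 -
        x)/2 evaluated at \<open>?s\<close>.\<close>
      then have pr: "proj ?N 0 n1 \<in> S" "proj ?N n1 n2 \<in> S" unfolding proj_def
        by (rule diag_in_subalgebra[OF S(1), where p = "[:1/2, 1/2:]"], simp,
            rule diag_in_subalgebra[OF S(1), where p = "[:1/2, -1/2:]"], auto)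
      show ?thesis
      proof (cases "p < n1")
        case True
        then have q: "q < n1" using pq(3) by (auto simp: col_def split: if_splits)
        show ?thesis
        proof (rule eu_in_subalgebra_if_block[OF S(1) _ pr(1) g1])
          show "\<exists>x\<in>S. \<forall>i<n1. \<forall>j<n1. x $$ (0 + i, 0 + j) = h $$ (i, j)" if h: "h \<in> isometries n1 \<beta>1 \<beta>1" for h
          proof (intro bexI allI impI)
            show "dsum h (1\<^sub>m n2) \<in> S" using dprodI[OF h one(2)] S(2) by blast
            fix i j assume "i < n1" "j < n1"
            then show "dsum h (1\<^sub>m n2) $$ (0 + i, 0 + j) = h $$ (i, j)"
              using isometriesD(2)[OF h] by (simp add: dsum_index[of _ n1 _ n2])
          qed
        qed (use True q isometriesD(2) in auto)
      next
        case False
        then have q: "\<not> q < n1" using pq(3) by (auto simp: col_def split: if_splits)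
        show ?thesis
        proof (rule eu_in_subalgebra_if_block[OF S(1) _ pr(2) g2])
          show "\<exists>x\<in>S. \<forall>i<n2. \<forall>j<n2. x $$ (n1 + i, n1 + j) = h $$ (i, j)" if h: "h \<in> isometries n2 \<beta>2 \<beta>2" for h
          proof (intro bexI allI impI)
            show "dsum (1\<^sub>m n1) h \<in> S" using dprodI[OF one(1) h] S(2) by blast
            fix i j assume "i < n2" "j < n2"
            then show "dsum (1\<^sub>m n1) h $$ (n1 + i, n1 + j) = h $$ (i, j)"
              using isometriesD(2)[OF h] by (simp add: dsum_index[of _ n1 _ n2])
          qed
        qed (use False q pq isometriesD(2) in auto)
      qed
    qed
    show "y $$ (p, q) = 0" if "col p \<noteq> col q" "col p \<noteq> col (f q)" for y :: "complex mat" and p q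
      using that n by (auto simp: col_def f_def split: if_splits)
    show "eu ?N p (f p) \<in> S" if "subalgebra ?N S" "?Y \<subseteq> S" for S p
      using generatingD[OF g that eu_carrier] .
    show "?s \<in> ?Y" by (rule sY)
    show "?s * x = x * ?s" if x: "x \<in> ?X" for x
    proof -
      obtain a b where ab: "x = dsum a b" "a \<in> carrier_mat n1 n1" "b \<in> carrier_mat n2 n2" using XD[OF x] by blast
      show ?thesis unfolding ab(1) by (rule dsum_scalar_commute[OF ab(2,3)])
    qed
    show "y \<in> ?X" if y: "y \<in> ?Y" "y * ?s = ?s * y" for y
    proof -
      obtain a b where ab: "a \<in> carrier_mat n1 n1" "b \<in> carrier_mat n2 n2" "y = dsum a b"
        by (rule dsum_commute_blocks[OF isometriesD(2)[OF y(1)] y(2)]) simp_all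
      then show ?thesis using X[OF ab(1,2)] y(1) by (simp add: dprodI)
    qed
  qed
qed

lemma plus_dual_scalar:
  assumes "c \<noteq> 0"
  shows "c \<cdot>\<^sub>m 1\<^sub>m n \<in> GL_group n" "plus_dual (c \<cdot>\<^sub>m 1\<^sub>m n) = gm (n + n) (\<lambda>i. i) (\<lambda>i. if i < n then c else 1 / c)"
proof -
  have e: "c \<cdot>\<^sub>m 1\<^sub>m n * ((1 / c) \<cdot>\<^sub>m 1\<^sub>m n) = 1\<^sub>m n"
    using assms by (simp add: mult_smult_distrib[of _ n n _ n] mult_smult_assoc_mat[of _ n n _ n] smult_smult smult_one)
  show g: "c \<cdot>\<^sub>m 1\<^sub>m n \<in> GL_group n" by (rule GL_group_if_right_inverse[OF _ _ e]) simp_all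
  have "minv n (c \<cdot>\<^sub>m 1\<^sub>m n) = (1 / c) \<cdot>\<^sub>m 1\<^sub>m n" by (rule minv_eq[OF _ _ e]) simp_all
  moreover have "transpose_mat ((1 / c) \<cdot>\<^sub>m 1\<^sub>m n) = ((1 / c) \<cdot>\<^sub>m 1\<^sub>m n :: complex mat)" by (rule eq_matI) auto
  ultimately show "plus_dual (c \<cdot>\<^sub>m 1\<^sub>m n) = gm (n + n) (\<lambda>i. i) (\<lambda>i. if i < n then c else 1 / c)"
    unfolding plus_dual_eq[OF g] by (simp add: dsum_scalar_gm)
qed

text \<open>The second half of \<open>plus_dual h\<close> is the contragredient of \<open>h\<close>;
  this ensures that it still runs through the whole group.\<close>

lemma inverse_transpose_surj:
  assumes "g \<in> GL_group n"
  obtains h where "h \<in> GL_group n" "transpose_mat (minv n h) = g"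
proof (rule that)
  show "minv n (transpose_mat g) \<in> GL_group n" using minv_GL[OF transpose_GL[OF assms]] .
  show "transpose_mat (minv n (minv n (transpose_mat g))) = g" using transpose_GL[OF assms] by simp
qed

text \<open>The halves are a module and its dual. On the second half \<open>K\<close> acts by
  contragredients and, being closed under them, generates the full matrix algebra there too; the
  projections in \<open>S\<close> keep the two halves apart.\<close>

lemma halves_eu_in_subalgebra:
  assumes S: "subalgebra (n + n) S" and pr: "proj (n + n) 0 n \<in> S" "proj (n + n) n n \<in> S"
    and K: "generating n K" "K \<subseteq> GL_group n" "\<And>g. g \<in> K \<Longrightarrow> \<exists>h\<in>K. transpose_mat (minv n h) = g"
    and sub: "plus_dual ` K \<subseteq> S" and pq: "p < n + n" "q < n + n" "p < n \<longleftrightarrow> q < n"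
  shows "eu (n + n) p q \<in> S"
proof -
  have Kc: "K \<subseteq> carrier_mat n n" using K(2) GL_groupD by blast
  show ?thesis
  proof (cases "p < n")
    case True
    show ?thesis
    proof (rule eu_in_subalgebra_if_block[OF S _ pr(1) K(1) Kc])
      show "\<exists>x\<in>S. \<forall>i<n. \<forall>j<n. x $$ (0 + i, 0 + j) = h $$ (i, j)" if h: "h \<in> K" for h
      proof (intro bexI allI impI)
        have hG: "h \<in> GL_group n" using h K(2) by blast
        show "plus_dual h \<in> S" using h sub by blast
        fix i j assume "i < n" "j < n"
        then show "plus_dual h $$ (0 + i, 0 + j) = h $$ (i, j)"
          using GL_groupD[OF hG] minv_carrier[OF hG] by (simp add: plus_dual_eq[OF hG] dsum_index[of _ n _ n])
      qed
    qed (use True pq in auto)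
  next
    case False
    show ?thesis
    proof (rule eu_in_subalgebra_if_block[OF S _ pr(2) K(1) Kc])
      show "\<exists>x\<in>S. \<forall>i<n. \<forall>j<n. x $$ (n + i, n + j) = g $$ (i, j)" if g: "g \<in> K" for g
      proof -
        obtain h where h: "h \<in> K" "transpose_mat (minv n h) = g" using K(3)[OF g] by blast
        have hG: "h \<in> GL_group n" using h(1) K(2) by blast
        show ?thesis
        proof (intro bexI allI impI)
          show "plus_dual h \<in> S" using h sub by blast
          fix i j assume "i < n" "j < n"
          then show "plus_dual h $$ (n + i, n + j) = g $$ (i, j)"
            using GL_groupD[OF hG] minv_carrier[OF hG] by (simp add: plus_dual_eq[OF hG] dsum_index[of _ n _ n] flip: h(2))
        qed
      qed
    qed (use False pq in auto)
  qed
qed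

text \<open>The two isotropic halves are the colours. They are dual to each other, so here the form
  exchanges the colours, and the sign \<open>\<epsilon>\<close> covers the orthogonal and the
  symplectic case at once.\<close>

lemma see_saw_polarization:
  assumes dp: "dual_pair m G G'" and sym: "symmetric_subgroup (2 * m) G H"
    and amp: "amplification (n + n) (2 * m) \<phi>"
    and w': "w' \<in> carrier_mat (2 * m) (2 * m)" "\<And>a. a \<in> carrier_mat (n + n) (n + n) \<Longrightarrow> w' * \<phi> a = \<phi> a * w'"
    and \<epsilon>: "\<epsilon> = 1 \<or> \<epsilon> = -1" and n: "n > 0"
    and g: "generating (n + n) (isometries (n + n) (hyp_form n \<epsilon>) (hyp_form n \<epsilon>))"
    and R: "R \<in> isometries (2 * m) (\<phi> (hyp_form n \<epsilon>) * w') (sympl_form m)"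
    and w: "(\<phi> (hyp_form n \<epsilon>) * w') * (\<phi> (hyp_form n \<epsilon>) * w') = c \<cdot>\<^sub>m 1\<^sub>m (2 * m)"
      "dagger (\<phi> (hyp_form n \<epsilon>) * w') = e \<cdot>\<^sub>m (\<phi> (hyp_form n \<epsilon>) * w')" "c \<noteq> 0" "e \<noteq> 0"
    and G: "G = conj_by R ` \<phi> ` isometries (n + n) (hyp_form n \<epsilon>) (hyp_form n \<epsilon>)"
    and H: "H = conj_by R ` \<phi> ` plus_dual ` GL_group n"
  shows "dual_pair m H (centralizer (Sp_group m) H) \<and> symmetric_subgroup (2 * m) (centralizer (Sp_group m) H) G'"
proof -
  let ?N = "n + n" and ?\<beta> = "hyp_form n \<epsilon>"
  let ?Y = "isometries ?N ?\<beta> ?\<beta>" and ?X = "plus_dual ` GL_group n"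
  \<comment> \<open>The scalar \<i> on one half and its inverse -\<i> on the other: an isometry of
    the hyperbolic form for either sign, with different eigenvalues on the halves.\<close>
  let ?s = "gm ?N (\<lambda>i. i) (\<lambda>i. if i < n then \<i> else 1 / \<i>)"
  define col where "col p = (if p < n then 0 else 1 :: nat)" for p :: nat
  define f where "f p = (if p < n then n else 0)" for p :: nat
  define st where "st i = (if i < n then i + n else i - n)" for i
  define dd where "dd i = (if i < n then 1 else \<epsilon>)" for i
  have sf: "std_form ?N ?\<beta> st dd \<epsilon>" using std_form_hyp[OF \<epsilon>, of n] unfolding st_def dd_def mult_2 .
  have si: "plus_dual (\<i> \<cdot>\<^sub>m 1\<^sub>m n) = ?s" "\<i> \<cdot>\<^sub>m 1\<^sub>m n \<in> GL_group n" using plus_dual_scalar[of \<i> n] by simp_all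
  have sX: "?s \<in> ?X" using si by (metis image_eqI)
  have XY: "?X \<subseteq> ?Y" using plus_dual_isometry[OF _ \<epsilon>] by blast
  have col: "coloured ?N (2 * m) \<phi> col f st ?\<beta> w'"
  proof (intro coloured.intro amp coloured_axioms.intro w')
    note s = std_formD[OF sf]
    show "f p < ?N" if "p < ?N" for p using n by (simp add: f_def)
    show "f p = f q" if "col p = col q" for p q using that by (auto simp: f_def col_def split: if_splits)
    show "col (f (f p)) = col p" for p using n by (auto simp: f_def col_def)
    show "st p < ?N" if "p < ?N" for p using s(2)[OF that] by blast
    show "col (f (st p)) = col (st (f p))" if p: "p < ?N" for p
      using n p by (auto simp: f_def col_def st_def)
    show "?\<beta> \<in> carrier_mat ?N ?N" using std_form_props(1)[OF sf] .
    show "?\<beta> $$ (p, q) = 0" if "p < ?N" "q < ?N" "q \<noteq> st p" for p q unfolding s(1) using that by simp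
    show "?\<beta> $$ (p, st p) \<noteq> 0" if "p < ?N" for p unfolding s(1) using s(2,5)[OF that] that by simp
  qed
  have XD: "\<exists>a b. x = dsum a b \<and> a \<in> carrier_mat n n \<and> b \<in> carrier_mat n n" if x: "x \<in> ?X" for x
  proof -
    obtain h where h: "h \<in> GL_group n" "x = plus_dual h" using x by blast
    then show ?thesis unfolding h(2) plus_dual_eq[OF h(1)] using GL_groupD[OF h(1)] minv_carrier[OF h(1)]
      by (intro exI[of _ h] exI[of _ "transpose_mat (minv n h)"]) simp
  qed
  show ?thesis
  proof (rule see_saw_swap[OF dp sym R w col G H XY, where s = ?s])
    show "?Y \<subseteq> carrier_mat ?N ?N" using isometriesD(2) by blast
    show "dagger x \<in> ?X" if x: "x \<in> ?X" for x
      using x dagger_plus_dual dagger_GL by auto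
    show "x $$ (p, q) = 0" if x: "x \<in> ?X" and pq: "p < ?N" "q < ?N" "col p \<noteq> col q" for x p q
    proof -
      obtain a b where ab: "x = dsum a b" "a \<in> carrier_mat n n" "b \<in> carrier_mat n n" using XD[OF x] by blast
      show ?thesis unfolding ab(1) dsum_index[OF ab(2,3) pq(1,2)] using pq(3) by (auto simp: col_def split: if_splits)
    qed
    show "eu ?N p q \<in> S" if S: "subalgebra ?N S" "?X \<subseteq> S" and pq: "p < ?N" "q < ?N" "col p = col q" for S p q
    proof (rule halves_eu_in_subalgebra[OF S(1) _ _ generating_GL order_refl _ S(2) pq(1,2)])
      have "?s \<in> S" using sX S(2) by blast
      \<comment> \<open>The polynomial (1 - \<i> x)/2 is 1 at \<i> and 0 at -\<i>; the polynomial (1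
        + \<i> x)/2 does the opposite.\<close>
      then show "proj ?N 0 n \<in> S" "proj ?N n n \<in> S" unfolding proj_def
        by (rule diag_in_subalgebra[OF S(1), where p = "[:1/2, -\<i>/2:]"], simp,
            rule diag_in_subalgebra[OF S(1), where p = "[:1/2, \<i>/2:]"], auto)
      show "\<exists>h\<in>GL_group n. transpose_mat (minv n h) = g" if "g \<in> GL_group n" for g
        by (rule inverse_transpose_surj[OF that]) blast
      show "p < n \<longleftrightarrow> q < n" using pq(3) by (auto simp: col_def split: if_splits)
    qed
    show "y $$ (p, q) = 0" if "col p \<noteq> col q" "col p \<noteq> col (f q)" for y :: "complex mat" and p q
      using that n by (auto simp: col_def f_def split: if_splits)
    show "eu ?N p (f p) \<in> S" if "subalgebra ?N S" "?Y \<subseteq> S" for S p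
      using generatingD[OF g that eu_carrier] .
    show "?s \<in> ?Y" using sX XY by blast
    show "?s * x = x * ?s" if x: "x \<in> ?X" for x
    proof -
      obtain a b where ab: "x = dsum a b" "a \<in> carrier_mat n n" "b \<in> carrier_mat n n" using XD[OF x] by blast
      show ?thesis unfolding ab(1) by (rule dsum_scalar_commute[OF ab(2,3)])
    qed
    show "y \<in> ?X" if y: "y \<in> ?Y" "y * ?s = ?s * y" for y
    proof -
      obtain a b where ab: "a \<in> carrier_mat n n" "b \<in> carrier_mat n n" "y = dsum a b"
        by (rule dsum_commute_blocks[OF isometriesD(2)[OF y(1)] y(2)]) (auto simp: field_simps)
      then show ?thesis using plus_dual_if_dsum_isometry[OF ab(1,2) \<epsilon>] y(1) by auto
    qed
  qed
qed

section \<open>Bilinear forms and diagonals\<close>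

text \<open>Under \<open>GL\<close> the module and its dual are different components; under the
  isometry group of \<open>\<beta>\<close> they become isomorphic, so \<open>H'\<close> mixes them.
  \<open>?t0\<close> interchanges them by means of \<open>\<beta>\<close>, and commuting with it
  singles out the isometries. The central element \<open>?s0\<close> of \<open>G\<close> separates
  them, so an element of \<open>H'\<close> commuting with \<open>?s0\<close> is block diagonal and,
  since \<open>H\<close> generates the matrix algebra of each half, commutes with all of
  \<open>G\<close>.\<close>

lemma see_saw_bilinear:
  assumes dp: "dual_pair m G G'" and sym: "symmetric_subgroup (2 * m) G H"
    and amp: "amplification (n + n) (2 * m) \<phi>" and n: "n > 0"
    and f: "std_form n \<beta> \<tau> d \<epsilon>" and g: "generating n (isometries n \<beta> \<beta>)"
    and R: "R \<in> isometries (2 * m) (\<phi> (hyp_form n (-1))) (sympl_form m)"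
    and G: "G = conj_by R ` \<phi> ` plus_dual ` GL_group n"
    and H: "H = conj_by R ` \<phi> ` plus_dual ` isometries n \<beta> \<beta>"
  shows "dual_pair m H (centralizer (Sp_group m) H) \<and> symmetric_subgroup (2 * m) (centralizer (Sp_group m) H) G'"
proof -
  interpret amplification "n + n" "2 * m" \<phi> by (rule amp)
  let ?N = "n + n" and ?w = "\<phi> (hyp_form n (-1))" and ?K = "isometries n \<beta> \<beta>"
  \<comment> \<open>The square of this element is the scalar -1, which makes conjugation by it
    involutive.\<close>
  let ?s0 = "gm ?N (\<lambda>i. i) (\<lambda>i. if i < n then \<i> else 1 / \<i>)"
  \<comment> \<open>With a plus sign in the lower block this matrix would reverse the alternating
    form instead of preserving it.\<close>
  let ?t0 = "off \<beta> ((-1) \<cdot>\<^sub>m \<beta>)"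
  note b = std_form_props[OF f]
  have \<epsilon>: "\<epsilon> * \<epsilon> = 1" "\<epsilon> \<noteq> 0" using std_formD(6)[OF f] by auto
  have bb: "transpose_mat \<beta> * \<beta> = 1\<^sub>m n"
    unfolding b(5) using mult_smult_assoc_mat[OF b(1,1)] b(3) \<epsilon> by (simp add: smult_smult smult_one)
  have nb: "(-1) \<cdot>\<^sub>m \<beta> \<in> carrier_mat n n" using b(1) by simp
  have sf: "std_form ?N (hyp_form n (-1)) (\<lambda>i. if i < n then i + n else i - n) (\<lambda>i. if i < n then 1 else -1) (-1)"
    using std_form_hyp[of "-1" n] by (simp add: mult_2)
  note h = std_form_props[OF sf]
  have KG: "?K \<subseteq> GL_group n" using isometriesD(1) by blast
  have pc: "plus_dual x \<in> carrier_mat ?N ?N" if "x \<in> GL_group n" for x using plus_dual_carrier[OF that] .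
  have iso: "\<phi> a \<in> isometries (2 * m) ?w ?w" if a: "a \<in> isometries ?N (hyp_form n (-1)) (hyp_form n (-1))" for a
  proof -
    note ac = isometriesD[OF a]
    have "transpose_mat (\<phi> a) * ?w * \<phi> a = \<phi> (transpose_mat a * hyp_form n (-1) * a)"
    proof -
      have ta: "transpose_mat a \<in> carrier_mat ?N ?N" using ac(2) by simp
      show ?thesis by (simp only: mul[OF sq_mult[OF ta h(1)] ac(2)] mul[OF ta h(1)] trn[OF ac(2)])
    qed
    then show ?thesis unfolding ac(3) isometries_sq_iff using GL[OF ac(1)] by blast
  qed
  have si: "plus_dual (\<i> \<cdot>\<^sub>m 1\<^sub>m n) = ?s0" "\<i> \<cdot>\<^sub>m 1\<^sub>m n \<in> GL_group n" using plus_dual_scalar[of \<i> n] by simp_all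
  have tc: "?t0 \<in> carrier_mat ?N ?N" using b(1) nb by simp
  have tiso: "?t0 \<in> isometries ?N (hyp_form n (-1)) (hyp_form n (-1))"
  proof (rule isometries_if_nondegenerate[OF tc h(2,1)])
    have bt: "transpose_mat \<beta> \<in> carrier_mat n n" "transpose_mat ((-1) \<cdot>\<^sub>m \<beta>) \<in> carrier_mat n n" using b(1) by simp_all
    have tn: "transpose_mat ((-1) \<cdot>\<^sub>m \<beta>) = (-1) \<cdot>\<^sub>m transpose_mat \<beta>" by (rule eq_matI) auto
    have m1: "(-1) \<cdot>\<^sub>m 1\<^sub>m n \<in> carrier_mat n n" by simp
    have "transpose_mat ?t0 * hyp_form n (-1) = dsum ((-1) \<cdot>\<^sub>m transpose_mat ((-1) \<cdot>\<^sub>m \<beta>)) (transpose_mat \<beta>)"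
      unfolding hyp_form_off off_transpose[OF b(1) nb] off_mult(3)[OF bt(2,1) one_carrier_mat m1]
      using bt by (simp add: mult_smult_distrib[of _ n n _ n])
    also have "(-1) \<cdot>\<^sub>m transpose_mat ((-1) \<cdot>\<^sub>m \<beta>) = transpose_mat \<beta>" unfolding tn by (simp add: smult_smult smult_one)
    also have "dsum (transpose_mat \<beta>) (transpose_mat \<beta>) * ?t0 = off (transpose_mat \<beta> * \<beta>) (transpose_mat \<beta> * ((-1) \<cdot>\<^sub>m \<beta>))"
      by (rule off_mult(1)[OF bt(1,1) b(1) nb])
    also have "transpose_mat \<beta> * ((-1) \<cdot>\<^sub>m \<beta>) = (-1) \<cdot>\<^sub>m 1\<^sub>m n" using mult_smult_distrib[OF bt(1) b(1)] bb by simp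
    finally show "transpose_mat ?t0 * hyp_form n (-1) * ?t0 = hyp_form n (-1)" unfolding bb hyp_form_off .
  qed
  have comm: "plus_dual x * ?t0 = ?t0 * plus_dual x \<longleftrightarrow> x * \<beta> = \<beta> * transpose_mat (minv n x)
      \<and> transpose_mat (minv n x) * \<beta> = \<beta> * x" if x: "x \<in> GL_group n" for x
  proof -
    have xc: "x \<in> carrier_mat n n" "transpose_mat (minv n x) \<in> carrier_mat n n" using GL_groupD[OF x] minv_carrier[OF x] by simp_all
    show ?thesis
      unfolding plus_dual_eq[OF x] off_mult(1)[OF xc b(1) nb] off_mult(2)[OF xc b(1) nb]
      using off_eq_iff[of "x * \<beta>" n "\<beta> * transpose_mat (minv n x)" "transpose_mat (minv n x) * ((-1) \<cdot>\<^sub>m \<beta>)" "(-1) \<cdot>\<^sub>m \<beta> * x"]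
        mult_smult_distrib[OF xc(2) b(1), of "-1"] mult_smult_assoc_mat[OF b(1) xc(1), of "-1"] xc b(1)
      by (simp add: sq_mult[of _ n] smult_eq_iff)
  qed
  \<comment> \<open>Of the two block equations in \<open>comm\<close>, the second is the isometry
    equation for \<open>x\<close>, multiplied by the contragredient. The first follows from it by
    multiplying with \<open>\<beta>\<close> on both sides and using
    \<open>\<beta> * \<beta> = \<epsilon>\<close>.\<close>
  have comm_iff: "plus_dual x * ?t0 = ?t0 * plus_dual x \<longleftrightarrow> x \<in> ?K" if x: "x \<in> GL_group n" for x
  proof -
    note xc = GL_groupD[OF x] minv_carrier[OF x]
    have xt: "transpose_mat x \<in> carrier_mat n n" "transpose_mat (minv n x) \<in> carrier_mat n n" using xc by simp_all
    have inv: "transpose_mat x * transpose_mat (minv n x) = 1\<^sub>m n" "transpose_mat (minv n x) * transpose_mat x = 1\<^sub>m n"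
      unfolding transpose_mult[OF xc(2,1), symmetric] transpose_mult[OF xc, symmetric] minv_left[OF x] minv_right[OF x] by simp_all
    have A: "transpose_mat (minv n x) * \<beta> = \<beta> * x \<longleftrightarrow> transpose_mat x * \<beta> * x = \<beta>"
    proof
      assume e: "transpose_mat (minv n x) * \<beta> = \<beta> * x"
      have "transpose_mat x * \<beta> * x = transpose_mat x * (transpose_mat (minv n x) * \<beta>)"
        unfolding e by (rule sq_assoc[OF xt(1) b(1) xc(1)])
      also have "\<dots> = transpose_mat x * transpose_mat (minv n x) * \<beta>" by (rule sq_assoc[OF xt b(1), symmetric])
      also have "\<dots> = \<beta>" unfolding inv(1) by (rule left_mult_one_mat[OF b(1)])
      finally show "transpose_mat x * \<beta> * x = \<beta>" .
    next
      assume e: "transpose_mat x * \<beta> * x = \<beta>"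
      have "transpose_mat (minv n x) * \<beta> = transpose_mat (minv n x) * (transpose_mat x * \<beta> * x)" using e by simp
      also have "\<dots> = transpose_mat (minv n x) * (transpose_mat x * (\<beta> * x))"
        unfolding sq_assoc[OF xt(1) b(1) xc(1)] ..
      also have "\<dots> = transpose_mat (minv n x) * transpose_mat x * (\<beta> * x)"
        by (rule sq_assoc[OF xt(2,1) sq_mult[OF b(1) xc(1)], symmetric])
      also have "\<dots> = \<beta> * x" unfolding inv(2) by (rule left_mult_one_mat[OF sq_mult[OF b(1) xc(1)]])
      finally show "transpose_mat (minv n x) * \<beta> = \<beta> * x" .
    qed
    have B: "transpose_mat (minv n x) * \<beta> = \<beta> * x \<Longrightarrow> x * \<beta> = \<beta> * transpose_mat (minv n x)"
    proof -
      assume e: "transpose_mat (minv n x) * \<beta> = \<beta> * x"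
      let ?y = "transpose_mat (minv n x)"
      have yb: "?y * \<beta> * \<beta> = \<epsilon> \<cdot>\<^sub>m ?y"
        unfolding sq_assoc[OF xt(2) b(1,1)] b(3) mult_smult_distrib[OF xt(2) one_carrier_mat] right_mult_one_mat[OF xt(2)] ..
      have bb': "\<beta> * (\<beta> * (x * \<beta>)) = \<epsilon> \<cdot>\<^sub>m (x * \<beta>)"
        unfolding sq_assoc[OF b(1,1) sq_mult[OF xc(1) b(1)], symmetric] b(3)
          mult_smult_assoc_mat[OF one_carrier_mat sq_mult[OF xc(1) b(1)]] left_mult_one_mat[OF sq_mult[OF xc(1) b(1)]] ..
      have "\<epsilon> \<cdot>\<^sub>m (\<beta> * ?y) = \<beta> * (?y * \<beta> * \<beta>)" unfolding yb by (rule mult_smult_distrib[OF b(1) xt(2), symmetric])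
      also have "\<dots> = \<beta> * (\<beta> * (x * \<beta>))" unfolding e sq_assoc[OF b(1) xc(1) b(1)] ..
      finally have "\<epsilon> \<cdot>\<^sub>m (\<beta> * ?y) = \<epsilon> \<cdot>\<^sub>m (x * \<beta>)" unfolding bb' .
      then show "x * \<beta> = \<beta> * transpose_mat (minv n x)" using \<epsilon>(2) by (simp add: smult_eq_iff)
    qed
    show ?thesis unfolding comm[OF x] isometries_sq_iff A[symmetric] using B x by blast
  qed
  have w2: "?w * ?w = (-1) \<cdot>\<^sub>m 1\<^sub>m (2 * m)" using mul[OF h(1,1)] h(3) smu[of "1\<^sub>m ?N" "-1"] by simp
  have wd: "dagger ?w = (-1) \<cdot>\<^sub>m ?w" using dag[OF h(1)] h(4) smu[OF h(1)] by simp
  have sc: "?s0 \<in> carrier_mat ?N ?N" by simp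
  have s2: "?s0 * ?s0 = (-1) \<cdot>\<^sub>m 1\<^sub>m ?N"
    unfolding gm_one gm_smult by (subst gm_mult) (auto intro!: gm_cong)
  have sx: "?s0 * plus_dual x = plus_dual x * ?s0" if x: "x \<in> GL_group n" for x
    unfolding plus_dual_eq[OF x] using GL_groupD[OF x] minv_carrier[OF x] by (intro dsum_scalar_commute) auto
  show ?thesis
  proof (rule see_saw_inner[OF dp sym R car[OF h(1)] w2 wd _ _ G H, where s = "\<phi> ?s0" and t = "\<phi> ?t0" and d = "-1"])
    show "\<phi> ` plus_dual ` ?K \<subseteq> \<phi> ` plus_dual ` GL_group n" using KG by blast
    show "\<phi> ` plus_dual ` GL_group n \<subseteq> carrier_mat (2 * m) (2 * m)" using car pc by blast
    show "dagger x \<in> \<phi> ` plus_dual ` ?K" if x: "x \<in> \<phi> ` plus_dual ` ?K" for x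
    proof -
      obtain a where a: "a \<in> ?K" "x = \<phi> (plus_dual a)" using x by blast
      have aG: "a \<in> GL_group n" using a(1) KG by blast
      have "dagger x = \<phi> (plus_dual (dagger a))"
        unfolding a(2) using dag[OF pc[OF aG]] dagger_plus_dual[OF aG] by simp
      then show ?thesis using isometries_dagger[OF f a(1)] by blast
    qed
    show "\<phi> ?t0 \<in> isometries (2 * m) ?w ?w" using iso[OF tiso] .
    show "\<phi> ?t0 * x = x * \<phi> ?t0" if x: "x \<in> \<phi> ` plus_dual ` ?K" for x
    proof -
      obtain a where a: "a \<in> ?K" "x = \<phi> (plus_dual a)" using x by blast
      have aG: "a \<in> GL_group n" using a(1) KG by blast
      show ?thesis unfolding a(2) using comm_iff[OF aG] a(1) mul[OF tc pc[OF aG]] mul[OF pc[OF aG] tc] by simp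
    qed
    show "y \<in> \<phi> ` plus_dual ` ?K" if y: "y \<in> \<phi> ` plus_dual ` GL_group n" "y * \<phi> ?t0 = \<phi> ?t0 * y" for y
    proof -
      obtain a where a: "a \<in> GL_group n" "y = \<phi> (plus_dual a)" using y(1) by blast
      have "\<phi> (plus_dual a * ?t0) = \<phi> (?t0 * plus_dual a)"
        using y(2) a mul[OF tc pc[OF a(1)]] mul[OF pc[OF a(1)] tc] by simp
      then have "plus_dual a * ?t0 = ?t0 * plus_dual a" using inj[OF sq_mult[OF pc[OF a(1)] tc] sq_mult[OF tc pc[OF a(1)]]] by blast
      then show ?thesis using comm_iff[OF a(1)] a(2) by blast
    qed
    show "\<phi> ?s0 \<in> \<phi> ` plus_dual ` GL_group n" using si by (metis image_eqI)
    show "\<phi> ?s0 \<in> isometries (2 * m) ?w ?w" using iso plus_dual_isometry[OF si(2), of "-1"] si(1) by simp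
    show "\<phi> ?s0 * x = x * \<phi> ?s0" if x: "x \<in> \<phi> ` plus_dual ` ?K" for x
    proof -
      obtain a where a: "a \<in> ?K" "x = \<phi> (plus_dual a)" using x by blast
      have aG: "a \<in> GL_group n" using a(1) KG by blast
      show ?thesis unfolding a(2) using sx[OF aG] mul[OF sc pc[OF aG]] mul[OF pc[OF aG] sc] by simp
    qed
    show "\<phi> ?s0 * \<phi> ?s0 = (-1) \<cdot>\<^sub>m 1\<^sub>m (2 * m)" using mul[OF sc sc] s2 smu[of "1\<^sub>m ?N" "-1"] by simp
    show "b' * y = y * b'" if b': "b' \<in> isometries (2 * m) ?w ?w" "\<And>x. x \<in> \<phi> ` plus_dual ` ?K \<Longrightarrow> b' * x = x * b'"
      "b' * \<phi> ?s0 = \<phi> ?s0 * b'" and y: "y \<in> \<phi> ` plus_dual ` GL_group n" for b' y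
    proof -
      obtain a where a: "a \<in> GL_group n" "y = \<phi> (plus_dual a)" using y by blast
      note bc = isometriesD(2)[OF b'(1)]
      define S where "S = {a \<in> carrier_mat ?N ?N. \<phi> a * b' = b' * \<phi> a}"
      have S: "subalgebra ?N S" unfolding S_def by (rule commutant_subalgebra[OF bc])
      have sub: "plus_dual ` ?K \<subseteq> S" using b'(2) KG pc unfolding S_def by auto
      have sS: "?s0 \<in> S" using b'(3) unfolding S_def by simp
      have eu: "eu ?N p q \<in> S" if pq: "p < ?N" "q < ?N" "p < n \<longleftrightarrow> q < n" for p q
      proof (rule halves_eu_in_subalgebra[OF S _ _ g KG _ sub pq])
        show "proj ?N 0 n \<in> S" unfolding proj_def
          by (rule diag_in_subalgebra[OF S sS, where p = "[:1/2, -\<i>/2:]"]) auto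
        show "proj ?N n n \<in> S" unfolding proj_def
          by (rule diag_in_subalgebra[OF S sS, where p = "[:1/2, \<i>/2:]"]) auto
        \<comment> \<open>The isometry group is closed under contragredients, because
          \<open>\<beta>\<close> intertwines \<open>k\<close> with its contragredient.\<close>
        show "\<exists>h\<in>?K. transpose_mat (minv n h) = k" if k: "k \<in> ?K" for k
        proof -
          have "transpose_mat (minv n k) \<in> ?K"
          proof -
            have kG: "k \<in> GL_group n" using k KG by blast
            note kc = GL_groupD[OF kG] minv_carrier[OF kG]
            have k1: "transpose_mat (minv n k) * \<beta> = \<beta> * k" "k * \<beta> = \<beta> * transpose_mat (minv n k)"
              using comm[OF kG] comm_iff[OF kG] k by auto
            let ?h = "transpose_mat (minv n k)"
            have hc: "?h \<in> carrier_mat n n" using kc by simp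
            have "transpose_mat ?h * \<beta> * ?h = minv n k * (\<beta> * ?h)" using kc hc b(1) by (simp add: sq_assoc[of _ n])
            also have "\<dots> = minv n k * (k * \<beta>)" unfolding k1(2) ..
            also have "\<dots> = \<beta>" using minv_cancel(1)[OF kG b(1)] .
            finally show ?thesis using transpose_GL[OF minv_GL[OF kG]] by (simp add: isometries_def)
          qed
          moreover have "transpose_mat (minv n (transpose_mat (minv n k))) = k"
            using k KG minv_transpose[OF minv_GL, of k n] by auto
          ultimately show ?thesis by blast
        qed
      qed
      show ?thesis unfolding a(2)
      proof (rule commutes_if_support[OF bc pc[OF a(1)]])
        show "E p p * b' = b' * E p p" if "p < ?N" for p using eu[of p p] that unfolding S_def by simp
        show "E p q * b' = b' * E p q" if pq: "p < ?N" "q < ?N" "plus_dual a $$ (p, q) \<noteq> 0" for p q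
        proof -
          have c: "a \<in> carrier_mat n n" "transpose_mat (minv n a) \<in> carrier_mat n n" using GL_groupD[OF a(1)] minv_carrier[OF a(1)] by auto
          have "p < n \<longleftrightarrow> q < n"
            using pq(3) unfolding plus_dual_eq[OF a(1)] dsum_index[OF c pq(1,2)] by (auto split: if_splits)
          then show ?thesis using eu[OF pq(1,2)] unfolding S_def by simp
        qed
      qed
    qed
  qed simp_all
qed

lemma four_block_mat_eq_iff:
  fixes P Q P' Q' U V U' V' :: "complex mat"
  assumes "P \<in> carrier_mat n n" "Q \<in> carrier_mat n k" "P' \<in> carrier_mat k n" "Q' \<in> carrier_mat k k"
    "U \<in> carrier_mat n n" "V \<in> carrier_mat n k" "U' \<in> carrier_mat k n" "V' \<in> carrier_mat k k"
  shows "four_block_mat P Q P' Q' = four_block_mat U V U' V' \<longleftrightarrow> P = U \<and> Q = V \<and> P' = U' \<and> Q' = V'"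
proof
  assume e: "four_block_mat P Q P' Q' = four_block_mat U V U' V'"
  note d = assms[THEN carrier_matD(1)] assms[THEN carrier_matD(2)]
  have "P $$ (i, j) = U $$ (i, j)" if "i < n" "j < n" for i j
    using arg_cong[OF e, of "\<lambda>z. z $$ (i, j)"] that by (simp add: d)
  moreover have "Q $$ (i, j) = V $$ (i, j)" if "i < n" "j < k" for i j
    using arg_cong[OF e, of "\<lambda>z. z $$ (i, n + j)"] that by (simp add: d)
  moreover have "P' $$ (i, j) = U' $$ (i, j)" if "i < k" "j < n" for i j
    using arg_cong[OF e, of "\<lambda>z. z $$ (n + i, j)"] that by (simp add: d)
  moreover have "Q' $$ (i, j) = V' $$ (i, j)" if "i < k" "j < k" for i j
    using arg_cong[OF e, of "\<lambda>z. z $$ (n + i, n + j)"] that by (simp add: d)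
  ultimately show "P = U \<and> Q = V \<and> P' = U' \<and> Q' = V'" using d by (intro conjI eq_matI) simp_all
qed simp

text \<open>\<open>T\<close> is a partial isometry between the two modules that intertwines the actions and the
  forms; the group element \<open>t\<close> exchanges its initial and its final space.\<close>

lemma see_saw_diagonal:
  assumes dp: "dual_pair (m1 + m2) G G'" and sym: "symmetric_subgroup (2 * (m1 + m2)) G H"
    and amp1: "amplification N (2 * m1) \<phi>1" and amp2: "amplification N (2 * m2) \<phi>2"
    and K: "K \<subseteq> carrier_mat N N" "\<And>a. a \<in> K \<Longrightarrow> dagger a \<in> K" "1\<^sub>m N \<in> K" "(-1) \<cdot>\<^sub>m 1\<^sub>m N \<in> K"
      "\<And>a. a \<in> K \<Longrightarrow> \<phi>1 a \<in> isometries (2 * m1) w1 w1" "\<And>a. a \<in> K \<Longrightarrow> \<phi>2 a \<in> isometries (2 * m2) w2 w2"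
    and w1: "w1 \<in> carrier_mat (2 * m1) (2 * m1)" "w1 * w1 = (-1) \<cdot>\<^sub>m 1\<^sub>m (2 * m1)" "dagger w1 = (-1) \<cdot>\<^sub>m w1" "transpose_mat w1 = (-1) \<cdot>\<^sub>m w1"
    and w2: "w2 \<in> carrier_mat (2 * m2) (2 * m2)" "w2 * w2 = (-1) \<cdot>\<^sub>m 1\<^sub>m (2 * m2)" "dagger w2 = (-1) \<cdot>\<^sub>m w2" "transpose_mat w2 = (-1) \<cdot>\<^sub>m w2"
    and T: "T \<in> carrier_mat (2 * m1) (2 * m2)" "T * transpose_mat T * T = T" "w1 * T = T * w2"
      "\<And>a. a \<in> carrier_mat N N \<Longrightarrow> \<phi>1 a * T = T * \<phi>2 a"
      "\<And>a b. a \<in> carrier_mat N N \<Longrightarrow> b \<in> carrier_mat N N \<Longrightarrow> \<phi>1 a * T = \<phi>1 b * T \<Longrightarrow> a = b"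
    and R: "R \<in> isometries (2 * (m1 + m2)) (dsum w1 w2) (sympl_form (m1 + m2))"
    and G: "G = conj_by R ` (\<lambda>(a, b). dsum (\<phi>1 a) (\<phi>2 b)) ` (K \<times> K)"
    and H: "H = conj_by R ` (\<lambda>a. dsum (\<phi>1 a) (\<phi>2 a)) ` K"
  shows "dual_pair (m1 + m2) H (centralizer (Sp_group (m1 + m2)) H) \<and>
    symmetric_subgroup (2 * (m1 + m2)) (centralizer (Sp_group (m1 + m2)) H) G'"
proof -
  interpret p1: amplification N "2 * m1" \<phi>1 by (rule amp1)
  interpret p2: amplification N "2 * m2" \<phi>2 by (rule amp2)
  let ?n = "2 * m1" and ?k = "2 * m2"
  let ?w = "dsum w1 w2" and ?X = "(\<lambda>a. dsum (\<phi>1 a) (\<phi>2 a)) ` K" and ?Y = "(\<lambda>(a, b). dsum (\<phi>1 a) (\<phi>2 b)) ` (K \<times> K)"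
  \<comment> \<open>The pair consisting of the identity and its negative. It lies in
    \<open>Y\<close>, and conjugation by it changes the sign of exactly the blocks that mix the two
    modules.\<close>
  let ?s = "gm (?n + ?k) (\<lambda>i. i) (\<lambda>i. if i < ?n then 1 else -1)"
  have nk: "2 * (m1 + m2) = ?n + ?k" by simp
  have Kc: "a \<in> carrier_mat N N" if "a \<in> K" for a using that K(1) by blast
  have c: "\<phi>1 a \<in> carrier_mat ?n ?n" "\<phi>2 a \<in> carrier_mat ?k ?k" if "a \<in> K" for a using Kc[OF that] by simp_all
  have wG: "w1 \<in> GL_group ?n" "w2 \<in> GL_group ?k"
  proof -
    have "w1 * ((-1) \<cdot>\<^sub>m w1) = 1\<^sub>m ?n" "w2 * ((-1) \<cdot>\<^sub>m w2) = 1\<^sub>m ?k"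
      unfolding mult_smult_distrib[OF w1(1,1)] mult_smult_distrib[OF w2(1,1)] w1(2) w2(2) by (simp_all add: smult_smult smult_one)
    then show "w1 \<in> GL_group ?n" "w2 \<in> GL_group ?k"
      using GL_group_if_right_inverse[OF w1(1) smult_carrier_mat[OF w1(1)]]
        GL_group_if_right_inverse[OF w2(1) smult_carrier_mat[OF w2(1)]] by blast+
  qed
  have wc: "?w \<in> carrier_mat (?n + ?k) (?n + ?k)" using w1(1) w2(1) by simp
  have ww: "?w * ?w = (-1) \<cdot>\<^sub>m 1\<^sub>m (?n + ?k)"
    unfolding dsum_mult[OF w1(1,1) w2(1,1)] w1(2) w2(2) dsum_one[symmetric]
    by (rule dsum_smult[OF one_carrier_mat one_carrier_mat, symmetric])
  have wd: "dagger ?w = (-1) \<cdot>\<^sub>m ?w"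
    unfolding dsum_dagger[OF w1(1) w2(1)] w1(3) w2(3) by (rule dsum_smult[OF w1(1) w2(1), symmetric])
  define T' where "T' = transpose_mat T"
  have T'c: "T' \<in> carrier_mat ?k ?n" using T(1) by (simp add: T'_def)
  have TT: "T * T' * T = T" "T' * (T * T') = T'"
  proof -
    show TTT: "T * T' * T = T" using T(2) by (simp add: T'_def)
    have "transpose_mat (T * T' * T) = T' * (T * T')"
      using T(1) T'c transpose_mult[OF mult_carrier_mat[OF T(1) T'c] T(1)] transpose_mult[OF T(1) T'c] by (simp add: T'_def)
    then show "T' * (T * T') = T'" using TTT by (simp add: T'_def)
  qed
  have wT': "w2 * T' = T' * w1"
  proof -
    have "transpose_mat (w1 * T) = transpose_mat (T * w2)" using T(3) by simp
    then have "T' * ((-1) \<cdot>\<^sub>m w1) = ((-1) \<cdot>\<^sub>m w2) * T'"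
      using transpose_mult[OF w1(1) T(1)] transpose_mult[OF T(1) w2(1)] w1(4) w2(4) by (simp add: T'_def)
    then have "(-1) \<cdot>\<^sub>m (T' * w1) = (-1) \<cdot>\<^sub>m (w2 * T')"
      using mult_smult_distrib[OF T'c w1(1)] mult_smult_assoc_mat[OF w2(1) T'c] by simp
    then show ?thesis by (simp add: smult_eq_iff)
  qed
  have phiT': "\<phi>2 a * T' = T' * \<phi>1 a" if a: "a \<in> K" for a
  proof -
    have ta: "transpose_mat a \<in> carrier_mat N N" using Kc[OF a] by simp
    have "transpose_mat (\<phi>1 (transpose_mat a) * T) = transpose_mat (T * \<phi>2 (transpose_mat a))" using T(4)[OF ta] by simp
    then show ?thesis
      using transpose_mult[OF p1.car[OF ta] T(1)] transpose_mult[OF T(1) p2.car[OF ta]] p1.trn[OF Kc[OF a]] p2.trn[OF Kc[OF a]]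
      by (simp add: T'_def)
  qed
  \<comment> \<open>\<open>F\<close> and \<open>F'\<close> extend the exchange by the identity on
    the complements, so that \<open>?t\<close> is an involution although \<open>T\<close> need not
    be invertible.\<close>
  define F where "F = 1\<^sub>m ?n - T * T'"
  define F' where "F' = 1\<^sub>m ?k - T' * T"
  have Fc: "F \<in> carrier_mat ?n ?n" "F' \<in> carrier_mat ?k ?k" using T(1) T'c by (auto simp: F_def F'_def)
  have TT'c: "T * T' \<in> carrier_mat ?n ?n" "T' * T \<in> carrier_mat ?k ?k" using T(1) T'c by auto
  have Fcomm: "F * a = a * F \<and> F' * b = b * F'" if a: "a \<in> carrier_mat ?n ?n" and b: "b \<in> carrier_mat ?k ?k"
      and aT: "a * T = T * b" and bT: "b * T' = T' * a" for a b
  proof -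
    have "T * T' * a = T * (b * T')" using assoc_mult_mat[OF T(1) T'c a] bT by simp
    also have "\<dots> = a * T * T'" unfolding aT using assoc_mult_mat[OF T(1) b T'c] by simp
    also have "\<dots> = a * (T * T')" using assoc_mult_mat[OF a T(1) T'c] .
    finally have 1: "T * T' * a = a * (T * T')" .
    have "T' * T * b = T' * (a * T)" using assoc_mult_mat[OF T'c T(1) b] aT by simp
    also have "\<dots> = b * T' * T" unfolding bT using assoc_mult_mat[OF T'c a T(1)] by simp
    also have "\<dots> = b * (T' * T)" using assoc_mult_mat[OF b T'c T(1)] .
    finally have 2: "T' * T * b = b * (T' * T)" .
    show ?thesis unfolding F_def F'_def
      using minus_mult_distrib_mat[OF one_carrier_mat TT'c(1) a] mult_minus_distrib_mat[OF a one_carrier_mat TT'c(1)]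
        minus_mult_distrib_mat[OF one_carrier_mat TT'c(2) b] mult_minus_distrib_mat[OF b one_carrier_mat TT'c(2)] 1 2 a b
      by simp
  qed
  let ?t = "four_block_mat F T T' F'"
  have tc: "?t \<in> carrier_mat (?n + ?k) (?n + ?k)" by (rule four_block_carrier_mat[OF Fc])
  have tcomm: "?t * dsum a b = dsum a b * ?t \<longleftrightarrow> F * a = a * F \<and> T * b = a * T \<and> T' * a = b * T' \<and> F' * b = b * F'"
    if a: "a \<in> carrier_mat ?n ?n" and b: "b \<in> carrier_mat ?k ?k" for a b
  proof -
    have z: "0\<^sub>m (dim_row a) (dim_col b) \<in> carrier_mat ?n ?k" "0\<^sub>m (dim_row b) (dim_col a) \<in> carrier_mat ?k ?n" using a b by auto
    have e1: "?t * dsum a b = four_block_mat (F * a) (T * b) (T' * a) (F' * b)"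
      unfolding dsum_def mult_four_block_mat[OF Fc(1) T(1) T'c Fc(2) a z b] using a b T(1) T'c Fc by simp
    have e2: "dsum a b * ?t = four_block_mat (a * F) (a * T) (b * T') (b * F')"
      unfolding dsum_def mult_four_block_mat[OF a z b Fc(1) T(1) T'c Fc(2)] using a b T(1) T'c Fc by simp
    show ?thesis unfolding e1 e2
      by (rule four_block_mat_eq_iff[where n = ?n and k = ?k]) (use a b T(1) T'c Fc in auto)
  qed
  have tt: "?t * ?t = 1\<^sub>m (?n + ?k)"
  proof -
    have FT: "F * T = 0\<^sub>m ?n ?k" "F' * T' = 0\<^sub>m ?k ?n" "T * F' = 0\<^sub>m ?n ?k" "T' * F = 0\<^sub>m ?k ?n"
    proof -
      have m: "T * (T' * T) = T" "T' * T * T' = T'"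
        using TT assoc_mult_mat[OF T(1) T'c T(1)] assoc_mult_mat[OF T'c T(1) T'c] by simp_all
      show "F * T = 0\<^sub>m ?n ?k" unfolding F_def using minus_mult_distrib_mat[OF one_carrier_mat TT'c(1) T(1)] TT(1) T(1) by simp
      show "F' * T' = 0\<^sub>m ?k ?n" unfolding F'_def using minus_mult_distrib_mat[OF one_carrier_mat TT'c(2) T'c] m(2) T'c by simp
      show "T * F' = 0\<^sub>m ?n ?k" unfolding F'_def using mult_minus_distrib_mat[OF T(1) one_carrier_mat TT'c(2)] m(1) T(1) by simp
      show "T' * F = 0\<^sub>m ?k ?n" unfolding F_def using mult_minus_distrib_mat[OF T'c one_carrier_mat TT'c(1)] TT(2) T'c by simp
    qed
    have FF: "F * F = F" "F' * F' = F'"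
    proof -
      have "F * F = F * 1\<^sub>m ?n - F * (T * T')" unfolding F_def
        by (rule mult_minus_distrib_mat[OF Fc(1)[unfolded F_def] one_carrier_mat TT'c(1)])
      moreover have "F * (T * T') = 0\<^sub>m ?n ?n" using assoc_mult_mat[OF Fc(1) T(1) T'c] FT(1) T'c by simp
      ultimately show "F * F = F" using Fc(1) by (auto intro!: eq_matI)
      have "F' * F' = F' * 1\<^sub>m ?k - F' * (T' * T)" unfolding F'_def
        by (rule mult_minus_distrib_mat[OF Fc(2)[unfolded F'_def] one_carrier_mat TT'c(2)])
      moreover have "F' * (T' * T) = 0\<^sub>m ?k ?k" using assoc_mult_mat[OF Fc(2) T'c T(1)] FT(2) T(1) by simp
      ultimately show "F' * F' = F'" using Fc(2) by (auto intro!: eq_matI)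
    qed
    have one: "(1\<^sub>m l - A) + A = 1\<^sub>m l" "A + (1\<^sub>m l - A) = 1\<^sub>m l" if "A \<in> carrier_mat l l" for l and A :: "complex mat"
      by (rule eq_matI, use that in auto)+
    have FF': "F + T * T' = 1\<^sub>m ?n" "T' * T + F' = 1\<^sub>m ?k"
      unfolding F_def F'_def by (rule one[OF TT'c(1)], rule one[OF TT'c(2)])
    have z: "0\<^sub>m l l' + 0\<^sub>m l l' = (0\<^sub>m l l' :: complex mat)" for l l' by (rule eq_matI) auto
    have "?t * ?t = four_block_mat (1\<^sub>m ?n) (0\<^sub>m ?n ?k) (0\<^sub>m ?k ?n) (1\<^sub>m ?k)"
      unfolding mult_four_block_mat[OF Fc(1) T(1) T'c Fc(2) Fc(1) T(1) T'c Fc(2)] FT FF FF' z ..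
    then show ?thesis by simp
  qed
  have tsym: "transpose_mat ?t = ?t"
  proof -
    have "transpose_mat (T * T') = T * T'" "transpose_mat (T' * T) = T' * T"
      using transpose_mult[OF T(1) T'c] transpose_mult[OF T'c T(1)] by (simp_all add: T'_def)
    then have "transpose_mat F = F" "transpose_mat F' = F'"
      unfolding F_def F'_def using transpose_minus[OF one_carrier_mat TT'c(1)] transpose_minus[OF one_carrier_mat TT'c(2)] by simp_all
    then show ?thesis
      unfolding transpose_four_block_mat[OF Fc(1) T(1) T'c Fc(2)] by (simp add: T'_def)
  qed
  have tw: "?t * ?w = ?w * ?t" unfolding tcomm[OF w1(1) w2(1)] using Fcomm[OF w1(1) w2(1) T(3) wT'] T(3) wT' by simp
  have tiso: "?t \<in> isometries (?n + ?k) ?w ?w"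
  proof (rule isometries_if_nondegenerate[OF tc dsum_GL[OF wG] wc])
    show "transpose_mat ?t * ?w * ?t = ?w" unfolding tsym tw
      using sq_assoc[OF wc tc tc] tt wc by simp
  qed
  have iff: "dsum a b \<in> isometries (?n + ?k) ?w ?w \<longleftrightarrow> a \<in> isometries ?n w1 w1 \<and> b \<in> isometries ?k w2 w2"
    if "a \<in> carrier_mat ?n ?n" "b \<in> carrier_mat ?k ?k" for a b
    using dsum_isometries_iff[OF that wG] .
  have phi1: "\<phi>2 ((-1) \<cdot>\<^sub>m 1\<^sub>m N) = (-1) \<cdot>\<^sub>m 1\<^sub>m ?k" using p2.smu[of "1\<^sub>m N" "-1"] by simp
  have ds: "dsum (\<phi>1 (1\<^sub>m N)) (\<phi>2 ((-1) \<cdot>\<^sub>m 1\<^sub>m N)) = ?s"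
    unfolding phi1 using dsum_scalar_gm[of 1 ?n "-1" ?k] by (simp add: smult_one)
  have sYiso: "?s \<in> ?Y" "?s \<in> isometries (?n + ?k) ?w ?w"
  proof -
    show "?s \<in> ?Y" by (rule image_eqI[of _ _ "(1\<^sub>m N, (-1) \<cdot>\<^sub>m 1\<^sub>m N)"]) (use ds K(3,4) in auto)
    show "?s \<in> isometries (?n + ?k) ?w ?w"
      unfolding ds[symmetric] using iff[OF c(1)[OF K(3)] c(2)[OF K(4)]] K(5)[OF K(3)] K(6)[OF K(4)] by blast
  qed
  show ?thesis
  proof (rule see_saw_inner[OF dp sym R wc[folded nk] ww[folded nk] wd _ _ G H, where s = ?s and t = ?t and d = 1])
    show "?X \<subseteq> ?Y" by auto
    show "?Y \<subseteq> carrier_mat (2 * (m1 + m2)) (2 * (m1 + m2))" unfolding nk using c by auto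
    show "dagger x \<in> ?X" if x: "x \<in> ?X" for x
    proof -
      obtain a where a: "a \<in> K" "x = dsum (\<phi>1 a) (\<phi>2 a)" using x by blast
      have "dagger x = dsum (\<phi>1 (dagger a)) (\<phi>2 (dagger a))"
        unfolding a(2) dsum_dagger[OF c[OF a(1)]] using p1.dag[OF Kc[OF a(1)]] p2.dag[OF Kc[OF a(1)]] by simp
      then show ?thesis using K(2)[OF a(1)] by blast
    qed
    show "?t \<in> isometries (2 * (m1 + m2)) ?w ?w" unfolding nk by (rule tiso)
    show "?t * x = x * ?t" if x: "x \<in> ?X" for x
    proof -
      obtain a where a: "a \<in> K" "x = dsum (\<phi>1 a) (\<phi>2 a)" using x by blast
      show ?thesis unfolding a(2) tcomm[OF c[OF a(1)]]
        using Fcomm[OF c[OF a(1)] T(4)[OF Kc[OF a(1)]] phiT'[OF a(1)]] T(4)[OF Kc[OF a(1)]] phiT'[OF a(1)] by simp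
    qed
    show "y \<in> ?X" if y: "y \<in> ?Y" "y * ?t = ?t * y" for y
    proof -
      obtain a b where ab: "a \<in> K" "b \<in> K" "y = dsum (\<phi>1 a) (\<phi>2 b)"
        using y(1) by (elim imageE SigmaE) simp
      have "?t * dsum (\<phi>1 a) (\<phi>2 b) = dsum (\<phi>1 a) (\<phi>2 b) * ?t" using y(2) ab(3) by simp
      then have "T * \<phi>2 b = \<phi>1 a * T" using tcomm[OF c(1)[OF ab(1)] c(2)[OF ab(2)]] by blast
      \<comment> \<open>Commuting with \<open>?t\<close> makes \<open>a\<close> and \<open>b\<close>
        agree after composition with \<open>T\<close>, which by the last hypothesis on
        \<open>T\<close> is large enough to tell them apart.\<close>
      then have "\<phi>1 a * T = \<phi>1 b * T" using T(4)[OF Kc[OF ab(2)]] by simp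
      then have "a = b" using T(5)[OF Kc[OF ab(1)] Kc[OF ab(2)]] by blast
      then show ?thesis using ab(1,3) by (intro image_eqI[of _ _ a]) simp_all
    qed
    show "?s \<in> ?Y" by (rule sYiso)
    show "?s \<in> isometries (2 * (m1 + m2)) ?w ?w" unfolding nk by (rule sYiso)
    show "?s * x = x * ?s" if x: "x \<in> ?X" for x
    proof -
      obtain a where a: "a \<in> K" "x = dsum (\<phi>1 a) (\<phi>2 a)" using x by blast
      show ?thesis unfolding a(2) by (rule dsum_scalar_commute[OF c[OF a(1)]])
    qed
    show "?s * ?s = 1 \<cdot>\<^sub>m 1\<^sub>m (2 * (m1 + m2))"
      unfolding nk gm_one gm_smult by (subst gm_mult) (auto intro!: gm_cong)
    show "b * y = y * b" if b: "b \<in> isometries (2 * (m1 + m2)) ?w ?w" "\<And>x. x \<in> ?X \<Longrightarrow> b * x = x * b" "b * ?s = ?s * b"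
      and y: "y \<in> ?Y" for b y
    proof -
      \<comment> \<open>Commutation with \<open>?s\<close> removes the mixed blocks. Each diagonal
        block then commutes with its own copy of \<open>K\<close>, hence also with independent
        elements in the two copies.\<close>
      obtain b1 b2 where bb: "b1 \<in> carrier_mat ?n ?n" "b2 \<in> carrier_mat ?k ?k" "b = dsum b1 b2"
        by (rule dsum_commute_blocks[OF isometriesD(2)[OF b(1)[unfolded nk]] b(3)]) simp_all
      have cm: "b1 * \<phi>1 a = \<phi>1 a * b1 \<and> b2 * \<phi>2 a = \<phi>2 a * b2" if a: "a \<in> K" for a
      proof -
        have "dsum b1 b2 * dsum (\<phi>1 a) (\<phi>2 a) = dsum (\<phi>1 a) (\<phi>2 a) * dsum b1 b2" using b(2) a bb(3) by blast
        then show ?thesis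
          unfolding dsum_mult[OF bb(1) c(1)[OF a] bb(2) c(2)[OF a]] dsum_mult[OF c(1)[OF a] bb(1) c(2)[OF a] bb(2)]
          using dsum_eq_iff[OF sq_mult[OF bb(1) c(1)[OF a]] sq_mult[OF c(1)[OF a] bb(1)] sq_mult[OF bb(2) c(2)[OF a]] sq_mult[OF c(2)[OF a] bb(2)]]
          by blast
      qed
      obtain a a' where a: "a \<in> K" "a' \<in> K" "y = dsum (\<phi>1 a) (\<phi>2 a')"
        using y by (elim imageE SigmaE) simp
      show ?thesis unfolding bb(3) a(3)
          dsum_mult[OF bb(1) c(1)[OF a(1)] bb(2) c(2)[OF a(2)]] dsum_mult[OF c(1)[OF a(1)] bb(1) c(2)[OF a(2)] bb(2)]
        using cm[OF a(1)] cm[OF a(2)] by simp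
    qed
  qed simp_all
qed

section \<open>Bases adapted to a polarization\<close>

definition bform :: "complex mat \<Rightarrow> complex vec \<Rightarrow> complex vec \<Rightarrow> complex" where
  "bform B u v = u \<bullet> (B *\<^sub>v v)"

lemma kernel_vector_if_zero_row:
  assumes A: "A \<in> carrier_mat N N" and r: "r < N" and zero: "\<And>j. j < N \<Longrightarrow> A $$ (r, j) = (0 :: complex)"
  shows "\<exists>x\<in>carrier_vec N. x \<noteq> 0\<^sub>v N \<and> A *\<^sub>v x = 0\<^sub>v N"
proof -
  have "transpose_mat A *\<^sub>v unit_vec N r = 0\<^sub>v N"
    by (rule eq_vecI) (use A r zero in auto)
  moreover have "unit_vec N r \<noteq> (0\<^sub>v N :: complex vec)" using r by (metis index_unit_vec(2) index_zero_vec(1) zero_neq_one)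
  moreover have "transpose_mat A \<in> carrier_mat N N" using A by simp
  ultimately have "det (transpose_mat A) = 0"
    using det_0_iff_vec_prod_zero_field[of "transpose_mat A" N] unit_vec_carrier by blast
  then have "det A = 0" using det_transpose[OF A] by simp
  then show ?thesis using det_0_iff_vec_prod_zero_field[OF A] by blast
qed

locale polarized =
  fixes N :: nat and B :: "complex mat" and \<epsilon> :: complex and L1 L2 :: "complex vec set"
  assumes B: "B \<in> GL_group N" "transpose_mat B = \<epsilon> \<cdot>\<^sub>m B" and \<epsilon>: "\<epsilon> = 1 \<or> \<epsilon> = -1"
    and L1: "L1 \<subseteq> carrier_vec N" "u \<in> L1 \<Longrightarrow> v \<in> L1 \<Longrightarrow> u + v \<in> L1" "u \<in> L1 \<Longrightarrow> c \<cdot>\<^sub>v u \<in> L1"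
    and L2: "L2 \<subseteq> carrier_vec N" "u \<in> L2 \<Longrightarrow> v \<in> L2 \<Longrightarrow> u + v \<in> L2" "u \<in> L2 \<Longrightarrow> c \<cdot>\<^sub>v u \<in> L2"
    and iso1: "u \<in> L1 \<Longrightarrow> v \<in> L1 \<Longrightarrow> bform B u v = 0" and iso2: "u \<in> L2 \<Longrightarrow> v \<in> L2 \<Longrightarrow> bform B u v = 0"
    and dec: "x \<in> carrier_vec N \<Longrightarrow> \<exists>u\<in>L1. \<exists>v\<in>L2. x = u + v"
begin

abbreviation b :: "complex vec \<Rightarrow> complex vec \<Rightarrow> complex" where "b \<equiv> bform B"

lemma Bc: "B \<in> carrier_mat N N" using GL_groupD[OF B(1)] .

lemma b_add_right: "x \<in> carrier_vec N \<Longrightarrow> y \<in> carrier_vec N \<Longrightarrow> z \<in> carrier_vec N \<Longrightarrow> b x (y + z) = b x y + b x z"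
  unfolding bform_def using Bc mult_add_distrib_mat_vec[OF Bc, of y z] scalar_prod_add_distrib[of x N "B *\<^sub>v y" "B *\<^sub>v z"] by auto

lemma b_smult_right: "x \<in> carrier_vec N \<Longrightarrow> y \<in> carrier_vec N \<Longrightarrow> b x (c \<cdot>\<^sub>v y) = c * b x y"
  unfolding bform_def using Bc mult_mat_vec[OF Bc, of y c] scalar_prod_smult_distrib[of x N "B *\<^sub>v y" c] by auto

lemma b_sym: assumes "x \<in> carrier_vec N" "y \<in> carrier_vec N" shows "b y x = \<epsilon> * b x y"
proof -
  have "b x y = (transpose_mat B *\<^sub>v x) \<bullet> y"
    unfolding bform_def using transpose_vec_mult_scalar[OF Bc assms(2,1)] by simp
  also have "transpose_mat B *\<^sub>v x = \<epsilon> \<cdot>\<^sub>v (B *\<^sub>v x)" unfolding B(2) by (rule eq_vecI) (use Bc assms in auto)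
  also have "(\<epsilon> \<cdot>\<^sub>v (B *\<^sub>v x)) \<bullet> y = \<epsilon> * (y \<bullet> (B *\<^sub>v x))"
    using Bc assms comm_scalar_prod[of "B *\<^sub>v x" N y] by (simp add: smult_scalar_prod_distrib[of _ N])
  finally show ?thesis using \<epsilon> by (auto simp: bform_def)
qed

lemma b_nondegenerate:
  assumes x: "x \<in> carrier_vec N" and z: "\<And>y. y \<in> carrier_vec N \<Longrightarrow> b y x = 0"
  shows "x = 0\<^sub>v N"
proof -
  have Bx: "B *\<^sub>v x \<in> carrier_vec N" using Bc x by simp
  have "B *\<^sub>v x = 0\<^sub>v N"
  proof (rule eq_vecI)
    fix i assume "i < dim_vec (0\<^sub>v N :: complex vec)"
    then have i: "i < N" by simp
    then show "(B *\<^sub>v x) $ i = 0\<^sub>v N $ i" using z[of "unit_vec N i"] scalar_prod_left_unit[OF Bx i] by (simp add: bform_def)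
  qed (use Bc in auto)
  then have "minv N B *\<^sub>v (B *\<^sub>v x) = 0\<^sub>v N" using minv_carrier[OF B(1)] by auto
  moreover have "minv N B *\<^sub>v (B *\<^sub>v x) = x"
    using assoc_mult_mat_vec[OF minv_carrier[OF B(1)] Bc x] minv_left[OF B(1)] x by simp
  ultimately show ?thesis by simp
qed

definition dual :: "nat \<Rightarrow> (nat \<Rightarrow> complex vec) \<Rightarrow> (nat \<Rightarrow> complex vec) \<Rightarrow> bool" where
  "dual j u v \<longleftrightarrow> (\<forall>i<j. u i \<in> L1 \<and> v i \<in> L2) \<and> (\<forall>i<j. \<forall>i'<j. b (u i) (v i') = (if i = i' then 1 else 0))"

lemma dualD: "dual j u v \<Longrightarrow> i < j \<Longrightarrow> u i \<in> L1" "dual j u v \<Longrightarrow> i < j \<Longrightarrow> v i \<in> L2"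
  "dual j u v \<Longrightarrow> i < j \<Longrightarrow> i' < j \<Longrightarrow> b (u i) (v i') = (if i = i' then 1 else 0)"
  by (auto simp: dual_def)

lemma c1: "x \<in> L1 \<Longrightarrow> x \<in> carrier_vec N" using L1(1) by blast
lemma c2: "x \<in> L2 \<Longrightarrow> x \<in> carrier_vec N" using L2(1) by blast

text \<open>Nondegeneracy gives a vector pairing nontrivially with \<open>w\<close>; its component
  in \<open>L1\<close> is invisible to \<open>w\<close>, so the partner can be taken in
  \<open>L2\<close>. After rescaling it is corrected by multiples of the \<open>v k\<close> until it
  is orthogonal to the old \<open>u i\<close>, as in the Gram-Schmidt process.\<close>

lemma dual_extend:
  assumes d: "dual j u v" and w: "w \<in> L1" "w \<noteq> 0\<^sub>v N" and perp: "\<And>i. i < j \<Longrightarrow> b w (v i) = 0"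
  shows "\<exists>u' v'. dual (Suc j) u' v'"
proof -
  have "\<exists>y\<in>carrier_vec N. b w y \<noteq> 0"
  proof (rule ccontr)
    assume "\<not> (\<exists>y\<in>carrier_vec N. b w y \<noteq> 0)"
    then have "b y w = 0" if "y \<in> carrier_vec N" for y using b_sym[OF c1[OF w(1)] that] that by simp
    then show False using b_nondegenerate[OF c1[OF w(1)]] w(2) by blast
  qed
  then obtain y where y: "y \<in> carrier_vec N" "b w y \<noteq> 0" by blast
  obtain y1 y2 where yy: "y1 \<in> L1" "y2 \<in> L2" "y = y1 + y2" using dec[OF y(1)] by blast
  have by2: "b w y2 \<noteq> 0"
    using y(2) iso1[OF w(1) yy(1)] b_add_right[OF c1[OF w(1)] c1[OF yy(1)] c2[OF yy(2)]] yy(3) by simp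
  have ex: "\<exists>x\<in>L2. b w x = 1 \<and> (\<forall>i<k. b (u i) x = 0)" if "k \<le> j" for k
    using that
  proof (induction k)
    case 0
    show ?case
      using b_smult_right[OF c1[OF w(1)] c2[OF yy(2)], of "1 / b w y2"] by2 L2(3)[OF yy(2)]
      by (intro bexI[of _ "(1 / b w y2) \<cdot>\<^sub>v y2"]) auto
  next
    case (Suc k)
    then obtain x where x: "x \<in> L2" "b w x = 1" "\<And>i. i < k \<Longrightarrow> b (u i) x = 0" by auto
    have k: "k < j" using Suc.prems by simp
    \<comment> \<open>Adding this multiple of \<open>v k\<close> kills the pairing with
      \<open>u k\<close>; the pairings with the other \<open>u i\<close> and with \<open>w\<close>
      do not change, by duality and by \<open>perp\<close>.\<close>
    let ?c = "- b (u k) x"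
    have sc: "?c \<cdot>\<^sub>v v k \<in> L2" using L2(3)[OF dualD(2)[OF d k]] .
    have e: "b z (x + ?c \<cdot>\<^sub>v v k) = b z x + ?c * b z (v k)" if "z \<in> L1" for z
      using b_add_right[OF c1[OF that] c2[OF x(1)] c2[OF sc]] b_smult_right[OF c1[OF that] c2[OF dualD(2)[OF d k]], of ?c] by simp
    show ?case
    proof (intro bexI[of _ "x + ?c \<cdot>\<^sub>v v k"] conjI allI impI)
      show "b w (x + ?c \<cdot>\<^sub>v v k) = 1" unfolding e[OF w(1)] using x(2) perp[OF k] by simp
      show "x + ?c \<cdot>\<^sub>v v k \<in> L2" using L2(2)[OF x(1) sc] .
      fix i assume i: "i < Suc k"
      then have ij: "i < j" using Suc.prems by simp
      show "b (u i) (x + ?c \<cdot>\<^sub>v v k) = 0"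
        unfolding e[OF dualD(1)[OF d ij]] dualD(3)[OF d ij k] using x(3)[of i] i by (cases "i = k") auto
    qed
  qed
  obtain x where x: "x \<in> L2" "b w x = 1" "\<And>i. i < j \<Longrightarrow> b (u i) x = 0" using ex[OF order_refl] by blast
  have "dual (Suc j) (u(j := w)) (v(j := x))"
    unfolding dual_def using d[unfolded dual_def] w(1) x perp by (auto simp: less_Suc_eq)
  then show ?thesis by blast
qed

text \<open>The \<open>2 * j\<close> vectors \<open>x\<close> and their partners \<open>y\<close>
  have a diagonal pairing matrix with nonzero diagonal, so the \<open>y\<close> satisfy only the
  trivial linear relation, while more than \<open>N\<close> vectors are dependent.\<close>

lemma dual_bound:
  assumes d: "dual j u v" shows "2 * j \<le> N"
proof (rule ccontr)
  assume "\<not> 2 * j \<le> N"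
  then have N: "N < 2 * j" by simp
  define x where "x i = (if i < j then u i else v (i - j))" for i
  define y where "y i = (if i < j then v i else u (i - j))" for i
  have m: "i - j < j" if "i < 2 * j" "\<not> i < j" for i using that by simp
  have xc: "x i \<in> carrier_vec N" "y i \<in> carrier_vec N" if "i < 2 * j" for i
    using that dualD(1,2)[OF d] c1 c2 m[OF that] by (auto simp: x_def y_def)
  have xy: "b (x i) (y i') = (if i = i' then b (x i) (y i) else 0) \<and> b (x i) (y i) \<noteq> 0" if i: "i < 2 * j" "i' < 2 * j" for i i'
  proof -
    have vu: "b (v k) (u k') = \<epsilon> * (if k = k' then 1 else 0)" if "k < j" "k' < j" for k k'
      using b_sym[OF c1[OF dualD(1)[OF d that(2)]] c2[OF dualD(2)[OF d that(1)]]] dualD(3)[OF d that(2,1)] by auto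
    have e0: "\<epsilon> \<noteq> 0" using \<epsilon> by auto
    show ?thesis
    proof (cases "i < j")
      case True
      then show ?thesis
        using dualD(3)[OF d True, of i'] dualD(3)[OF d True True] iso1[OF dualD(1)[OF d True] dualD(1)[OF d, of "i' - j"]] m[OF i(2)]
        by (auto simp: x_def y_def)
    next
      case False
      note mi = m[OF i(1) False]
      show ?thesis
      proof (cases "i' < j")
        case True
        then show ?thesis using False iso2[OF dualD(2)[OF d mi] dualD(2)[OF d True]] vu[OF mi mi] e0 by (auto simp: x_def y_def)
      next
        case False2: False
        then show ?thesis using False vu[OF mi m[OF i(2) False2]] vu[OF mi mi] e0 by (auto simp: x_def y_def)
      qed
    qed
  qed
  have ex: "\<exists>c. (\<exists>i\<le>N. c i \<noteq> 0) \<and> (\<forall>r<N. (\<Sum>i\<le>N. y i $ r * c i) = 0)"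
    by (rule mat_vec_sum_dependent) (use xc N in auto)
  obtain c where c: "(\<exists>i\<le>N. c i \<noteq> 0) \<and> (\<forall>r<N. (\<Sum>i\<le>N. y i $ r * c i) = 0)"
    using ex by (elim exE) (rule that)
  then obtain i where i: "i \<le> N" "c i \<noteq> 0" by blast
  have i2: "i < 2 * j" using i N by simp
  define g where "g = transpose_mat B *\<^sub>v x i"
  have gb: "b (x i) z = (\<Sum>r\<in>{0..<N}. g $ r * z $ r)" if "z \<in> carrier_vec N" for z
    unfolding bform_def g_def using transpose_vec_mult_scalar[OF Bc that xc(1)[OF i2]] that by (simp add: scalar_prod_def)
  have "(\<Sum>k\<le>N. c k * b (x i) (y k)) = (\<Sum>k\<le>N. \<Sum>r\<in>{0..<N}. g $ r * (y k $ r * c k))"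
    using N xc(2) by (intro sum.cong refl) (simp add: gb sum_distrib_left mult.assoc mult.left_commute mult.commute)
  also have "\<dots> = (\<Sum>r\<in>{0..<N}. g $ r * (\<Sum>k\<le>N. y k $ r * c k))"
    by (subst sum.swap) (simp add: sum_distrib_left)
  also have "\<dots> = 0" using c by simp
  finally have "(\<Sum>k\<le>N. c k * b (x i) (y k)) = 0" .
  moreover have "(\<Sum>k\<le>N. c k * b (x i) (y k)) = (\<Sum>k\<le>N. if k = i then c i * b (x i) (y i) else 0)"
  proof (rule sum.cong[OF refl])
    fix k assume "k \<in> {..N}"
    then have "k < 2 * j" using N by simp
    then show "c k * b (x i) (y k) = (if k = i then c i * b (x i) (y i) else 0)" using xy[OF i2, of k] by auto
  qed
  ultimately show False using i xy[OF i2 i2] by simp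
qed

text \<open>A dual system of largest size takes the place of a basis of \<open>L1\<close> with its
  dual basis in \<open>L2\<close>, which bypasses dimensions of subspaces.\<close>

lemma maximal_dual:
  obtains j u v where "dual j u v" "\<And>w. w \<in> L1 \<Longrightarrow> (\<And>i. i < j \<Longrightarrow> b w (v i) = 0) \<Longrightarrow> w = 0\<^sub>v N"
proof -
  have d0: "\<exists>u v. dual 0 u v" by (simp add: dual_def)
  have bd: "\<forall>j. (\<exists>u v. dual j u v) \<longrightarrow> j \<le> N" using dual_bound by (metis le_add1 le_trans mult_2)
  define j where "j = (GREATEST j. \<exists>u v. dual j u v)"
  have "\<exists>u v. dual j u v" unfolding j_def by (rule GreatestI_nat[where P = "\<lambda>j. \<exists>u v. dual j u v", OF d0]) (use bd in blast)
  then obtain u v where uv: "dual j u v" by blast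
  have "\<not> (\<exists>u v. dual (Suc j) u v)"
  proof
    assume "\<exists>u v. dual (Suc j) u v"
    then have "Suc j \<le> j" unfolding j_def
      by (rule Greatest_le_nat[where P = "\<lambda>j. \<exists>u v. dual j u v"]) (use bd in blast)
    then show False by simp
  qed
  then have "w = 0\<^sub>v N" if "w \<in> L1" "\<And>i. i < j \<Longrightarrow> b w (v i) = 0" for w
    using dual_extend[OF uv that(1)] that(2) by blast
  then show thesis using that uv by blast
qed

end

context polarized begin

text \<open>By maximality, a vector of one subspace orthogonal to the half of the system in the
  other subspace is zero. Hence \<open>L1\<close> is the orthogonal complement of the
  \<open>u i\<close>, and \<open>L2\<close> that of the \<open>v i\<close>. If the system did not
  fill the space, some nonzero vector would be orthogonal to all of it; it would lie in
  \<open>L1\<close> and so vanish.\<close>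

lemma adapted_basis:
  obtains u v j where "N = 2 * j" "dual j u v"
    "\<And>w. w \<in> L1 \<longleftrightarrow> w \<in> carrier_vec N \<and> (\<forall>i<j. b (u i) w = 0)"
    "\<And>w. w \<in> L2 \<longleftrightarrow> w \<in> carrier_vec N \<and> (\<forall>i<j. b (v i) w = 0)"
proof -
  obtain j u v where d: "dual j u v" and mx: "\<And>w. w \<in> L1 \<Longrightarrow> (\<And>i. i < j \<Longrightarrow> b w (v i) = 0) \<Longrightarrow> w = 0\<^sub>v N"
    by (rule maximal_dual) blast
  have e0: "\<epsilon> \<noteq> 0" using \<epsilon> by auto
  have mx1: "w = 0\<^sub>v N" if w: "w \<in> L1" "\<And>i. i < j \<Longrightarrow> b (v i) w = 0" for w
  proof (rule mx[OF w(1)])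
    fix i assume i: "i < j"
    show "b w (v i) = 0" using b_sym[OF c2[OF dualD(2)[OF d i]] c1[OF w(1)]] w(2)[OF i] by simp
  qed
  \<comment> \<open>Maximality speaks about \<open>L1\<close>. To transfer it, a vector
    \<open>w\<close> of \<open>L1\<close> is modified by the \<open>u k\<close> until it is
    orthogonal to all \<open>v i\<close>, hence zero; its pairing with \<open>z\<close> does not
    change on the way, so \<open>z\<close> is orthogonal to \<open>L1\<close> as well as to
    \<open>L2\<close>.\<close>
  have mx2: "z = 0\<^sub>v N" if z: "z \<in> L2" "\<And>i. i < j \<Longrightarrow> b (u i) z = 0" for z
  proof (rule b_nondegenerate[OF c2[OF z(1)]])
    fix y :: "complex vec" assume y: "y \<in> carrier_vec N"
    have zu: "b z (u i) = 0" if "i < j" for i using b_sym[OF c1[OF dualD(1)[OF d that]] c2[OF z(1)]] z(2)[OF that] by simp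
    have z1: "b z w = 0" if w: "w \<in> L1" for w
    proof -
      have "\<exists>w'\<in>L1. b z w' = b z w \<and> (\<forall>i<k. b (v i) w' = 0)" if "k \<le> j" for k
        using that
      proof (induction k)
        case 0 then show ?case using w by auto
      next
        case (Suc k)
        then obtain w' where w': "w' \<in> L1" "b z w' = b z w" "\<And>i. i < k \<Longrightarrow> b (v i) w' = 0" by auto
        have k: "k < j" using Suc.prems by simp
        let ?c = "- (b (v k) w' / \<epsilon>)"
        have sc: "?c \<cdot>\<^sub>v u k \<in> L1" using L1(3)[OF dualD(1)[OF d k]] .
        have e: "b x (w' + ?c \<cdot>\<^sub>v u k) = b x w' + ?c * b x (u k)" if "x \<in> L2" for x
          using b_add_right[OF c2[OF that] c1[OF w'(1)] c1[OF sc]] b_smult_right[OF c2[OF that] c1[OF dualD(1)[OF d k]], of ?c] by simp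
        show ?case
        proof (intro bexI[of _ "w' + ?c \<cdot>\<^sub>v u k"] conjI allI impI)
          show "b z (w' + ?c \<cdot>\<^sub>v u k) = b z w" unfolding e[OF z(1)] using w'(2) zu[OF k] by simp
          show "w' + ?c \<cdot>\<^sub>v u k \<in> L1" using L1(2)[OF w'(1) sc] .
          fix i assume i: "i < Suc k"
          then have ij: "i < j" using Suc.prems by simp
          have "b (v i) (u k) = \<epsilon> * (if k = i then 1 else 0)"
            using b_sym[OF c1[OF dualD(1)[OF d k]] c2[OF dualD(2)[OF d ij]]] dualD(3)[OF d k ij] by simp
          then show "b (v i) (w' + ?c \<cdot>\<^sub>v u k) = 0"
            unfolding e[OF dualD(2)[OF d ij]] using w'(3)[of i] i e0 by (cases "i = k") auto
        qed
      qed
      then obtain w' where "w' \<in> L1" "b z w' = b z w" "\<forall>i<j. b (v i) w' = 0" by blast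
      then have "w' = 0\<^sub>v N" using mx1 by blast
      then have "b z w = b z (0\<^sub>v N)" using \<open>b z w' = b z w\<close> by simp
      also have "\<dots> = 0"
      proof -
        have "B *\<^sub>v 0\<^sub>v N = 0\<^sub>v N" using Bc by auto
        then show ?thesis using c2[OF z(1)] by (simp add: bform_def)
      qed
      finally show ?thesis .
    qed
    obtain y1 y2 where yy: "y1 \<in> L1" "y2 \<in> L2" "y = y1 + y2" using dec[OF y] by blast
    have "b z y = 0"
      using b_add_right[OF c2[OF z(1)] c1[OF yy(1)] c2[OF yy(2)]] z1[OF yy(1)] iso2[OF z(1) yy(2)] yy(3) by simp
    then show "b y z = 0" using b_sym[OF c2[OF z(1)] y] by simp
  qed
  have char1: "w \<in> L1 \<longleftrightarrow> w \<in> carrier_vec N \<and> (\<forall>i<j. b (u i) w = 0)" for w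
  proof
    assume "w \<in> L1" then show "w \<in> carrier_vec N \<and> (\<forall>i<j. b (u i) w = 0)" using c1 iso1 dualD(1)[OF d] by blast
  next
    assume w: "w \<in> carrier_vec N \<and> (\<forall>i<j. b (u i) w = 0)"
    then obtain w1 w2 where ww: "w1 \<in> L1" "w2 \<in> L2" "w = w1 + w2" using dec by blast
    have "b (u i) w2 = 0" if i: "i < j" for i
      using b_add_right[OF c1[OF dualD(1)[OF d i]] c1[OF ww(1)] c2[OF ww(2)]] iso1[OF dualD(1)[OF d i] ww(1)] w i ww(3) by simp
    then have "w2 = 0\<^sub>v N" using mx2[OF ww(2)] by blast
    then show "w \<in> L1" using ww c1 by simp
  qed
  have char2: "w \<in> L2 \<longleftrightarrow> w \<in> carrier_vec N \<and> (\<forall>i<j. b (v i) w = 0)" for w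
  proof
    assume "w \<in> L2" then show "w \<in> carrier_vec N \<and> (\<forall>i<j. b (v i) w = 0)" using c2 iso2 dualD(2)[OF d] by blast
  next
    assume w: "w \<in> carrier_vec N \<and> (\<forall>i<j. b (v i) w = 0)"
    then obtain w1 w2 where ww: "w1 \<in> L1" "w2 \<in> L2" "w = w1 + w2" using dec by blast
    have "b (v i) w1 = 0" if i: "i < j" for i
      using b_add_right[OF c2[OF dualD(2)[OF d i]] c1[OF ww(1)] c2[OF ww(2)]] iso2[OF dualD(2)[OF d i] ww(2)] w i ww(3) by simp
    then have "w1 = 0\<^sub>v N" using mx1[OF ww(1)] by blast
    then show "w \<in> L2" using ww c2 by simp
  qed
  have "N = 2 * j"
  proof (rule ccontr)
    assume "N \<noteq> 2 * j"
    then have jN: "2 * j < N" using dual_bound[OF d] by simp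
    define x where "x i = (if i < j then u i else v (i - j))" for i
    have xc: "x i \<in> carrier_vec N" if "i < 2 * j" for i
      using that dualD(1,2)[OF d] c1 c2 by (auto simp: x_def)
    \<comment> \<open>The conditions of orthogonality to the system, padded to a square matrix. Row
      \<open>2 * j\<close> is zero because the system is too small, so a nonzero solution
      exists.\<close>
    define A where "A = mat N N (\<lambda>(i, r). if i < 2 * j then (transpose_mat B *\<^sub>v x i) $ r else 0)"
    have Ac: "A \<in> carrier_mat N N" by (simp add: A_def)
    have zr: "A $$ (2 * j, r) = 0" if "r < N" for r
      using that jN by (simp add: A_def)
    obtain z where z: "z \<in> carrier_vec N" "z \<noteq> 0\<^sub>v N" "A *\<^sub>v z = 0\<^sub>v N"
      using kernel_vector_if_zero_row[OF Ac jN zr] by blast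
    have bz: "b (x i) z = 0" if i: "i < 2 * j" for i
    proof -
      have iN: "i < N" using i jN by simp
      have "(A *\<^sub>v z) $ i = (\<Sum>r\<in>{0..<N}. A $$ (i, r) * z $ r)"
        using iN Ac z(1) by (simp add: scalar_prod_def)
      also have "\<dots> = (transpose_mat B *\<^sub>v x i) \<bullet> z"
        using iN i z(1) by (simp add: scalar_prod_def A_def)
      also have "\<dots> = b (x i) z" unfolding bform_def by (rule transpose_vec_mult_scalar[OF Bc z(1) xc[OF i]])
      finally show ?thesis using z(3) iN by simp
    qed
    have "b (u i) z = 0" if "i < j" for i using bz[of i] that by (simp add: x_def)
    then have z1: "z \<in> L1" using char1 z(1) by blast
    have "b (v i) z = 0" if "i < j" for i using bz[of "i + j"] that by (simp add: x_def)
    then show False using mx1[OF z1] z(2) by blast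
  qed
  then show thesis using that d char1 char2 by blast
qed

text \<open>The columns of \<open>Q\<close> are the \<open>u i\<close> followed by the
  \<open>v i\<close>. Coordinates in this basis are, up to the sign \<open>\<epsilon>\<close>,
  pairings with the opposite half of the basis, which turns the descriptions of \<open>L1\<close>
  and \<open>L2\<close> into the vanishing of coordinates.\<close>

lemma hyperbolic_basis:
  obtains Q n where "N = n + n" "Q \<in> isometries N (hyp_form n \<epsilon>) B"
    "\<And>w. w \<in> L1 \<longleftrightarrow> w \<in> carrier_vec N \<and> (\<forall>i<n. (minv N Q *\<^sub>v w) $ (n + i) = 0)"
    "\<And>w. w \<in> L2 \<longleftrightarrow> w \<in> carrier_vec N \<and> (\<forall>i<n. (minv N Q *\<^sub>v w) $ i = 0)"
proof -
  obtain u v n where n: "N = 2 * n" and d: "dual n u v"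
    and char1: "\<And>w. w \<in> L1 \<longleftrightarrow> w \<in> carrier_vec N \<and> (\<forall>i<n. b (u i) w = 0)"
    and char2: "\<And>w. w \<in> L2 \<longleftrightarrow> w \<in> carrier_vec N \<and> (\<forall>i<n. b (v i) w = 0)"
    by (rule adapted_basis) blast
  have e0: "\<epsilon> \<noteq> 0" using \<epsilon> by auto
  have sf: "std_form N (hyp_form n \<epsilon>) (\<lambda>i. if i < n then i + n else i - n) (\<lambda>i. if i < n then 1 else \<epsilon>) \<epsilon>"
    using std_form_hyp[OF \<epsilon>] n by simp
  note h = std_form_props[OF sf]
  define x where "x i = (if i < n then u i else v (i - n))" for i
  have xc: "x i \<in> carrier_vec N" if "i < N" for i using that n dualD(1,2)[OF d] c1 c2 by (auto simp: x_def)
  define Q where "Q = mat N N (\<lambda>(r, i). x i $ r)"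
  have Qc: "Q \<in> carrier_mat N N" by (simp add: Q_def)
  have colQ: "col Q i = x i" if "i < N" for i by (rule eq_vecI) (use that xc[OF that] in \<open>auto simp: Q_def\<close>)
  have row: "(transpose_mat Q * B *\<^sub>v w) $ i = b (x i) w" if "w \<in> carrier_vec N" "i < N" for w i
  proof -
    have tQ: "transpose_mat Q \<in> carrier_mat N N" using Qc by simp
    have "transpose_mat Q * B *\<^sub>v w = transpose_mat Q *\<^sub>v (B *\<^sub>v w)" by (rule assoc_mult_mat_vec[OF tQ Bc that(1)])
    then show ?thesis using that Qc colQ[OF that(2)] by (simp add: bform_def)
  qed
  have TB: "transpose_mat Q * B \<in> carrier_mat N N" using Qc Bc by simp
  have Qform: "transpose_mat Q * B * Q = hyp_form n \<epsilon>"
  proof (rule eq_matI)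
    fix i k assume "i < dim_row (hyp_form n \<epsilon>)" "k < dim_col (hyp_form n \<epsilon>)"
    then have ik: "i < N" "k < N" using h(1) by auto
    have "(transpose_mat Q * B * Q) $$ (i, k) = (transpose_mat Q * B *\<^sub>v col Q k) $ i"
      using ik TB Qc by simp
    also have "\<dots> = b (x i) (x k)" unfolding colQ[OF ik(2)] using row[OF xc[OF ik(2)] ik(1)] .
    also have "\<dots> = hyp_form n \<epsilon> $$ (i, k)"
    proof -
      have hi: "hyp_form n \<epsilon> $$ (i, k) = (if k = (if i < n then i + n else i - n) then (if i < n then 1 else \<epsilon>) else 0)"
        using ik n by (simp add: hyp_form_def)
      have m: "l - n < n" if "l < N" "\<not> l < n" for l using that n by simp
      show ?thesis
      proof (cases "i < n")
        case True
        note T = True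
        show ?thesis
        proof (cases "k < n")
          case True then show ?thesis using T iso1[OF dualD(1)[OF d T] dualD(1)[OF d True]] by (simp add: hi x_def)
        next
          case False then show ?thesis using T dualD(3)[OF d T m[OF ik(2) False]] by (auto simp: hi x_def)
        qed
      next
        case False
        note F = False and mi = m[OF ik(1) False]
        show ?thesis
        proof (cases "k < n")
          case True
          have "b (v (i - n)) (u k) = \<epsilon> * b (u k) (v (i - n))"
            using b_sym[OF c1[OF dualD(1)[OF d True]] c2[OF dualD(2)[OF d mi]]] .
          then show ?thesis using F True dualD(3)[OF d True mi] by (auto simp: hi x_def)
        next
          case False then show ?thesis using F mi iso2[OF dualD(2)[OF d mi] dualD(2)[OF d m[OF ik(2) False]]] by (auto simp: hi x_def)
        qed
      qed
    qed
    finally show "(transpose_mat Q * B * Q) $$ (i, k) = hyp_form n \<epsilon> $$ (i, k)" .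
  qed (use Qc h(1) in auto)
  have Q: "Q \<in> isometries N (hyp_form n \<epsilon>) B" by (rule isometries_if_nondegenerate[OF Qc h(2) Bc Qform])
  note QG = isometriesD(1)[OF Q]
  have coord: "b (x i) w = (if i < n then 1 else \<epsilon>) * (minv N Q *\<^sub>v w) $ (if i < n then i + n else i - n)"
    if w: "w \<in> carrier_vec N" and i: "i < N" for w i
  proof -
    let ?z = "minv N Q *\<^sub>v w"
    have mv: "(hyp_form n \<epsilon> *\<^sub>v y) $ i = (\<Sum>r\<in>{0..<N}. hyp_form n \<epsilon> $$ (i, r) * y $ r)" if "y \<in> carrier_vec N" for y
      using i h(1) that by (simp add: scalar_prod_def)
    have zc: "?z \<in> carrier_vec N" using minv_carrier[OF QG] w by simp
    have "Q *\<^sub>v ?z = w" using assoc_mult_mat_vec[OF Qc minv_carrier[OF QG] w] minv_right[OF QG] w by simp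
    then have "transpose_mat Q * B *\<^sub>v w = transpose_mat Q * B * Q *\<^sub>v ?z"
      using assoc_mult_mat_vec[OF TB Qc zc] by simp
    then have "b (x i) w = (hyp_form n \<epsilon> *\<^sub>v ?z) $ i" using row[OF w i] unfolding Qform by simp
    also have "\<dots> = (\<Sum>r\<in>{0..<N}. hyp_form n \<epsilon> $$ (i, r) * ?z $ r)"
      by (rule mv[OF zc])
    also have "\<dots> = (\<Sum>r\<in>{0..<N}. if r = (if i < n then i + n else i - n) then (if i < n then 1 else \<epsilon>) * ?z $ (if i < n then i + n else i - n) else 0)"
      using i n by (intro sum.cong refl) (auto simp: hyp_form_def)
    also have "\<dots> = (if i < n then 1 else \<epsilon>) * ?z $ (if i < n then i + n else i - n)"
      using i n by (subst sum.delta) auto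
    finally show ?thesis .
  qed
  have u: "b (u i) w = (minv N Q *\<^sub>v w) $ (n + i)" if "w \<in> carrier_vec N" "i < n" for w i
    using coord[OF that(1), of i] that(2) n by (simp add: x_def add.commute)
  have v: "b (v i) w = 0 \<longleftrightarrow> (minv N Q *\<^sub>v w) $ i = 0" if "w \<in> carrier_vec N" "i < n" for w i
    using coord[OF that(1), of "i + n"] that(2) n e0 by (simp add: x_def)
  show thesis
  proof (rule that[OF _ Q])
    show "N = n + n" using n by simp
    show "w \<in> L1 \<longleftrightarrow> w \<in> carrier_vec N \<and> (\<forall>i<n. (minv N Q *\<^sub>v w) $ (n + i) = 0)" for w
      using char1[of w] u[of w] by auto
    show "w \<in> L2 \<longleftrightarrow> w \<in> carrier_vec N \<and> (\<forall>i<n. (minv N Q *\<^sub>v w) $ i = 0)" for w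
      using char2[of w] v[of w] by auto
  qed
qed

end

section \<open>Direct sums in the general linear group\<close>

lemma dsum_gm_id:
  "dsum (gm n (\<lambda>i. i) c) (gm k (\<lambda>i. i) d) = gm (n + k) (\<lambda>i. i) (\<lambda>i. if i < n then c i else d (i - n))"
proof (rule eq_matI)
  fix i j assume "i < dim_row (gm (n + k) (\<lambda>i. i) (\<lambda>i. if i < n then c i else d (i - n)))"
    "j < dim_col (gm (n + k) (\<lambda>i. i) (\<lambda>i. if i < n then c i else d (i - n)))"
  then have ij: "i < n + k" "j < n + k" by simp_all
  show "dsum (gm n (\<lambda>i. i) c) (gm k (\<lambda>i. i) d) $$ (i, j) = gm (n + k) (\<lambda>i. i) (\<lambda>i. if i < n then c i else d (i - n)) $$ (i, j)"
    unfolding dsum_index[OF gm_carrier gm_carrier ij] using ij by auto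
qed (auto simp: dsum_def)

lemma minv_scalar:
  assumes "c \<noteq> 0"
  shows "minv n (c \<cdot>\<^sub>m 1\<^sub>m n) = (1 / c) \<cdot>\<^sub>m 1\<^sub>m n"
proof (rule minv_eq)
  show "c \<cdot>\<^sub>m 1\<^sub>m n * ((1 / c) \<cdot>\<^sub>m 1\<^sub>m n) = 1\<^sub>m n"
    using assms by (simp add: mult_smult_distrib[of _ n n _ n] mult_smult_assoc_mat[of _ n n _ n] smult_smult smult_one)
qed simp_all

lemma transpose_scalar: "transpose_mat (c \<cdot>\<^sub>m 1\<^sub>m n) = (c \<cdot>\<^sub>m 1\<^sub>m n :: complex mat)"
  by (rule eq_matI) auto

lemma plus_dual_dsum:
  assumes "a \<in> GL_group n" "b \<in> GL_group k"
  shows "plus_dual (dsum a b) = dsum (dsum a b) (dsum (transpose_mat (minv n a)) (transpose_mat (minv k b)))"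
  unfolding plus_dual_eq[OF dsum_GL[OF assms]] minv_dsum[OF assms] dsum_transpose[OF minv_carrier[OF assms(1)] minv_carrier[OF assms(2)]] ..

lemma plus_dual_dsum_index:
  assumes a: "a \<in> GL_group n" and b: "b \<in> GL_group k"
  shows "i < n \<Longrightarrow> j < n \<Longrightarrow> plus_dual (dsum a b) $$ (i, j) = a $$ (i, j)"
    "i < k \<Longrightarrow> j < k \<Longrightarrow> plus_dual (dsum a b) $$ (n + i, n + j) = b $$ (i, j)"
    "i < n \<Longrightarrow> j < n \<Longrightarrow> plus_dual (dsum a b) $$ (n + k + i, n + k + j) = transpose_mat (minv n a) $$ (i, j)"
    "i < k \<Longrightarrow> j < k \<Longrightarrow> plus_dual (dsum a b) $$ (n + k + n + i, n + k + n + j) = transpose_mat (minv k b) $$ (i, j)"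
proof -
  have c: "a \<in> carrier_mat n n" "b \<in> carrier_mat k k" "transpose_mat (minv n a) \<in> carrier_mat n n" "transpose_mat (minv k b) \<in> carrier_mat k k"
    using GL_groupD[OF a] GL_groupD[OF b] minv_carrier[OF a] minv_carrier[OF b] by simp_all
  note d = plus_dual_dsum[OF a b]
  show "plus_dual (dsum a b) $$ (i, j) = a $$ (i, j)" if "i < n" "j < n"
    unfolding d using that c by (simp add: dsum_index[of _ "n + k" _ "n + k"] dsum_index[of _ n _ k] del: index_transpose_mat)
  show "plus_dual (dsum a b) $$ (n + i, n + j) = b $$ (i, j)" if "i < k" "j < k"
    unfolding d using that c by (simp add: dsum_index[of _ "n + k" _ "n + k"] dsum_index[of _ n _ k] del: index_transpose_mat)
  show "plus_dual (dsum a b) $$ (n + k + i, n + k + j) = transpose_mat (minv n a) $$ (i, j)" if "i < n" "j < n"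
    unfolding d using that c by (simp add: dsum_index[of _ "n + k" _ "n + k"] dsum_index[of _ n _ k] del: index_transpose_mat)
  show "plus_dual (dsum a b) $$ (n + k + n + i, n + k + n + j) = transpose_mat (minv k b) $$ (i, j)" if "i < k" "j < k"
    unfolding d using that c by (simp add: dsum_index[of _ "n + k" _ "n + k"] dsum_index[of _ n _ k] add.assoc del: index_transpose_mat)
qed

text \<open>A block diagonal matrix commutes with \<open>?D\<close>, hence so does its inverse,
  which is therefore block diagonal and inverts the blocks separately.\<close>

lemma dsum_GL_blocks:
  assumes "a \<in> carrier_mat n n" "b \<in> carrier_mat k k" "dsum a b \<in> GL_group (n + k)"
  shows "a \<in> GL_group n" "b \<in> GL_group k"
proof -
  obtain y where y: "y \<in> carrier_mat (n + k) (n + k)" "dsum a b * y = 1\<^sub>m (n + k)" "y * dsum a b = 1\<^sub>m (n + k)"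
    by (rule GL_obtain_inverse[OF assms(3)])
  let ?D = "gm (n + k) (\<lambda>i. i) (\<lambda>i. if i < n then 1 else -1)"
  have Dc: "?D \<in> carrier_mat (n + k) (n + k)" by simp
  have abc: "dsum a b \<in> carrier_mat (n + k) (n + k)" using assms by simp
  note cm = dsum_scalar_commute[OF assms(1,2), of 1 "-1"]
  have "y * ?D = y * ?D * (dsum a b * y)" using y Dc by (simp add: sq_mult[of _ "n + k"])
  also have "\<dots> = y * (?D * dsum a b) * y" using y(1) Dc abc by (simp add: sq_assoc[of _ "n + k"] sq_mult[of _ "n + k"])
  also have "\<dots> = (y * dsum a b) * (?D * y)" unfolding cm using y(1) Dc abc by (simp add: sq_assoc[of _ "n + k"] sq_mult[of _ "n + k"])
  also have "\<dots> = ?D * y" unfolding y(3) by (rule left_mult_one_mat[OF sq_mult[OF Dc y(1)]])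
  finally have yD: "y * ?D = ?D * y" .
  obtain c d where cd: "c \<in> carrier_mat n n" "d \<in> carrier_mat k k" "y = dsum c d"
    by (rule dsum_commute_blocks[OF y(1) yD]) simp_all
  have "dsum (a * c) (b * d) = dsum (1\<^sub>m n) (1\<^sub>m k)"
    using y(2) unfolding cd(3) dsum_mult[OF assms(1) cd(1) assms(2) cd(2)] dsum_one .
  then have "a * c = 1\<^sub>m n" "b * d = 1\<^sub>m k"
    using dsum_eq_iff[OF sq_mult[OF assms(1) cd(1)] one_carrier_mat sq_mult[OF assms(2) cd(2)] one_carrier_mat] by blast+
  then show "a \<in> GL_group n" "b \<in> GL_group k"
    using GL_group_if_right_inverse[OF assms(1) cd(1)] GL_group_if_right_inverse[OF assms(2) cd(2)] by blast+
qed

text \<open>A module and its dual both split under \<open>H\<close>, which makes four colours.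
  Partners are exchanged inside the module and inside the dual, never between the two, because
  \<open>G\<close> does not connect them; the form pairs colour 0 with 2 and colour 1 with
  3.\<close>

lemma see_saw_direct_sum_GL:
  assumes dp: "dual_pair m G G'" and sym: "symmetric_subgroup (2 * m) G H"
    and amp: "amplification ((n + k) + (n + k)) (2 * m) \<phi>" and n: "n > 0" "k > 0"
    and R: "R \<in> isometries (2 * m) (\<phi> (hyp_form (n + k) (-1))) (sympl_form m)"
    and G: "G = conj_by R ` \<phi> ` plus_dual ` GL_group (n + k)"
    and H: "H = conj_by R ` \<phi> ` plus_dual ` dprod (GL_group n) (GL_group k)"
  shows "dual_pair m H (centralizer (Sp_group m) H) \<and> symmetric_subgroup (2 * m) (centralizer (Sp_group m) H) G'"
proof -
  interpret p: amplification "(n + k) + (n + k)" "2 * m" \<phi> by (rule amp)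
  let ?h = "n + k" let ?N = "?h + ?h" and ?\<beta> = "hyp_form (n + k) (-1)" and ?w' = "1\<^sub>m (2 * m)"
  let ?Y = "plus_dual ` GL_group ?h" and ?X = "plus_dual ` dprod (GL_group n) (GL_group k)"
  define s0 where "s0 = gm ?h (\<lambda>i. i) (\<lambda>i. if i < n then 1 else (-1 :: complex))"
  define col where "col p = (if p < n then 0 else if p < n + k then 1 else if p < n + k + n then 2 else 3 :: nat)" for p :: nat
  define f where "f p = (if p < n then n else if p < n + k then 0 else if p < n + k + n then n + k + n else n + k)" for p :: nat
  define st where "st i = (if i < n + k then i + (n + k) else i - (n + k))" for i
  define dd where "dd i = (if i < n + k then 1 else (-1 :: complex))" for i
  have sf: "std_form ?N ?\<beta> st dd (-1)" using std_form_hyp[of "-1" ?h] unfolding st_def dd_def mult_2 by simp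
  note h = std_form_props[OF sf]
  have Bw: "\<phi> ?\<beta> * ?w' = \<phi> ?\<beta>" using right_mult_one_mat[OF p.car[OF h(1)]] .
  have w2: "\<phi> ?\<beta> * \<phi> ?\<beta> = (-1) \<cdot>\<^sub>m 1\<^sub>m (2 * m)"
    unfolding p.mul[OF h(1,1), symmetric] h(3) p.smu[OF one_carrier_mat] p.one ..
  have wd: "dagger (\<phi> ?\<beta>) = (-1) \<cdot>\<^sub>m \<phi> ?\<beta>"
    unfolding p.dag[OF h(1), symmetric] h(4) p.smu[OF h(1)] ..
  have XG: "dprod (GL_group n) (GL_group k) \<subseteq> GL_group ?h" using dsum_GL by (auto elim: dprodE)
  have s0G: "s0 \<in> GL_group ?h" unfolding s0_def by (rule gm_GL) auto
  have colour: "coloured ?N (2 * m) \<phi> col f st ?\<beta> ?w'"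
  proof (intro coloured.intro amp coloured_axioms.intro)
    note s = std_formD[OF sf]
    show "f p < ?N" if "p < ?N" for p using n by (simp add: f_def)
    show "f p = f q" if "col p = col q" for p q using that by (auto simp: f_def col_def split: if_splits)
    show "col (f (f p)) = col p" for p using n by (auto simp: f_def col_def)
    show "st p < ?N" if "p < ?N" for p using s(2)[OF that] by blast
    show "col (f (st p)) = col (st (f p))" if p: "p < ?N" for p
    proof -
      consider "p < n" | "n \<le> p" "p < n + k" | "n + k \<le> p" "p < n + k + n" | "n + k + n \<le> p" "p < n + k + n + k"
        using p by linarith
      then show ?thesis 
      proof cases
        case 4
        then have "p - (n + k) < n + k" "\<not> p - (n + k) < n" by linarith+
        then show ?thesis using 4 n by (simp add: col_def f_def st_def)
      qed (use n in \<open>simp_all add: col_def f_def st_def\<close>)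
    qed
    show "?\<beta> \<in> carrier_mat ?N ?N" by (rule h(1))
    show "?\<beta> $$ (p, q) = 0" if "p < ?N" "q < ?N" "q \<noteq> st p" for p q unfolding s(1) using that by simp
    show "?\<beta> $$ (p, st p) \<noteq> 0" if "p < ?N" for p unfolding s(1) using s(2,5)[OF that] that by simp
    show "?w' \<in> carrier_mat (2 * m) (2 * m)" by simp
    show "?w' * \<phi> a = \<phi> a * ?w'" if "a \<in> carrier_mat ?N ?N" for a
      using left_mult_one_mat[OF p.car[OF that]] right_mult_one_mat[OF p.car[OF that]] by simp
  qed
  have pd2: "plus_dual (dsum (c \<cdot>\<^sub>m 1\<^sub>m n) (d \<cdot>\<^sub>m 1\<^sub>m k)) =
    gm ?N (\<lambda>i. i) (\<lambda>i. if i < n + k then (if i < n then c else d) else (if i - (n + k) < n then 1 / c else 1 / d))"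
    "plus_dual (dsum (c \<cdot>\<^sub>m 1\<^sub>m n) (d \<cdot>\<^sub>m 1\<^sub>m k)) \<in> ?X"
    if "c \<noteq> 0" "d \<noteq> 0" for c d
  proof -
    note sc = plus_dual_scalar(1)[OF that(1), of n] plus_dual_scalar(1)[OF that(2), of k]
    show "plus_dual (dsum (c \<cdot>\<^sub>m 1\<^sub>m n) (d \<cdot>\<^sub>m 1\<^sub>m k)) =
      gm ?N (\<lambda>i. i) (\<lambda>i. if i < n + k then (if i < n then c else d) else (if i - (n + k) < n then 1 / c else 1 / d))"
      unfolding plus_dual_dsum[OF sc]
      unfolding minv_scalar[OF that(1)] minv_scalar[OF that(2)] transpose_scalar dsum_scalar_gm
      unfolding dsum_gm_id ..
    show "plus_dual (dsum (c \<cdot>\<^sub>m 1\<^sub>m n) (d \<cdot>\<^sub>m 1\<^sub>m k)) \<in> ?X" using dprodI[OF sc] by blast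
  qed
  show ?thesis
  proof (rule see_saw_swap[OF dp sym _ _ _ _ _ colour G H, unfolded Bw, OF R w2 wd, where s = "plus_dual s0"])
    show "?X \<subseteq> ?Y" using XG by blast
    show "?Y \<subseteq> carrier_mat ?N ?N" using plus_dual_carrier by blast
    show "dagger x \<in> ?X" if x: "x \<in> ?X" for x
    proof -
      obtain g where g: "g \<in> dprod (GL_group n) (GL_group k)" "x = plus_dual g" using x by blast
      obtain a b where ab: "a \<in> GL_group n" "b \<in> GL_group k" "g = dsum a b" using g(1) by (rule dprodE)
      have "dagger g \<in> dprod (GL_group n) (GL_group k)"
        unfolding ab(3) dsum_dagger[OF GL_groupD[OF ab(1)] GL_groupD[OF ab(2)]] using dprodI[OF dagger_GL[OF ab(1)] dagger_GL[OF ab(2)]] .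
      moreover have "dagger x = plus_dual (dagger g)" unfolding g(2) using dagger_plus_dual XG g(1) by blast
      ultimately show ?thesis by blast
    qed
    show "x $$ (p, q) = 0" if x: "x \<in> ?X" and pq: "p < ?N" "q < ?N" "col p \<noteq> col q" for x p q
    proof -
      obtain g where g: "g \<in> dprod (GL_group n) (GL_group k)" "x = plus_dual g" using x by blast
      obtain a b where ab: "a \<in> GL_group n" "b \<in> GL_group k" "g = dsum a b" using g(1) by (rule dprodE)
      have c: "a \<in> carrier_mat n n" "b \<in> carrier_mat k k" "transpose_mat (minv n a) \<in> carrier_mat n n" "transpose_mat (minv k b) \<in> carrier_mat k k"
        using GL_groupD[OF ab(1)] GL_groupD[OF ab(2)] minv_carrier[OF ab(1)] minv_carrier[OF ab(2)] by simp_all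
      have "\<not> (p < ?h \<and> q < ?h) \<or> dsum a b $$ (p, q) = 0"
        using pq dsum_index[OF c(1,2), of p q] by (auto simp: col_def split: if_splits)
      moreover have "\<not> (p \<ge> ?h \<and> q \<ge> ?h) \<or> dsum (transpose_mat (minv n a)) (transpose_mat (minv k b)) $$ (p - ?h, q - ?h) = 0"
        using pq dsum_index[OF c(3,4), of "p - ?h" "q - ?h"] by (auto simp: col_def split: if_splits)
      ultimately show ?thesis
        unfolding g(2) ab(3) plus_dual_dsum[OF ab(1,2)] dsum_index[OF dsum_carrier[OF c(1,2)] dsum_carrier[OF c(3,4)] pq(1,2)] by auto
    qed
    show "eu ?N p q \<in> S" if S: "subalgebra ?N S" "?X \<subseteq> S" and pq: "p < ?N" "q < ?N" "col p = col q" for S p q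
    proof -
      \<comment> \<open>The first element acts by 2, 1, 1/2, 1 on the four blocks, the second by 1,
        2, 1, 1/2. The quadratics below interpolate the values 1, 0, 0 at 2, 1, 1/2 and at 1/2, 1,
        2, respectively.\<close>
      have D1: "plus_dual (dsum (2 \<cdot>\<^sub>m 1\<^sub>m n) (1 \<cdot>\<^sub>m 1\<^sub>m k)) \<in> S" and D2: "plus_dual (dsum (1 \<cdot>\<^sub>m 1\<^sub>m n) (2 \<cdot>\<^sub>m 1\<^sub>m k)) \<in> S"
        using pd2(2)[of 2 1] pd2(2)[of 1 2] S(2) by auto
      have c21: "(2 :: complex) \<noteq> 0" "(1 :: complex) \<noteq> 0" and c12: "(1 :: complex) \<noteq> 0" "(2 :: complex) \<noteq> 0" by simp_all
      note D1' = D1[unfolded pd2(1)[OF c21]] and D2' = D2[unfolded pd2(1)[OF c12]]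
      have pr: "proj ?N 0 n \<in> S" "proj ?N n k \<in> S" "proj ?N (n + k) n \<in> S" "proj ?N (n + k + n) k \<in> S"
      proof -
        show "proj ?N 0 n \<in> S" unfolding proj_def
          by (rule diag_in_subalgebra[OF S(1) D1', where p = "[:1/3, -1, 2/3:]"]) auto
        show "proj ?N (n + k) n \<in> S" unfolding proj_def
          by (rule diag_in_subalgebra[OF S(1) D1', where p = "[:8/3, -4, 4/3:]"]) auto
        show "proj ?N n k \<in> S" unfolding proj_def
          by (rule diag_in_subalgebra[OF S(1) D2', where p = "[:1/3, -1, 2/3:]"]) auto
        show "proj ?N (n + k + n) k \<in> S" unfolding proj_def
          by (rule diag_in_subalgebra[OF S(1) D2', where p = "[:8/3, -4, 4/3:]"]) auto
      qed
      have x1: "plus_dual (dsum g (1\<^sub>m k)) \<in> S" if "g \<in> GL_group n" for g using dprodI[OF that one_in_GL] S(2) by blast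
      have x2: "plus_dual (dsum (1\<^sub>m n) g) \<in> S" if "g \<in> GL_group k" for g using dprodI[OF one_in_GL that] S(2) by blast
      have Gc: "GL_group l \<subseteq> carrier_mat l l" for l using GL_groupD by blast
      have e1: "\<exists>x\<in>S. \<forall>i<n. \<forall>j<n. x $$ (0 + i, 0 + j) = g $$ (i, j)" if "g \<in> GL_group n" for g
        using plus_dual_dsum_index(1)[OF that one_in_GL[of k]] by (intro bexI[OF _ x1[OF that]]) simp
      have e2: "\<exists>x\<in>S. \<forall>i<k. \<forall>j<k. x $$ (n + i, n + j) = g $$ (i, j)" if "g \<in> GL_group k" for g
        using plus_dual_dsum_index(2)[OF one_in_GL[of n] that] by (intro bexI[OF _ x2[OF that]]) simp
      have e3: "\<exists>x\<in>S. \<forall>i<n. \<forall>j<n. x $$ (n + k + i, n + k + j) = g $$ (i, j)" if g: "g \<in> GL_group n" for g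
      proof -
        obtain u where u: "u \<in> GL_group n" "transpose_mat (minv n u) = g" by (rule inverse_transpose_surj[OF g])
        show ?thesis using plus_dual_dsum_index(3)[OF u(1) one_in_GL[of k]] unfolding u(2) by (intro bexI[OF _ x1[OF u(1)]]) simp
      qed
      have e4: "\<exists>x\<in>S. \<forall>i<k. \<forall>j<k. x $$ (n + k + n + i, n + k + n + j) = g $$ (i, j)" if g: "g \<in> GL_group k" for g
      proof -
        obtain u where u: "u \<in> GL_group k" "transpose_mat (minv k u) = g" by (rule inverse_transpose_surj[OF g])
        show ?thesis using plus_dual_dsum_index(4)[OF one_in_GL[of n] u(1)] unfolding u(2) by (intro bexI[OF _ x2[OF u(1)]]) simp
      qed
      consider "p < n" "q < n" | "n \<le> p" "p < n + k" "n \<le> q" "q < n + k"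
        | "n + k \<le> p" "p < n + k + n" "n + k \<le> q" "q < n + k + n"
        | "n + k + n \<le> p" "p < n + k + n + k" "n + k + n \<le> q" "q < n + k + n + k"
        using pq by (auto simp: col_def split: if_splits)
      then show ?thesis
      proof cases
        case 1 then show ?thesis using eu_in_subalgebra_if_block[OF S(1) _ pr(1) generating_GL Gc e1, of p q] by simp
      next
        case 2 then show ?thesis using eu_in_subalgebra_if_block[OF S(1) _ pr(2) generating_GL Gc e2, of p q] by simp
      next
        case 3 then show ?thesis using eu_in_subalgebra_if_block[OF S(1) _ pr(3) generating_GL Gc e3, of p q] by simp
      next
        case 4 then show ?thesis using eu_in_subalgebra_if_block[OF S(1) _ pr(4) generating_GL Gc e4, of p q] by simp
      qed
    qed
    show "y $$ (p, q) = 0" if y: "y \<in> ?Y" and pq: "p < ?N" "q < ?N" "col p \<noteq> col q" "col p \<noteq> col (f q)" for y p q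
    proof -
      obtain g where g: "g \<in> GL_group ?h" "y = plus_dual g" using y by blast
      have c: "g \<in> carrier_mat ?h ?h" "transpose_mat (minv ?h g) \<in> carrier_mat ?h ?h" using GL_groupD[OF g(1)] minv_carrier[OF g(1)] by simp_all
      have "p < ?h \<longleftrightarrow> q \<ge> ?h" using pq n by (auto simp: col_def f_def split: if_splits)
      then show ?thesis unfolding g(2) plus_dual_eq[OF g(1)] dsum_index[OF c pq(1,2)] by auto
    qed
    show "eu ?N p (f p) \<in> S" if S: "subalgebra ?N S" "?Y \<subseteq> S" and p: "p < ?N" for S p
    proof (rule halves_eu_in_subalgebra[OF S(1) _ _ generating_GL order_refl _ S(2) p])
      have "plus_dual (2 \<cdot>\<^sub>m 1\<^sub>m ?h) \<in> S" using plus_dual_scalar(1)[of 2 ?h] S(2) by auto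
      \<comment> \<open>The eigenvalue is 2 on the module and 1/2 on its dual, so linear polynomials
        separate the two.\<close>
      then have D: "gm ?N (\<lambda>i. i) (\<lambda>i. if i < ?h then 2 else 1 / 2) \<in> S" using plus_dual_scalar(2)[of 2 ?h] by simp
      show "proj ?N 0 ?h \<in> S" unfolding proj_def
        by (rule diag_in_subalgebra[OF S(1) D, where p = "[:-1/3, 2/3:]"]) auto
      show "proj ?N ?h ?h \<in> S" unfolding proj_def
        by (rule diag_in_subalgebra[OF S(1) D, where p = "[:4/3, -2/3:]"]) auto
      show "\<exists>h\<in>GL_group ?h. transpose_mat (minv ?h h) = g" if "g \<in> GL_group ?h" for g
        by (rule inverse_transpose_surj[OF that]) blast
      show "f p < ?N" "p < ?h \<longleftrightarrow> f p < ?h" using n p by (auto simp: f_def)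
    qed
    show "plus_dual s0 \<in> isometries ?N ?\<beta> ?\<beta>" using plus_dual_isometry[OF s0G, of "-1"] by simp
    show "plus_dual s0 * x = x * plus_dual s0" if x: "x \<in> ?X" for x
    proof -
      obtain g where g: "g \<in> dprod (GL_group n) (GL_group k)" "x = plus_dual g" using x by blast
      obtain a b where ab: "a \<in> GL_group n" "b \<in> GL_group k" "g = dsum a b" using g(1) by (rule dprodE)
      have gG: "g \<in> GL_group ?h" using g(1) XG by blast
      have "s0 * g = g * s0" unfolding ab(3) s0_def by (rule dsum_scalar_commute[OF GL_groupD[OF ab(1)] GL_groupD[OF ab(2)]])
      then show ?thesis unfolding g(2) plus_dual_mult[OF s0G gG, symmetric] plus_dual_mult[OF gG s0G, symmetric] by simp
    qed
    show "y \<in> ?X" if y: "y \<in> ?Y" "y * plus_dual s0 = plus_dual s0 * y" for y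
    proof -
      obtain g where g: "g \<in> GL_group ?h" "y = plus_dual g" using y(1) by blast
      have "plus_dual (g * s0) = plus_dual (s0 * g)"
        using y(2) unfolding g(2) plus_dual_mult[OF s0G g(1)] plus_dual_mult[OF g(1) s0G] .
      then have c: "g * s0 = s0 * g" using plus_dual_inj[OF GL_group_mult[OF g(1) s0G] GL_group_mult[OF s0G g(1)]] by blast
      obtain a b where ab: "a \<in> carrier_mat n n" "b \<in> carrier_mat k k" "g = dsum a b"
        by (rule dsum_commute_blocks[OF GL_groupD[OF g(1)] c[unfolded s0_def]]) simp_all
      have "g \<in> dprod (GL_group n) (GL_group k)"
        unfolding ab(3) using dsum_GL_blocks[OF ab(1,2)] g(1) ab(3) by (intro dprodI) blast+
      then show ?thesis using g(2) by blast
    qed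
  qed simp_all
qed

section \<open>Stabilizers of polarizations\<close>

lemma polarized_if_polarization:
  assumes p: "polarization N B L1 L2" and B: "B \<in> GL_group N" "transpose_mat B = \<epsilon> \<cdot>\<^sub>m B" "\<epsilon> = 1 \<or> \<epsilon> = -1"
  shows "polarized N B \<epsilon> L1 L2"
proof -
  have iso: "isotropic N B L1" "isotropic N B L2" and sum: "{u + v | u v. u \<in> L1 \<and> v \<in> L2} = carrier_vec N"
    using p by (simp_all add: polarization_def maximal_isotropic_def)
  have sub: "L \<subseteq> carrier_vec N" "\<And>u v. u \<in> L \<Longrightarrow> v \<in> L \<Longrightarrow> u + v \<in> L" "\<And>u c. u \<in> L \<Longrightarrow> c \<cdot>\<^sub>v u \<in> L"
    "\<And>u v. u \<in> L \<Longrightarrow> v \<in> L \<Longrightarrow> bform B u v = 0" if L: "isotropic N B L" for L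
  proof -
    have s: "submodule class_ring L (module_vec TYPE(complex) N)"
      using L by (simp add: isotropic_def VectorSpace.subspace_def)
    show "L \<subseteq> carrier_vec N" using submodule.subset[OF s] by (simp add: module_vec_simps)
    show "u + v \<in> L" if "u \<in> L" "v \<in> L" for u v using submodule.m_closed[OF s that] by (simp add: module_vec_simps)
    show "c \<cdot>\<^sub>v u \<in> L" if "u \<in> L" for u c using submodule.smult_closed[OF s _ that, of c] by (simp add: module_vec_simps class_ring_simps)
    show "bform B u v = 0" if "u \<in> L" "v \<in> L" for u v using L that by (simp add: isotropic_def bform_def)
  qed
  show ?thesis
  proof
    show "B \<in> GL_group N" "transpose_mat B = \<epsilon> \<cdot>\<^sub>m B" "\<epsilon> = 1 \<or> \<epsilon> = -1" by (fact B)+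
    show "L1 \<subseteq> carrier_vec N" "L2 \<subseteq> carrier_vec N" using sub(1) iso by blast+
    show "u + v \<in> L1" if "u \<in> L1" "v \<in> L1" for u v using sub(2)[OF iso(1) that] .
    show "u + v \<in> L2" if "u \<in> L2" "v \<in> L2" for u v using sub(2)[OF iso(2) that] .
    show "c \<cdot>\<^sub>v u \<in> L1" if "u \<in> L1" for u c using sub(3)[OF iso(1) that] .
    show "c \<cdot>\<^sub>v u \<in> L2" if "u \<in> L2" for u c using sub(3)[OF iso(2) that] .
    show "bform B u v = 0" if "u \<in> L1" "v \<in> L1" for u v using sub(4)[OF iso(1) that] .
    show "bform B u v = 0" if "u \<in> L2" "v \<in> L2" for u v using sub(4)[OF iso(2) that] .
    show "\<exists>u\<in>L1. \<exists>v\<in>L2. x = u + v" if x: "x \<in> carrier_vec N" for x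
      using x unfolding sum[symmetric] by blast
  qed
qed

lemma dsum_mult_vec_index:
  assumes "a \<in> carrier_mat n n" "b \<in> carrier_mat k k" "x \<in> carrier_vec (n + k)"
  shows "i < n \<Longrightarrow> (dsum a b *\<^sub>v x) $ i = (\<Sum>j<n. a $$ (i, j) * x $ j)"
    "i < k \<Longrightarrow> (dsum a b *\<^sub>v x) $ (n + i) = (\<Sum>j<k. b $$ (i, j) * x $ (n + j))"
proof -
  have e: "(dsum a b *\<^sub>v x) $ l = (\<Sum>j\<in>{0..<n + k}. dsum a b $$ (l, j) * x $ j)" if "l < n + k" for l
  proof -
    have "dsum a b \<in> carrier_mat (n + k) (n + k)" using assms by simp
    then show ?thesis using that assms(3) by (simp add: scalar_prod_def)
  qed
  have split: "(\<Sum>j\<in>{0..<n + k}. g j) = (\<Sum>j<n. g j) + (\<Sum>j<k. g (n + j))" for g :: "nat \<Rightarrow> complex"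
  proof -
    have "(\<Sum>j\<in>{0..<n + k}. g j) = (\<Sum>j\<in>{0..<n}. g j) + (\<Sum>j\<in>{n..<n + k}. g j)"
      by (rule sum.atLeastLessThan_concat[symmetric]) auto
    also have "(\<Sum>j\<in>{n..<n + k}. g j) = (\<Sum>j\<in>{0..<k}. g (j + n))"
      using sum.shift_bounds_nat_ivl[of g 0 n k] by (simp add: add.commute)
    finally show ?thesis by (simp add: atLeast0LessThan add.commute)
  qed
  show "(dsum a b *\<^sub>v x) $ i = (\<Sum>j<n. a $$ (i, j) * x $ j)" if i: "i < n"
    unfolding e[OF trans_less_add1[OF i]] split using i assms by (simp add: dsum_index[of _ n _ k])
  show "(dsum a b *\<^sub>v x) $ (n + i) = (\<Sum>j<k. b $$ (i, j) * x $ (n + j))" if i: "i < k"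
    unfolding e[OF add_strict_left_mono[OF i]] split using i assms by (simp add: dsum_index[of _ n _ k])
qed

text \<open>\<open>pair_stabilizer\<close> asks for equality of the image with the subspace; the
  inclusion in the other direction is obtained from the inverse rather than from dimensions.\<close>

lemma image_eq_if_inverse_closed:
  assumes g: "g \<in> GL_group N" and L: "L \<subseteq> carrier_vec N"
    and "\<And>w. w \<in> L \<Longrightarrow> g *\<^sub>v w \<in> L" "\<And>w. w \<in> L \<Longrightarrow> minv N g *\<^sub>v w \<in> L"
  shows "(*\<^sub>v) g ` L = L"
proof (intro equalityI subsetI)
  fix w assume w: "w \<in> L"
  have "g *\<^sub>v (minv N g *\<^sub>v w) = w"
    using assoc_mult_mat_vec[OF GL_groupD[OF g] minv_carrier[OF g], of w] minv_right[OF g] w L by auto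
  then show "w \<in> (*\<^sub>v) g ` L" using assms(4)[OF w] by (metis image_eqI)
qed (use assms(3) in auto)

text \<open>In the hyperbolic basis the two subspaces are the coordinate halves. An isometry that
  stabilizes both is block diagonal, and the block diagonal isometries are the matrices
  \<open>plus_dual h\<close>.\<close>

lemma pair_stabilizer_eq:
  assumes p: "polarized N B \<epsilon> L1 L2"
  obtains Q n where "N = n + n" "Q \<in> isometries N (hyp_form n \<epsilon>) B"
    "pair_stabilizer (isometries N B B) L1 L2 = conj_by Q ` plus_dual ` GL_group n"
proof -
  interpret polarized N B \<epsilon> L1 L2 by (rule p)
  obtain Q n where n: "N = n + n" and Q: "Q \<in> isometries N (hyp_form n \<epsilon>) B"
    and ch1: "\<And>w. w \<in> L1 \<longleftrightarrow> w \<in> carrier_vec N \<and> (\<forall>i<n. (minv N Q *\<^sub>v w) $ (n + i) = 0)"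
    and ch2: "\<And>w. w \<in> L2 \<longleftrightarrow> w \<in> carrier_vec N \<and> (\<forall>i<n. (minv N Q *\<^sub>v w) $ i = 0)"
    by (rule hyperbolic_basis) blast
  note QG = isometriesD(1)[OF Q]
  note Qc = GL_groupD[OF QG] and Q'c = minv_carrier[OF QG]
  have hc: "hyp_form n \<epsilon> \<in> carrier_mat N N" using n by (simp add: hyp_form_def mult_2)
  note cj = isometries_conj_by[OF Q hc Bc]
  have coord: "minv N Q *\<^sub>v (conj_by Q y *\<^sub>v w) = y *\<^sub>v (minv N Q *\<^sub>v w)" if "y \<in> carrier_mat N N" "w \<in> carrier_vec N" for y w
  proof -
    note Q'w = mult_mat_vec_carrier[OF Q'c that(2)]
    note yw = mult_mat_vec_carrier[OF that(1) Q'w]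
    have "conj_by Q y *\<^sub>v w = Q *\<^sub>v (y *\<^sub>v (minv N Q *\<^sub>v w))"
      unfolding conj_by_eq[OF QG] assoc_mult_mat_vec[OF sq_mult[OF Qc that(1)] Q'c that(2)] by (rule assoc_mult_mat_vec[OF Qc that(1) Q'w])
    then show ?thesis
      using assoc_mult_mat_vec[OF Q'c Qc yw] minv_left[OF QG] yw by simp
  qed
  have stab: "conj_by Q (plus_dual h) *\<^sub>v w \<in> L1" if h: "h \<in> GL_group n" and w: "w \<in> L1" for h w
  proof -
    have pc: "plus_dual h \<in> carrier_mat N N" using plus_dual_carrier[OF h] n by simp
    have wc: "w \<in> carrier_vec N" using w c1 by blast
    have xc: "minv N Q *\<^sub>v w \<in> carrier_vec (n + n)" using mult_mat_vec_carrier[OF Q'c wc] n by simp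
    have hc': "h \<in> carrier_mat n n" "transpose_mat (minv n h) \<in> carrier_mat n n" using GL_groupD[OF h] minv_carrier[OF h] by simp_all
    have "(plus_dual h *\<^sub>v (minv N Q *\<^sub>v w)) $ (n + i) = 0" if i: "i < n" for i
      unfolding plus_dual_eq[OF h] dsum_mult_vec_index(2)[OF hc' xc i] using w ch1[of w] by (intro sum.neutral) simp
    moreover have "conj_by Q (plus_dual h) *\<^sub>v w \<in> carrier_vec N" by (rule mult_mat_vec_carrier[OF conj_by_carrier[OF QG pc] wc])
    ultimately show ?thesis unfolding ch1 coord[OF pc wc] by blast
  qed
  have stab2: "conj_by Q (plus_dual h) *\<^sub>v w \<in> L2" if h: "h \<in> GL_group n" and w: "w \<in> L2" for h w
  proof -
    have pc: "plus_dual h \<in> carrier_mat N N" using plus_dual_carrier[OF h] n by simp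
    have wc: "w \<in> carrier_vec N" using w c2 by blast
    have xc: "minv N Q *\<^sub>v w \<in> carrier_vec (n + n)" using mult_mat_vec_carrier[OF Q'c wc] n by simp
    have hc': "h \<in> carrier_mat n n" "transpose_mat (minv n h) \<in> carrier_mat n n" using GL_groupD[OF h] minv_carrier[OF h] by simp_all
    have "(plus_dual h *\<^sub>v (minv N Q *\<^sub>v w)) $ i = 0" if i: "i < n" for i
      unfolding plus_dual_eq[OF h] dsum_mult_vec_index(1)[OF hc' xc i] using w ch2[of w] by (intro sum.neutral) simp
    moreover have "conj_by Q (plus_dual h) *\<^sub>v w \<in> carrier_vec N" by (rule mult_mat_vec_carrier[OF conj_by_carrier[OF QG pc] wc])
    ultimately show ?thesis unfolding ch2 coord[OF pc wc] by blast
  qed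
  have "pair_stabilizer (isometries N B B) L1 L2 = conj_by Q ` plus_dual ` GL_group n"
  proof (intro equalityI subsetI)
    fix g assume "g \<in> conj_by Q ` plus_dual ` GL_group n"
    then obtain h where h: "h \<in> GL_group n" "g = conj_by Q (plus_dual h)" by blast
    have hi: "plus_dual h \<in> isometries N (hyp_form n \<epsilon>) (hyp_form n \<epsilon>)" unfolding n by (rule plus_dual_isometry[OF h(1) \<epsilon>])
    then have gi: "g \<in> isometries N B B" unfolding cj h(2) by blast
    have pG: "plus_dual h \<in> GL_group N" using plus_dual_GL[OF h(1)] n by simp
    have inv: "minv N g = conj_by Q (plus_dual (minv n h))"
      unfolding h(2) minv_conj_by[OF QG pG] using minv_plus_dual[OF h(1)] n by simp
    have "(*\<^sub>v) g ` L1 = L1"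
      by (rule image_eq_if_inverse_closed[OF isometriesD(1)[OF gi] L1(1)])
        (simp_all only: inv, simp_all only: h(2) stab[OF h(1)] stab[OF minv_GL[OF h(1)]])
    moreover have "(*\<^sub>v) g ` L2 = L2"
      by (rule image_eq_if_inverse_closed[OF isometriesD(1)[OF gi] L2(1)])
        (simp_all only: inv, simp_all only: h(2) stab2[OF h(1)] stab2[OF minv_GL[OF h(1)]])
    ultimately show "g \<in> pair_stabilizer (isometries N B B) L1 L2" using gi by (simp add: pair_stabilizer_def)
  next
    fix g assume "g \<in> pair_stabilizer (isometries N B B) L1 L2"
    then have g: "g \<in> isometries N B B" "\<And>w. w \<in> L1 \<Longrightarrow> g *\<^sub>v w \<in> L1" "\<And>w. w \<in> L2 \<Longrightarrow> g *\<^sub>v w \<in> L2"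
      by (auto simp: pair_stabilizer_def)
    obtain y where y: "y \<in> isometries N (hyp_form n \<epsilon>) (hyp_form n \<epsilon>)" "g = conj_by Q y" using g(1) unfolding cj by blast
    have yc: "y \<in> carrier_mat N N" using isometriesD(2)[OF y(1)] .
    have colQ: "col Q j \<in> carrier_vec N" "minv N Q *\<^sub>v col Q j = unit_vec N j" if "j < N" for j
    proof -
      show c: "col Q j \<in> carrier_vec N" using Qc by auto
      have u: "unit_vec N j \<in> carrier_vec N" by simp
      have "Q *\<^sub>v unit_vec N j = col Q j" by (rule eq_vecI) (use Qc that in auto)
      then show "minv N Q *\<^sub>v col Q j = unit_vec N j" using assoc_mult_mat_vec[OF Q'c Qc u] minv_left[OF QG] by simp
    qed
    \<comment> \<open>The basis vectors lie in the subspaces themselves, so stability is read off as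
      the vanishing of off-diagonal entries of \<open>y\<close>.\<close>
    have colQ1: "col Q j \<in> L1" if "j < n" for j unfolding ch1 using colQ[of j] that n by auto
    have colQ2: "col Q (n + j) \<in> L2" if "j < n" for j unfolding ch2 using colQ[of "n + j"] that n by auto
    have ent: "(minv N Q *\<^sub>v (g *\<^sub>v col Q j)) $ i = y $$ (i, j)" if "i < N" "j < N" for i j
    proof -
      have "minv N Q *\<^sub>v (g *\<^sub>v col Q j) = y *\<^sub>v unit_vec N j" unfolding y(2) coord[OF yc colQ(1)[OF that(2)]] colQ(2)[OF that(2)] ..
      then show ?thesis using yc that by simp
    qed
    obtain a b where ab: "a \<in> carrier_mat n n" "b \<in> carrier_mat n n" "y = dsum a b"
    proof (rule dsum_blocks[of y n n])
      show "y \<in> carrier_mat (n + n) (n + n)" using yc n by simp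
      fix i j assume ij: "i < n" "j < n"
      have "y $$ (n + j, i) = 0" using ent[of "n + j" i] g(2)[OF colQ1[OF ij(1)]] ij n ch1 by simp
      moreover have "y $$ (i, n + j) = 0" using ent[of i "n + j"] g(3)[OF colQ2[OF ij(2)]] ij n ch2 by simp
      ultimately show "y $$ (i, n + j) = 0 \<and> y $$ (n + j, i) = 0" by blast
    qed blast
    have "dsum a b \<in> isometries (n + n) (hyp_form n \<epsilon>) (hyp_form n \<epsilon>)" using y(1) unfolding ab(3) n .
    then show "g \<in> conj_by Q ` plus_dual ` GL_group n"
      unfolding y(2) ab(3) using plus_dual_if_dsum_isometry[OF ab(1,2) \<epsilon>] by simp
  qed
  then show thesis using that n Q by blast
qed

section \<open>Change of basis\<close>

context amplification
begin

text \<open>A change of basis \<open>Q\<close> of the standard module becomes the change of basis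
  \<open>\<phi> Q\<close> after amplification and is absorbed into \<open>P\<close>.\<close>

lemma conj_by_image:
  assumes "P \<in> GL_group M" "Q \<in> GL_group N" "X \<subseteq> carrier_mat N N"
  shows "conj_by P ` \<phi> ` conj_by Q ` X = conj_by (P * \<phi> Q) ` \<phi> ` X"
proof -
  have "conj_by P (\<phi> (conj_by Q x)) = conj_by (P * \<phi> Q) (\<phi> x)" if "x \<in> X" for x
  proof -
    have x: "x \<in> carrier_mat N N" using that assms(3) by blast
    note q = GL_groupD[OF assms(2)] minv_carrier[OF assms(2)]
    have "\<phi> (conj_by Q x) = conj_by (\<phi> Q) (\<phi> x)"
      unfolding conj_by_eq[OF assms(2)] conj_by_eq[OF GL[OF assms(2)]] minv[OF assms(2)]
        mul[OF sq_mult[OF q(1) x] q(2)] mul[OF q(1) x] ..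
    then show ?thesis using conj_by_comp[OF assms(1) GL[OF assms(2)] car[OF x]] by simp
  qed
  then show ?thesis unfolding image_image by (intro image_cong) simp_all
qed

lemma isometry:
  assumes w': "w' \<in> carrier_mat M M" "\<And>a. a \<in> carrier_mat N N \<Longrightarrow> w' * \<phi> a = \<phi> a * w'"
    and \<beta>: "\<beta> \<in> carrier_mat N N" and Q: "Q \<in> isometries N \<delta> \<beta>"
  shows "\<phi> Q \<in> isometries M (\<phi> \<delta> * w') (\<phi> \<beta> * w')"
proof -
  note q = isometriesD[OF Q]
  have t: "transpose_mat Q \<in> carrier_mat N N" using q(2) by simp
  have "transpose_mat (\<phi> Q) * (\<phi> \<beta> * w') * \<phi> Q = \<phi> (transpose_mat Q) * (\<phi> \<beta> * (w' * \<phi> Q))"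
    unfolding trn[OF q(2), symmetric] using car[OF q(2)] car[OF \<beta>] car[OF t] w'(1) by (simp add: sq_assoc[of _ M] sq_mult[of _ M])
  also have "\<dots> = \<phi> (transpose_mat Q) * \<phi> \<beta> * \<phi> Q * w'"
    unfolding w'(2)[OF q(2)] using car[OF q(2)] car[OF \<beta>] car[OF t] w'(1) by (simp add: sq_assoc[of _ M] sq_mult[of _ M])
  also have "\<dots> = \<phi> \<delta> * w'"
    unfolding mul[OF t \<beta>, symmetric] mul[OF sq_mult[OF t \<beta>] q(2), symmetric] q(3) ..
  finally show ?thesis using GL[OF q(1)] by (simp add: isometries_def)
qed

lemma isometry_untwisted:
  assumes "\<beta> \<in> carrier_mat N N" "\<delta> \<in> carrier_mat N N" "Q \<in> isometries N \<delta> \<beta>"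
  shows "\<phi> Q \<in> isometries M (\<phi> \<delta>) (\<phi> \<beta>)"
proof -
  have "\<phi> Q \<in> isometries M (\<phi> \<delta> * 1\<^sub>m M) (\<phi> \<beta> * 1\<^sub>m M)"
  proof (rule isometry[OF one_carrier_mat _ assms(1,3)])
    show "1\<^sub>m M * \<phi> a = \<phi> a * 1\<^sub>m M" if "a \<in> carrier_mat N N" for a
      using left_mult_one_mat[OF car[OF that]] right_mult_one_mat[OF car[OF that]] by simp
  qed
  then show ?thesis unfolding right_mult_one_mat[OF car[OF assms(1)]] right_mult_one_mat[OF car[OF assms(2)]] .
qed

text \<open>The two factors commute, so squares and adjoints multiply; this supplies the conditions
  on the form \<open>w\<close> in the criterion.\<close>

lemma twisted_form:
  assumes f: "std_form N \<beta> \<tau> d \<epsilon>"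
    and w': "w' \<in> carrier_mat M M" "\<And>a. a \<in> carrier_mat N N \<Longrightarrow> w' * \<phi> a = \<phi> a * w'"
      "w' * w' = c \<cdot>\<^sub>m 1\<^sub>m M" "dagger w' = e \<cdot>\<^sub>m w'"
  shows "\<phi> \<beta> * w' * (\<phi> \<beta> * w') = (\<epsilon> * c) \<cdot>\<^sub>m 1\<^sub>m M" "dagger (\<phi> \<beta> * w') = (\<epsilon> * e) \<cdot>\<^sub>m (\<phi> \<beta> * w')"
proof -
  note b = std_form_props[OF f]
  note bc = car[OF b(1)]
  have "\<phi> \<beta> * w' * (\<phi> \<beta> * w') = \<phi> \<beta> * (w' * \<phi> \<beta>) * w'" using bc w'(1) by (simp add: sq_assoc[of _ M] sq_mult[of _ M])
  also have "\<dots> = (\<phi> \<beta> * \<phi> \<beta>) * (w' * w')"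
    unfolding w'(2)[OF b(1)] using bc w'(1) by (simp add: sq_assoc[of _ M] sq_mult[of _ M])
  also have "\<dots> = (\<epsilon> \<cdot>\<^sub>m 1\<^sub>m M) * (c \<cdot>\<^sub>m 1\<^sub>m M)"
    unfolding mul[OF b(1,1), symmetric] b(3) smu[OF one_carrier_mat] one w'(3) ..
  also have "\<dots> = (\<epsilon> * c) \<cdot>\<^sub>m 1\<^sub>m M"
    by (simp add: mult_smult_distrib[of _ M M _ M] mult_smult_assoc_mat[of _ M M _ M] smult_smult mult.commute)
  finally show "\<phi> \<beta> * w' * (\<phi> \<beta> * w') = (\<epsilon> * c) \<cdot>\<^sub>m 1\<^sub>m M" .
  have "dagger (\<phi> \<beta> * w') = (e \<cdot>\<^sub>m w') * (\<epsilon> \<cdot>\<^sub>m \<phi> \<beta>)"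
    unfolding dagger_mult[OF bc w'(1)] dag[OF b(1), symmetric] b(4) smu[OF b(1)] w'(4) ..
  also have "\<dots> = (\<epsilon> * e) \<cdot>\<^sub>m (w' * \<phi> \<beta>)"
    using bc w'(1) by (simp add: mult_smult_distrib[of _ M M _ M] mult_smult_assoc_mat[of _ M M _ M] smult_smult mult.commute)
  finally show "dagger (\<phi> \<beta> * w') = (\<epsilon> * e) \<cdot>\<^sub>m (\<phi> \<beta> * w')" unfolding w'(2)[OF b(1)] .
qed

end

lemma generating_isometries:
  assumes Q: "Q \<in> isometries N \<delta> \<beta>" and c: "\<delta> \<in> carrier_mat N N" "\<beta> \<in> carrier_mat N N"
    and g: "generating N (isometries N \<beta> \<beta>)"
  shows "generating N (isometries N \<delta> \<delta>)"
proof -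
  have "isometries N \<beta> \<beta> \<subseteq> carrier_mat N N" using isometriesD(2) by blast
  then show ?thesis
    unfolding isometries_conj_by[OF isometries_minv[OF Q c(2)] c(2,1)]
    by (intro generating_conj minv_GL isometriesD(1)[OF Q] g)
qed

text \<open>Passes from the form \<open>\<beta>\<close> in which \<open>G\<close> is given to the
  form \<open>dsum \<beta>1 \<beta>2\<close> in which \<open>H\<close> is block diagonal. The
  decomposition is arbitrary, so \<open>H\<close> need not be self-adjoint before this change of
  basis.\<close>

lemma see_saw_isometries_direct_sum:
  assumes dp: "dual_pair m G G'" and sym: "symmetric_subgroup (2 * m) G H"
    and amp: "amplification (n1 + n2) (2 * m) \<phi>"
    and w': "w' \<in> carrier_mat (2 * m) (2 * m)" "\<And>a. a \<in> carrier_mat (n1 + n2) (n1 + n2) \<Longrightarrow> w' * \<phi> a = \<phi> a * w'"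
      "w' * w' = c \<cdot>\<^sub>m 1\<^sub>m (2 * m)" "dagger w' = e \<cdot>\<^sub>m w'" "c \<noteq> 0" "e \<noteq> 0"
    and f1: "std_form n1 \<beta>1 \<tau>1 d1 \<epsilon>" and f2: "std_form n2 \<beta>2 \<tau>2 d2 \<epsilon>" and n: "n1 > 0" "n2 > 0"
    and g1: "generating n1 (isometries n1 \<beta>1 \<beta>1)" and g2: "generating n2 (isometries n2 \<beta>2 \<beta>2)"
    and \<beta>: "\<beta> \<in> carrier_mat (n1 + n2) (n1 + n2)" and g: "generating (n1 + n2) (isometries (n1 + n2) \<beta> \<beta>)"
    and Q: "Q \<in> isometries (n1 + n2) (dsum \<beta>1 \<beta>2) \<beta>"
    and P: "P \<in> isometries (2 * m) (\<phi> \<beta> * w') (sympl_form m)"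
    and G: "G = conj_by P ` \<phi> ` isometries (n1 + n2) \<beta> \<beta>"
    and H: "H = conj_by P ` \<phi> ` conj_by Q ` dprod (isometries n1 \<beta>1 \<beta>1) (isometries n2 \<beta>2 \<beta>2)"
  shows "dual_pair m H (centralizer (Sp_group m) H) \<and> symmetric_subgroup (2 * m) (centralizer (Sp_group m) H) G'"
proof -
  interpret p: amplification "n1 + n2" "2 * m" \<phi> by (rule amp)
  note sf = std_form_dsum[OF f1 f2]
  note \<delta> = std_form_props(1)[OF sf]
  note tw = p.twisted_form[OF sf w'(1-4)]
  note PG = isometriesD(1)[OF P] and QG = isometriesD(1)[OF Q]
  have c: "isometries (n1 + n2) (dsum \<beta>1 \<beta>2) (dsum \<beta>1 \<beta>2) \<subseteq> carrier_mat (n1 + n2) (n1 + n2)"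
    "dprod (isometries n1 \<beta>1 \<beta>1) (isometries n2 \<beta>2 \<beta>2) \<subseteq> carrier_mat (n1 + n2) (n1 + n2)"
    using isometriesD(2) by (auto elim!: dprodE)
  show ?thesis
  proof (rule see_saw_direct_sum[OF dp sym amp w'(1,2) f1 f2 n g1 g2])
    show "generating (n1 + n2) (isometries (n1 + n2) (dsum \<beta>1 \<beta>2) (dsum \<beta>1 \<beta>2))"
      by (rule generating_isometries[OF Q \<delta> \<beta> g])
    show "P * \<phi> Q \<in> isometries (2 * m) (\<phi> (dsum \<beta>1 \<beta>2) * w') (sympl_form m)"
      by (rule isometries_comp[OF P p.isometry[OF w'(1,2) \<beta> Q] sympl_form_carrier])
    show "G = conj_by (P * \<phi> Q) ` \<phi> ` isometries (n1 + n2) (dsum \<beta>1 \<beta>2) (dsum \<beta>1 \<beta>2)"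
      unfolding G isometries_conj_by[OF Q \<delta> \<beta>] by (rule p.conj_by_image[OF PG QG c(1)])
    show "H = conj_by (P * \<phi> Q) ` \<phi> ` dprod (isometries n1 \<beta>1 \<beta>1) (isometries n2 \<beta>2 \<beta>2)"
      unfolding H by (rule p.conj_by_image[OF PG QG c(2)])
    show "\<epsilon> * c \<noteq> 0" "\<epsilon> * e \<noteq> 0" using std_formD(7)[OF f1] w'(5,6) by simp_all
  qed (use tw in simp_all)
qed

text \<open>The basis adapted to the polarization plays the part of \<open>Q\<close> here. In the
  orthogonal case it also replaces the identity form by the hyperbolic one, in which the isotropic
  subspaces are spanned by basis vectors.\<close>

lemma see_saw_isometries_polarization:
  assumes dp: "dual_pair m G G'" and sym: "symmetric_subgroup (2 * m) G H"
    and amp: "amplification N (2 * m) \<phi>"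
    and w': "w' \<in> carrier_mat (2 * m) (2 * m)" "\<And>a. a \<in> carrier_mat N N \<Longrightarrow> w' * \<phi> a = \<phi> a * w'"
      "w' * w' = c \<cdot>\<^sub>m 1\<^sub>m (2 * m)" "dagger w' = e \<cdot>\<^sub>m w'" "c \<noteq> 0" "e \<noteq> 0"
    and f: "std_form N \<beta> \<tau> d \<epsilon>" and N: "N > 0" and g: "generating N (isometries N \<beta> \<beta>)"
    and pol: "polarization N \<beta> L1 L2"
    and P: "P \<in> isometries (2 * m) (\<phi> \<beta> * w') (sympl_form m)"
    and G: "G = conj_by P ` \<phi> ` isometries N \<beta> \<beta>"
    and H: "H = conj_by P ` \<phi> ` pair_stabilizer (isometries N \<beta> \<beta>) L1 L2"
  shows "dual_pair m H (centralizer (Sp_group m) H) \<and> symmetric_subgroup (2 * m) (centralizer (Sp_group m) H) G'"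
proof -
  note \<beta> = std_form_props[OF f] and \<epsilon> = std_formD(6)[OF f]
  obtain Q n where Nn: "N = n + n" and Q: "Q \<in> isometries N (hyp_form n \<epsilon>) \<beta>"
    and st: "pair_stabilizer (isometries N \<beta> \<beta>) L1 L2 = conj_by Q ` plus_dual ` GL_group n"
    by (rule pair_stabilizer_eq[OF polarized_if_polarization[OF pol \<beta>(2,5) \<epsilon>]])
  interpret p: amplification N "2 * m" \<phi> by (rule amp)
  note sf = std_form_hyp[OF \<epsilon>, of n, unfolded mult_2, folded Nn]
  note \<delta> = std_form_props(1)[OF sf]
  note tw = p.twisted_form[OF sf w'(1-4)]
  note PG = isometriesD(1)[OF P] and QG = isometriesD(1)[OF Q]
  have c: "isometries N (hyp_form n \<epsilon>) (hyp_form n \<epsilon>) \<subseteq> carrier_mat N N" "plus_dual ` GL_group n \<subseteq> carrier_mat N N"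
    using isometriesD(2) plus_dual_carrier Nn by blast+
  show ?thesis
  proof (rule see_saw_polarization[OF dp sym amp[unfolded Nn] w'(1) w'(2)[unfolded Nn] \<epsilon>])
    show "n > 0" using N Nn by simp
    show "generating (n + n) (isometries (n + n) (hyp_form n \<epsilon>) (hyp_form n \<epsilon>))"
      using generating_isometries[OF Q \<delta> \<beta>(1) g] unfolding Nn .
    show "P * \<phi> Q \<in> isometries (2 * m) (\<phi> (hyp_form n \<epsilon>) * w') (sympl_form m)"
      by (rule isometries_comp[OF P p.isometry[OF w'(1,2) \<beta>(1) Q] sympl_form_carrier])
    show "G = conj_by (P * \<phi> Q) ` \<phi> ` isometries (n + n) (hyp_form n \<epsilon>) (hyp_form n \<epsilon>)"
      unfolding G isometries_conj_by[OF Q \<delta> \<beta>(1)] p.conj_by_image[OF PG QG c(1)] unfolding Nn ..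
    show "H = conj_by (P * \<phi> Q) ` \<phi> ` plus_dual ` GL_group n"
      unfolding H st by (rule p.conj_by_image[OF PG QG c(2)])
    show "\<epsilon> * c \<noteq> 0" "\<epsilon> * e \<noteq> 0" using std_formD(7)[OF f] w'(5,6) by simp_all
  qed (use tw in simp_all)
qed

lemma plus_dual_conj_by:
  assumes "Q \<in> GL_group n" "x \<in> GL_group n"
  shows "plus_dual (conj_by Q x) = conj_by (plus_dual Q) (plus_dual x)"
  unfolding conj_by_eq[OF assms(1)] conj_by_eq[OF plus_dual_GL[OF assms(1)]] minv_plus_dual[OF assms(1)]
    plus_dual_mult[OF GL_group_mult[OF assms] minv_GL[OF assms(1)]] plus_dual_mult[OF assms] ..

lemma conj_by_GL_group:
  assumes "Q \<in> GL_group n"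
  shows "conj_by Q ` GL_group n = GL_group n"
proof (intro equalityI subsetI)
  fix g assume g: "g \<in> GL_group n"
  have "g = conj_by Q (conj_by (minv n Q) g)" using conj_by_minv(1)[OF assms GL_groupD[OF g]] by simp
  then show "g \<in> conj_by Q ` GL_group n" using conj_by_GL[OF minv_GL[OF assms] g] by blast
qed (use conj_by_GL[OF assms] in blast)

text \<open>A change of basis of the standard module acts contragrediently on the dual, so it
  preserves the alternating form on their sum and leaves the model unchanged.\<close>

lemma plus_dual_change_of_basis:
  assumes amp: "amplification (n + n) (2 * m) \<phi>"
    and P: "P \<in> isometries (2 * m) (\<phi> (hyp_form n (-1))) (sympl_form m)" and Q: "Q \<in> GL_group n"
  shows "P * \<phi> (plus_dual Q) \<in> isometries (2 * m) (\<phi> (hyp_form n (-1))) (sympl_form m)"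
    "X \<subseteq> GL_group n \<Longrightarrow> conj_by P ` \<phi> ` plus_dual ` conj_by Q ` X = conj_by (P * \<phi> (plus_dual Q)) ` \<phi> ` plus_dual ` X"
proof -
  interpret p: amplification "n + n" "2 * m" \<phi> by (rule amp)
  have h: "hyp_form n (-1) \<in> carrier_mat (n + n) (n + n)" by (simp add: hyp_form_def mult_2)
  have q: "plus_dual Q \<in> isometries (n + n) (hyp_form n (-1)) (hyp_form n (-1))" by (rule plus_dual_isometry[OF Q]) simp
  show "P * \<phi> (plus_dual Q) \<in> isometries (2 * m) (\<phi> (hyp_form n (-1))) (sympl_form m)"
    by (rule isometries_comp[OF P p.isometry_untwisted[OF h h q] sympl_form_carrier])
  assume X: "X \<subseteq> GL_group n"
  have "plus_dual ` conj_by Q ` X = conj_by (plus_dual Q) ` plus_dual ` X"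
    unfolding image_image using plus_dual_conj_by[OF Q] X by (intro image_cong refl) blast
  moreover have "plus_dual ` X \<subseteq> carrier_mat (n + n) (n + n)" using plus_dual_carrier X by blast
  ultimately show "conj_by P ` \<phi> ` plus_dual ` conj_by Q ` X = conj_by (P * \<phi> (plus_dual Q)) ` \<phi> ` plus_dual ` X"
    using p.conj_by_image[OF isometriesD(1)[OF P] plus_dual_GL[OF Q]] by simp
qed

lemma see_saw_GL_direct_sum:
  assumes dp: "dual_pair m G G'" and sym: "symmetric_subgroup (2 * m) G H"
    and amp: "amplification ((n + k) + (n + k)) (2 * m) \<phi>" and n: "n > 0" "k > 0"
    and P: "P \<in> isometries (2 * m) (\<phi> (hyp_form (n + k) (-1))) (sympl_form m)" and Q: "Q \<in> GL_group (n + k)"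
    and G: "G = conj_by P ` \<phi> ` plus_dual ` GL_group (n + k)"
    and H: "H = conj_by P ` \<phi> ` plus_dual ` conj_by Q ` dprod (GL_group n) (GL_group k)"
  shows "dual_pair m H (centralizer (Sp_group m) H) \<and> symmetric_subgroup (2 * m) (centralizer (Sp_group m) H) G'"
proof (rule see_saw_direct_sum_GL[OF dp sym amp n plus_dual_change_of_basis(1)[OF amp P Q]])
  show "G = conj_by (P * \<phi> (plus_dual Q)) ` \<phi> ` plus_dual ` GL_group (n + k)"
    unfolding G plus_dual_change_of_basis(2)[OF amp P Q order_refl, symmetric] conj_by_GL_group[OF Q] ..
  have "dprod (GL_group n) (GL_group k) \<subseteq> GL_group (n + k)" using dsum_GL by (auto elim!: dprodE)
  then show "H = conj_by (P * \<phi> (plus_dual Q)) ` \<phi> ` plus_dual ` dprod (GL_group n) (GL_group k)"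
    unfolding H by (rule plus_dual_change_of_basis(2)[OF amp P Q])
qed

lemma see_saw_GL_bilinear:
  assumes dp: "dual_pair m G G'" and sym: "symmetric_subgroup (2 * m) G H"
    and amp: "amplification (n + n) (2 * m) \<phi>" and n: "n > 0"
    and f: "std_form n \<beta> \<tau> d \<epsilon>" and g: "generating n (isometries n \<beta> \<beta>)"
    and P: "P \<in> isometries (2 * m) (\<phi> (hyp_form n (-1))) (sympl_form m)" and Q: "Q \<in> GL_group n"
    and G: "G = conj_by P ` \<phi> ` plus_dual ` GL_group n"
    and H: "H = conj_by P ` \<phi> ` plus_dual ` conj_by Q ` isometries n \<beta> \<beta>"
  shows "dual_pair m H (centralizer (Sp_group m) H) \<and> symmetric_subgroup (2 * m) (centralizer (Sp_group m) H) G'"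
proof (rule see_saw_bilinear[OF dp sym amp n f g plus_dual_change_of_basis(1)[OF amp P Q]])
  show "G = conj_by (P * \<phi> (plus_dual Q)) ` \<phi> ` plus_dual ` GL_group n"
    unfolding G plus_dual_change_of_basis(2)[OF amp P Q order_refl, symmetric] conj_by_GL_group[OF Q] ..
  have "isometries n \<beta> \<beta> \<subseteq> GL_group n" using isometriesD(1) by blast
  then show "H = conj_by (P * \<phi> (plus_dual Q)) ` \<phi> ` plus_dual ` isometries n \<beta> \<beta>"
    unfolding H by (rule plus_dual_change_of_basis(2)[OF amp P Q])
qed

section \<open>The models of the irreducible pairs\<close>

lemma kron_transpose:
  assumes "A \<in> carrier_mat n n'" "B \<in> carrier_mat k k'"
  shows "transpose_mat (kron A B) = kron (transpose_mat A) (transpose_mat B)"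
proof (rule eq_matI)
  fix i j assume "i < dim_row (kron (transpose_mat A) (transpose_mat B))" "j < dim_col (kron (transpose_mat A) (transpose_mat B))"
  then have ij: "i < n' * k'" "j < n * k" using assms by auto
  have t: "transpose_mat A \<in> carrier_mat n' n" "transpose_mat B \<in> carrier_mat k' k" using assms by simp_all
  have "transpose_mat (kron A B) $$ (i, j) = kron A B $$ (j, i)" using ij assms by (intro index_transpose_mat(1)) simp_all
  then show "transpose_mat (kron A B) $$ (i, j) = kron (transpose_mat A) (transpose_mat B) $$ (i, j)"
    unfolding kron_index[OF assms ij(2,1)] kron_index[OF t ij] using div_mod_bounds[OF ij(1)] div_mod_bounds[OF ij(2)] assms by simp
qed (use assms in auto)

text \<open>In the lexicographic order each index of the small form becomes a block of
  \<open>k\<close> consecutive indices, so halves correspond to halves. This exhibits the model of a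
  \<open>GL\<close> pair as an amplification of the standard module plus its dual.\<close>

lemma sympl_form_kron: "sympl_form (n * k) = kron (sympl_form n) (1\<^sub>m k)"
proof (rule eq_matI)
  fix i j assume "i < dim_row (kron (sympl_form n) (1\<^sub>m k))" "j < dim_col (kron (sympl_form n) (1\<^sub>m k))"
  then have ij: "i < (2 * n) * k" "j < (2 * n) * k" using carrier_matD[OF sympl_form_carrier[of n]] by simp_all
  have ij': "i < 2 * (n * k)" "j < 2 * (n * k)" using ij by simp_all
  note b1 = div_mod_bounds[OF ij(1)] and b2 = div_mod_bounds[OF ij(2)]
  have lt: "l < n * k \<longleftrightarrow> l div k < n" for l using b1(3) by (simp add: div_less_iff_less_mult)
  have sh: "r = l + n * k \<longleftrightarrow> r div k = l div k + n \<and> r mod k = l mod k" for l r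
  proof
    assume "r = l + n * k"
    then show "r div k = l div k + n \<and> r mod k = l mod k" using b1(3) by simp
  next
    assume e: "r div k = l div k + n \<and> r mod k = l mod k"
    have "r = r div k * k + r mod k" by simp
    also have "\<dots> = (l div k * k + l mod k) + n * k" using e by (simp add: add_mult_distrib)
    finally show "r = l + n * k" by simp
  qed
  have "j = i - n * k \<longleftrightarrow> j div k = i div k - n \<and> j mod k = i mod k" if "\<not> i < n * k"
  proof -
    have "i = (i - n * k) + n * k" using that by simp
    have "j = i - n * k \<longleftrightarrow> i = j + n * k" using that by auto
    also have "\<dots> \<longleftrightarrow> i div k = j div k + n \<and> i mod k = j mod k" by (rule sh)
    also have "\<dots> \<longleftrightarrow> j div k = i div k - n \<and> j mod k = i mod k" using that unfolding lt by auto
    finally show ?thesis .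
  qed
  then show "sympl_form (n * k) $$ (i, j) = kron (sympl_form n) (1\<^sub>m k) $$ (i, j)"
    unfolding kron_index[OF sympl_form_carrier one_carrier_mat ij] unfolding sympl_form_eq hyp_form_def
      gm_index[OF b1(1) b2(1)] gm_index[OF ij'] index_one_mat(1)[OF b1(2) b2(2)]
    unfolding lt using sh[of j i] lt[of i] by (cases "i div k < n") auto
qed (use carrier_matD[OF sympl_form_carrier[of n]] carrier_matD[OF sympl_form_carrier[of "n * k"]] in simp_all)

lemma kron_dsum:
  assumes "a \<in> carrier_mat n n" "b \<in> carrier_mat n' n'" "c \<in> carrier_mat k k"
  shows "kron (dsum a b) c = dsum (kron a c) (kron b c)"
proof (rule eq_matI)
  have d: "dim_row (dsum (kron a c) (kron b c)) = (n + n') * k" "dim_col (dsum (kron a c) (kron b c)) = (n + n') * k"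
    using carrier_matD[OF dsum_carrier[OF kron_carrier[OF assms(1,3)] kron_carrier[OF assms(2,3)]]] by (simp_all add: add_mult_distrib)
  show "dim_row (kron (dsum a b) c) = dim_row (dsum (kron a c) (kron b c))" "dim_col (kron (dsum a b) c) = dim_col (dsum (kron a c) (kron b c))"
    unfolding d using carrier_matD[OF dsum_carrier[OF assms(1,2)]] carrier_matD[OF assms(3)] by simp_all
  fix i j assume "i < dim_row (dsum (kron a c) (kron b c))" "j < dim_col (dsum (kron a c) (kron b c))"
  then have ij: "i < (n + n') * k" "j < (n + n') * k" unfolding d .
  then have ij': "i < n * k + n' * k" "j < n * k + n' * k" by (simp_all add: add_mult_distrib)
  note b1 = div_mod_bounds[OF ij(1)] and b2 = div_mod_bounds[OF ij(2)]
  have lt: "l < n * k \<longleftrightarrow> l div k < n" for l using b1(3) by (simp add: div_less_iff_less_mult)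
  have ge: "n * k \<le> l \<longleftrightarrow> \<not> l div k < n" for l using lt[of l] by linarith
  have sh: "(l - n * k) div k = l div k - n" "(l - n * k) mod k = l mod k" if "\<not> l < n * k" for l
  proof -
    obtain r where r: "l = r + n * k" using \<open>\<not> l < n * k\<close> by (metis add.commute le_Suc_ex not_less)
    show "(l - n * k) div k = l div k - n" "(l - n * k) mod k = l mod k" unfolding r using b1(3) by simp_all
  qed
  have "kron a c $$ (i, j) = a $$ (i div k, j div k) * c $$ (i mod k, j mod k)" if "i < n * k" "j < n * k"
    by (rule kron_index[OF assms(1,3) that])
  moreover have "kron b c $$ (i - n * k, j - n * k) = b $$ (i div k - n, j div k - n) * c $$ (i mod k, j mod k)"
    if "\<not> i < n * k" "\<not> j < n * k"
  proof -
    have "i - n * k < n' * k" "j - n * k < n' * k" using ij' that by linarith+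
    then show ?thesis unfolding sh[OF that(1), symmetric] sh[OF that(2), symmetric] by (rule kron_index[OF assms(2,3)])
  qed
  ultimately show "kron (dsum a b) c $$ (i, j) = dsum (kron a c) (kron b c) $$ (i, j)"
    unfolding kron_index[OF dsum_carrier[OF assms(1,2)] assms(3) ij] dsum_index[OF assms(1,2) b1(1) b2(1)]
      dsum_index[OF kron_carrier[OF assms(1,3)] kron_carrier[OF assms(2,3)] ij']
    by (auto simp: lt ge)
qed

lemma plus_dual_kron:
  assumes "g \<in> GL_group n" "k > 0"
  shows "plus_dual (kron g (1\<^sub>m k)) = kron (plus_dual g) (1\<^sub>m k)"
proof -
  interpret amplification n "n * k" "\<lambda>a. kron a (1\<^sub>m k)" by (rule amplification_left[OF assms(2)])
  note c = GL_groupD[OF assms(1)] minv_carrier[OF assms(1)]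
  have t: "transpose_mat (minv n g) \<in> carrier_mat n n" using c by simp
  show ?thesis
    unfolding plus_dual_eq[OF GL[OF assms(1)]] plus_dual_eq[OF assms(1)] minv[OF assms(1)] trn[OF c(2), symmetric]
      kron_dsum[OF c(1) t one_carrier_mat] ..
qed

lemma (in amplification) form:
  assumes "std_form N \<beta> \<tau> d \<epsilon>"
  shows "\<phi> \<beta> \<in> carrier_mat M M" "\<phi> \<beta> * \<phi> \<beta> = \<epsilon> \<cdot>\<^sub>m 1\<^sub>m M" "dagger (\<phi> \<beta>) = \<epsilon> \<cdot>\<^sub>m \<phi> \<beta>" "transpose_mat (\<phi> \<beta>) = \<epsilon> \<cdot>\<^sub>m \<phi> \<beta>"
proof -
  note b = std_form_props[OF assms]
  show "\<phi> \<beta> \<in> carrier_mat M M" by (rule car[OF b(1)])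
  show "\<phi> \<beta> * \<phi> \<beta> = \<epsilon> \<cdot>\<^sub>m 1\<^sub>m M" unfolding mul[OF b(1,1), symmetric] b(3) smu[OF one_carrier_mat] one ..
  show "dagger (\<phi> \<beta>) = \<epsilon> \<cdot>\<^sub>m \<phi> \<beta>" unfolding dag[OF b(1), symmetric] b(4) smu[OF b(1)] ..
  show "transpose_mat (\<phi> \<beta>) = \<epsilon> \<cdot>\<^sub>m \<phi> \<beta>" unfolding trn[OF b(1), symmetric] b(5) smu[OF b(1)] ..
qed

section \<open>Partial intertwiners for the diagonal pairs\<close>

text \<open>The multiplicity spaces of the two modules may have different dimensions. This matrix
  identifies a coordinate line in one with a coordinate line in the other, which is enough to link
  the two copies of the group.\<close>

definition corner :: "nat \<Rightarrow> nat \<Rightarrow> complex mat" where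
  "corner r c = mat r c (\<lambda>(i, j). if i = 0 \<and> j = 0 then 1 else 0)"

lemma corner_carrier [simp]: "corner r c \<in> carrier_mat r c"
  by (simp add: corner_def)

lemma corner_transpose: "transpose_mat (corner r c) = corner c r"
  by (rule eq_matI) (auto simp: corner_def)

lemma corner_mult:
  assumes "c > 0"
  shows "corner r c * corner c s = corner r s"
proof (rule eq_matI)
  fix i j assume "i < dim_row (corner r s)" "j < dim_col (corner r s)"
  then have ij: "i < r" "j < s" by (simp_all add: corner_def)
  have "(corner r c * corner c s) $$ (i, j) = (\<Sum>l\<in>{0..<c}. corner r c $$ (i, l) * corner c s $$ (l, j))"
    using ij by (simp add: scalar_prod_def corner_def)
  also have "\<dots> = (\<Sum>l\<in>{0..<c}. if l = 0 then corner r s $$ (i, j) else 0)"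
    using ij by (intro sum.cong) (auto simp: corner_def)
  finally show "(corner r c * corner c s) $$ (i, j) = corner r s $$ (i, j)" using assms by simp
qed (simp_all add: corner_def)

text \<open>The entries of the product that involve \<open>E $$ (0, 0) = 1\<close> are the entries
  of the other factor.\<close>

lemma kron_inj:
  assumes "a \<in> carrier_mat n n" "b \<in> carrier_mat n n" "E \<in> carrier_mat r c" "E $$ (0, 0) = 1" "r > 0" "c > 0"
  shows "kron a E = kron b E \<Longrightarrow> a = b" "kron E a = kron E b \<Longrightarrow> a = b"
proof -
  assume e: "kron a E = kron b E"
  show "a = b"
  proof (rule eq_matI)
    fix p q assume "p < dim_row b" "q < dim_col b"
    then have pq: "p < n" "q < n" using assms by auto
    then have l: "p * r < n * r" "q * c < n * c" using assms by simp_all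
    show "a $$ (p, q) = b $$ (p, q)"
      using arg_cong[OF e, of "\<lambda>x. x $$ (p * r, q * c)"] unfolding kron_index[OF assms(1,3) l] kron_index[OF assms(2,3) l]
      using assms by simp
  qed (use assms in auto)
next
  assume e: "kron E a = kron E b"
  show "a = b"
  proof (rule eq_matI)
    fix p q assume "p < dim_row b" "q < dim_col b"
    then have pq: "p < n" "q < n" using assms by auto
    moreover have "n \<le> r * n" "n \<le> c * n" using assms by simp_all
    ultimately have l: "p < r * n" "q < c * n" by linarith+
    show "a $$ (p, q) = b $$ (p, q)"
      using arg_cong[OF e, of "\<lambda>x. x $$ (p, q)"] unfolding kron_index[OF assms(3,1) l] kron_index[OF assms(3,2) l]
      using assms pq by simp
  qed (use assms in auto)
qed

text \<open>An operator that touches only the multiplicity spaces intertwines the group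
  automatically; compatibility with the forms is reduced to the factors \<open>S1\<close> and
  \<open>S2\<close> on these spaces.\<close>

lemma intertwiner_left:
  assumes E: "E \<in> carrier_mat k1 k2" "E * transpose_mat E * E = E"
    and B: "B \<in> carrier_mat N N" "S1 \<in> carrier_mat k1 k1" "S2 \<in> carrier_mat k2 k2" "S1 * E = E * S2"
  shows "kron (1\<^sub>m N) E * transpose_mat (kron (1\<^sub>m N) E) * kron (1\<^sub>m N) E = kron (1\<^sub>m N) E"
    "kron B S1 * kron (1\<^sub>m N) E = kron (1\<^sub>m N) E * kron B S2"
    "a \<in> carrier_mat N N \<Longrightarrow> kron a (1\<^sub>m k1) * kron (1\<^sub>m N) E = kron a E"
    "a \<in> carrier_mat N N \<Longrightarrow> kron (1\<^sub>m N) E * kron a (1\<^sub>m k2) = kron a E"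
proof -
  note I = one_carrier_mat[of N]
  have tE: "transpose_mat E \<in> carrier_mat k2 k1" using E(1) by simp
  show "kron (1\<^sub>m N) E * transpose_mat (kron (1\<^sub>m N) E) * kron (1\<^sub>m N) E = kron (1\<^sub>m N) E"
    unfolding kron_transpose[OF I E(1)] transpose_one kron_mult[OF I I E(1) tE] left_mult_one_mat[OF I]
      kron_mult[OF I I mult_carrier_mat[OF E(1) tE] E(1)] E(2) ..
  show "kron B S1 * kron (1\<^sub>m N) E = kron (1\<^sub>m N) E * kron B S2"
    unfolding kron_mult[OF B(1) I B(2) E(1)] kron_mult[OF I B(1) E(1) B(3)] B(4) left_mult_one_mat[OF B(1)] right_mult_one_mat[OF B(1)] ..
  assume a: "a \<in> carrier_mat N N"
  show "kron a (1\<^sub>m k1) * kron (1\<^sub>m N) E = kron a E"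
    unfolding kron_mult[OF a I one_carrier_mat E(1)] right_mult_one_mat[OF a] left_mult_one_mat[OF E(1)] ..
  show "kron (1\<^sub>m N) E * kron a (1\<^sub>m k2) = kron a E"
    unfolding kron_mult[OF I a E(1) one_carrier_mat] left_mult_one_mat[OF a] right_mult_one_mat[OF E(1)] ..
qed

lemma intertwiner_right:
  assumes E: "E \<in> carrier_mat n1 n2" "E * transpose_mat E * E = E"
  shows "kron E (1\<^sub>m N) * transpose_mat (kron E (1\<^sub>m N)) * kron E (1\<^sub>m N) = kron E (1\<^sub>m N)"
    "a \<in> carrier_mat N N \<Longrightarrow> kron (1\<^sub>m n1) a * kron E (1\<^sub>m N) = kron E a"
    "a \<in> carrier_mat N N \<Longrightarrow> kron E (1\<^sub>m N) * kron (1\<^sub>m n2) a = kron E a"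
proof -
  note I = one_carrier_mat[of N]
  have tE: "transpose_mat E \<in> carrier_mat n2 n1" using E(1) by simp
  show "kron E (1\<^sub>m N) * transpose_mat (kron E (1\<^sub>m N)) * kron E (1\<^sub>m N) = kron E (1\<^sub>m N)"
    unfolding kron_transpose[OF E(1) I] transpose_one kron_mult[OF E(1) tE I I] left_mult_one_mat[OF I]
      kron_mult[OF mult_carrier_mat[OF E(1) tE] E(1) I I] E(2) ..
  assume a: "a \<in> carrier_mat N N"
  show "kron (1\<^sub>m n1) a * kron E (1\<^sub>m N) = kron E a"
    unfolding kron_mult[OF one_carrier_mat E(1) a I] right_mult_one_mat[OF a] left_mult_one_mat[OF E(1)] ..
  show "kron E (1\<^sub>m N) * kron (1\<^sub>m n2) a = kron E a"
    unfolding kron_mult[OF E(1) one_carrier_mat I a] left_mult_one_mat[OF a] right_mult_one_mat[OF E(1)] ..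
qed

lemma corner_partial_isometry:
  assumes "r > 0" "c > 0"
  shows "corner r c * transpose_mat (corner r c) * corner r c = corner r c"
  unfolding corner_transpose corner_mult[OF assms(2)] corner_mult[OF assms(1)] ..

text \<open>For an orthogonal group the multiplicity space is symplectic, and a corner of rank one
  does not intertwine the forms. The symplectic form is the form of size 2 tensored with an
  identity, so tensoring a corner with the identity of size 2 works: it identifies a hyperbolic
  plane on each side.\<close>

lemma sympl_intertwiner:
  assumes "k1 > 0" "k2 > 0"
  obtains E where "E \<in> carrier_mat (2 * k1) (2 * k2)" "E * transpose_mat E * E = E" "E $$ (0, 0) = 1"
    "sympl_form k1 * E = E * sympl_form k2"
proof (rule that)
  let ?E = "kron (1\<^sub>m 2) (corner k1 k2)"
  show "?E \<in> carrier_mat (2 * k1) (2 * k2)" by simp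
  have J: "sympl_form k = kron (sympl_form 1) (1\<^sub>m k)" for k using sympl_form_kron[of 1 k] by simp
  have B: "sympl_form 1 \<in> carrier_mat 2 2" using sympl_form_carrier[of 1] by simp
  note i = intertwiner_left[OF corner_carrier corner_partial_isometry[OF assms] B one_carrier_mat one_carrier_mat,
      unfolded left_mult_one_mat[OF corner_carrier] right_mult_one_mat[OF corner_carrier]]
  show "?E * transpose_mat ?E * ?E = ?E" by (rule i(1)) simp
  show "sympl_form k1 * ?E = ?E * sympl_form k2" unfolding J[of k1] J[of k2] by (rule i(2)) simp
  have l: "0 < 2 * k1" "0 < 2 * k2" using assms by simp_all
  show "?E $$ (0, 0) = 1" unfolding kron_index[OF one_carrier_mat corner_carrier l] using assms by (simp add: corner_def)
qed

text \<open>\<open>\<rho>\<close> is \<open>plus_dual\<close> for \<open>GL\<close>, whose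
  symplectic space contains the dual as well, and the identity for \<open>O\<close> and
  \<open>Sp\<close>. The three isomorphisms of the data are collected into the single change of
  basis \<open>Q * dsum P1 P2\<close>.\<close>

lemma see_saw_diagonal_basis:
  assumes dp: "dual_pair (m1 + m2) G G'" and sym: "symmetric_subgroup (2 * (m1 + m2)) G H"
    and amp1: "amplification N (2 * m1) \<phi>1" and amp2: "amplification N (2 * m2) \<phi>2"
    and K: "\<rho> ` K \<subseteq> carrier_mat N N" "\<And>a. a \<in> \<rho> ` K \<Longrightarrow> dagger a \<in> \<rho> ` K" "1\<^sub>m N \<in> \<rho> ` K" "(-1) \<cdot>\<^sub>m 1\<^sub>m N \<in> \<rho> ` K"
      "\<And>a. a \<in> \<rho> ` K \<Longrightarrow> \<phi>1 a \<in> isometries (2 * m1) w1 w1" "\<And>a. a \<in> \<rho> ` K \<Longrightarrow> \<phi>2 a \<in> isometries (2 * m2) w2 w2"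
    and w1: "w1 \<in> carrier_mat (2 * m1) (2 * m1)" "w1 * w1 = (-1) \<cdot>\<^sub>m 1\<^sub>m (2 * m1)" "dagger w1 = (-1) \<cdot>\<^sub>m w1" "transpose_mat w1 = (-1) \<cdot>\<^sub>m w1"
    and w2: "w2 \<in> carrier_mat (2 * m2) (2 * m2)" "w2 * w2 = (-1) \<cdot>\<^sub>m 1\<^sub>m (2 * m2)" "dagger w2 = (-1) \<cdot>\<^sub>m w2" "transpose_mat w2 = (-1) \<cdot>\<^sub>m w2"
    and T: "T \<in> carrier_mat (2 * m1) (2 * m2)" "T * transpose_mat T * T = T" "w1 * T = T * w2"
      "\<And>a. a \<in> carrier_mat N N \<Longrightarrow> \<phi>1 a * T = T * \<phi>2 a"
      "\<And>a b. a \<in> carrier_mat N N \<Longrightarrow> b \<in> carrier_mat N N \<Longrightarrow> \<phi>1 a * T = \<phi>1 b * T \<Longrightarrow> a = b"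
    and P1: "P1 \<in> isometries (2 * m1) w1 (sympl_form m1)" and P2: "P2 \<in> isometries (2 * m2) w2 (sympl_form m2)"
    and Q: "Q \<in> isometries (2 * (m1 + m2)) (dsum (sympl_form m1) (sympl_form m2)) (sympl_form (m1 + m2))"
    and \<iota>: "\<And>a b. a \<in> K \<Longrightarrow> b \<in> K \<Longrightarrow> \<iota> (dsum a b) = conj_by Q (dsum (conj_by P1 (\<phi>1 (\<rho> a))) (conj_by P2 (\<phi>2 (\<rho> b))))"
    and G: "G = \<iota> ` dprod K K" and H: "H = \<iota> ` {dsum g g | g. g \<in> K}"
  shows "dual_pair (m1 + m2) H (centralizer (Sp_group (m1 + m2)) H) \<and>
    symmetric_subgroup (2 * (m1 + m2)) (centralizer (Sp_group (m1 + m2)) H) G'"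
proof -
  interpret p1: amplification N "2 * m1" \<phi>1 by (rule amp1)
  interpret p2: amplification N "2 * m2" \<phi>2 by (rule amp2)
  let ?n = "2 * m1" and ?k = "2 * m2"
  have nk: "2 * (m1 + m2) = ?n + ?k" by simp
  note p = isometriesD[OF P1] and q = isometriesD[OF P2]
  have QG: "Q \<in> GL_group (?n + ?k)" using isometriesD(1)[OF Q] unfolding nk .
  have P12: "dsum P1 P2 \<in> isometries (?n + ?k) (dsum w1 w2) (dsum (sympl_form m1) (sympl_form m2))"
  proof -
    note J = sympl_form_carrier[of m1] sympl_form_carrier[of m2]
    have t: "transpose_mat P1 \<in> carrier_mat ?n ?n" "transpose_mat P2 \<in> carrier_mat ?k ?k" using p(2) q(2) by simp_all
    have "transpose_mat (dsum P1 P2) * dsum (sympl_form m1) (sympl_form m2) * dsum P1 P2 =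
      dsum (transpose_mat P1 * sympl_form m1 * P1) (transpose_mat P2 * sympl_form m2 * P2)"
      unfolding dsum_transpose[OF p(2) q(2)] dsum_mult[OF t(1) J(1) t(2) J(2)]
        dsum_mult[OF sq_mult[OF t(1) J(1)] p(2) sq_mult[OF t(2) J(2)] q(2)] ..
    then show ?thesis unfolding p(3) q(3) using dsum_GL[OF p(1) q(1)] by (simp add: isometries_def)
  qed
  have e: "\<iota> (dsum a b) = conj_by (Q * dsum P1 P2) (dsum (\<phi>1 (\<rho> a)) (\<phi>2 (\<rho> b)))" if ab: "a \<in> K" "b \<in> K" for a b
  proof -
    have c: "\<phi>1 (\<rho> a) \<in> carrier_mat ?n ?n" "\<phi>2 (\<rho> b) \<in> carrier_mat ?k ?k"
      using p1.car p2.car K(1) ab by blast+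
    have "dsum (conj_by P1 (\<phi>1 (\<rho> a))) (conj_by P2 (\<phi>2 (\<rho> b))) = conj_by (dsum P1 P2) (dsum (\<phi>1 (\<rho> a)) (\<phi>2 (\<rho> b)))"
      unfolding conj_by_eq[OF p(1)] conj_by_eq[OF q(1)] conj_by_eq[OF dsum_GL[OF p(1) q(1)]] minv_dsum[OF p(1) q(1)]
        dsum_mult[OF p(2) c(1) q(2) c(2)]
        dsum_mult[OF sq_mult[OF p(2) c(1)] minv_carrier[OF p(1)] sq_mult[OF q(2) c(2)] minv_carrier[OF q(1)]] ..
    then show ?thesis
      unfolding \<iota>[OF ab] using conj_by_comp[OF QG dsum_GL[OF p(1) q(1)] dsum_carrier[OF c]] by simp
  qed
  show ?thesis
  proof (rule see_saw_diagonal[OF dp sym amp1 amp2 K w1 w2 T])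
    show "Q * dsum P1 P2 \<in> isometries (2 * (m1 + m2)) (dsum w1 w2) (sympl_form (m1 + m2))"
      by (rule isometries_comp[OF Q _ sympl_form_carrier]) (use P12 nk in simp)
    show "G = conj_by (Q * dsum P1 P2) ` (\<lambda>(a, b). dsum (\<phi>1 a) (\<phi>2 b)) ` (\<rho> ` K \<times> \<rho> ` K)"
    proof (intro equalityI subsetI)
      fix x assume "x \<in> G"
      then obtain a b where ab: "a \<in> K" "b \<in> K" "x = \<iota> (dsum a b)" unfolding G by (auto elim!: dprodE)
      have r: "(\<rho> a, \<rho> b) \<in> \<rho> ` K \<times> \<rho> ` K" using ab by blast
      show "x \<in> conj_by (Q * dsum P1 P2) ` (\<lambda>(a, b). dsum (\<phi>1 a) (\<phi>2 b)) ` (\<rho> ` K \<times> \<rho> ` K)"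
        unfolding ab(3) e[OF ab(1,2)] by (intro imageI, rule image_eqI[OF _ r]) simp
    next
      fix x assume "x \<in> conj_by (Q * dsum P1 P2) ` (\<lambda>(a, b). dsum (\<phi>1 a) (\<phi>2 b)) ` (\<rho> ` K \<times> \<rho> ` K)"
      then obtain a b where ab: "a \<in> K" "b \<in> K" "x = conj_by (Q * dsum P1 P2) (dsum (\<phi>1 (\<rho> a)) (\<phi>2 (\<rho> b)))"
        by (elim imageE SigmaE) simp
      then have "x = \<iota> (dsum a b)" using e[OF ab(1,2)] by simp
      then show "x \<in> G" unfolding G using dprodI[OF ab(1,2)] by blast
    qed
    have "H = (\<lambda>g. \<iota> (dsum g g)) ` K" unfolding H by blast
    also have "\<dots> = (\<lambda>g. conj_by (Q * dsum P1 P2) (dsum (\<phi>1 (\<rho> g)) (\<phi>2 (\<rho> g)))) ` K"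
      using e by (intro image_cong refl) blast
    finally show "H = conj_by (Q * dsum P1 P2) ` (\<lambda>a. dsum (\<phi>1 a) (\<phi>2 a)) ` \<rho> ` K"
      unfolding image_image .
  qed
qed

section \<open>The types of classical groups are disjoint\<close>

lemma scalar_in_GL: "c \<noteq> 0 \<Longrightarrow> c \<cdot>\<^sub>m 1\<^sub>m n \<in> GL_group n"
  by (rule plus_dual_scalar(1))

lemma scalar_isometry_iff:
  assumes "\<beta> \<in> GL_group N" "N > 0" "c \<noteq> 0"
  shows "c \<cdot>\<^sub>m 1\<^sub>m N \<in> isometries N \<beta> \<beta> \<longleftrightarrow> c * c = 1"
proof -
  note b = GL_groupD[OF assms(1)]
  have e: "transpose_mat (c \<cdot>\<^sub>m 1\<^sub>m N) * \<beta> * (c \<cdot>\<^sub>m 1\<^sub>m N) = (c * c) \<cdot>\<^sub>m \<beta>"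
    using b by (simp add: transpose_scalar mult_smult_distrib[of _ N N _ N] mult_smult_assoc_mat[of _ N N _ N] smult_smult)
  have "c * c = 1" if "(c * c) \<cdot>\<^sub>m \<beta> = \<beta>"
  proof -
    have "(c * c) \<cdot>\<^sub>m 1\<^sub>m N = (c * c) \<cdot>\<^sub>m (\<beta> * minv N \<beta>)" using minv_right[OF assms(1)] by simp
    also have "\<dots> = ((c * c) \<cdot>\<^sub>m \<beta>) * minv N \<beta>" using mult_smult_assoc_mat[OF b minv_carrier[OF assms(1)]] by simp
    also have "\<dots> = 1\<^sub>m N" using that minv_right[OF assms(1)] by simp
    finally have "((c * c) \<cdot>\<^sub>m 1\<^sub>m N) $$ (0, 0) = (1\<^sub>m N :: complex mat) $$ (0, 0)" by simp
    then show ?thesis using assms(2) by simp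
  qed
  then show ?thesis using e scalar_in_GL[OF assms(3)] smult_one by (auto simp: isometries_def)
qed

text \<open>The dual pair and the symmetric pair come from separate rules that share only the set
  \<open>K\<close>. Matching them means recovering size and type from this set; a set with an
  element of one fixed matrix size determines the size.\<close>

definition matrix_group_of_size :: "nat \<Rightarrow> complex mat set \<Rightarrow> bool" where
  "matrix_group_of_size N K \<longleftrightarrow> N > 0 \<and> 1\<^sub>m N \<in> K \<and> K \<subseteq> carrier_mat N N"

lemma matrix_group_of_sizeD:
  assumes "matrix_group_of_size N K"
  shows "N > 0" "1\<^sub>m N \<in> K" "K \<subseteq> carrier_mat N N"
  using assms unfolding matrix_group_of_size_def by blast+

lemma size_unique: "matrix_group_of_size N K \<Longrightarrow> matrix_group_of_size N' K \<Longrightarrow> N = N'"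
  unfolding matrix_group_of_size_def by (metis carrier_matD(1) one_carrier_mat subsetD)

lemma size_isometries: "\<beta> \<in> carrier_mat N N \<Longrightarrow> N > 0 \<Longrightarrow> matrix_group_of_size N (isometries N \<beta> \<beta>)"
  unfolding matrix_group_of_size_def using isometriesD(2) by (auto simp: isometries_def)

lemma size_GL: "n > 0 \<Longrightarrow> matrix_group_of_size n (GL_group n)"
  unfolding matrix_group_of_size_def using GL_groupD by auto

lemma size_O: "n > 0 \<Longrightarrow> matrix_group_of_size n (O_group n)"
  unfolding O_group_def by (rule size_isometries) simp_all

lemma size_Sp: "k > 0 \<Longrightarrow> matrix_group_of_size (2 * k) (Sp_group k)"
  unfolding Sp_group_def by (rule size_isometries) simp_all

lemma size_dprod:
  assumes "matrix_group_of_size N X"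
  shows "matrix_group_of_size (N + N) (dprod X X)"
  unfolding matrix_group_of_size_def
proof (intro conjI subsetI)
  note X = matrix_group_of_sizeD[OF assms]
  show "N + N > 0" using X(1) by simp
  show "1\<^sub>m (N + N) \<in> dprod X X" using dprodI[OF X(2,2)] by (simp add: dsum_one)
  show "x \<in> carrier_mat (N + N) (N + N)" if x: "x \<in> dprod X X" for x
  proof -
    obtain a b where ab: "a \<in> X" "b \<in> X" "x = dsum a b" using x by (rule dprodE)
    show ?thesis unfolding ab(3) using ab(1,2) X(3) by (intro dsum_carrier) blast+
  qed
qed

lemma sympl_form_GL: "sympl_form k \<in> GL_group (2 * k)"
  by (rule std_form_props(2)[OF std_form_sympl])

text \<open>The scalar 2 is invertible but multiplies every bilinear form by 4.\<close>

lemma GL_neq_isometries: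
  assumes "n > 0" "N > 0" "\<beta> \<in> GL_group N"
  shows "GL_group n \<noteq> isometries N \<beta> \<beta>"
proof
  assume e: "GL_group n = isometries N \<beta> \<beta>"
  have "n = N" using size_unique[OF size_GL[OF assms(1)]] size_isometries[OF GL_groupD[OF assms(3)] assms(2)] unfolding e by blast
  then have "2 \<cdot>\<^sub>m 1\<^sub>m N \<in> isometries N \<beta> \<beta>" using scalar_in_GL[of 2 N] e by simp
  then show False using scalar_isometry_iff[OF assms(3,2), of 2] by simp
qed

text \<open>The diagonal matrix with 2 on the first half and 1/2 on the second preserves the
  alternating form but not the identity form.\<close>

lemma O_neq_Sp:
  assumes "n > 0" "k > 0"
  shows "O_group n \<noteq> Sp_group k"
proof
  assume e: "O_group n = Sp_group k"
  let ?g = "gm (k + k) (\<lambda>i. i) (\<lambda>i. if i < k then 2 else 1 / 2)"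
  have n: "n = k + k" using size_unique[OF size_O[OF assms(1)]] size_Sp[OF assms(2)] unfolding e mult_2 by blast
  have "plus_dual (2 \<cdot>\<^sub>m 1\<^sub>m k) \<in> Sp_group k"
    unfolding Sp_group_def sympl_form_eq mult_2 by (rule plus_dual_isometry[OF scalar_in_GL]) simp_all
  then have "?g \<in> O_group n" unfolding e plus_dual_scalar(2)[of 2, simplified] by simp
  then have "transpose_mat ?g * 1\<^sub>m n * ?g = 1\<^sub>m n" unfolding O_group_def by (rule isometriesD(3))
  moreover have "transpose_mat ?g = ?g" by (rule eq_matI) auto
  moreover have "?g * 1\<^sub>m n = ?g" unfolding n by (rule right_mult_one_mat[OF gm_carrier])
  ultimately have "?g * ?g = 1\<^sub>m n" by simp
  moreover have "?g * ?g = gm (k + k) (\<lambda>i. i) (\<lambda>i. (if i < k then 2 else 1 / 2) * (if i < k then 2 else 1 / 2))"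
    by (rule gm_mult)
  ultimately have "gm (k + k) (\<lambda>i. i) (\<lambda>i. (if i < k then 2 else 1 / 2) * (if i < k then 2 else 1 / 2)) $$ (0, 0) = (1\<^sub>m n :: complex mat) $$ (0, 0)"
    by simp
  then show False using assms n by simp
qed

lemma hyp_form_in_O: "hyp_form n 1 \<in> O_group (n + n)"
proof -
  note h = std_form_props[OF std_form_hyp[of 1 n], unfolded mult_2, simplified]
  have "transpose_mat (hyp_form n 1) * 1\<^sub>m (n + n) * hyp_form n 1 = 1\<^sub>m (n + n)"
    unfolding h(5) smult_one right_mult_one_mat[OF h(1)] h(3) ..
  then show ?thesis using h(2) by (simp add: O_group_def isometries_def)
qed

lemma sympl_form_in_Sp: "sympl_form n \<in> Sp_group n"
proof -
  note h = std_form_props[OF std_form_sympl[of n]]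
  have "transpose_mat (sympl_form n) * sympl_form n * sympl_form n = sympl_form n"
    unfolding h(5) mult_smult_assoc_mat[OF h(1,1)] h(3) smult_smult using left_mult_one_mat[OF h(1)] by (simp add: smult_one)
  then show ?thesis using h(2) by (simp add: Sp_group_def isometries_def)
qed

text \<open>For a suitable sign this matrix lies in each classical group of size
  \<open>N + N\<close>, whereas its entry at \<open>(0, N)\<close> is outside the diagonal
  blocks.\<close>

lemma hyp_form_notin_dprod:
  assumes "matrix_group_of_size N X"
  shows "hyp_form N \<epsilon> \<notin> dprod X X"
proof
  note X = matrix_group_of_sizeD[OF assms]
  assume "hyp_form N \<epsilon> \<in> dprod X X"
  then obtain a b where ab: "a \<in> carrier_mat N N" "b \<in> carrier_mat N N" "hyp_form N \<epsilon> = dsum a b" using X(3) by (auto elim!: dprodE)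
  have l: "0 < N + N" "N < N + N" using X(1) by simp_all
  have "hyp_form N \<epsilon> $$ (0, N) = 1" using X(1) by (simp add: hyp_form_def)
  moreover have "dsum a b $$ (0, N) = 0" unfolding dsum_index[OF ab(1,2) l] using X(1) by simp
  ultimately show False using ab(3) by simp
qed

lemma dprod_neq:
  assumes "matrix_group_of_size N X" "n > 0"
  shows "dprod X X \<noteq> GL_group n" "dprod X X \<noteq> O_group n" "dprod X X \<noteq> Sp_group n"
proof -
  note s = size_dprod[OF assms(1)]
  have c: "hyp_form N \<epsilon> \<notin> dprod X X" for \<epsilon> by (rule hyp_form_notin_dprod[OF assms(1)])
  show "dprod X X \<noteq> GL_group n"
  proof
    assume e: "dprod X X = GL_group n"
    have "n = N + N" using size_unique[OF size_GL[OF assms(2)]] s unfolding e by blast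
    then show False using c[of 1] isometriesD(1)[OF hyp_form_in_O[of N, unfolded O_group_def]] unfolding e by simp
  qed
  show "dprod X X \<noteq> O_group n"
  proof
    assume e: "dprod X X = O_group n"
    have "n = N + N" using size_unique[OF size_O[OF assms(2)]] s unfolding e by blast
    then show False using c[of 1] hyp_form_in_O[of N] unfolding e by simp
  qed
  show "dprod X X \<noteq> Sp_group n"
  proof
    assume e: "dprod X X = Sp_group n"
    have "2 * n = N + N" using size_unique[OF size_Sp[OF assms(2)]] s unfolding e by blast
    then have "n = N" by simp
    then show False using c[of "-1"] sympl_form_in_Sp[of N] unfolding e sympl_form_eq by simp
  qed
qed

text \<open>The factor is recovered from the elements \<open>dsum x x\<close>.\<close>

lemma dprod_inj:
  assumes "matrix_group_of_size N X" "matrix_group_of_size N' X'" "dprod X X = dprod X' X'"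
  shows "X = X'"
proof -
  have "N + N = N' + N'" using size_unique[OF size_dprod[OF assms(1)]] size_dprod[OF assms(2)] unfolding assms(3) by blast
  then have N: "N' = N" by simp
  note X = matrix_group_of_sizeD(3)[OF assms(1)] and X' = matrix_group_of_sizeD(3)[OF assms(2)[unfolded N]]
  have *: "Y \<subseteq> Y'" if s: "Y \<subseteq> carrier_mat N N" "Y' \<subseteq> carrier_mat N N" and e: "dprod Y Y = dprod Y' Y'" for Y Y'
  proof
    fix x assume x: "x \<in> Y"
    have "dsum x x \<in> dprod Y' Y'" using dprodI[OF x x] unfolding e .
    then obtain a b where ab: "a \<in> Y'" "b \<in> Y'" "dsum x x = dsum a b" by (rule dprodE)
    have "x \<in> carrier_mat N N" "a \<in> carrier_mat N N" "b \<in> carrier_mat N N" using x ab s by blast+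
    then have "x = a" using dsum_eq_iff[of x N a x N b] ab(3) by blast
    then show "x \<in> Y'" using ab(1) by simp
  qed
  show ?thesis using *[OF X X' assms(3)] *[OF X' X assms(3)[symmetric]] by blast
qed

lemma irreducible_pair_size:
  assumes "irreducible_pair m K \<iota> G'"
  obtains N where "matrix_group_of_size N K"
  using assms by cases (use size_GL size_O size_Sp in blast)+

lemma irreducible_pair_neq_dprod:
  assumes "irreducible_pair m (dprod X X) \<iota> G'" "matrix_group_of_size N X"
  shows False
  using assms(1) by cases (use dprod_neq[OF assms(2)] in blast)+

text \<open>Inversion of the rules: the other two are excluded because \<open>GL\<close> is not the
  isometry group of an invertible form, and the sizes agree because the set determines them.\<close>

lemma irreducible_pair_GL:
  assumes "irreducible_pair m (GL_group n) \<iota> G'" "n > 0"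
  obtains k P where "k > 0" "m = n * k" "P \<in> Sp_group (n * k)" "\<iota> = (\<lambda>g. conj_by P (plus_dual (kron g (1\<^sub>m k))))"
  using assms(1)
proof cases
  case (GL_GL n' k P)
  have "n' = n" using size_unique[OF size_GL[OF GL_GL(5)]] size_GL[OF assms(2)] unfolding GL_GL(2) by blast
  then show thesis using that GL_GL by blast
next
  case (O_Sp n' k P)
  then show thesis using GL_neq_isometries[OF assms(2) _ one_in_GL, of n'] unfolding O_group_def by blast
next
  case (Sp_O n' k P)
  then show thesis using GL_neq_isometries[OF assms(2) _ sympl_form_GL, of k] unfolding Sp_group_def by simp
qed

lemma irreducible_pair_O:
  assumes "irreducible_pair m (O_group n) \<iota> G'" "n > 0"
  obtains k P where "k > 0" "m = n * k"
    "P \<in> isometries (2 * (n * k)) (kron (1\<^sub>m n) (sympl_form k)) (sympl_form (n * k))"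
    "\<iota> = (\<lambda>g. conj_by P (kron g (1\<^sub>m (2 * k))))"
  using assms(1)
proof cases
  case (GL_GL n' k P)
  then show thesis using GL_neq_isometries[OF _ assms(2) one_in_GL, of n'] unfolding O_group_def by metis
next
  case (O_Sp n' k P)
  have "n' = n" using size_unique[OF size_O[OF O_Sp(5)]] size_O[OF assms(2)] unfolding O_Sp(2) by blast
  then show thesis using that O_Sp by blast
next
  case (Sp_O n' k P)
  then show thesis using O_neq_Sp[OF assms(2), of k] by blast
qed

lemma irreducible_pair_Sp:
  assumes "irreducible_pair m (Sp_group k) \<iota> G'" "k > 0"
  obtains n P where "n > 0" "m = n * k"
    "P \<in> isometries (2 * (n * k)) (kron (1\<^sub>m n) (sympl_form k)) (sympl_form (n * k))"
    "\<iota> = (\<lambda>h. conj_by P (kron (1\<^sub>m n) h))"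
  using assms(1)
proof cases
  case (GL_GL n k' P)
  have "2 * k > 0" using assms(2) by simp
  then show thesis using GL_neq_isometries[OF _ _ sympl_form_GL, of n k] GL_GL unfolding Sp_group_def by metis
next
  case (O_Sp n k' P)
  then show thesis using O_neq_Sp[OF _ assms(2), of n] by metis
next
  case (Sp_O n k' P)
  have "2 * k' = 2 * k" using size_unique[OF size_Sp[OF Sp_O(6)]] size_Sp[OF assms(2)] unfolding Sp_O(2) by blast
  then have "k' = k" by simp
  then show thesis using that Sp_O by blast
qed

section \<open>The ten types\<close>

lemma GL_model:
  assumes "k > 0"
  shows "amplification (n + n) (2 * (n * k)) (\<lambda>a. kron a (1\<^sub>m k))"
    and "kron (hyp_form n (-1)) (1\<^sub>m k) = sympl_form (n * k)"
    and "X \<subseteq> GL_group n \<Longrightarrow> (\<lambda>g. conj_by P (plus_dual (kron g (1\<^sub>m k)))) ` X = conj_by P ` (\<lambda>a. kron a (1\<^sub>m k)) ` plus_dual ` X"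
proof -
  have "(n + n) * k = 2 * (n * k)" by simp
  then show "amplification (n + n) (2 * (n * k)) (\<lambda>a. kron a (1\<^sub>m k))" using amplification_left[OF assms, of "n + n"] by metis
  show "kron (hyp_form n (-1)) (1\<^sub>m k) = sympl_form (n * k)" unfolding sympl_form_eq[symmetric] sympl_form_kron ..
  show "(\<lambda>g. conj_by P (plus_dual (kron g (1\<^sub>m k)))) ` X = conj_by P ` (\<lambda>a. kron a (1\<^sub>m k)) ` plus_dual ` X" if X: "X \<subseteq> GL_group n"
    unfolding image_image
  proof (rule image_cong[OF refl])
    fix g assume "g \<in> X"
    then have "g \<in> GL_group n" using X by blast
    then show "conj_by P (plus_dual (kron g (1\<^sub>m k))) = conj_by P (kron (plus_dual g) (1\<^sub>m k))"
      by (simp only: plus_dual_kron[OF _ assms])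
  qed
qed

text \<open>The symplectic form of the tensor product is the identity form of the standard module
  times \<open>kron 1 (sympl_form k)\<close>. The latter commutes with the orthogonal group and is
  the factor \<open>w'\<close> of the swap.\<close>

lemma O_model:
  assumes "n > 0" "k > 0"
  shows "amplification n (2 * (n * k)) (\<lambda>a. kron a (1\<^sub>m (2 * k)))"
    and "kron (1\<^sub>m n) (sympl_form k) \<in> carrier_mat (2 * (n * k)) (2 * (n * k))"
    and "a \<in> carrier_mat n n \<Longrightarrow> kron (1\<^sub>m n) (sympl_form k) * kron a (1\<^sub>m (2 * k)) = kron a (1\<^sub>m (2 * k)) * kron (1\<^sub>m n) (sympl_form k)"
    and "kron (1\<^sub>m n) (1\<^sub>m (2 * k)) * kron (1\<^sub>m n) (sympl_form k) = kron (1\<^sub>m n) (sympl_form k)"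
proof -
  have e: "n * (2 * k) = 2 * (n * k)" by simp
  show "amplification n (2 * (n * k)) (\<lambda>a. kron a (1\<^sub>m (2 * k)))"
    using amplification_left[of "2 * k" n] assms unfolding e by simp
  show "kron (1\<^sub>m n) (sympl_form k) \<in> carrier_mat (2 * (n * k)) (2 * (n * k))"
    using kron_carrier[OF one_carrier_mat sympl_form_carrier, of n k] unfolding e .
  show "kron (1\<^sub>m n) (sympl_form k) * kron a (1\<^sub>m (2 * k)) = kron a (1\<^sub>m (2 * k)) * kron (1\<^sub>m n) (sympl_form k)" if a: "a \<in> carrier_mat n n"
    unfolding kron_commute[OF a sympl_form_carrier] ..
  show "kron (1\<^sub>m n) (1\<^sub>m (2 * k)) * kron (1\<^sub>m n) (sympl_form k) = kron (1\<^sub>m n) (sympl_form k)"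
    by (rule kron_commute(1)[OF one_carrier_mat sympl_form_carrier])
qed

text \<open>For \<open>Sp\<close> the form is amplified from the standard module, and
  \<open>w'\<close> is the identity. The same computations describe the factor \<open>w'\<close> of
  the orthogonal model.\<close>

lemma Sp_model:
  assumes "n > 0"
  shows "amplification (2 * k) (2 * (n * k)) (\<lambda>a. kron (1\<^sub>m n) a)"
    and "kron (1\<^sub>m n) (sympl_form k) * 1\<^sub>m (2 * (n * k)) = kron (1\<^sub>m n) (sympl_form k)"
    and "kron (1\<^sub>m n) (sympl_form k) * kron (1\<^sub>m n) (sympl_form k) = (-1) \<cdot>\<^sub>m 1\<^sub>m (2 * (n * k))"
      "dagger (kron (1\<^sub>m n) (sympl_form k)) = (-1) \<cdot>\<^sub>m kron (1\<^sub>m n) (sympl_form k)"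
      "transpose_mat (kron (1\<^sub>m n) (sympl_form k)) = (-1) \<cdot>\<^sub>m kron (1\<^sub>m n) (sympl_form k)"
proof -
  have e: "n * (2 * k) = 2 * (n * k)" by simp
  show amp: "amplification (2 * k) (2 * (n * k)) (\<lambda>a. kron (1\<^sub>m n) a)"
    using amplification_right[OF assms, of "2 * k"] unfolding e .
  note f = amplification.form[OF amp std_form_sympl]
  show "kron (1\<^sub>m n) (sympl_form k) * 1\<^sub>m (2 * (n * k)) = kron (1\<^sub>m n) (sympl_form k)" by (rule right_mult_one_mat[OF f(1)])
  show "kron (1\<^sub>m n) (sympl_form k) * kron (1\<^sub>m n) (sympl_form k) = (-1) \<cdot>\<^sub>m 1\<^sub>m (2 * (n * k))"
    "dagger (kron (1\<^sub>m n) (sympl_form k)) = (-1) \<cdot>\<^sub>m kron (1\<^sub>m n) (sympl_form k)"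
    "transpose_mat (kron (1\<^sub>m n) (sympl_form k)) = (-1) \<cdot>\<^sub>m kron (1\<^sub>m n) (sympl_form k)"
    by (fact f)+
qed

text \<open>The type of the symmetric pair fixes the kind of \<open>K\<close> and hence, as the
  kinds are disjoint, the rule that produced the irreducible pair. The diagonal types cannot occur,
  since \<open>K\<close> would be a product.\<close>

lemma see_saw_irreducible:
  assumes ir: "irreducible_pair m K \<iota> G'" and dp: "dual_pair m (\<iota> ` K) G'"
    and cs: "classical_symmetric_pair K L" and sym: "symmetric_subgroup (2 * m) (\<iota> ` K) (\<iota> ` L)"
  shows "dual_pair m (\<iota> ` L) (centralizer (Sp_group m) (\<iota> ` L)) \<and> symmetric_subgroup (2 * m) (centralizer (Sp_group m) (\<iota> ` L)) G'"
  using cs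
proof cases
  case (diagonal_GL n)
  show ?thesis using irreducible_pair_neq_dprod[OF ir[unfolded diagonal_GL(1)] size_GL[OF diagonal_GL(3)]] by blast
next
  case (diagonal_O n)
  show ?thesis using irreducible_pair_neq_dprod[OF ir[unfolded diagonal_O(1)] size_O[OF diagonal_O(3)]] by blast
next
  case (diagonal_Sp n)
  show ?thesis using irreducible_pair_neq_dprod[OF ir[unfolded diagonal_Sp(1)] size_Sp[OF diagonal_Sp(3)]] by blast
next
  case (direct_sum_GL n1 n2 Q)
  have n: "n1 + n2 > 0" using direct_sum_GL by simp
  obtain k P where k: "k > 0" "m = (n1 + n2) * k" "P \<in> Sp_group ((n1 + n2) * k)" "\<iota> = (\<lambda>g. conj_by P (plus_dual (kron g (1\<^sub>m k))))"
    by (rule irreducible_pair_GL[OF ir[unfolded direct_sum_GL(1)] n])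
  note M = GL_model[OF k(1), where n = "n1 + n2"]
  show ?thesis
  proof (rule see_saw_GL_direct_sum[OF dp sym M(1)[folded k(2)] direct_sum_GL(3,4) _ direct_sum_GL(5)])
    show "P \<in> isometries (2 * m) (kron (hyp_form (n1 + n2) (-1)) (1\<^sub>m k)) (sympl_form m)"
      using k(3) unfolding M(2) Sp_group_def k(2) .
    show "\<iota> ` K = conj_by P ` (\<lambda>a. kron a (1\<^sub>m k)) ` plus_dual ` GL_group (n1 + n2)"
      unfolding k(4) direct_sum_GL(1) by (rule M(3)[OF order_refl])
    have "conj_by Q ` dprod (GL_group n1) (GL_group n2) \<subseteq> GL_group (n1 + n2)"
      using conj_by_GL[OF direct_sum_GL(5) dsum_GL] by (auto elim!: dprodE)
    then show "\<iota> ` L = conj_by P ` (\<lambda>a. kron a (1\<^sub>m k)) ` plus_dual ` conj_by Q ` dprod (GL_group n1) (GL_group n2)"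
      unfolding k(4) direct_sum_GL(2) by (rule M(3))
  qed
next
  case (direct_sum_O n1 n2 Q)
  have n: "n1 + n2 > 0" using direct_sum_O by simp
  obtain k P where k: "k > 0" "m = (n1 + n2) * k"
    "P \<in> isometries (2 * ((n1 + n2) * k)) (kron (1\<^sub>m (n1 + n2)) (sympl_form k)) (sympl_form ((n1 + n2) * k))"
    "\<iota> = (\<lambda>g. conj_by P (kron g (1\<^sub>m (2 * k))))"
    by (rule irreducible_pair_O[OF ir[unfolded direct_sum_O(1)] n])
  note M = O_model[OF n k(1)] and S = Sp_model[OF n, of k]
  show ?thesis
  proof (rule see_saw_isometries_direct_sum[OF dp sym M(1)[folded k(2)] M(2)[folded k(2)] M(3) S(3)[folded k(2)] S(4) _ _
        std_form_one std_form_one direct_sum_O(3,4) generating_O[unfolded O_group_def] generating_O[unfolded O_group_def]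
        one_carrier_mat generating_O[unfolded O_group_def]])
    show "Q \<in> isometries (n1 + n2) (dsum (1\<^sub>m n1) (1\<^sub>m n2)) (1\<^sub>m (n1 + n2))"
      using direct_sum_O(5) unfolding O_group_def dsum_one .
    show "P \<in> isometries (2 * m) (kron (1\<^sub>m (n1 + n2)) (1\<^sub>m (2 * k)) * kron (1\<^sub>m (n1 + n2)) (sympl_form k)) (sympl_form m)"
      using k(3) unfolding M(4) k(2) .
    show "\<iota> ` K = conj_by P ` (\<lambda>a. kron a (1\<^sub>m (2 * k))) ` isometries (n1 + n2) (1\<^sub>m (n1 + n2)) (1\<^sub>m (n1 + n2))"
      unfolding k(4) direct_sum_O(1) O_group_def image_image ..
    show "\<iota> ` L = conj_by P ` (\<lambda>a. kron a (1\<^sub>m (2 * k))) ` conj_by Q ` dprod (isometries n1 (1\<^sub>m n1) (1\<^sub>m n1)) (isometries n2 (1\<^sub>m n2) (1\<^sub>m n2))"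
      unfolding k(4) direct_sum_O(2) O_group_def image_image ..
  qed simp_all
next
  case (direct_sum_Sp n1 n2 Q)
  have n: "n1 + n2 > 0" using direct_sum_Sp by simp
  obtain k P where k: "k > 0" "m = k * (n1 + n2)"
    "P \<in> isometries (2 * (k * (n1 + n2))) (kron (1\<^sub>m k) (sympl_form (n1 + n2))) (sympl_form (k * (n1 + n2)))"
    "\<iota> = (\<lambda>h. conj_by P (kron (1\<^sub>m k) h))"
    by (rule irreducible_pair_Sp[OF ir[unfolded direct_sum_Sp(1)] n])
  note M = Sp_model[OF k(1), of "n1 + n2", folded k(2)]
  have e: "2 * n1 + 2 * n2 = 2 * (n1 + n2)" by simp
  interpret p: amplification "2 * (n1 + n2)" "2 * m" "\<lambda>a. kron (1\<^sub>m k) a" by (rule M(1))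
  have pos: "2 * n1 > 0" "2 * n2 > 0" using direct_sum_Sp by simp_all
  have c: "1\<^sub>m (2 * m) * kron (1\<^sub>m k) a = kron (1\<^sub>m k) a * 1\<^sub>m (2 * m)" if "a \<in> carrier_mat (2 * (n1 + n2)) (2 * (n1 + n2))" for a
    using left_mult_one_mat[OF p.car[OF that]] right_mult_one_mat[OF p.car[OF that]] by simp
  show ?thesis
  proof (rule see_saw_isometries_direct_sum[where ?n1.0 = "2 * n1" and ?n2.0 = "2 * n2" and \<phi> = "\<lambda>a. kron (1\<^sub>m k) a" and c = 1 and e = 1,
        OF dp sym _ one_carrier_mat _ _ _ _ _ std_form_sympl std_form_sympl pos
          generating_Sp[unfolded Sp_group_def] generating_Sp[unfolded Sp_group_def], unfolded e])
    show "amplification (2 * (n1 + n2)) (2 * m) (\<lambda>a. kron (1\<^sub>m k) a)" by (rule M(1))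
    show "1\<^sub>m (2 * m) * kron (1\<^sub>m k) a = kron (1\<^sub>m k) a * 1\<^sub>m (2 * m)" if "a \<in> carrier_mat (2 * (n1 + n2)) (2 * (n1 + n2))" for a
      using c[OF that] .
    show "sympl_form (n1 + n2) \<in> carrier_mat (2 * (n1 + n2)) (2 * (n1 + n2))" by (rule sympl_form_carrier)
    show "generating (2 * (n1 + n2)) (isometries (2 * (n1 + n2)) (sympl_form (n1 + n2)) (sympl_form (n1 + n2)))"
      by (rule generating_Sp[unfolded Sp_group_def])
    show "Q \<in> isometries (2 * (n1 + n2)) (dsum (sympl_form n1) (sympl_form n2)) (sympl_form (n1 + n2))" by (rule direct_sum_Sp(5))
    show "P \<in> isometries (2 * m) (kron (1\<^sub>m k) (sympl_form (n1 + n2)) * 1\<^sub>m (2 * m)) (sympl_form m)"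
      unfolding M(2) using k(3)[folded k(2)] .
    show "\<iota> ` K = conj_by P ` (\<lambda>a. kron (1\<^sub>m k) a) ` isometries (2 * (n1 + n2)) (sympl_form (n1 + n2)) (sympl_form (n1 + n2))"
      unfolding k(4) direct_sum_Sp(1) Sp_group_def image_image ..
    show "\<iota> ` L = conj_by P ` (\<lambda>a. kron (1\<^sub>m k) a) ` conj_by Q ` dprod (isometries (2 * n1) (sympl_form n1) (sympl_form n1)) (isometries (2 * n2) (sympl_form n2) (sympl_form n2))"
      unfolding k(4) direct_sum_Sp(2) Sp_group_def image_image ..
  qed (simp_all add: smult_one)
next
  case (polarization_O n L1 L2)
  have n: "2 * n > 0" using polarization_O by simp
  obtain k P where k: "k > 0" "m = (2 * n) * k"
    "P \<in> isometries (2 * ((2 * n) * k)) (kron (1\<^sub>m (2 * n)) (sympl_form k)) (sympl_form ((2 * n) * k))"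
    "\<iota> = (\<lambda>g. conj_by P (kron g (1\<^sub>m (2 * k))))"
    by (rule irreducible_pair_O[OF ir[unfolded polarization_O(1)] n])
  note M = O_model[OF n k(1)] and S = Sp_model[OF n, of k]
  show ?thesis
  proof (rule see_saw_isometries_polarization[OF dp sym M(1)[folded k(2)] M(2)[folded k(2)] M(3) S(3)[folded k(2)] S(4) _ _
        std_form_one n generating_O[unfolded O_group_def] polarization_O(4)])
    show "P \<in> isometries (2 * m) (kron (1\<^sub>m (2 * n)) (1\<^sub>m (2 * k)) * kron (1\<^sub>m (2 * n)) (sympl_form k)) (sympl_form m)"
      using k(3) unfolding M(4) k(2) .
    show "\<iota> ` K = conj_by P ` (\<lambda>a. kron a (1\<^sub>m (2 * k))) ` isometries (2 * n) (1\<^sub>m (2 * n)) (1\<^sub>m (2 * n))"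
      unfolding k(4) polarization_O(1) O_group_def image_image ..
    show "\<iota> ` L = conj_by P ` (\<lambda>a. kron a (1\<^sub>m (2 * k))) ` pair_stabilizer (isometries (2 * n) (1\<^sub>m (2 * n)) (1\<^sub>m (2 * n))) L1 L2"
      unfolding k(4) polarization_O(2) O_group_def image_image ..
  qed simp_all
next
  case (polarization_Sp n L1 L2)
  obtain k P where k: "k > 0" "m = k * n"
    "P \<in> isometries (2 * (k * n)) (kron (1\<^sub>m k) (sympl_form n)) (sympl_form (k * n))"
    "\<iota> = (\<lambda>h. conj_by P (kron (1\<^sub>m k) h))"
    by (rule irreducible_pair_Sp[OF ir[unfolded polarization_Sp(1)] polarization_Sp(3)])
  note M = Sp_model[OF k(1), of n, folded k(2)]
  interpret p: amplification "2 * n" "2 * m" "\<lambda>a. kron (1\<^sub>m k) a" by (rule M(1))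
  have n: "2 * n > 0" using polarization_Sp by simp
  show ?thesis
  proof (rule see_saw_isometries_polarization[where c = 1 and e = 1, OF dp sym M(1) one_carrier_mat _ _ _ _ _
        std_form_sympl n generating_Sp[unfolded Sp_group_def] polarization_Sp(4)])
    show "1\<^sub>m (2 * m) * kron (1\<^sub>m k) a = kron (1\<^sub>m k) a * 1\<^sub>m (2 * m)" if "a \<in> carrier_mat (2 * n) (2 * n)" for a
      using left_mult_one_mat[OF p.car[OF that]] right_mult_one_mat[OF p.car[OF that]] by simp
    show "P \<in> isometries (2 * m) (kron (1\<^sub>m k) (sympl_form n) * 1\<^sub>m (2 * m)) (sympl_form m)"
      unfolding M(2) using k(3)[folded k(2)] .
    show "\<iota> ` K = conj_by P ` (\<lambda>a. kron (1\<^sub>m k) a) ` isometries (2 * n) (sympl_form n) (sympl_form n)"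
      unfolding k(4) polarization_Sp(1) Sp_group_def image_image ..
    show "\<iota> ` L = conj_by P ` (\<lambda>a. kron (1\<^sub>m k) a) ` pair_stabilizer (isometries (2 * n) (sympl_form n) (sympl_form n)) L1 L2"
      unfolding k(4) polarization_Sp(2) Sp_group_def image_image ..
  qed (simp_all add: smult_one)
next
  case (bilinear_O n Q)
  obtain k P where k: "k > 0" "m = n * k" "P \<in> Sp_group (n * k)" "\<iota> = (\<lambda>g. conj_by P (plus_dual (kron g (1\<^sub>m k))))"
    by (rule irreducible_pair_GL[OF ir[unfolded bilinear_O(1)] bilinear_O(3)])
  note M = GL_model[OF k(1), where n = n]
  show ?thesis
  proof (rule see_saw_GL_bilinear[OF dp sym M(1)[folded k(2)] bilinear_O(3) std_form_one generating_O[unfolded O_group_def] _ bilinear_O(4)])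
    show "P \<in> isometries (2 * m) (kron (hyp_form n (-1)) (1\<^sub>m k)) (sympl_form m)"
      using k(3) unfolding M(2) Sp_group_def k(2) .
    show "\<iota> ` K = conj_by P ` (\<lambda>a. kron a (1\<^sub>m k)) ` plus_dual ` GL_group n"
      unfolding k(4) bilinear_O(1) by (rule M(3)[OF order_refl])
    have "conj_by Q ` O_group n \<subseteq> GL_group n"
      using conj_by_GL[OF bilinear_O(4)] isometriesD(1) unfolding O_group_def by blast
    then show "\<iota> ` L = conj_by P ` (\<lambda>a. kron a (1\<^sub>m k)) ` plus_dual ` conj_by Q ` isometries n (1\<^sub>m n) (1\<^sub>m n)"
      unfolding k(4) bilinear_O(2) O_group_def by (rule M(3))
  qed
next
  case (bilinear_Sp n Q)
  have n: "2 * n > 0" using bilinear_Sp by simp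
  obtain k P where k: "k > 0" "m = 2 * n * k" "P \<in> Sp_group (2 * n * k)" "\<iota> = (\<lambda>g. conj_by P (plus_dual (kron g (1\<^sub>m k))))"
    by (rule irreducible_pair_GL[OF ir[unfolded bilinear_Sp(1)] n])
  note M = GL_model[OF k(1), where n = "2 * n"]
  show ?thesis
  proof (rule see_saw_GL_bilinear[OF dp sym M(1)[folded k(2)] n std_form_sympl generating_Sp[unfolded Sp_group_def] _ bilinear_Sp(4)])
    show "P \<in> isometries (2 * m) (kron (hyp_form (2 * n) (-1)) (1\<^sub>m k)) (sympl_form m)"
      using k(3) unfolding M(2) Sp_group_def k(2) .
    show "\<iota> ` K = conj_by P ` (\<lambda>a. kron a (1\<^sub>m k)) ` plus_dual ` GL_group (2 * n)"
      unfolding k(4) bilinear_Sp(1) by (rule M(3)[OF order_refl])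
    have "conj_by Q ` Sp_group n \<subseteq> GL_group (2 * n)"
      using conj_by_GL[OF bilinear_Sp(4)] isometriesD(1) unfolding Sp_group_def by blast
    then show "\<iota> ` L = conj_by P ` (\<lambda>a. kron a (1\<^sub>m k)) ` plus_dual ` conj_by Q ` isometries (2 * n) (sympl_form n) (sympl_form n)"
      unfolding k(4) bilinear_Sp(2) Sp_group_def by (rule M(3))
  qed
qed

lemma isometries_symmetric:
  assumes "std_form N \<beta> \<tau> d \<epsilon>" "N > 0"
  shows "isometries N \<beta> \<beta> \<subseteq> carrier_mat N N" "\<And>a. a \<in> isometries N \<beta> \<beta> \<Longrightarrow> dagger a \<in> isometries N \<beta> \<beta>"
    "1\<^sub>m N \<in> isometries N \<beta> \<beta>" "(-1) \<cdot>\<^sub>m 1\<^sub>m N \<in> isometries N \<beta> \<beta>"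
proof -
  note b = std_form_props[OF assms(1)]
  show "isometries N \<beta> \<beta> \<subseteq> carrier_mat N N" using isometriesD(2) by blast
  show "dagger a \<in> isometries N \<beta> \<beta>" if "a \<in> isometries N \<beta> \<beta>" for a by (rule isometries_dagger[OF assms(1) that])
  show "1\<^sub>m N \<in> isometries N \<beta> \<beta>" using b(1) by (simp add: isometries_def)
  show "(-1) \<cdot>\<^sub>m 1\<^sub>m N \<in> isometries N \<beta> \<beta>" using scalar_isometry_iff[OF b(2) assms(2), of "-1"] by simp
qed

lemma plus_dual_symmetric:
  shows "plus_dual ` GL_group n \<subseteq> carrier_mat (n + n) (n + n)" "\<And>a. a \<in> plus_dual ` GL_group n \<Longrightarrow> dagger a \<in> plus_dual ` GL_group n"
    "1\<^sub>m (n + n) \<in> plus_dual ` GL_group n" "(-1) \<cdot>\<^sub>m 1\<^sub>m (n + n) \<in> plus_dual ` GL_group n"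
proof -
  show "plus_dual ` GL_group n \<subseteq> carrier_mat (n + n) (n + n)" using plus_dual_carrier by blast
  show "dagger a \<in> plus_dual ` GL_group n" if a: "a \<in> plus_dual ` GL_group n" for a
  proof -
    obtain g where g: "g \<in> GL_group n" "a = plus_dual g" using a by blast
    show ?thesis unfolding g(2) dagger_plus_dual[OF g(1)] using dagger_GL[OF g(1)] by (rule imageI)
  qed
  have s: "c \<cdot>\<^sub>m 1\<^sub>m (n + n) \<in> plus_dual ` GL_group n" if c: "c = 1 \<or> c = -1" for c :: complex
  proof -
    have c0: "c \<noteq> 0" and ci: "1 / c = c" using c by auto
    have "plus_dual (c \<cdot>\<^sub>m 1\<^sub>m n) = c \<cdot>\<^sub>m 1\<^sub>m (n + n)"
      unfolding plus_dual_scalar(2)[OF c0] ci unfolding gm_one gm_smult by (rule gm_cong) simp_all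
    then show ?thesis using scalar_in_GL[OF c0, of n] by (metis imageI)
  qed
  show "1\<^sub>m (n + n) \<in> plus_dual ` GL_group n" using s[of 1] by (simp add: smult_one)
  show "(-1) \<cdot>\<^sub>m 1\<^sub>m (n + n) \<in> plus_dual ` GL_group n" by (rule s) simp
qed

text \<open>Only the diagonal types survive, because a product of two equal groups is never a single
  classical group. The two irreducible pairs may have different partners, so the intertwiner between
  their modules is in general only partial.\<close>

lemma see_saw_two_copies:
  assumes ir1: "irreducible_pair m1 K \<iota>1 G1'" and ir2: "irreducible_pair m2 K \<iota>2 G2'"
    and Q: "Q \<in> isometries (2 * (m1 + m2)) (dsum (sympl_form m1) (sympl_form m2)) (sympl_form (m1 + m2))"
    and \<iota>: "\<And>a b. a \<in> K \<Longrightarrow> b \<in> K \<Longrightarrow> \<iota> (dsum a b) = conj_by Q (dsum (\<iota>1 a) (\<iota>2 b))"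
    and dp: "dual_pair (m1 + m2) (\<iota> ` dprod K K) G'"
    and cs: "classical_symmetric_pair (dprod K K) L"
    and sym: "symmetric_subgroup (2 * (m1 + m2)) (\<iota> ` dprod K K) (\<iota> ` L)"
  shows "dual_pair (m1 + m2) (\<iota> ` L) (centralizer (Sp_group (m1 + m2)) (\<iota> ` L)) \<and>
    symmetric_subgroup (2 * (m1 + m2)) (centralizer (Sp_group (m1 + m2)) (\<iota> ` L)) G'"
proof -
  obtain N where N: "matrix_group_of_size N K" by (rule irreducible_pair_size[OF ir1])
  note neq = dprod_neq[OF N]
  from cs show ?thesis
  proof cases
    case (diagonal_GL n)
    have K: "K = GL_group n" by (rule dprod_inj[OF N size_GL[OF diagonal_GL(3)] diagonal_GL(1)])
    obtain k1 P1 where k1: "k1 > 0" "m1 = n * k1" "P1 \<in> Sp_group (n * k1)" "\<iota>1 = (\<lambda>g. conj_by P1 (plus_dual (kron g (1\<^sub>m k1))))"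
      by (rule irreducible_pair_GL[OF ir1[unfolded K] diagonal_GL(3)])
    obtain k2 P2 where k2: "k2 > 0" "m2 = n * k2" "P2 \<in> Sp_group (n * k2)" "\<iota>2 = (\<lambda>g. conj_by P2 (plus_dual (kron g (1\<^sub>m k2))))"
      by (rule irreducible_pair_GL[OF ir2[unfolded K] diagonal_GL(3)])
    note M1 = GL_model[OF k1(1), where n = n, folded k1(2)] and M2 = GL_model[OF k2(1), where n = n, folded k2(2)]
    have h: "hyp_form n (-1) \<in> carrier_mat (n + n) (n + n)" by (simp add: hyp_form_def mult_2)
    have i: "a \<in> isometries (n + n) (hyp_form n (-1)) (hyp_form n (-1))" if "a \<in> plus_dual ` GL_group n" for a
      using that plus_dual_isometry[of _ n "-1"] by auto
    \<comment> \<open>The form comes entirely from the module plus its dual, so the intertwiner of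
      the multiplicity spaces has no further form to respect and a corner suffices.\<close>
    let ?T = "kron (1\<^sub>m (n + n)) (corner k1 k2)"
    note T = intertwiner_left[OF corner_carrier corner_partial_isometry[OF k1(1) k2(1)] h one_carrier_mat one_carrier_mat,
        unfolded left_mult_one_mat[OF corner_carrier] right_mult_one_mat[OF corner_carrier], OF refl, unfolded M1(2) M2(2)]
    show ?thesis
    proof (rule see_saw_diagonal_basis[where \<rho> = plus_dual and K = "GL_group n" and T = ?T and \<iota> = \<iota> and ?P1.0 = P1 and ?P2.0 = P2 and Q = Q,
          OF dp sym M1(1) M2(1) plus_dual_symmetric _ _ sympl_form_carrier _ _ _ sympl_form_carrier _ _ _ _ T(1,2)])
      show "kron a (1\<^sub>m k1) \<in> isometries (2 * m1) (sympl_form m1) (sympl_form m1)" if "a \<in> plus_dual ` GL_group n" for a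
        using amplification.isometry_untwisted[OF M1(1) h h i[OF that]] unfolding M1(2) .
      show "kron a (1\<^sub>m k2) \<in> isometries (2 * m2) (sympl_form m2) (sympl_form m2)" if "a \<in> plus_dual ` GL_group n" for a
        using amplification.isometry_untwisted[OF M2(1) h h i[OF that]] unfolding M2(2) .
      show "?T \<in> carrier_mat (2 * m1) (2 * m2)"
        using kron_carrier[OF one_carrier_mat[of "n + n"] corner_carrier[of k1 k2]] unfolding k1(2) k2(2)
        by (simp add: mult_2 add_mult_distrib)
      show "kron a (1\<^sub>m k1) * ?T = ?T * kron a (1\<^sub>m k2)" if "a \<in> carrier_mat (n + n) (n + n)" for a
        unfolding T(3)[OF that] T(4)[OF that] ..
      show "a = b" if "a \<in> carrier_mat (n + n) (n + n)" "b \<in> carrier_mat (n + n) (n + n)" "kron a (1\<^sub>m k1) * ?T = kron b (1\<^sub>m k1) * ?T" for a b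
        using kron_inj(1)[OF that(1,2) corner_carrier _ k1(1) k2(1)] that(3) k1(1) k2(1)
        unfolding T(3)[OF that(1)] T(3)[OF that(2)] by (simp add: corner_def)
      show "P1 \<in> isometries (2 * m1) (sympl_form m1) (sympl_form m1)" "P2 \<in> isometries (2 * m2) (sympl_form m2) (sympl_form m2)"
        using k1(3) k2(3) unfolding Sp_group_def k1(2) k2(2) .
      show "Q \<in> isometries (2 * (m1 + m2)) (dsum (sympl_form m1) (sympl_form m2)) (sympl_form (m1 + m2))" by (rule Q)
      show "\<iota> (dsum a b) = conj_by Q (dsum (conj_by P1 (kron (plus_dual a) (1\<^sub>m k1))) (conj_by P2 (kron (plus_dual b) (1\<^sub>m k2))))"
        if "a \<in> GL_group n" "b \<in> GL_group n" for a b
        using \<iota>[unfolded K, OF that] unfolding k1(4) k2(4) plus_dual_kron[OF that(1) k1(1)] plus_dual_kron[OF that(2) k2(1)] .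
      show "\<iota> ` dprod K K = \<iota> ` dprod (GL_group n) (GL_group n)" unfolding K ..
      show "\<iota> ` L = \<iota> ` {dsum g g |g. g \<in> GL_group n}" unfolding diagonal_GL(2) ..
    qed (assumption | rule std_form_props(3-5)[OF std_form_sympl])+
  next
    case (diagonal_O n)
    have K: "K = O_group n" by (rule dprod_inj[OF N size_O[OF diagonal_O(3)] diagonal_O(1)])
    obtain k1 P1 where k1: "k1 > 0" "m1 = n * k1"
      "P1 \<in> isometries (2 * (n * k1)) (kron (1\<^sub>m n) (sympl_form k1)) (sympl_form (n * k1))"
      "\<iota>1 = (\<lambda>g. conj_by P1 (kron g (1\<^sub>m (2 * k1))))"
      by (rule irreducible_pair_O[OF ir1[unfolded K] diagonal_O(3)])
    obtain k2 P2 where k2: "k2 > 0" "m2 = n * k2"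
      "P2 \<in> isometries (2 * (n * k2)) (kron (1\<^sub>m n) (sympl_form k2)) (sympl_form (n * k2))"
      "\<iota>2 = (\<lambda>g. conj_by P2 (kron g (1\<^sub>m (2 * k2))))"
      by (rule irreducible_pair_O[OF ir2[unfolded K] diagonal_O(3)])
    note M1 = O_model[OF diagonal_O(3) k1(1), folded k1(2)] and M2 = O_model[OF diagonal_O(3) k2(1), folded k2(2)]
    note S1 = Sp_model[OF diagonal_O(3), of k1, folded k1(2)] and S2 = Sp_model[OF diagonal_O(3), of k2, folded k2(2)]
    obtain E where E: "E \<in> carrier_mat (2 * k1) (2 * k2)" "E * transpose_mat E * E = E" "E $$ (0, 0) = 1" "sympl_form k1 * E = E * sympl_form k2"
      by (rule sympl_intertwiner[OF k1(1) k2(1)])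
    \<comment> \<open>Here the alternating form sits on the multiplicity spaces, so the intertwiner
      has to be compatible with it.\<close>
    let ?T = "kron (1\<^sub>m n) E"
    note T = intertwiner_left[OF E(1,2) one_carrier_mat sympl_form_carrier sympl_form_carrier E(4), where N = n]
    note O = isometries_symmetric[OF std_form_one diagonal_O(3), folded O_group_def]
    have pos: "2 * k1 > 0" "2 * k2 > 0" using k1(1) k2(1) by simp_all
    show ?thesis
    proof (rule see_saw_diagonal_basis[where \<rho> = "\<lambda>a. a" and K = "O_group n" and T = ?T and \<iota> = \<iota> and ?P1.0 = P1 and ?P2.0 = P2 and Q = Q,
          unfolded image_ident, OF dp sym M1(1) M2(1) O _ _ M1(2) S1(3-5) M2(2) S2(3-5) _ T(1,2)])
      show "kron a (1\<^sub>m (2 * k1)) \<in> isometries (2 * m1) (kron (1\<^sub>m n) (sympl_form k1)) (kron (1\<^sub>m n) (sympl_form k1))" if "a \<in> O_group n" for a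
        using amplification.isometry[OF M1(1-3) one_carrier_mat that[unfolded O_group_def]] unfolding M1(4) .
      show "kron a (1\<^sub>m (2 * k2)) \<in> isometries (2 * m2) (kron (1\<^sub>m n) (sympl_form k2)) (kron (1\<^sub>m n) (sympl_form k2))" if "a \<in> O_group n" for a
        using amplification.isometry[OF M2(1-3) one_carrier_mat that[unfolded O_group_def]] unfolding M2(4) .
      show "?T \<in> carrier_mat (2 * m1) (2 * m2)"
        using kron_carrier[OF one_carrier_mat[of n] E(1)] unfolding k1(2) k2(2) by (simp add: algebra_simps)
      show "kron a (1\<^sub>m (2 * k1)) * ?T = ?T * kron a (1\<^sub>m (2 * k2))" if "a \<in> carrier_mat n n" for a
        unfolding T(3)[OF that] T(4)[OF that] ..
      show "a = b" if "a \<in> carrier_mat n n" "b \<in> carrier_mat n n" "kron a (1\<^sub>m (2 * k1)) * ?T = kron b (1\<^sub>m (2 * k1)) * ?T" for a b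
        using kron_inj(1)[OF that(1,2) E(1,3) pos] that(3) unfolding T(3)[OF that(1)] T(3)[OF that(2)] .
      show "P1 \<in> isometries (2 * m1) (kron (1\<^sub>m n) (sympl_form k1)) (sympl_form m1)"
        "P2 \<in> isometries (2 * m2) (kron (1\<^sub>m n) (sympl_form k2)) (sympl_form m2)"
        using k1(3) k2(3) unfolding k1(2) k2(2) .
      show "Q \<in> isometries (2 * (m1 + m2)) (dsum (sympl_form m1) (sympl_form m2)) (sympl_form (m1 + m2))" by (rule Q)
      show "\<iota> (dsum a b) = conj_by Q (dsum (conj_by P1 (kron a (1\<^sub>m (2 * k1)))) (conj_by P2 (kron b (1\<^sub>m (2 * k2)))))"
        if "a \<in> O_group n" "b \<in> O_group n" for a b
        using \<iota>[unfolded K, OF that] unfolding k1(4) k2(4) .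
      show "\<iota> ` dprod K K = \<iota> ` dprod (O_group n) (O_group n)" unfolding K ..
      show "\<iota> ` L = \<iota> ` {dsum g g |g. g \<in> O_group n}" unfolding diagonal_O(2) ..
    qed
  next
    case (diagonal_Sp k)
    have K: "K = Sp_group k" by (rule dprod_inj[OF N size_Sp[OF diagonal_Sp(3)] diagonal_Sp(1)])
    obtain n1 P1 where n1: "n1 > 0" "m1 = n1 * k"
      "P1 \<in> isometries (2 * (n1 * k)) (kron (1\<^sub>m n1) (sympl_form k)) (sympl_form (n1 * k))"
      "\<iota>1 = (\<lambda>h. conj_by P1 (kron (1\<^sub>m n1) h))"
      by (rule irreducible_pair_Sp[OF ir1[unfolded K] diagonal_Sp(3)])
    obtain n2 P2 where n2: "n2 > 0" "m2 = n2 * k"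
      "P2 \<in> isometries (2 * (n2 * k)) (kron (1\<^sub>m n2) (sympl_form k)) (sympl_form (n2 * k))"
      "\<iota>2 = (\<lambda>h. conj_by P2 (kron (1\<^sub>m n2) h))"
      by (rule irreducible_pair_Sp[OF ir2[unfolded K] diagonal_Sp(3)])
    note S1 = Sp_model[OF n1(1), of k, folded n1(2)] and S2 = Sp_model[OF n2(1), of k, folded n2(2)]
    \<comment> \<open>The multiplicity spaces carry the identity matrix as their form and stand on
      the left of the tensor product in this model.\<close>
    let ?T = "kron (corner n1 n2) (1\<^sub>m (2 * k))"
    note T = intertwiner_right[OF corner_carrier corner_partial_isometry[OF n1(1) n2(1)], where N = "2 * k"]
    have k: "2 * k > 0" using diagonal_Sp(3) by simp
    note O = isometries_symmetric[OF std_form_sympl k, folded Sp_group_def]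
    note J = sympl_form_carrier[of k]
    show ?thesis
    proof (rule see_saw_diagonal_basis[where \<rho> = "\<lambda>a. a" and K = "Sp_group k" and T = ?T and \<iota> = \<iota> and ?P1.0 = P1 and ?P2.0 = P2 and Q = Q,
          unfolded image_ident, OF dp sym S1(1) S2(1) O _ _ amplification.car[OF S1(1) J] S1(3-5) amplification.car[OF S2(1) J] S2(3-5) _ T(1)])
      show "kron (1\<^sub>m n1) a \<in> isometries (2 * m1) (kron (1\<^sub>m n1) (sympl_form k)) (kron (1\<^sub>m n1) (sympl_form k))" if "a \<in> Sp_group k" for a
        by (rule amplification.isometry_untwisted[OF S1(1) J J that[unfolded Sp_group_def]])
      show "kron (1\<^sub>m n2) a \<in> isometries (2 * m2) (kron (1\<^sub>m n2) (sympl_form k)) (kron (1\<^sub>m n2) (sympl_form k))" if "a \<in> Sp_group k" for a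
        by (rule amplification.isometry_untwisted[OF S2(1) J J that[unfolded Sp_group_def]])
      show "?T \<in> carrier_mat (2 * m1) (2 * m2)"
        using kron_carrier[OF corner_carrier[of n1 n2] one_carrier_mat[of "2 * k"]] unfolding n1(2) n2(2) by (simp add: algebra_simps)
      show "kron (1\<^sub>m n1) (sympl_form k) * ?T = ?T * kron (1\<^sub>m n2) (sympl_form k)" unfolding T(2)[OF J] T(3)[OF J] ..
      show "kron (1\<^sub>m n1) a * ?T = ?T * kron (1\<^sub>m n2) a" if "a \<in> carrier_mat (2 * k) (2 * k)" for a
        unfolding T(2)[OF that] T(3)[OF that] ..
      show "a = b" if "a \<in> carrier_mat (2 * k) (2 * k)" "b \<in> carrier_mat (2 * k) (2 * k)" "kron (1\<^sub>m n1) a * ?T = kron (1\<^sub>m n1) b * ?T" for a b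
        using kron_inj(2)[OF that(1,2) corner_carrier _ n1(1) n2(1)] that(3) n1(1) n2(1)
        unfolding T(2)[OF that(1)] T(2)[OF that(2)] by (simp add: corner_def)
      show "P1 \<in> isometries (2 * m1) (kron (1\<^sub>m n1) (sympl_form k)) (sympl_form m1)"
        "P2 \<in> isometries (2 * m2) (kron (1\<^sub>m n2) (sympl_form k)) (sympl_form m2)"
        using n1(3) n2(3) unfolding n1(2) n2(2) .
      show "Q \<in> isometries (2 * (m1 + m2)) (dsum (sympl_form m1) (sympl_form m2)) (sympl_form (m1 + m2))" by (rule Q)
      show "\<iota> (dsum a b) = conj_by Q (dsum (conj_by P1 (kron (1\<^sub>m n1) a)) (conj_by P2 (kron (1\<^sub>m n2) b)))"
        if "a \<in> Sp_group k" "b \<in> Sp_group k" for a b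
        using \<iota>[unfolded K, OF that] unfolding n1(4) n2(4) .
      show "\<iota> ` dprod K K = \<iota> ` dprod (Sp_group k) (Sp_group k)" unfolding K ..
      show "\<iota> ` L = \<iota> ` {dsum g g |g. g \<in> Sp_group k}" unfolding diagonal_Sp(2) ..
    qed
  next
    case (direct_sum_GL n k Q)
    then show ?thesis using neq(1)[of "n + k"] by simp
  next
    case (direct_sum_O n k Q)
    then show ?thesis using neq(2)[of "n + k"] by simp
  next
    case (direct_sum_Sp n k Q)
    then show ?thesis using neq(3)[of "n + k"] by simp
  next
    case (polarization_O n L1 L2)
    then show ?thesis using neq(2)[of "2 * n"] by simp
  next
    case (polarization_Sp n L1 L2)
    then show ?thesis using neq(3)[of n] by simp
  next
    case (bilinear_O n Q)
    then show ?thesis using neq(1)[of n] by simp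
  next
    case (bilinear_Sp n Q)
    then show ?thesis using neq(1)[of "2 * n"] by simp
  qed
qed

theorem proposition4p2:
  fixes m :: nat
    and G G' H H' K L :: "complex mat set"
    and \<iota> :: "complex mat \<Rightarrow> complex mat"
  assumes "classical_pair m K \<iota> G'" and "G = \<iota> ` K" and "dual_pair m G G'"
    and "classical_symmetric_pair K L" and "H = \<iota> ` L" and "symmetric_subgroup (2 * m) G H"
    and "H' = centralizer (Sp_group m) H"
  shows "dual_pair m H H' \<and> symmetric_subgroup (2 * m) H' G'"
  using assms(1)
proof cases
  case single
  show ?thesis
    using see_saw_irreducible[OF single assms(3)[unfolded assms(2)] assms(4) assms(6)[unfolded assms(2,5)]]
    unfolding assms(7,5) .
next
  case (two_copies m1 K0 \<iota>1 G1' m2 \<iota>2 G2' Q)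
  note a = assms(3)[unfolded assms(2) two_copies(1,2)] assms(4)[unfolded two_copies(2)]
    assms(6)[unfolded assms(2,5) two_copies(1,2)]
  show ?thesis
    using see_saw_two_copies[OF two_copies(4-6) two_copies(7) a] unfolding assms(7,5) two_copies(1) .
qed

end
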